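(* Let $N\ge 1$ and $1<p<\infty$. Then: (1) for every $0<s<1$, \[ \mathfrak{h}_{s,p}(\mathbb{H}^N_+)=C_{N,s\,p}\,\Lambda_{s,p}; \] (2) for every $1/p\le s<1$ and every nonempty open convex set $\Omega\subsetneq\mathbb{R}^N$, \[ \mathfrak{h}_{s,p}(\Omega)=\mathfrak{h}_{s,p}(\mathbb{H}^N_+); \] (3) for $p=2$, for every $0<s<1$ and every nonempty open convex set $\Omega\subsetneq\mathbb{R}^N$, \[ \mathfrak{h}_{s,2}(\Omega)=\mathfrak{h}_{s,2}(\mathbb{H}^N_+). \] In each of these cases, the constant $\mathfrak{h}_{s,p}$ is not attained, i.e. there is no $u\in\widetilde W^{s,p}_0(\Omega)$ with $\int_\Omega |u|^p\,d_\Omega^{-s\,p}\,dx=1$ and $[u]^p_{W^{s,p}(\mathbb{R}^N)}=\mathfrak{h}_{s,p}(\Omega)$ (with $\Omega=\mathbb{H}^N_+$ in case (1)).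
   Context: $\mathbb{H}^1_+=(0,+\infty)$ and $\mathbb{H}^N_+=\mathbb{R}^{N-1}\times(0,+\infty)$ for $N\ge 2$. For an open set $\Omega\subsetneq\mathbb{R}^N$, $d_\Omega(x)=\min_{y\in\partial\Omega}|x-y|$ for $x\in\Omega$. For $1<p<\infty$, $0<s<1$, \[ [u]_{W^{s,p}(\mathbb{R}^N)}=\left(\iint_{\mathbb{R}^N\times\mathbb{R}^N}\frac{|u(x)-u(y)|^p}{|x-y|^{N+s\,p}}\,dx\,dy\right)^{1/p}, \] $W^{s,p}(\mathbb{R}^N)=\{u\in L^p(\mathbb{R}^N): [u]_{W^{s,p}(\mathbb{R}^N)}<+\infty\}$ with norm $\|u\|_{L^p(\mathbb{R}^N)}+[u]_{W^{s,p}(\mathbb{R}^N)}$. $C^\infty_0(\Omega)$ is the space of smooth functions with compact support in $\Omega$ (extended by $0$ to $\mathbb{R}^N$), and $\widetilde W^{s,p}_0(\Omega)$ is its closure in $W^{s,p}(\mathbb{R}^N)$. The sharp fractional Hardy constant is \[ \mathfrak{h}_{s,p}(\Omega)=\inf_{u\in C^\infty_0(\Omega)}\left\{[u]^p_{W^{s,p}(\mathbb{R}^N)}\,:\,\int_\Omega\frac{|u|^p}{d_\Omega^{s\,p}}\,dx=1\right\}, \] which coincides with the same infimum taken over $u\in\widetilde W^{s,p}_0(\Omega)$; "attained" refers to the latter infimum. The constants are \[ \Lambda_{s,p}=2\int_0^1\frac{\left|1-t^{\frac{s\,p-1}{p}}\right|^p}{(1-t)^{1+s\,p}}\,dt+\frac{2}{s\,p},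 \] \[ C_{N,s\,p}=(N-1)\,\omega_{N-1}\int_0^{+\infty}t^{N-2}(1+t^2)^{-\frac{N+s\,p}{2}}\,dt\ \text{ for } N\ge 2,\qquad C_{1,s\,p}=1, \] where $\omega_k$ is the volume of the unit ball of $\mathbb{R}^k$. *)

theory Defs
  imports "HOL-Analysis.Analysis"
begin

text \<open>
  The role of \<open>\<real>\<^sup>N\<close>, \<open>N \<ge> 1\<close>, is played by an arbitrary type of class
  \<^class>\<open>euclidean_space\<close>, with \<open>N = DIM('a)\<close>.  The coordinate that is positive on the half-space
  is the one in the direction of a basis vector \<open>b\<close>.  For \<^typ>\<open>real\<close> and \<open>b = 1\<close> it is the
  half-line.
\<close>

definition half_space :: "'a::euclidean_space \<Rightarrow> 'a set" where
  "half_space b = {x. 0 < x \<bullet> b}"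

definition bdry_dist :: "'a::euclidean_space set \<Rightarrow> 'a \<Rightarrow> real" where
  "bdry_dist \<Omega> x = infdist x (frontier \<Omega>)"

primrec Ck :: "nat \<Rightarrow> ('a::euclidean_space \<Rightarrow> real) \<Rightarrow> bool" where
  "Ck 0 u \<longleftrightarrow> continuous_on UNIV u"
| "Ck (Suc k) u \<longleftrightarrow> (\<forall>x. u differentiable (at x)) \<and>
     (\<forall>i\<in>Basis. Ck k (\<lambda>x. frechet_derivative u (at x) i))"

definition smooth :: "('a::euclidean_space \<Rightarrow> real) \<Rightarrow> bool" where
  "smooth u \<longleftrightarrow> (\<forall>k. Ck k u)"

definition test_functions :: "'a::euclidean_space set \<Rightarrow> ('a \<Rightarrow> real) set" where
  "test_functions \<Omega> =
     {u. smooth u \<and> compact (closure {x. u x \<noteq> 0}) \<and> closure {x. u x \<noteq> 0} \<subseteq> \<Omega>}"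

text \<open>
  Integrals of nonnegative functions take values in \<^typ>\<open>ennreal\<close>; \<open>enn_root\<close> is the
  \<open>p\<close>-th root there, for real \<open>p > 0\<close>.
\<close>

definition enn_root :: "real \<Rightarrow> ennreal \<Rightarrow> ennreal" where
  "enn_root p a = (if a = \<infinity> then \<infinity> else ennreal (enn2real a powr (1 / p)))"

definition Lp_norm :: "real \<Rightarrow> ('a::euclidean_space \<Rightarrow> real) \<Rightarrow> ennreal" where
  "Lp_norm p u = enn_root p (\<integral>\<^sup>+x. ennreal (\<bar>u x\<bar> powr p) \<partial>lebesgue)"

text \<open>
  \<open>energy s p u\<close> is the \<open>p\<close>-th power of the Gagliardo seminorm.  On the null set \<open>x = y\<close> the
  integrand is \<open>0 / 0 = 0\<close>.
\<close>

definition energy :: "real \<Rightarrow> real \<Rightarrow> ('a::euclidean_space \<Rightarrow> real) \<Rightarrow> ennreal" where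
  "energy s p u =
     (\<integral>\<^sup>+(x, y). ennreal (\<bar>u x - u y\<bar> powr p / norm (x - y) powr (real DIM('a) + s * p))
       \<partial>(lebesgue \<Otimes>\<^sub>M lebesgue))"

definition seminorm :: "real \<Rightarrow> real \<Rightarrow> ('a::euclidean_space \<Rightarrow> real) \<Rightarrow> ennreal" where
  "seminorm s p u = enn_root p (energy s p u)"

text \<open>Elements of the function spaces are functions, not classes modulo equality a.e.\<close>

definition Wsp :: "real \<Rightarrow> real \<Rightarrow> ('a::euclidean_space \<Rightarrow> real) set" where
  "Wsp s p = {u. u \<in> borel_measurable lebesgue \<and> Lp_norm p u < \<infinity> \<and> seminorm s p u < \<infinity>}"

definition Wsp_norm :: "real \<Rightarrow> real \<Rightarrow> ('a::euclidean_space \<Rightarrow> real) \<Rightarrow> ennreal" where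
  "Wsp_norm s p u = Lp_norm p u + seminorm s p u"

definition Wsp0 :: "real \<Rightarrow> real \<Rightarrow> 'a::euclidean_space set \<Rightarrow> ('a \<Rightarrow> real) set" where
  "Wsp0 s p \<Omega> =
     {u \<in> Wsp s p. \<forall>\<epsilon>>0. \<exists>\<phi>\<in>test_functions \<Omega>. Wsp_norm s p (\<lambda>x. u x - \<phi> x) < ennreal \<epsilon>}"

definition hardy_integral ::
    "real \<Rightarrow> real \<Rightarrow> 'a::euclidean_space set \<Rightarrow> ('a \<Rightarrow> real) \<Rightarrow> ennreal" where
  "hardy_integral s p \<Omega> u =
     (\<integral>\<^sup>+x\<in>\<Omega>. ennreal (\<bar>u x\<bar> powr p / bdry_dist \<Omega> x powr (s * p)) \<partial>lebesgue)"

definition hardy_const :: "real \<Rightarrow> real \<Rightarrow> 'a::euclidean_space set \<Rightarrow> ennreal" where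
  "hardy_const s p \<Omega> =
     (INF u\<in>{u \<in> test_functions \<Omega>. hardy_integral s p \<Omega> u = 1}. energy s p u)"

definition hardy_attained :: "real \<Rightarrow> real \<Rightarrow> 'a::euclidean_space set \<Rightarrow> bool" where
  "hardy_attained s p \<Omega> \<longleftrightarrow>
     (\<exists>u\<in>Wsp0 s p \<Omega>. hardy_integral s p \<Omega> u = 1 \<and> energy s p u = hardy_const s p \<Omega>)"

definition Lambda :: "real \<Rightarrow> real \<Rightarrow> real" where
  "Lambda s p =
     2 * (LINT t:{0<..<1}|lborel. \<bar>1 - t powr ((s * p - 1) / p)\<bar> powr p / (1 - t) powr (1 + s * p))
     + 2 / (s * p)"

definition dim_const :: "nat \<Rightarrow> real \<Rightarrow> real" where
  "dim_const N a =
     (if N = 1 then 1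
      else real (N - 1) * unit_ball_vol (real (N - 1)) *
        (LINT t:{0<..}|lborel. t ^ (N - 2) * (1 + t\<^sup>2) powr (- (real N + a) / 2)))"

end

theory Submission
  imports Defs
begin

text \<open>
  On the half-line, Picone's inequality with the ground state \<open>t powr ((s * p - 1) / p)\<close> gives a
  one-dimensional Hardy inequality whose weight is a power of the distance to the complement;
  related ground states give it on bounded intervals when \<open>1 <= s * p\<close> or \<open>p = 2\<close>.  Integrating it
  over all directions and over all parallel lines, and bounding the directional distances by
  means of a supporting hyperplane, gives the lower bound; the remainder in Picone's inequality
  is strict, so equality forces the Hardy integral to vanish.  The constant is optimal because
  a logarithmic cut-off of the ground state is almost extremal on the half-space, and a small
  copy of it fits into the domain next to any boundary point with an inner tangent ball.
\<close>

subsection \<open>The discrete Picone inequality\<close>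

text \<open>The exponent (a - 1) / p, with a = s p, is borderline: the p-th power of the ground
  state times t^(-a) is 1 / t, which just fails to be integrable. A multiple of the ground state
  therefore has infinite Hardy integral, while a cut-off that is slow in ln t makes it almost
  extremal. The obstacle is that the nonlinear fractional operator in general converges on the
  ground state only as a principal value. Interactions are therefore restricted to pairs whose
  ratio, taken from an end point or after a Moebius map, is at most th < 1. This truncation respects
  scaling, so the truncated flux is an explicit integral over ratios; th tends to 1 only after
  finite terms have been cancelled. On bounded intervals the second end point must not spoil the
  flux: for a >= 1 the ground state grows with the distance and comparison with the half-line
  suffices; for a < 1 this comparison reverses, and p = 2 is settled by Moebius covariance.
  Averaging over directions loses nothing on a half-space, where the distance along h, in multiples
  of h, is exactly d / |h . n|; this makes one constant sharp for all the convex sets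
  considered.\<close>

lemma abs_powr_tangent_strict:
  fixes X A p :: real
  assumes p: "1 < p" and A: "0 <= A" and ne: "X \<noteq> A"
  shows "A powr p + p * A powr (p - 1) * (X - A) < \<bar>X\<bar> powr p"
proof (cases "A = 0")
  case True
  then show ?thesis using p ne by simp
next
  case False
  then have A: "0 < A" using A by simp
  have AA: "A powr p = A powr (p - 1) * A"
    using A powr_mult_base[of A "p - 1"] by (simp add: mult.commute)
  \<comment> \<open>For A > 0 and X <= 0 the tangent is already negative, so differentiating the
    power is confined to positive X.\<close>
  show ?thesis
  proof (cases "X <= 0")
    case True
    have "A powr p + p * A powr (p - 1) * (X - A) = A powr (p - 1) * ((1 - p) * A + p * X)"
      unfolding AA by (simp add: algebra_simps)
    also have "\<dots> < 0"
    proof -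
      have "(1 - p) * A < 0" using p A by (simp add: mult_less_0_iff)
      moreover have "p * X <= 0" using p True by (simp add: mult_nonneg_nonpos)
      ultimately have "(1 - p) * A + p * X < 0" by linarith
      then show ?thesis using A by (simp add: zero_less_mult_iff mult_less_0_iff)
    qed
    finally show ?thesis by (smt (verit) powr_ge_zero)
  next
    case False
    then have X: "0 < X" by simp
    have der: "((\<lambda>x. x powr p) has_real_derivative p * x powr (p - 1)) (at x)" if "0 < x" for x
      using that by (auto intro!: derivative_eq_intros)
    have "0 < X powr p - (A powr p + p * A powr (p - 1) * (X - A))"
    proof (cases "X < A")
      case True
      obtain z where z: "X < z" "z < A" "A powr p - X powr p = (A - X) * (p * z powr (p - 1))"
        using MVT2[of X A "\<lambda>x. x powr p" "\<lambda>x. p * x powr (p - 1)"] True X der by auto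
      have "z powr (p - 1) < A powr (p - 1)"
        using z X p by (intro powr_less_mono2) auto
      then have "(A - X) * (p * z powr (p - 1)) < (A - X) * (p * A powr (p - 1))"
        using True p by simp
      then show ?thesis using z by (simp add: algebra_simps)
    next
      case False
      then have lt: "A < X" using ne by simp
      obtain z where z: "A < z" "z < X" "X powr p - A powr p = (X - A) * (p * z powr (p - 1))"
        using MVT2[of A X "\<lambda>x. x powr p" "\<lambda>x. p * x powr (p - 1)"] lt A der by auto
      have "A powr (p - 1) < z powr (p - 1)"
        using z A p by (intro powr_less_mono2) auto
      then have "(X - A) * (p * A powr (p - 1)) < (X - A) * (p * z powr (p - 1))"
        using lt p by simp
      then show ?thesis using z by (simp add: algebra_simps)
    qed
    then show ?thesis using X by simp
  qed
qed

lemma abs_powr_tangent: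
  fixes X A p :: real
  assumes "1 < p" "0 <= A"
  shows "A powr p + p * A powr (p - 1) * (X - A) <= \<bar>X\<bar> powr p"
  using abs_powr_tangent_strict[of p A X] assms by (cases "X = A") auto

text \<open>Only \<open>X\<close> may be negative; this is the form used for Picone's inequality,
  where \<open>X\<close> is a difference quotient of unknown sign. It is the sum of the tangent
  inequalities at \<open>A\<close> with weights \<open>l\<close> and \<open>1 - l\<close>.
  Strictness comes from \<open>X\<close>, which differs from \<open>A\<close> as soon as it differs
  from \<open>B\<close>.\<close>

lemma abs_powr_convex_strict:
  fixes X B p l :: real
  assumes p: "1 < p" and B: "0 <= B" and l: "0 < l" "l < 1"
    and A: "A = l * X + (1 - l) * B" "0 <= A" and ne: "X \<noteq> B"
  shows "A powr p < l * \<bar>X\<bar> powr p + (1 - l) * B powr p"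
proof -
  have "X \<noteq> A"
  proof
    assume "X = A"
    then have "(1 - l) * (X - B) = 0" using A by (simp add: algebra_simps)
    then show False using ne l by simp
  qed
  from abs_powr_tangent_strict[OF p A(2) this]
  have 1: "l * (A powr p + p * A powr (p - 1) * (X - A)) < l * \<bar>X\<bar> powr p"
    using l by simp
  have 2: "(1 - l) * (A powr p + p * A powr (p - 1) * (B - A)) <= (1 - l) * B powr p"
    using abs_powr_tangent[OF p A(2), of B] l B by simp
  have "l * (A powr p + p * A powr (p - 1) * (X - A)) +
      (1 - l) * (A powr p + p * A powr (p - 1) * (B - A)) =
      A powr p + p * A powr (p - 1) * (l * X + (1 - l) * B - A)"
    by (simp add: algebra_simps)
  then show ?thesis using 1 2 A(1) by simp
qed

text \<open>The odd function |t|^(p-2) t, that is the derivative of |t|^p / p for p > 1. Writing it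
  with \<open>sgn\<close> avoids a negative exponent when p < 2.\<close>

definition Jp :: "real => real => real" where
  "Jp p t = sgn t * \<bar>t\<bar> powr (p - 1)"

lemma Jp_minus: "Jp p (- t) = - Jp p t"
  by (simp add: Jp_def sgn_minus)

lemma Jp_mult: "Jp p (c * t) = c powr (p - 1) * Jp p t" if "0 < c"
  using that by (simp add: Jp_def sgn_mult abs_mult powr_mult)

lemma Jp_nonneg: "0 <= t ==> 0 <= Jp p t"
  by (simp add: Jp_def)

lemma Jp_nonpos: "t <= 0 ==> Jp p t <= 0"
  using Jp_nonneg[of "- t" p] by (simp add: Jp_minus)

lemma Jp_mono:
  assumes "1 < p" "s <= t" shows "Jp p s <= Jp p t"
proof -
  have *: "Jp p s <= Jp p t" if "0 <= s" "s <= t" for s t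
  proof (cases "s = 0")
    case True then show ?thesis using that Jp_nonneg[of t p] by (simp add: Jp_def)
  next
    case False then show ?thesis using that \<open>1 < p\<close> by (simp add: Jp_def powr_mono2)
  qed
  consider "0 <= s" | "s < 0" "0 <= t" | "t < 0" by linarith
  then show ?thesis
  proof cases
    case 1 then show ?thesis using * assms by simp
  next
    case 2 then show ?thesis using Jp_nonneg[of t p] Jp_nonpos[of s p] by simp
  next
    case 3 then show ?thesis using *[of "- t" "- s"] assms by (simp add: Jp_minus)
  qed
qed

lemma Jp_times_self: "1 < p ==> Jp p t * t = \<bar>t\<bar> powr p"
proof -
  assume "1 < p"
  have "Jp p t * t = \<bar>t\<bar> * \<bar>t\<bar> powr (p - 1)"
    by (simp add: Jp_def abs_sgn mult.commute mult.left_commute)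
  also have "\<dots> = \<bar>t\<bar> powr p" using \<open>1 < p\<close> powr_mult_base[of "\<bar>t\<bar>" "p - 1"] by simp
  finally show ?thesis .
qed

lemma measurable_Jp[measurable]: "Jp p \<in> borel_measurable borel"
  unfolding Jp_def[abs_def] by measurable

text \<open>For w1 > w2 the quotient |v1| / w1 is the convex combination of X = (|v1| - |v2|) / (w1
  - w2) and |v2| / w2 with weights (w1 - w2) / w1 and w2 / w1. Convexity of the p-th power,
  multiplied by (w1 - w2)^(p-1) w1, is the inequality with ||v1| - |v2||^p on the right. Strict
  convexity leaves equality only if the two quotients |v1| / w1 and |v2| / w2 coincide.\<close>

lemma picone_aux:
  fixes v1 v2 w1 w2 p :: real
  assumes p: "1 < p" and w: "0 < w2" "w2 <= w1"
  shows "Jp p (w1 - w2) * (\<bar>v1\<bar> powr p / w1 powr (p - 1) - \<bar>v2\<bar> powr p / w2 powr (p - 1))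
      <= \<bar>v1 - v2\<bar> powr p \<and>
    (Jp p (w1 - w2) * (\<bar>v1\<bar> powr p / w1 powr (p - 1) - \<bar>v2\<bar> powr p / w2 powr (p - 1))
      = \<bar>v1 - v2\<bar> powr p \<longrightarrow> \<bar>v1\<bar> * w2 = \<bar>v2\<bar> * w1)"
proof (cases "w1 = w2")
  case True
  then show ?thesis using p by (auto simp: Jp_def)
next
  case False
  define d where "d = w1 - w2"
  have d: "0 < d" using w False by (simp add: d_def)
  have w1: "0 < w1" using w by simp
  define A B where "A = \<bar>v1\<bar> / w1" and "B = \<bar>v2\<bar> / w2"
  define X where "X = (w1 * A - w2 * B) / d"
  define l where "l = d / w1"
  have l: "0 < l" "l < 1" "1 - l = w2 / w1" using d w w1 by (auto simp: l_def d_def field_simps)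
  have AB: "0 <= A" "0 <= B" using w w1 by (auto simp: A_def B_def)
  have wA: "w1 * A = \<bar>v1\<bar>" "w2 * B = \<bar>v2\<bar>" using w w1 by (auto simp: A_def B_def)
  have Aeq: "A = l * X + (1 - l) * B"
    using d w w1 unfolding l(3) l_def X_def by (simp add: field_simps) (simp add: d_def algebra_simps)
  have powA: "\<bar>v1\<bar> powr p / w1 powr (p - 1) = w1 * A powr p"
    using w1 by (simp add: A_def powr_divide powr_diff)
  have powB: "\<bar>v2\<bar> powr p / w2 powr (p - 1) = w2 * B powr p"
    using w by (simp add: B_def powr_divide powr_diff)
  have dX: "d powr p * \<bar>X\<bar> powr p <= \<bar>v1 - v2\<bar> powr p"
  proof -
    have "d powr p * \<bar>X\<bar> powr p = (\<bar>\<bar>v1\<bar> - \<bar>v2\<bar>\<bar>) powr p"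
      using d by (simp add: X_def wA powr_divide)
    also have "\<dots> <= \<bar>v1 - v2\<bar> powr p" using p by (intro powr_mono2) auto
    finally show ?thesis .
  qed
  have lhs: "Jp p (w1 - w2) * (\<bar>v1\<bar> powr p / w1 powr (p - 1) - \<bar>v2\<bar> powr p / w2 powr (p - 1)) =
      d powr (p - 1) * w1 * (A powr p - (1 - l) * B powr p)"
    unfolding powA powB l(3) using d w1 by (simp add: Jp_def d_def[symmetric] field_simps)
  have rhs: "d powr p * \<bar>X\<bar> powr p = d powr (p - 1) * w1 * (l * \<bar>X\<bar> powr p)"
    using d w1 by (simp add: l_def powr_diff)
  have c: "0 < d powr (p - 1) * w1" using d w1 by simp
  show ?thesis
  proof (cases "X = B")
    case True
    then have "A = B" using Aeq by (simp add: algebra_simps)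
    then have "A powr p = l * \<bar>X\<bar> powr p + (1 - l) * B powr p"
      using True AB by (simp add: algebra_simps)
    then have "Jp p (w1 - w2) * (\<bar>v1\<bar> powr p / w1 powr (p - 1) - \<bar>v2\<bar> powr p / w2 powr (p - 1)) =
      d powr p * \<bar>X\<bar> powr p" unfolding lhs rhs by simp
    moreover have "\<bar>v1\<bar> * w2 = \<bar>v2\<bar> * w1" using \<open>A = B\<close> wA by (metis mult.commute mult.left_commute)
    ultimately show ?thesis using dX by simp
  next
    case False
    have "A powr p < l * \<bar>X\<bar> powr p + (1 - l) * B powr p"
      by (rule abs_powr_convex_strict[OF p AB(2) l(1,2) Aeq AB(1) False])
    then have "d powr (p - 1) * w1 * (A powr p - (1 - l) * B powr p) <
        d powr (p - 1) * w1 * (l * \<bar>X\<bar> powr p)"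
      using c by (intro mult_strict_left_mono) auto
    then show ?thesis using dX unfolding lhs rhs by simp
  qed
qed

text \<open>As \<open>Jp\<close> is odd, the left side is unchanged when the two indices are
  exchanged, so the ordered case suffices.\<close>

lemma picone:
  fixes v1 v2 w1 w2 p :: real
  assumes "1 < p" "0 < w1" "0 < w2"
  shows "Jp p (w1 - w2) * (\<bar>v1\<bar> powr p / w1 powr (p - 1) - \<bar>v2\<bar> powr p / w2 powr (p - 1))
      <= \<bar>v1 - v2\<bar> powr p"
    and "Jp p (w1 - w2) * (\<bar>v1\<bar> powr p / w1 powr (p - 1) - \<bar>v2\<bar> powr p / w2 powr (p - 1))
      = \<bar>v1 - v2\<bar> powr p ==> \<bar>v1\<bar> * w2 = \<bar>v2\<bar> * w1"
proof -
  have eq: "Jp p (w1 - w2) * (\<bar>v1\<bar> powr p / w1 powr (p - 1) - \<bar>v2\<bar> powr p / w2 powr (p - 1)) =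
     Jp p (w2 - w1) * (\<bar>v2\<bar> powr p / w2 powr (p - 1) - \<bar>v1\<bar> powr p / w1 powr (p - 1))"
    using Jp_minus[of p "w2 - w1"] by (simp add: algebra_simps)
  show "Jp p (w1 - w2) * (\<bar>v1\<bar> powr p / w1 powr (p - 1) - \<bar>v2\<bar> powr p / w2 powr (p - 1))
      <= \<bar>v1 - v2\<bar> powr p"
    using picone_aux[of p w2 w1 v1 v2] picone_aux[of p w1 w2 v2 v1] assms eq
    by (cases "w2 <= w1") (auto simp: abs_minus_commute)
  show "Jp p (w1 - w2) * (\<bar>v1\<bar> powr p / w1 powr (p - 1) - \<bar>v2\<bar> powr p / w2 powr (p - 1))
      = \<bar>v1 - v2\<bar> powr p ==> \<bar>v1\<bar> * w2 = \<bar>v2\<bar> * w1"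
    using picone_aux[of p w2 w1 v1 v2] picone_aux[of p w1 w2 v2 v1] assms eq
    by (cases "w2 <= w1") (auto simp: abs_minus_commute)
qed

subsection \<open>Change of variables for nonnegative functions\<close>

text \<open>Translates between absolute integrability, in which the change of variables theorem is
  phrased, and finiteness of an integral with values in \<open>ennreal\<close>.\<close>

lemma nn_integral_absolutely_integrable_iff:
  fixes h :: "real => real"
  assumes S: "S \<in> sets borel" and h: "set_borel_measurable borel S h"
    and nn: "\<And>x. x \<in> S ==> 0 <= h x"
  shows "h absolutely_integrable_on S \<longleftrightarrow> (\<integral>\<^sup>+x\<in>S. ennreal (h x) \<partial>lborel) < \<infinity>"
    and "h absolutely_integrable_on S ==>
      (\<integral>\<^sup>+x\<in>S. ennreal (h x) \<partial>lborel) = ennreal (integral S h)"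
proof -
  have h': "(\<lambda>x. indicator S x *\<^sub>R h x) \<in> borel_measurable lborel"
    using h by (simp add: set_borel_measurable_def)
  then have h'': "(\<lambda>x. indicator S x *\<^sub>R h x) \<in> borel_measurable lebesgue"
    by (rule measurable_completion)
  have eq: "(\<integral>\<^sup>+x\<in>S. ennreal (h x) \<partial>lborel) = (\<integral>\<^sup>+x. ennreal (norm (indicator S x *\<^sub>R h x)) \<partial>lebesgue)"
    unfolding nn_integral_completion
    by (intro nn_integral_cong) (auto simp: indicator_def nn)
  show iff: "h absolutely_integrable_on S \<longleftrightarrow> (\<integral>\<^sup>+x\<in>S. ennreal (h x) \<partial>lborel) < \<infinity>"
    unfolding set_integrable_def integrable_iff_bounded eq using h'' by simp
  assume ai: "h absolutely_integrable_on S"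
  have "(\<integral>\<^sup>+x\<in>S. ennreal (h x) \<partial>lborel) = (\<integral>\<^sup>+x. ennreal (indicator S x *\<^sub>R h x) \<partial>lebesgue)"
    unfolding nn_integral_completion
    by (intro nn_integral_cong) (auto simp: indicator_def)
  also have "\<dots> = ennreal (\<integral>x. indicator S x *\<^sub>R h x \<partial>lebesgue)"
    using ai unfolding set_integrable_def
    by (intro nn_integral_eq_integral) (auto simp: indicator_def nn)
  also have "(\<integral>x. indicator S x *\<^sub>R h x \<partial>lebesgue) = integral S h"
    using set_lebesgue_integral_eq_integral(2)[OF ai] by (simp add: set_lebesgue_integral_def)
  finally show "(\<integral>\<^sup>+x\<in>S. ennreal (h x) \<partial>lborel) = ennreal (integral S h)" .
qed

text \<open>Both sides may be infinite. If \<open>f\<close> is absolutely integrable on the image,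
  the theorem for signed integrals applies; otherwise its equivalence of integrability makes both
  sides infinite.\<close>

lemma nn_integral_change_of_variables_real:
  fixes f g g' :: "real => real"
  assumes S: "S \<in> sets borel" "g ` S \<in> sets borel"
    and der: "\<And>x. x \<in> S ==> (g has_real_derivative g' x) (at x)"
    and inj: "inj_on g S"
    and m[measurable]: "f \<in> borel_measurable borel" "g \<in> borel_measurable borel" "g' \<in> borel_measurable borel"
    and nn: "\<And>y. 0 <= f y"
  shows "(\<integral>\<^sup>+y\<in>g ` S. ennreal (f y) \<partial>lborel) = (\<integral>\<^sup>+x\<in>S. ennreal (\<bar>g' x\<bar> * f (g x)) \<partial>lborel)"
proof -
  have SL: "S \<in> sets lebesgue" using S by simp
  have der': "\<And>x. x \<in> S ==> (g has_real_derivative g' x) (at x within S)"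
    using der by (rule has_field_derivative_at_within)
  note cov = has_absolute_integral_change_of_variables_1'[OF SL der' inj, where f = f]
  have m1: "set_borel_measurable borel S (\<lambda>x. \<bar>g' x\<bar> * f (g x))"
    unfolding set_borel_measurable_def using S by measurable
  have m2: "set_borel_measurable borel (g ` S) f"
    unfolding set_borel_measurable_def using S by measurable
  note i1 = nn_integral_absolutely_integrable_iff[OF S(1) m1]
  note i2 = nn_integral_absolutely_integrable_iff[OF S(2) m2]
  show ?thesis
  proof (cases "f absolutely_integrable_on g ` S")
    case True
    then have "(\<lambda>x. \<bar>g' x\<bar> * f (g x)) absolutely_integrable_on S"
      "integral S (\<lambda>x. \<bar>g' x\<bar> * f (g x)) = integral (g ` S) f"
      using cov[of "integral (g ` S) f"] by auto
    then show ?thesis using i1(2) i2(2) True nn by simp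
  next
    case False
    then have "\<not> (\<lambda>x. \<bar>g' x\<bar> * f (g x)) absolutely_integrable_on S"
      using cov by auto
    then show ?thesis using False i1(1) i2(1) nn by (simp add: less_top[symmetric])
  qed
qed

lemma borel_measurable_section:
  fixes f :: "real => real => ennreal"
  assumes "(\<lambda>z. f (fst z) (snd z)) \<in> borel_measurable (borel \<Otimes>\<^sub>M borel)"
  shows "f x \<in> borel_measurable borel"
  using measurable_compose[OF measurable_Pair1' assms, of x] by simp

subsection \<open>The ground state argument on the line\<close>

text \<open>Here and below \<open>a\<close> stands for s p, so that 1 + a is the exponent N + s p of
  the kernel in dimension one.\<close>

definition energy1 :: "real => real => (real => real) => ennreal" where
  "energy1 p a v = (\<integral>\<^sup>+x. \<integral>\<^sup>+y. ennreal (\<bar>v x - v y\<bar> powr p / \<bar>x - y\<bar> powr (1 + a)) \<partial>lborel \<partial>lborel)"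

text \<open>The defect in Picone's inequality, integrated over the pairs in \<open>I\<close> that
  the truncation \<open>N\<close> keeps. Where \<open>w\<close> is positive the integrand is
  nonnegative, so the passage to \<open>ennreal\<close> loses nothing. It is carried along for the
  discussion of equality.\<close>

definition picone_rem ::
  "real => real => real set => (real => real) => (real => real) => (real => real => bool) => ennreal" where
  "picone_rem p a I w v N = (\<integral>\<^sup>+x. \<integral>\<^sup>+y. (if x \<in> I \<and> y \<in> I \<and> N x y then
     ennreal ((\<bar>v x - v y\<bar> powr p - Jp p (w x - w y) *
       (\<bar>v x\<bar> powr p / w x powr (p - 1) - \<bar>v y\<bar> powr p / w y powr (p - 1))) / \<bar>x - y\<bar> powr (1 + a))
     else 0) \<partial>lborel \<partial>lborel)"

lemma picone_rem_mono: "(\<And>x y. N x y ==> N' x y) ==> picone_rem p a I w v N <= picone_rem p a I w v N'"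
  unfolding picone_rem_def by (intro nn_integral_mono) auto

text \<open>Positive and negative part of the flux are kept apart, so that only one cancellation of a
  finite term is needed and no signed integral occurs.\<close>

definition flux :: "real => real => real set => (real => real) => (real => real => bool) => real => real => ennreal" where
  "flux p a I w N \<sigma> x = (\<integral>\<^sup>+y. (if y \<in> I \<and> N x y then
     ennreal (Jp p (\<sigma> * (w x - w y)) / \<bar>x - y\<bar> powr (1 + a)) else 0) \<partial>lborel)"

text \<open>The interaction of a point with the region in which the competing functions
  vanish.\<close>

definition outer :: "real => real set => real => ennreal" where
  "outer a I x = (\<integral>\<^sup>+y\<in>- I. ennreal (1 / \<bar>x - y\<bar> powr (1 + a)) \<partial>lborel)"

text \<open>Multiplying the flux inequality \<open>key\<close> by V = |v|^p / w^(p-1) and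
  integrating produces the Hardy term, and Picone's inequality turns the flux terms into energy. By
  \<open>fin\<close> and \<open>H\<close> the truncated negative flux has a finite integral Q, so 2
  Q may be cancelled. The pairs with exactly one point in \<open>I\<close> supply the exterior term
  twice.\<close>

lemma ground_state_truncated:
  fixes I :: "real set" and w d v :: "real => real" and c M :: ennreal
  assumes p: "1 < p" and I[measurable]: "I \<in> sets borel"
    and w[measurable]: "w \<in> borel_measurable borel" and d[measurable]: "d \<in> borel_measurable borel"
    and v[measurable]: "v \<in> borel_measurable borel"
    and wpos: "\<And>x. x \<in> I ==> 0 < w x"
    and v0: "\<And>x. x \<notin> I ==> v x = 0"
    and N[measurable]: "Measurable.pred (borel \<Otimes>\<^sub>M borel) (\<lambda>z. N (fst z) (snd z))"
    and Nsym: "\<And>x y. N x y ==> N y x"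
    and M: "M < \<infinity>"
    and fin: "\<And>x. x \<in> I ==> flux p a I w N (-1) x <= M * ennreal (w x powr (p - 1) * d x powr (- a))"
    and key: "\<And>x. x \<in> I ==> flux p a I w N (-1) x + c * ennreal (w x powr (p - 1) * d x powr (- a))
        <= flux p a I w N 1 x + ennreal (w x powr (p - 1)) * outer a I x"
    and H: "(\<integral>\<^sup>+x. ennreal (\<bar>v x\<bar> powr p * d x powr (- a)) \<partial>lborel) < \<infinity>"
  shows "2 * (c * (\<integral>\<^sup>+x. ennreal (\<bar>v x\<bar> powr p * d x powr (- a)) \<partial>lborel)) + picone_rem p a I w v N
    <= energy1 p a v"
proof -
  define V where "V x = \<bar>v x\<bar> powr p / w x powr (p - 1)" for x
  have V[measurable]: "V \<in> borel_measurable borel" unfolding V_def[abs_def] by measurable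
  have Vnn: "0 <= V x" for x by (simp add: V_def)
  define k where "k x y = 1 / \<bar>x - y\<bar> powr (1 + a)" for x y :: real
  have k[measurable]: "(\<lambda>z. k (fst z) (snd z)) \<in> borel_measurable (borel \<Otimes>\<^sub>M borel)"
    unfolding k_def by measurable
  have knn: "0 <= k x y" for x y by (simp add: k_def)
  have ksym: "k x y = k y x" for x y by (simp add: k_def abs_minus_commute)
  define B where "B x y \<longleftrightarrow> x \<in> I \<and> y \<in> I \<and> N x y" for x y
  have B[measurable]: "Measurable.pred (borel \<Otimes>\<^sub>M borel) (\<lambda>z. B (fst z) (snd z))"
    unfolding B_def by measurable
  have Bsym: "B x y = B y x" for x y using Nsym by (auto simp: B_def)
  \<comment> \<open>\<open>ennreal\<close> sends negative reals to 0, so \<open>F 1\<close> and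
    \<open>F (-1)\<close> are the positive and the negative part of the flux density.\<close>
  define F where "F s x y = (if B x y then ennreal (Jp p (s * (w x - w y)) * k x y) else 0)" for s x y
  have F[measurable]: "(\<lambda>z. F s (fst z) (snd z)) \<in> borel_measurable (borel \<Otimes>\<^sub>M borel)" for s
    unfolding F_def by measurable
  have Fsym: "F 1 y x = F (-1) x y" for x y
    by (simp add: F_def Bsym[of x y] ksym[of x y])
  define D where "D x y = (if B x y then ennreal (\<bar>v x - v y\<bar> powr p * k x y) else 0)" for x y
  have D[measurable]: "(\<lambda>z. D (fst z) (snd z)) \<in> borel_measurable (borel \<Otimes>\<^sub>M borel)"
    unfolding D_def by measurable
  define R where "R x y = (if B x y then ennreal ((\<bar>v x - v y\<bar> powr p - Jp p (w x - w y) * (V x - V y)) * k x y) else 0)" for x y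
  have R[measurable]: "(\<lambda>z. R (fst z) (snd z)) \<in> borel_measurable (borel \<Otimes>\<^sub>M borel)"
    unfolding R_def by measurable
  note [measurable] = borel_measurable_section[OF D] borel_measurable_section[OF F] borel_measurable_section[OF R]
  let ?II = "\<lambda>G. (\<integral>\<^sup>+x. \<integral>\<^sup>+y. G x y \<partial>lborel \<partial>lborel) :: ennreal"
  note FubL = lborel_pair.Fubini'[where ?'a = real and ?'b = real]
  have Rem: "picone_rem p a I w v N = ?II R"
    unfolding picone_rem_def R_def B_def V_def k_def times_divide_eq_right mult_1_right conj_assoc ..
  \<comment> \<open>The identity |v x - v y|^p = remainder + j (V x - V y), times the kernel, with
    each negative term moved to the other side so that it can be stated in
    \<open>ennreal\<close>.\<close>
  have pt: "D x y + F 1 x y * ennreal (V y) + F (-1) x y * ennreal (V x) =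
      R x y + F 1 x y * ennreal (V x) + F (-1) x y * ennreal (V y)" for x y
  proof (cases "B x y")
    case True
    then have wx: "0 < w x" "0 < w y" using wpos by (auto simp: B_def)
    have pic: "Jp p (w x - w y) * (V x - V y) <= \<bar>v x - v y\<bar> powr p"
      using picone(1)[OF p wx, of "v x" "v y"] by (simp add: V_def)
    define j where "j = Jp p (w x - w y)"
    have F1: "F 1 x y = ennreal (j * k x y)" and Fm: "F (-1) x y = ennreal (- j * k x y)"
      using True Jp_minus[of p "w x - w y"] by (auto simp: F_def j_def)
    have D: "D x y = ennreal (\<bar>v x - v y\<bar> powr p * k x y)"
      and R: "R x y = ennreal ((\<bar>v x - v y\<bar> powr p - j * (V x - V y)) * k x y)"
      using True by (auto simp: D_def R_def j_def)
    have nR: "0 <= (\<bar>v x - v y\<bar> powr p - j * (V x - V y)) * k x y"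
      using pic knn by (simp add: j_def)
    have nD: "0 <= \<bar>v x - v y\<bar> powr p * k x y" using knn by simp
    show ?thesis
    proof (cases "0 <= j")
      case True
      then have "F (-1) x y = 0" using knn[of x y] unfolding Fm
        by (auto simp: ennreal_eq_0_iff mult_nonneg_nonneg)
      moreover have "0 <= j * k x y" using True knn by simp
      moreover have "0 <= j * (V x * k x y)" "0 <= j * (V y * k x y)" using True knn Vnn by simp_all
      ultimately show ?thesis using nR nD Vnn unfolding F1 D R
        by (simp add: ennreal_mult'[symmetric] ennreal_plus[symmetric] algebra_simps del: ennreal_plus)
    next
      case False
      then have "F 1 x y = 0" using knn[of x y] unfolding F1
        by (simp add: ennreal_eq_0_iff mult_nonpos_nonneg)
      moreover have "0 <= - j * k x y" using False knn by (intro mult_nonneg_nonneg) auto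
      moreover have "j * (V x * k x y) <= 0" "j * (V y * k x y) <= 0"
        using False knn Vnn by (auto intro!: mult_nonpos_nonneg)
      ultimately show ?thesis using nR nD Vnn unfolding Fm D R
        by (simp add: ennreal_mult'[symmetric] ennreal_plus[symmetric] algebra_simps del: ennreal_plus)
    qed
  qed (simp add: D_def F_def R_def)
  define Q where "Q = ?II (\<lambda>x y. F (-1) x y * ennreal (V x))"
  define P where "P = ?II (\<lambda>x y. F 1 x y * ennreal (V x))"
  \<comment> \<open>Exchanging the points turns the positive part of the flux into the negative
    part, so Tonelli's theorem moves the weight from V y to V x.\<close>
  have Q': "?II (\<lambda>x y. F 1 x y * ennreal (V y)) = Q"
    unfolding Q_def by (subst FubL) (simp_all add: Fsym)
  have P': "?II (\<lambda>x y. F (-1) x y * ennreal (V y)) = P"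
    unfolding P_def by (subst FubL) (simp_all add: Fsym[symmetric])
  have "?II (\<lambda>x y. D x y + F 1 x y * ennreal (V y) + F (-1) x y * ennreal (V x)) =
      ?II D + ?II (\<lambda>x y. F 1 x y * ennreal (V y)) + Q"
    unfolding Q_def by (simp add: nn_integral_add)
  moreover have "?II (\<lambda>x y. R x y + F 1 x y * ennreal (V x) + F (-1) x y * ennreal (V y)) =
      ?II R + P + ?II (\<lambda>x y. F (-1) x y * ennreal (V y))"
    unfolding P_def by (simp add: nn_integral_add)
  ultimately have bal: "?II D + Q + Q = ?II R + P + P"
    unfolding Q' P' pt by simp
  define h where "h x = ennreal (\<bar>v x\<bar> powr p * d x powr (- a))" for x
  have h[measurable]: "h \<in> borel_measurable borel" unfolding h_def by measurable
  have Vh: "ennreal (V x) * ennreal (w x powr (p - 1) * d x powr (- a)) = h x" if "x \<in> I" for x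
    using wpos[OF that] by (simp add: V_def h_def ennreal_mult'[symmetric])
  have Vw: "ennreal (V x) * ennreal (w x powr (p - 1)) = ennreal (\<bar>v x\<bar> powr p)" if "x \<in> I" for x
    using wpos[OF that] by (simp add: V_def ennreal_mult'[symmetric])
  have V0: "V x = 0" "h x = 0" if "x \<notin> I" for x using v0[OF that] p by (auto simp: V_def h_def)
  have flF: "(\<integral>\<^sup>+y. F s x y \<partial>lborel) = flux p a I w N s x" if "x \<in> I" for s x
    using that unfolding flux_def F_def B_def k_def by (intro nn_integral_cong) auto
  have Qx: "Q = (\<integral>\<^sup>+x. ennreal (V x) * (\<integral>\<^sup>+y. F (-1) x y \<partial>lborel) \<partial>lborel)"
    unfolding Q_def by (simp add: nn_integral_multc mult.commute[of "ennreal (V x)" for x])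
  have Px: "P = (\<integral>\<^sup>+x. ennreal (V x) * (\<integral>\<^sup>+y. F 1 x y \<partial>lborel) \<partial>lborel)"
    unfolding P_def by (simp add: nn_integral_multc mult.commute[of "ennreal (V x)" for x])
  have "Q <= (\<integral>\<^sup>+x. M * h x \<partial>lborel)"
    unfolding Qx
  proof (rule nn_integral_mono)
    fix x :: real
    show "ennreal (V x) * (\<integral>\<^sup>+y. F (-1) x y \<partial>lborel) <= M * h x"
    proof (cases "x \<in> I")
      case True
      show ?thesis
        using mult_left_mono[OF fin[OF True], of "ennreal (V x)"] Vh[OF True, symmetric] True
        by (simp add: flF mult_ac)
    qed (simp add: V0)
  qed
  also have "\<dots> < \<infinity>"
    using M H by (simp add: nn_integral_cmult h_def[symmetric] ennreal_mult_less_top)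
  finally have Qfin: "Q < \<infinity>" .
  define Wout where "Wout = (\<integral>\<^sup>+x. ennreal (\<bar>v x\<bar> powr p) * (if x \<in> I then outer a I x else 0) \<partial>lborel)"
  have outer[measurable]: "outer a I \<in> borel_measurable borel"
    unfolding outer_def[abs_def] by measurable
  have QP: "Q + c * (\<integral>\<^sup>+x. h x \<partial>lborel) <= P + Wout"
  proof -
    have "Q + c * (\<integral>\<^sup>+x. h x \<partial>lborel) =
        (\<integral>\<^sup>+x. ennreal (V x) * (\<integral>\<^sup>+y. F (-1) x y \<partial>lborel) + c * h x \<partial>lborel)"
      unfolding Qx by (simp add: nn_integral_add nn_integral_cmult)
    also have "\<dots> <= (\<integral>\<^sup>+x. ennreal (V x) * (\<integral>\<^sup>+y. F 1 x y \<partial>lborel) +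
        ennreal (\<bar>v x\<bar> powr p) * (if x \<in> I then outer a I x else 0) \<partial>lborel)"
    proof (rule nn_integral_mono)
      fix x :: real
      show "ennreal (V x) * (\<integral>\<^sup>+y. F (-1) x y \<partial>lborel) + c * h x <=
        ennreal (V x) * (\<integral>\<^sup>+y. F 1 x y \<partial>lborel) +
        ennreal (\<bar>v x\<bar> powr p) * (if x \<in> I then outer a I x else 0)"
      proof (cases "x \<in> I")
        case True
        show ?thesis
          using mult_left_mono[OF key[OF True], of "ennreal (V x)"] True
          by (simp add: flF distrib_left Vh[OF True, symmetric] Vw[OF True, symmetric] mult_ac)
      qed (simp add: V0)
    qed
    also have "\<dots> = P + Wout"
      unfolding Px by (subst nn_integral_add) (auto simp: Wout_def)
    finally show ?thesis .
  qed
  \<comment> \<open>The kept pairs inside \<open>I\<close>, the pairs leaving \<open>I\<close> and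
    the pairs entering \<open>I\<close> are disjoint regions; dropping the remaining pairs only
    lowers the energy.\<close>
  have "?II D + Wout + Wout <= energy1 p a v"
  proof -
    define G where "G x y = (if x \<in> I \<and> y \<notin> I then ennreal (\<bar>v x\<bar> powr p * k x y) else 0)" for x y
    have G[measurable]: "(\<lambda>z. G (fst z) (snd z)) \<in> borel_measurable (borel \<Otimes>\<^sub>M borel)"
      unfolding G_def by measurable
    note [measurable] = borel_measurable_section[OF G]
    have G1: "?II G = Wout"
      unfolding Wout_def
    proof (rule nn_integral_cong)
      fix x :: real
      have "(\<integral>\<^sup>+y. G x y \<partial>lborel) = (\<integral>\<^sup>+y. (if x \<in> I then ennreal (\<bar>v x\<bar> powr p) else 0) *
         (ennreal (1 / \<bar>x - y\<bar> powr (1 + a)) * indicator (- I) y) \<partial>lborel)"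
        unfolding G_def k_def by (intro nn_integral_cong) (auto simp: ennreal_mult'[symmetric])
      also have "\<dots> = ennreal (\<bar>v x\<bar> powr p) * (if x \<in> I then outer a I x else 0)"
        unfolding outer_def by (subst nn_integral_cmult) auto
      finally show "(\<integral>\<^sup>+y. G x y \<partial>lborel) = ennreal (\<bar>v x\<bar> powr p) * (if x \<in> I then outer a I x else 0)" .
    qed
    have G2: "?II (\<lambda>x y. G y x) = Wout"
      unfolding G1[symmetric] by (subst FubL) simp_all
    have G': "(\<lambda>z. (\<lambda>x y. G y x) (fst z) (snd z)) \<in> borel_measurable (borel \<Otimes>\<^sub>M borel)"
      unfolding G_def k_def by measurable
    note [measurable] = G' borel_measurable_section[OF G']
    have "?II D + Wout + Wout = ?II D + ?II G + ?II (\<lambda>x y. G y x)"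
      by (simp only: G1 G2)
    also have "\<dots> = ?II (\<lambda>x y. D x y + G x y + G y x)"
      by (simp add: nn_integral_add)
    also have "\<dots> <= energy1 p a v"
      unfolding energy1_def
      by (intro nn_integral_mono) (auto simp: D_def G_def B_def v0 k_def abs_minus_commute)
    finally show ?thesis .
  qed
  then have e1: "?II D + Wout + Wout + Q + Q <= energy1 p a v + Q + Q" by (intro add_mono) auto
  have e2: "?II D + Wout + Wout + Q + Q = ?II R + (P + Wout) + (P + Wout)"
    using bal by (metis (no_types, lifting) add.assoc add.commute)
  have e3: "?II R + (Q + c * (\<integral>\<^sup>+x. h x \<partial>lborel)) + (Q + c * (\<integral>\<^sup>+x. h x \<partial>lborel)) <=
     ?II R + (P + Wout) + (P + Wout)" by (rule add_mono[OF add_mono[OF order_refl QP] QP])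
  have "?II R + (Q + c * (\<integral>\<^sup>+x. h x \<partial>lborel)) + (Q + c * (\<integral>\<^sup>+x. h x \<partial>lborel)) <=
      energy1 p a v + Q + Q" by (rule order_trans[OF e3 e1[unfolded e2]])
  then have "(Q + Q) + (2 * (c * (\<integral>\<^sup>+x. h x \<partial>lborel)) + ?II R) <= (Q + Q) + energy1 p a v"
    by (simp only: mult_2 add_ac)
  \<comment> \<open>The only cancellation in the argument, of the finite term 2 Q.\<close>
  then show ?thesis using Qfin unfolding Rem h_def[symmetric]
    by (subst (asm) ennreal_add_left_cancel_le) auto
qed


text \<open>On the interval from r exp(-n) to r the integral of 1 / y is n, and this interval stays
  inside the domain for every n.\<close>

lemma nn_integral_inverse_at_0:
  fixes \<eta> :: real assumes "0 < \<eta>"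
  shows "(\<integral>\<^sup>+y\<in>{0<..<\<eta>}. ennreal (1 / y) \<partial>lborel) = \<infinity>"
proof -
  have "ennreal (real n) <= (\<integral>\<^sup>+y\<in>{0<..<\<eta>}. ennreal (1 / y) \<partial>lborel)" for n
  proof -
    define l r where "l = \<eta> / 2 * exp (- real n)" and "r = \<eta> / 2"
    have lr: "0 < l" "l <= r" "r < \<eta>" using assms by (auto simp: l_def r_def)
    have "(\<integral>\<^sup>+y\<in>{l..r}. ennreal (1 / y) \<partial>lborel) = ennreal (ln r - ln l)"
      using lr by (intro nn_integral_FTC_Icc) (auto intro!: derivative_eq_intros)
    also have "ln r - ln l = real n" unfolding l_def r_def[symmetric] using assms by (subst ln_mult) (auto simp: r_def)
    finally have "ennreal (real n) = (\<integral>\<^sup>+y\<in>{l..r}. ennreal (1 / y) \<partial>lborel)" by simp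
    also have "\<dots> <= (\<integral>\<^sup>+y\<in>{0<..<\<eta>}. ennreal (1 / y) \<partial>lborel)"
      using lr by (intro nn_integral_mono) (auto simp: indicator_def)
    finally show ?thesis .
  qed
  then show ?thesis
    by (metis ennreal_Ex_less_of_nat ennreal_of_nat_eq_real_of_nat infinity_ennreal_def
        less_top linorder_not_le)
qed

text \<open>Each truncation comes with its own constant \<open>c n\<close>. As \<open>N 0\<close> is
  contained in every \<open>N n\<close>, the remainder over \<open>N 0\<close> bounds all the
  remainders from below and survives the limit.\<close>

lemma ground_state:
  fixes I :: "real set" and w d v :: "real => real" and c M :: "nat => ennreal"
    and N :: "nat => real => real => bool"
  assumes p: "1 < p" and I: "I \<in> sets borel"
    and w: "w \<in> borel_measurable borel" and d: "d \<in> borel_measurable borel"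
    and v: "v \<in> borel_measurable borel"
    and wpos: "\<And>x. x \<in> I ==> 0 < w x"
    and v0: "\<And>x. x \<notin> I ==> v x = 0"
    and N: "\<And>n. Measurable.pred (borel \<Otimes>\<^sub>M borel) (\<lambda>z. N n (fst z) (snd z))"
    and Nsym: "\<And>n x y. N n x y ==> N n y x"
    and Nmono: "\<And>n x y. N 0 x y ==> N n x y"
    and M: "\<And>n. M n < \<infinity>"
    and fin: "\<And>n x. x \<in> I ==> flux p a I w (N n) (-1) x <= M n * ennreal (w x powr (p - 1) * d x powr (- a))"
    and key: "\<And>n x. x \<in> I ==> flux p a I w (N n) (-1) x + c n * ennreal (w x powr (p - 1) * d x powr (- a))
        <= flux p a I w (N n) 1 x + ennreal (w x powr (p - 1)) * outer a I x"
    and lim: "c \<longlonglongrightarrow> C"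
    and H: "(\<integral>\<^sup>+x. ennreal (\<bar>v x\<bar> powr p * d x powr (- a)) \<partial>lborel) < \<infinity>"
  shows "2 * (C * (\<integral>\<^sup>+x. ennreal (\<bar>v x\<bar> powr p * d x powr (- a)) \<partial>lborel)) + picone_rem p a I w v (N 0)
    <= energy1 p a v"
proof -
  let ?H = "\<integral>\<^sup>+x. ennreal (\<bar>v x\<bar> powr p * d x powr (- a)) \<partial>lborel"
  have "2 * (c n * ?H) + picone_rem p a I w v (N 0) <= energy1 p a v" for n
  proof -
    have "2 * (c n * ?H) + picone_rem p a I w v (N 0) <= 2 * (c n * ?H) + picone_rem p a I w v (N n)"
      using Nmono by (intro add_mono picone_rem_mono) auto
    also have "\<dots> <= energy1 p a v"
      by (rule ground_state_truncated[OF p I w d v wpos v0 N _ M fin key H]) (auto intro: Nsym)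
    finally show ?thesis .
  qed
  moreover have "(\<lambda>n. 2 * (?H * c n) + picone_rem p a I w v (N 0)) \<longlonglongrightarrow>
      2 * (?H * C) + picone_rem p a I w v (N 0)"
    using lim H by (intro tendsto_add ennreal_tendsto_cmult tendsto_const) auto
  ultimately show ?thesis
    by (intro LIMSEQ_le_const2) (auto simp: mult.commute)
qed

text \<open>A vanishing remainder means equality in Picone's inequality for almost every kept pair.
  From a single point x with v x nonzero this reads off |v| = const w almost everywhere near 0; by
  \<open>near0\<close> the Hardy density then dominates a multiple of 1 / y, and the Hardy integral
  diverges.\<close>

lemma ground_state_strict:
  fixes I :: "real set" and w d v :: "real => real" and C :: ennreal
    and N :: "real => real => bool"
  assumes p: "1 < p" and I[measurable]: "I \<in> sets borel"
    and w[measurable]: "w \<in> borel_measurable borel" and d[measurable]: "d \<in> borel_measurable borel"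
    and v[measurable]: "v \<in> borel_measurable borel"
    and wpos: "\<And>x. x \<in> I ==> 0 < w x"
    and v0: "\<And>x. x \<notin> I ==> v x = 0"
    and N[measurable]: "Measurable.pred (borel \<Otimes>\<^sub>M borel) (\<lambda>z. N (fst z) (snd z))"
    and near0: "\<And>y. 0 < y ==> y < 1 / 2 ==> 1 / y <= w y powr p * d y powr (- a)"
    and I0: "\<And>x. x \<in> I ==> \<exists>\<eta>>0. \<forall>y. 0 < y \<and> y < \<eta> \<longrightarrow> y \<in> I \<and> N x y \<and> y < x"
    and H: "(\<integral>\<^sup>+x. ennreal (\<bar>v x\<bar> powr p * d x powr (- a)) \<partial>lborel) < \<infinity>"
    and rem: "picone_rem p a I w v N = 0"
  shows "(\<integral>\<^sup>+x. ennreal (\<bar>v x\<bar> powr p * d x powr (- a)) \<partial>lborel) = 0"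
proof (rule ccontr)
  assume nz: "(\<integral>\<^sup>+x. ennreal (\<bar>v x\<bar> powr p * d x powr (- a)) \<partial>lborel) \<noteq> 0"
  define R where "R x y = (if x \<in> I \<and> y \<in> I \<and> N x y then
     ennreal ((\<bar>v x - v y\<bar> powr p - Jp p (w x - w y) *
       (\<bar>v x\<bar> powr p / w x powr (p - 1) - \<bar>v y\<bar> powr p / w y powr (p - 1))) / \<bar>x - y\<bar> powr (1 + a))
     else 0)" for x y
  have R[measurable]: "(\<lambda>z. R (fst z) (snd z)) \<in> borel_measurable (borel \<Otimes>\<^sub>M borel)"
    unfolding R_def by measurable
  note [measurable] = borel_measurable_section[OF R]
  have "(\<integral>\<^sup>+x. \<integral>\<^sup>+y. R x y \<partial>lborel \<partial>lborel) = 0"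
    using rem unfolding picone_rem_def R_def by simp
  then have good: "AE x in lborel. AE y in lborel. R x y = 0"
    by (subst (asm) nn_integral_0_iff_AE) (auto simp: nn_integral_0_iff_AE)
  have "\<not> (AE x in lborel. v x = 0)"
  proof
    assume "AE x in lborel. v x = 0"
    then have "(\<integral>\<^sup>+x. ennreal (\<bar>v x\<bar> powr p * d x powr (- a)) \<partial>lborel) = (\<integral>\<^sup>+x. 0 \<partial>(lborel :: real measure))"
      using p by (intro nn_integral_cong_AE) auto
    then show False using nz by simp
  qed
  then have "\<exists>x. v x \<noteq> 0 \<and> (AE y in lborel. R x y = 0)"
    using good by (metis (mono_tags, lifting) eventually_mono)
  then obtain x where vx: "v x \<noteq> 0" and x: "AE y in lborel. R x y = 0" by blast
  have xI: "x \<in> I" using v0 vx by blast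
  then obtain \<eta> where \<eta>: "0 < \<eta>" "\<And>y. 0 < y ==> y < \<eta> ==> y \<in> I \<and> N x y \<and> y < x" using I0 by blast
  define \<eta>' where "\<eta>' = min \<eta> (1 / 2)"
  have \<eta>': "0 < \<eta>'" using \<eta> by (simp add: \<eta>'_def)
  define K where "K = (\<bar>v x\<bar> / w x) powr p"
  have K: "0 < K" using vx wpos[OF xI] by (simp add: K_def)
  have "AE y in lborel. ennreal K * (ennreal (1 / y) * indicator {0<..<\<eta>'} y) <=
      ennreal (\<bar>v y\<bar> powr p * d y powr (- a))"
    using x
  proof eventually_elim
    fix y assume R0: "R x y = 0"
    show "ennreal K * (ennreal (1 / y) * indicator {0<..<\<eta>'} y) <= ennreal (\<bar>v y\<bar> powr p * d y powr (- a))"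
    proof (cases "0 < y \<and> y < \<eta>'")
      case True
      then have y: "y \<in> I" "N x y" "y < x" using \<eta>(2)[of y] by (auto simp: \<eta>'_def)
      have wy: "0 < w x" "0 < w y" using wpos xI y by auto
      let ?P = "Jp p (w x - w y) * (\<bar>v x\<bar> powr p / w x powr (p - 1) - \<bar>v y\<bar> powr p / w y powr (p - 1))"
      have "(\<bar>v x - v y\<bar> powr p - ?P) / \<bar>x - y\<bar> powr (1 + a) <= 0"
        using R0 y xI by (simp add: R_def ennreal_eq_0_iff)
      then have "\<bar>v x - v y\<bar> powr p <= ?P"
        using y by (simp add: divide_le_0_iff)
      then have "?P = \<bar>v x - v y\<bar> powr p"
        using picone(1)[OF p wy, of "v x" "v y"] by linarith
      from picone(2)[OF p wy this] have "\<bar>v y\<bar> = \<bar>v x\<bar> / w x * w y"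
        using wy by (simp add: field_simps)
      then have "\<bar>v y\<bar> powr p = K * w y powr p"
        unfolding K_def by (simp only: powr_mult)
      then have "\<bar>v y\<bar> powr p * d y powr (- a) = K * (w y powr p * d y powr (- a))"
        by simp
      moreover have "K * (1 / y) <= K * (w y powr p * d y powr (- a))"
        using near0[of y] True K by (intro mult_left_mono) (auto simp: \<eta>'_def)
      ultimately have "K * (1 / y) <= \<bar>v y\<bar> powr p * d y powr (- a)" by linarith
      moreover have "ennreal K * ennreal (1 / y) = ennreal (K * (1 / y))"
        using K True by (intro ennreal_mult[symmetric]) auto
      ultimately show ?thesis using True by (simp add: ennreal_leI)
    qed auto
  qed
  then have "(\<integral>\<^sup>+y. ennreal K * (ennreal (1 / y) * indicator {0<..<\<eta>'} y) \<partial>lborel) <=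
    (\<integral>\<^sup>+x. ennreal (\<bar>v x\<bar> powr p * d x powr (- a)) \<partial>lborel)"
    by (rule nn_integral_mono_AE)
  moreover have "(\<integral>\<^sup>+y. ennreal K * (ennreal (1 / y) * indicator {0<..<\<eta>'} y) \<partial>lborel) = \<infinity>"
    using nn_integral_inverse_at_0[OF \<eta>'] K
    by (subst nn_integral_cmult) (auto simp: ennreal_mult_eq_top_iff ennreal_eq_0_iff)
  ultimately show False using H by simp
qed


text \<open>Half of the sharp constant of the half-line: the flux through the truncation at ratio
  \<open>th\<close>, and its limit \<open>th \<rightarrow> 1\<close>, to which the exterior of the half-line adds \<open>1 / a\<close>.\<close>

definition hK :: "real => real => real => ennreal" where
  "hK p a th = (\<integral>\<^sup>+t\<in>{0<..th}. ennreal (\<bar>1 - t powr ((a - 1) / p)\<bar> powr p / (1 - t) powr (1 + a)) \<partial>lborel)"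

definition hC :: "real => real => ennreal" where
  "hC p a = (\<integral>\<^sup>+t\<in>{0<..<1}. ennreal (\<bar>1 - t powr ((a - 1) / p)\<bar> powr p / (1 - t) powr (1 + a)) \<partial>lborel)
     + ennreal (1 / a)"

text \<open>Truncation ratios increasing from 1/2 to 1; the offset 2 puts the first of them strictly
  between 0 and 1.\<close>

definition hth :: "nat => real" where "hth n = 1 - 1 / (real n + 2)"

lemma hth: "0 < hth n" "hth n < 1" "hth 0 = 1 / 2" "m <= n ==> hth m <= hth n"
  by (auto simp: hth_def field_simps)

lemma hK_lim: "(\<lambda>n. hK p a (hth n) + ennreal (1 / a)) \<longlonglongrightarrow> hC p a"
proof -
  let ?f = "\<lambda>t. ennreal (\<bar>1 - t powr ((a - 1) / p)\<bar> powr p / (1 - t) powr (1 + a))"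
  have lim: "hth \<longlonglongrightarrow> 1"
  proof -
    have "(\<lambda>n. 1 - 1 / real (n + 2)) \<longlonglongrightarrow> 1 - 0"
      by (intro tendsto_diff tendsto_const LIMSEQ_ignore_initial_segment[OF lim_1_over_n])
    then show ?thesis by (simp add: hth_def[abs_def] add.commute)
  qed
  have "(\<lambda>n. \<integral>\<^sup>+t. ?f t * indicator {0<..hth n} t \<partial>lborel) \<longlonglongrightarrow> (\<integral>\<^sup>+t. ?f t * indicator {0<..<1} t \<partial>lborel)"
  proof (rule nn_integral_LIMSEQ)
    show "incseq (\<lambda>n t. ?f t * indicator {0<..hth n} t)"
      using hth(4) by (auto simp: incseq_def le_fun_def indicator_def intro: order_trans)
    fix t :: real
    have "eventually (\<lambda>n. indicator {0<..hth n} t = (indicator {0<..<1} t :: ennreal)) sequentially"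
    proof (cases "t < 1")
      case True
      have "eventually (\<lambda>n. t < hth n) sequentially" using lim True by (rule order_tendstoD)
      then show ?thesis by eventually_elim (use True in \<open>auto simp: indicator_def\<close>)
    next
      case False
      then have "hth n < t" for n using hth(2)[of n] by simp
      then show ?thesis using False by (auto simp: indicator_def not_le)
    qed
    then show "(\<lambda>n. ?f t * indicator {0<..hth n} t) \<longlonglongrightarrow> ?f t * indicator {0<..<1} t"
      by (intro tendsto_eventually) (auto elim: eventually_mono)
  qed measurable
  then show ?thesis unfolding hK_def hC_def by (intro tendsto_add tendsto_const)
qed

text \<open>The sharp inequality together with its rigidity: for a finite Hardy integral, equality
  is possible only if that integral is 0. The factor 2 appears because \<open>hC\<close> is half of
  the constant of the half-line.\<close>

definition line_hardy :: "real => real => real set => (real => real) => bool" where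
  "line_hardy p a I d \<longleftrightarrow> (\<forall>v\<in>borel_measurable borel. (\<forall>x. x \<notin> I \<longrightarrow> v x = 0) \<longrightarrow>
     (\<integral>\<^sup>+x. ennreal (\<bar>v x\<bar> powr p * d x powr (- a)) \<partial>lborel) < \<infinity> \<longrightarrow>
     2 * (hC p a * (\<integral>\<^sup>+x. ennreal (\<bar>v x\<bar> powr p * d x powr (- a)) \<partial>lborel)) <= energy1 p a v \<and>
     (energy1 p a v = 2 * (hC p a * (\<integral>\<^sup>+x. ennreal (\<bar>v x\<bar> powr p * d x powr (- a)) \<partial>lborel)) \<longrightarrow>
       (\<integral>\<^sup>+x. ennreal (\<bar>v x\<bar> powr p * d x powr (- a)) \<partial>lborel) = 0))"

text \<open>Reduces the inequality on an interval to pointwise flux estimates for one ground state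
  and a sequence of truncations. In the case of equality the finite main term can be subtracted, so
  the remainder over \<open>N 0\<close> vanishes and rigidity follows.\<close>

lemma line_hardyI:
  fixes I :: "real set" and w d :: "real => real" and M :: "nat => ennreal"
    and N :: "nat => real => real => bool"
  assumes p: "1 < p" and fin_C: "hC p a < \<infinity>" and I: "I \<in> sets borel"
    and w: "w \<in> borel_measurable borel" and d: "d \<in> borel_measurable borel"
    and wpos: "\<And>x. x \<in> I ==> 0 < w x"
    and N: "\<And>n. Measurable.pred (borel \<Otimes>\<^sub>M borel) (\<lambda>z. N n (fst z) (snd z))"
    and Nsym: "\<And>n x y. N n x y ==> N n y x"
    and Nmono: "\<And>n x y. N 0 x y ==> N n x y"
    and M: "\<And>n. M n < \<infinity>"
    and fin: "\<And>n x. x \<in> I ==> flux p a I w (N n) (-1) x <= M n * ennreal (w x powr (p - 1) * d x powr (- a))"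
    and key: "\<And>n x. x \<in> I ==> flux p a I w (N n) (-1) x +
        (hK p a (hth n) + ennreal (1 / a)) * ennreal (w x powr (p - 1) * d x powr (- a))
        <= flux p a I w (N n) 1 x + ennreal (w x powr (p - 1)) * outer a I x"
    and near0: "\<And>y. 0 < y ==> y < 1 / 2 ==> 1 / y <= w y powr p * d y powr (- a)"
    and I0: "\<And>x. x \<in> I ==> \<exists>\<eta>>0. \<forall>y. 0 < y \<and> y < \<eta> \<longrightarrow> y \<in> I \<and> N 0 x y \<and> y < x"
  shows "line_hardy p a I d"
  unfolding line_hardy_def
proof (intro ballI impI)
  fix v :: "real => real"
  assume v: "v \<in> borel_measurable borel" and v0: "\<forall>x. x \<notin> I \<longrightarrow> v x = 0"
  let ?H = "\<integral>\<^sup>+x. ennreal (\<bar>v x\<bar> powr p * d x powr (- a)) \<partial>lborel"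
  assume H: "?H < \<infinity>"
  have ge: "2 * (hC p a * ?H) + picone_rem p a I w v (N 0) <= energy1 p a v"
    by (rule ground_state[OF p I w d v wpos _ N Nsym Nmono M fin key hK_lim H]) (use v0 in auto)
  have "?H = 0" if "energy1 p a v = 2 * (hC p a * ?H)"
  proof -
    have "2 * (hC p a * ?H) + picone_rem p a I w v (N 0) <= 2 * (hC p a * ?H) + 0"
      using ge that by simp
    moreover have "2 * (hC p a * ?H) < \<infinity>" using fin_C H by (simp add: ennreal_mult_less_top)
    ultimately have "picone_rem p a I w v (N 0) = 0"
      by (subst (asm) ennreal_add_left_cancel_le) auto
    then show ?thesis
      by (intro ground_state_strict[OF p I w d v wpos _ N near0 I0 H]) (use v0 in auto)
  qed
  moreover have "2 * (hC p a * ?H) <= energy1 p a v" by (rule order_trans[OF _ ge]) (simp add: add_increasing2)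
  ultimately show "2 * (hC p a * ?H) <= energy1 p a v \<and> (energy1 p a v = 2 * (hC p a * ?H) \<longrightarrow> ?H = 0)"
    by blast
qed

subsection \<open>The half-line\<close>

lemma nn_integral_powr_from_0:
  fixes \<beta> th :: real
  assumes "-1 < \<beta>" "0 <= th"
  shows "(\<integral>\<^sup>+t\<in>{0<..th}. ennreal (t powr \<beta>) \<partial>lborel) = ennreal (th powr (\<beta> + 1) / (\<beta> + 1))"
proof -
  have "((\<lambda>x. x powr \<beta>) has_integral (th powr (\<beta> + 1) / (\<beta> + 1))) {0..th}"
    using assms by (rule has_integral_powr_from_0)
  from nn_integral_has_integral_lebesgue[OF _ this]
  have *: "(\<integral>\<^sup>+t. ennreal (indicator {0..th} t * t powr \<beta>) \<partial>lborel) = ennreal (th powr (\<beta> + 1) / (\<beta> + 1))"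
    by simp
  have "AE t::real in lborel. t \<noteq> 0" by (rule AE_lborel_singleton)
  then have "(\<integral>\<^sup>+t\<in>{0<..th}. ennreal (t powr \<beta>) \<partial>lborel) = (\<integral>\<^sup>+t. ennreal (indicator {0..th} t * t powr \<beta>) \<partial>lborel)"
    by (intro nn_integral_cong_AE) (auto elim!: eventually_mono simp: indicator_def)
  then show ?thesis using * by simp
qed

lemma nn_integral_power_tail:
  fixes a x :: real
  assumes "0 < a" "0 < x"
  shows "(\<integral>\<^sup>+t\<in>{x..}. ennreal (1 / t powr (1 + a)) \<partial>lborel) = ennreal (x powr (- a) / a)"
proof -
  have lim: "((\<lambda>t. - (t powr (- a) / a)) \<longlongrightarrow> - (0 / a)) at_top"
    using assms by (intro tendsto_intros tendsto_neg_powr filterlim_ident) auto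
  have "(\<integral>\<^sup>+t\<in>{x..}. ennreal (1 / t powr (1 + a)) \<partial>lborel) = ennreal (- (0 / a) - - (x powr (- a) / a))"
  proof (rule nn_integral_FTC_atLeast[OF _ _ _ lim])
    fix t assume t: "x <= t"
    then have "0 < t" using assms by simp
    then show "((\<lambda>t. - (t powr (- a) / a)) has_real_derivative 1 / t powr (1 + a)) (at t)"
      using assms by (auto intro!: derivative_eq_intros simp: powr_minus powr_diff powr_add divide_simps)
  qed auto
  then show ?thesis by simp
qed

text \<open>This is the origin of the summand 1 / a in \<open>hC\<close>, and thereby of 2 / (s p)
  in \<open>Lambda\<close>.\<close>

lemma outer_nonpos:
  assumes "0 < a" "0 < x"
  shows "(\<integral>\<^sup>+y\<in>{..0}. ennreal (1 / \<bar>x - y\<bar> powr (1 + a)) \<partial>lborel) = ennreal (x powr (- a) / a)"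
proof -
  have "(\<integral>\<^sup>+y\<in>{..0}. ennreal (1 / \<bar>x - y\<bar> powr (1 + a)) \<partial>lborel) =
    (\<integral>\<^sup>+t. ennreal (1 / \<bar>x - (x + (-1) * t)\<bar> powr (1 + a)) * indicator {..0} (x + (-1) * t) \<partial>lborel)"
    by (subst nn_integral_real_affine[where c = "-1" and t = x]) auto
  also have "\<dots> = (\<integral>\<^sup>+t\<in>{x..}. ennreal (1 / t powr (1 + a)) \<partial>lborel)"
    using assms by (intro nn_integral_cong) (auto simp: indicator_def)
  finally show ?thesis using nn_integral_power_tail[OF assms] by simp
qed

text \<open>A kept region that is parametrised from below and from above by \<open>t <= th\<close> is folded onto
  \<open>{0<..th}\<close>; the contributions of the two sides then cancel up to a nonnegative term.\<close>

lemma flux_fold: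
  fixes g1 g2 g1' g2' w :: "real => real"
  assumes w[measurable]: "w \<in> borel_measurable borel" and I[measurable]: "I \<in> sets borel"
    and reg: "{y \<in> I. N x y} = g1 ` {0<..th} \<union> g2 ` {0<..th}" "g1 ` {0<..th} \<inter> g2 ` {0<..th} = {}"
    and im[measurable]: "g1 ` {0<..th} \<in> sets borel" "g2 ` {0<..th} \<in> sets borel"
    and der: "\<And>t. 0 < t ==> t <= th ==> (g1 has_real_derivative g1' t) (at t)"
      "\<And>t. 0 < t ==> t <= th ==> (g2 has_real_derivative g2' t) (at t)"
    and inj: "inj_on g1 {0<..th}" "inj_on g2 {0<..th}"
    and m[measurable]: "g1 \<in> borel_measurable borel" "g2 \<in> borel_measurable borel"
      "g1' \<in> borel_measurable borel" "g2' \<in> borel_measurable borel"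
    and h: "\<And>t. 0 < t ==> t <= th ==> \<bar>g1' t\<bar> * (Jp p (\<sigma> * (w x - w (g1 t))) / \<bar>x - g1 t\<bar> powr (1 + a)) = h1 t"
      "\<And>t. 0 < t ==> t <= th ==> \<bar>g2' t\<bar> * (Jp p (\<sigma> * (w x - w (g2 t))) / \<bar>x - g2 t\<bar> powr (1 + a)) = h2 t"
  shows "flux p a I w N \<sigma> x =
    (\<integral>\<^sup>+t\<in>{0<..th}. ennreal (h1 t) \<partial>lborel) + (\<integral>\<^sup>+t\<in>{0<..th}. ennreal (h2 t) \<partial>lborel)"
proof -
  \<comment> \<open>The maximum makes the integrand nonnegative, as the change of variables demands,
    without altering its image in \<open>ennreal\<close>.\<close>
  define f where "f y = max 0 (Jp p (\<sigma> * (w x - w y)) / \<bar>x - y\<bar> powr (1 + a))" for y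
  have f[measurable]: "f \<in> borel_measurable borel" unfolding f_def[abs_def] by measurable
  have fn: "0 <= f y" for y by (simp add: f_def)
  have fe: "ennreal (f y) = ennreal (Jp p (\<sigma> * (w x - w y)) / \<bar>x - y\<bar> powr (1 + a))" for y
    by (simp add: f_def max_def ennreal_neg)
  have c: "(\<integral>\<^sup>+y\<in>g ` {0<..th}. ennreal (f y) \<partial>lborel) = (\<integral>\<^sup>+t\<in>{0<..th}. ennreal (h t) \<partial>lborel)"
    if "g ` {0<..th} \<in> sets borel" "\<And>t. 0 < t ==> t <= th ==> (g has_real_derivative g' t) (at t)"
      "inj_on g {0<..th}" "g \<in> borel_measurable borel" "g' \<in> borel_measurable borel"
      "\<And>t. 0 < t ==> t <= th ==> \<bar>g' t\<bar> * (Jp p (\<sigma> * (w x - w (g t))) / \<bar>x - g t\<bar> powr (1 + a)) = h t"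
    for g g' h
  proof -
    have "(\<integral>\<^sup>+y\<in>g ` {0<..th}. ennreal (f y) \<partial>lborel) = (\<integral>\<^sup>+t\<in>{0<..th}. ennreal (\<bar>g' t\<bar> * f (g t)) \<partial>lborel)"
      using that fn by (intro nn_integral_change_of_variables_real) auto
    also have "\<dots> = (\<integral>\<^sup>+t\<in>{0<..th}. ennreal (h t) \<partial>lborel)"
    proof (rule nn_integral_cong)
      fix t :: real
      show "ennreal (\<bar>g' t\<bar> * f (g t)) * indicator {0<..th} t = ennreal (h t) * indicator {0<..th} t"
      proof (cases "0 < t \<and> t <= th")
        case True
        have "\<bar>g' t\<bar> * f (g t) = max 0 (\<bar>g' t\<bar> * (Jp p (\<sigma> * (w x - w (g t))) / \<bar>x - g t\<bar> powr (1 + a)))"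
          unfolding f_def by (simp add: max_mult_distrib_left)
        also have "\<dots> = max 0 (h t)" using that(6) True by simp
        finally show ?thesis by (simp add: max_def ennreal_neg)
      qed simp
    qed
    finally show ?thesis .
  qed
  have "flux p a I w N \<sigma> x = (\<integral>\<^sup>+y. ennreal (f y) * indicator (g1 ` {0<..th}) y + ennreal (f y) * indicator (g2 ` {0<..th}) y \<partial>lborel)"
    unfolding flux_def fe[symmetric]
  proof (rule nn_integral_cong)
    fix y :: real
    have "y \<in> I \<and> N x y \<longleftrightarrow> y \<in> g1 ` {0<..th} \<or> y \<in> g2 ` {0<..th}" using reg(1) by blast
    moreover have "\<not> (y \<in> g1 ` {0<..th} \<and> y \<in> g2 ` {0<..th})" using reg(2) by blast
    ultimately show "(if y \<in> I \<and> N x y then ennreal (f y) else 0) =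
        ennreal (f y) * indicator (g1 ` {0<..th}) y + ennreal (f y) * indicator (g2 ` {0<..th}) y"
      by (auto simp: indicator_def)
  qed
  also have "\<dots> = (\<integral>\<^sup>+t\<in>{0<..th}. ennreal (h1 t) \<partial>lborel) + (\<integral>\<^sup>+t\<in>{0<..th}. ennreal (h2 t) \<partial>lborel)"
    by (simp add: nn_integral_add c[OF im(1) der(1) inj(1) m(1,3) h(1)] c[OF im(2) der(2) inj(2) m(2,4) h(2)])
  finally show ?thesis .
qed


text \<open>For positive points: y / x is at most th or at least 1 / th. A cut-off in the ratio,
  unlike one in the difference, is invariant under dilations, so the truncated flux of a power is
  again a power.\<close>

definition ratio_kept :: "real => real => real => bool" where
  "ratio_kept th x y \<longleftrightarrow> y <= th * x \<or> x <= th * y"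

lemma image_scale_unit:
  fixes th x :: real
  assumes "0 < x" "0 < th"
  shows "(\<lambda>t. x * t) ` {0<..th} = {0<..x * th}" "(\<lambda>t. x / t) ` {0<..th} = {x / th..}"
proof -
  show "(\<lambda>t. x * t) ` {0<..th} = {0<..x * th}"
  proof (intro set_eqI iffI)
    fix y assume "y \<in> {0<..x * th}"
    then show "y \<in> (\<lambda>t. x * t) ` {0<..th}"
      using assms by (intro image_eqI[of _ _ "y / x"]) (auto simp: field_simps)
  qed (use assms in auto)
  show "(\<lambda>t. x / t) ` {0<..th} = {x / th..}"
  proof (intro set_eqI iffI)
    fix y assume "y \<in> {x / th..}"
    moreover have "0 < x / th" using assms by simp
    ultimately have "0 < y" "x / th <= y" by (auto simp del: zero_less_divide_iff)
    then show "y \<in> (\<lambda>t. x / t) ` {0<..th}"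
      using assms by (intro image_eqI[of _ _ "x / y"]) (auto simp: field_simps)
  qed (use assms in \<open>auto simp: field_simps\<close>)
qed

text \<open>The flux of \<open>x powr \<alpha>\<close> scales, and \<open>t \<mapsto> 1 / t\<close> turns the contribution of
  \<open>y \<ge> x / th\<close> into \<open>- t powr \<alpha>\<close> times that of \<open>y <= th x\<close>.\<close>

lemma flux_halfline:
  assumes p: "1 < p" and a: "0 < a" and x: "0 < x" and th: "0 < th" "th < 1"
  defines "\<alpha> \<equiv> (a - 1) / p"
  defines "q \<equiv> \<lambda>t. Jp p (1 - t powr \<alpha>) / (1 - t) powr (1 + a)"
  shows "flux p a {0<..} (\<lambda>x. x powr \<alpha>) (ratio_kept th) \<sigma> x =
    ennreal ((x powr \<alpha>) powr (p - 1) * x powr (- a)) *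
    ((\<integral>\<^sup>+t\<in>{0<..th}. ennreal (Jp p (\<sigma> * (1 - t powr \<alpha>)) / (1 - t) powr (1 + a)) \<partial>lborel) +
     (\<integral>\<^sup>+t\<in>{0<..th}. ennreal (t powr \<alpha> * (Jp p (- \<sigma> * (1 - t powr \<alpha>)) / (1 - t) powr (1 + a))) \<partial>lborel))"
proof -
  define X where "X = (x powr \<alpha>) powr (p - 1) * x powr (- a)"
  have X: "0 <= X" by (simp add: X_def)
  have xa: "0 < x powr \<alpha>" using x by simp
  have ap: "\<alpha> * p = a - 1" using p by (simp add: \<alpha>_def)
  let ?h1 = "\<lambda>t. X * (Jp p (\<sigma> * (1 - t powr \<alpha>)) / (1 - t) powr (1 + a))"
  let ?h2 = "\<lambda>t. X * (t powr \<alpha> * (Jp p (- \<sigma> * (1 - t powr \<alpha>)) / (1 - t) powr (1 + a)))"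
  have sep: "x * th < x / th"
  proof -
    have "th * th < 1 * 1" using th by (intro mult_strict_mono) auto
    then have "x * (th * th) < x * 1" using x by (intro mult_strict_left_mono) auto
    then show ?thesis using x th by (simp add: field_simps)
  qed
  have E: "flux p a {0<..} (\<lambda>x. x powr \<alpha>) (ratio_kept th) \<sigma> x =
    (\<integral>\<^sup>+t\<in>{0<..th}. ennreal (?h1 t) \<partial>lborel) + (\<integral>\<^sup>+t\<in>{0<..th}. ennreal (?h2 t) \<partial>lborel)"
  proof (rule flux_fold[where ?g1.0 = "\<lambda>t. x * t" and ?g2.0 = "\<lambda>t. x / t" and ?g1'.0 = "\<lambda>t. x"
        and ?g2'.0 = "\<lambda>t. - x / t\<^sup>2"])
    have "y \<in> {0<..} \<and> ratio_kept th x y \<longleftrightarrow> y \<in> {0<..x * th} \<union> {x / th..}" for y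
    proof -
      have "0 < y" if "x <= th * y"
        using less_le_trans[OF x that] th by (simp add: zero_less_mult_iff)
      then show ?thesis using x th by (auto simp: ratio_kept_def field_simps)
    qed
    then show "{y \<in> {0<..}. ratio_kept th x y} = (\<lambda>t. x * t) ` {0<..th} \<union> (\<lambda>t. x / t) ` {0<..th}"
      unfolding image_scale_unit[OF x th(1)] by blast
    show "(\<lambda>t. x * t) ` {0<..th} \<inter> (\<lambda>t. x / t) ` {0<..th} = {}"
      using sep unfolding image_scale_unit[OF x th(1)] by auto
    show "(\<lambda>t. x * t) ` {0<..th} \<in> sets borel" "(\<lambda>t. x / t) ` {0<..th} \<in> sets borel"
      unfolding image_scale_unit[OF x th(1)] by auto
    show "inj_on (\<lambda>t. x * t) {0<..th}" "inj_on (\<lambda>t. x / t) {0<..th}"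
      using x by (auto simp: inj_on_def field_simps)
    fix t assume t: "0 < t" "t <= th"
    then have t1: "0 < 1 - t" using th by simp
    show "((\<lambda>t. x * t) has_real_derivative x) (at t)" by (auto intro!: derivative_eq_intros)
    show "((\<lambda>t. x / t) has_real_derivative - x / t\<^sup>2) (at t)"
      using t by (auto intro!: derivative_eq_intros simp: power2_eq_square)
    have e1: "\<sigma> * (x powr \<alpha> - (x * t) powr \<alpha>) = x powr \<alpha> * (\<sigma> * (1 - t powr \<alpha>))"
      by (simp add: powr_mult algebra_simps)
    have 1: "Jp p (\<sigma> * (x powr \<alpha> - (x * t) powr \<alpha>)) = (x powr \<alpha>) powr (p - 1) * Jp p (\<sigma> * (1 - t powr \<alpha>))"
      unfolding e1 by (intro Jp_mult[OF xa])
    have "\<bar>x - x * t\<bar> = x * (1 - t)" using x t1 by (simp add: abs_mult[symmetric] algebra_simps)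
    then have 2: "\<bar>x - x * t\<bar> powr (1 + a) = x * (x powr a * (1 - t) powr (1 + a))"
      using x t1 by (simp add: powr_mult powr_add)
    show "\<bar>x\<bar> * (Jp p (\<sigma> * (x powr \<alpha> - (x * t) powr \<alpha>)) / \<bar>x - x * t\<bar> powr (1 + a)) = ?h1 t"
      unfolding 1 2 X_def using x by (simp add: powr_minus divide_simps)
    have ta: "0 < x powr \<alpha> * t powr (- \<alpha>)" using x t by simp
    have e3: "\<sigma> * (x powr \<alpha> - (x / t) powr \<alpha>) = (x powr \<alpha> * t powr (- \<alpha>)) * (- \<sigma> * (1 - t powr \<alpha>))"
      using t by (simp add: powr_divide powr_minus divide_simps algebra_simps)
    have 3: "Jp p (\<sigma> * (x powr \<alpha> - (x / t) powr \<alpha>)) =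
        (x powr \<alpha>) powr (p - 1) * t powr (- \<alpha> * (p - 1)) * Jp p (- \<sigma> * (1 - t powr \<alpha>))"
      unfolding e3 Jp_mult[OF ta] by (simp add: powr_mult powr_powr)
    have "\<bar>x - x / t\<bar> = x / t * (1 - t)"
    proof -
      have "x - x / t = - (x / t * (1 - t))" using t by (simp add: field_simps)
      then show ?thesis using x t t1 by (simp add: abs_mult)
    qed
    then have 4: "\<bar>x - x / t\<bar> powr (1 + a) = x * (x powr a * t powr (- 1 - a) * (1 - t) powr (1 + a))"
      using x t t1 by (simp add: powr_mult powr_divide powr_add powr_diff powr_minus divide_simps)
    \<comment> \<open>Here the choice of the exponent matters: because of \<alpha> p = a - 1, the
      Jacobian 1 / t^2, the kernel and the ground state combine to the single factor t powr
      \<alpha>.\<close>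
    have 5: "t powr (- \<alpha> * (p - 1)) = t powr \<alpha> * (t * t powr (- a))"
    proof -
      have "- \<alpha> * (p - 1) = \<alpha> + (1 + - a)" using ap by (simp add: algebra_simps)
      then show ?thesis using t by (simp only: powr_add) simp
    qed
    have 6: "t powr (- 1 - a) = 1 / (t * t powr a)"
    proof -
      have "- 1 - a = - (1 + a)" by simp
      then show ?thesis using t by (simp only: powr_minus powr_add) (simp add: divide_simps)
    qed
    show "\<bar>- x / t\<^sup>2\<bar> * (Jp p (\<sigma> * (x powr \<alpha> - (x / t) powr \<alpha>)) / \<bar>x - x / t\<bar> powr (1 + a)) = ?h2 t"
      unfolding 3 4 5 6 X_def using x t t1
      by (simp add: powr_minus divide_simps power2_eq_square)
  qed auto
  have pull: "(\<integral>\<^sup>+t\<in>{0<..th}. ennreal (X * f t) \<partial>lborel) = ennreal X * (\<integral>\<^sup>+t\<in>{0<..th}. ennreal (f t) \<partial>lborel)"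
    if [measurable]: "f \<in> borel_measurable borel" for f
    using X by (simp add: ennreal_mult' mult.assoc nn_integral_cmult)
  show ?thesis
    unfolding E X_def[symmetric] distrib_left by (intro arg_cong2[where f = "(+)"] pull) measurable
qed

text \<open>With J = Jp p (1 - u) / m the direct and the folded contribution add up to J - u J = J
  (1 - u) = |1 - u|^p / m. The statement is this identity with positive and negative parts on
  opposite sides. For u = t powr \<alpha> the last term integrates to \<open>hK\<close>.\<close>

lemma flux_parts:
  assumes p: "1 < p" and u: "0 <= u" and m: "0 < m"
  shows "ennreal (Jp p (1 - u) / m) + ennreal (u * (Jp p (- 1 * (1 - u)) / m)) =
    ennreal (Jp p (- 1 * (1 - u)) / m) + ennreal (u * (Jp p (1 - u) / m)) + ennreal (\<bar>1 - u\<bar> powr p / m)"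
proof -
  define J where "J = Jp p (1 - u) / m"
  have J: "Jp p (1 - u) / m = J" "Jp p (-1 * (1 - u)) / m = - J"
    using Jp_minus[of p "1 - u"] by (simp_all add: J_def)
  have JJ: "\<bar>1 - u\<bar> powr p / m = J * (1 - u)"
    using Jp_times_self[OF p, of "1 - u"] by (simp add: J_def)
  have nn: "0 <= J * (1 - u)" using m unfolding JJ[symmetric] by simp
  show ?thesis
  proof (cases "0 <= J")
    case True
    then have "0 <= u * J" "u * - J <= 0" "- J <= 0" using u by auto
    moreover have "u * J + J * (1 - u) = J" by (simp add: algebra_simps)
    ultimately show ?thesis unfolding J JJ
      using nn ennreal_plus[of "u * J" "J * (1 - u)"] by (simp add: ennreal_neg del: ennreal_plus)
  next
    case False
    then have "u * J <= 0" "0 <= - J" "J <= 0" using u by (auto simp: mult_nonneg_nonpos)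
    moreover have "- J + J * (1 - u) = u * - J" by (simp add: algebra_simps)
    ultimately show ?thesis unfolding J JJ
      using nn ennreal_plus[of "- J" "J * (1 - u)"] by (simp add: ennreal_neg del: ennreal_plus)
  qed
qed

text \<open>These two expressions make up the negative flux. For \<alpha> >= 0 the first is
  nonpositive and the second at most 1; for \<alpha> < 0 the second is nonpositive and the first at
  most t powr (\<alpha> (p - 1)).\<close>

lemma Jp_one_minus_powr_bounds:
  assumes p: "1 < p" and a: "0 < a" and t: "0 < t" "t < 1"
  defines "\<alpha> \<equiv> (a - 1) / p"
  shows "Jp p (- 1 * (1 - t powr \<alpha>)) <= 1 + t powr (\<alpha> * (p - 1))"
    and "t powr \<alpha> * Jp p (1 - t powr \<alpha>) <= 1 + t powr (\<alpha> * (p - 1))"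
proof -
  have pos: "0 <= t powr (\<alpha> * (p - 1))" by simp
  have "Jp p (- 1 * (1 - t powr \<alpha>)) <= 1 + t powr (\<alpha> * (p - 1)) \<and>
    t powr \<alpha> * Jp p (1 - t powr \<alpha>) <= 1 + t powr (\<alpha> * (p - 1))"
  proof (cases "0 <= \<alpha>")
    case True
    then have le: "t powr \<alpha> <= 1" using t by (simp add: powr_le1)
    then have "Jp p (- 1 * (1 - t powr \<alpha>)) <= 0" by (intro Jp_nonpos) simp
    moreover have "Jp p (1 - t powr \<alpha>) <= 1"
      using Jp_mono[OF p, of "1 - t powr \<alpha>" 1] by (simp add: Jp_def)
    then have "t powr \<alpha> * Jp p (1 - t powr \<alpha>) <= 1 * 1"
      using le by (intro mult_mono Jp_nonneg) auto
    ultimately show ?thesis using pos by linarith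
  next
    case False
    then have ge: "1 <= t powr \<alpha>" using powr_mono'[of \<alpha> 0 t] t by simp
    have "Jp p (- 1 * (1 - t powr \<alpha>)) <= Jp p (t powr \<alpha>)"
      using ge by (intro Jp_mono[OF p]) simp
    also have "\<dots> = t powr (\<alpha> * (p - 1))" using t by (simp add: Jp_def powr_powr)
    finally have "Jp p (- 1 * (1 - t powr \<alpha>)) <= t powr (\<alpha> * (p - 1))" .
    moreover have "t powr \<alpha> * Jp p (1 - t powr \<alpha>) <= 0"
      using ge by (intro mult_nonneg_nonpos Jp_nonpos) auto
    ultimately show ?thesis using pos by linarith
  qed
  then show "Jp p (- 1 * (1 - t powr \<alpha>)) <= 1 + t powr (\<alpha> * (p - 1))"
    "t powr \<alpha> * Jp p (1 - t powr \<alpha>) <= 1 + t powr (\<alpha> * (p - 1))" by auto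
qed

text \<open>The bracket in \<open>flux_halfline\<close> for \<sigma> = -1, that is the negative flux
  normalised to x = 1. The double minus is the shape in which it arises there.\<close>

definition flux_neg :: "real => real => real => ennreal" where
  "flux_neg p a th =
     (\<integral>\<^sup>+t\<in>{0<..th}. ennreal (Jp p (- 1 * (1 - t powr ((a - 1) / p))) / (1 - t) powr (1 + a)) \<partial>lborel) +
     (\<integral>\<^sup>+t\<in>{0<..th}. ennreal (t powr ((a - 1) / p) *
        (Jp p (- (- 1) * (1 - t powr ((a - 1) / p))) / (1 - t) powr (1 + a))) \<partial>lborel)"

lemma flux_neg_finite:
  assumes p: "1 < p" and a: "0 < a" and th: "0 < th" "th < 1"
  shows "flux_neg p a th < \<infinity>"
proof -
  define \<alpha> where "\<alpha> = (a - 1) / p"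
  define \<beta> where "\<beta> = \<alpha> * (p - 1)"
  \<comment> \<open>Integrability at 0: (a - 1) (p - 1) = a (p - 1) - p + 1 > - p.\<close>
  have \<beta>: "-1 < \<beta>"
  proof -
    have "0 < a * (p - 1)" using p a by simp
    then have "- p < (a - 1) * (p - 1)" by (simp add: algebra_simps)
    then show ?thesis using p by (simp add: \<beta>_def \<alpha>_def field_simps)
  qed
  define m where "m = (1 - th) powr (1 + a)"
  have m: "0 < m" using th by (simp add: m_def)
  have mt: "m <= (1 - t) powr (1 + a)" if "t <= th" for t
    unfolding m_def using that th a by (intro powr_mono2) auto
  have fin: "(\<integral>\<^sup>+t\<in>{0<..th}. ennreal ((1 + t powr \<beta>) / m) \<partial>lborel) < \<infinity>"
  proof -
    have "(\<integral>\<^sup>+t\<in>{0<..th}. ennreal ((1 + t powr \<beta>) / m) \<partial>lborel) =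
       (\<integral>\<^sup>+t. ennreal (1 / m) * (ennreal (t powr 0) * indicator {0<..th} t + ennreal (t powr \<beta>) * indicator {0<..th} t) \<partial>lborel)"
    proof (intro nn_integral_cong)
      fix t :: real
      have "ennreal ((1 + t powr \<beta>) / m) = ennreal (1 / m * (1 + t powr \<beta>))" by simp
      also have "\<dots> = ennreal (1 / m) * ennreal (1 + t powr \<beta>)" using m by (intro ennreal_mult) auto
      also have "ennreal (1 + t powr \<beta>) = 1 + ennreal (t powr \<beta>)" by simp
      finally show "ennreal ((1 + t powr \<beta>) / m) * indicator {0<..th} t = ennreal (1 / m) *
          (ennreal (t powr 0) * indicator {0<..th} t + ennreal (t powr \<beta>) * indicator {0<..th} t)"
        by (auto simp: indicator_def)
    qed
    also have "\<dots> = ennreal (1 / m) * (ennreal (th powr (0 + 1) / (0 + 1)) + ennreal (th powr (\<beta> + 1) / (\<beta> + 1)))"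
      using nn_integral_powr_from_0[of 0 th] nn_integral_powr_from_0[OF \<beta>, of th] th
      by (simp add: nn_integral_cmult nn_integral_add)
    also have "\<dots> < \<infinity>" by (simp add: ennreal_mult_less_top)
    finally show ?thesis .
  qed
  have le: "(\<integral>\<^sup>+t\<in>{0<..th}. ennreal (f t / (1 - t) powr (1 + a)) \<partial>lborel) < \<infinity>"
    if f: "\<And>t. 0 < t ==> t < 1 ==> f t <= 1 + t powr \<beta>" for f
  proof (rule order.strict_trans1[OF nn_integral_mono fin])
    fix t :: real
    show "ennreal (f t / (1 - t) powr (1 + a)) * indicator {0<..th} t <= ennreal ((1 + t powr \<beta>) / m) * indicator {0<..th} t"
    proof (cases "0 < t \<and> t <= th")
      case True
      have "f t / (1 - t) powr (1 + a) <= (1 + t powr \<beta>) / (1 - t) powr (1 + a)"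
        using f[of t] True th by (intro divide_right_mono) auto
      also have "\<dots> <= (1 + t powr \<beta>) / m" using mt[of t] m True th by (intro divide_left_mono mult_pos_pos) auto
      finally show ?thesis using True by (simp add: ennreal_leI)
    qed simp
  qed
  note b = Jp_one_minus_powr_bounds[OF p a, folded \<alpha>_def, folded \<beta>_def]
  show ?thesis
    using le[OF b(1)] le[of "\<lambda>t. t powr \<alpha> * Jp p (1 - t powr \<alpha>)", OF b(2)]
    unfolding flux_neg_def \<alpha>_def[symmetric] by simp
qed

text \<open>On the half-line the second estimate is in fact an identity: folding expresses the
  positive flux as the negative flux plus \<open>hK\<close>, and the exterior supplies exactly 1 /
  a.\<close>

lemma halfline_flux_estimates:
  assumes p: "1 < p" and a: "0 < a" and x: "0 < x" and th: "0 < th" "th < 1"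
  defines "w \<equiv> \<lambda>x. x powr ((a - 1) / p)"
  shows "flux p a {0<..} w (ratio_kept th) (-1) x <= flux_neg p a th * ennreal (w x powr (p - 1) * x powr (- a))"
    and "flux p a {0<..} w (ratio_kept th) (-1) x +
        (hK p a th + ennreal (1 / a)) * ennreal (w x powr (p - 1) * x powr (- a))
      <= flux p a {0<..} w (ratio_kept th) 1 x + ennreal (w x powr (p - 1)) * ennreal (x powr (- a) / a)"
proof -
  define \<alpha> where "\<alpha> = (a - 1) / p"
  define X where "X = ennreal (w x powr (p - 1) * x powr (- a))"
  note fl = flux_halfline[OF p a x th, folded \<alpha>_def]
  have w: "w = (\<lambda>x. x powr \<alpha>)" by (simp add: w_def \<alpha>_def)
  have neg: "flux p a {0<..} w (ratio_kept th) (-1) x = X * flux_neg p a th"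
    unfolding X_def w fl flux_neg_def \<alpha>_def[symmetric] by simp
  then show "flux p a {0<..} w (ratio_kept th) (-1) x <= flux_neg p a th * ennreal (w x powr (p - 1) * x powr (- a))"
    by (simp add: X_def mult.commute)
  have pos: "flux p a {0<..} w (ratio_kept th) 1 x = X * (flux_neg p a th + hK p a th)"
  proof -
    let ?A = "\<lambda>t. ennreal (Jp p (1 * (1 - t powr \<alpha>)) / (1 - t) powr (1 + a)) * indicator {0<..th} t"
    let ?B = "\<lambda>t. ennreal (t powr \<alpha> * (Jp p (- 1 * (1 - t powr \<alpha>)) / (1 - t) powr (1 + a))) * indicator {0<..th} t"
    let ?C = "\<lambda>t. ennreal (Jp p (- 1 * (1 - t powr \<alpha>)) / (1 - t) powr (1 + a)) * indicator {0<..th} t"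
    let ?D = "\<lambda>t. ennreal (t powr \<alpha> * (Jp p (- (- 1) * (1 - t powr \<alpha>)) / (1 - t) powr (1 + a))) * indicator {0<..th} t"
    let ?E = "\<lambda>t. ennreal (\<bar>1 - t powr \<alpha>\<bar> powr p / (1 - t) powr (1 + a)) * indicator {0<..th} t"
    have "(\<integral>\<^sup>+t. ?A t \<partial>lborel) + (\<integral>\<^sup>+t. ?B t \<partial>lborel) = (\<integral>\<^sup>+t. ?A t + ?B t \<partial>lborel)"
      by (rule nn_integral_add[symmetric]) auto
    also have "\<dots> = (\<integral>\<^sup>+t. ?C t + ?D t + ?E t \<partial>lborel)"
    proof (rule nn_integral_cong)
      fix t :: real
      show "?A t + ?B t = ?C t + ?D t + ?E t"
      proof (cases "0 < t \<and> t <= th")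
        case True
        then have "0 < (1 - t) powr (1 + a)" using th by simp
        from flux_parts[OF p _ this, of "t powr \<alpha>"] show ?thesis using True by simp
      qed simp
    qed
    also have "\<dots> = (\<integral>\<^sup>+t. ?C t \<partial>lborel) + (\<integral>\<^sup>+t. ?D t \<partial>lborel) + (\<integral>\<^sup>+t. ?E t \<partial>lborel)"
      by (simp add: nn_integral_add)
    finally show ?thesis unfolding X_def w fl flux_neg_def hK_def \<alpha>_def[symmetric] by simp
  qed
  have "ennreal (w x powr (p - 1)) * ennreal (x powr (- a) / a) = X * ennreal (1 / a)"
    unfolding X_def using a by (simp add: ennreal_mult'[symmetric])
  then show "flux p a {0<..} w (ratio_kept th) (-1) x +
        (hK p a th + ennreal (1 / a)) * ennreal (w x powr (p - 1) * x powr (- a))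
      <= flux p a {0<..} w (ratio_kept th) 1 x + ennreal (w x powr (p - 1)) * ennreal (x powr (- a) / a)"
    unfolding pos neg X_def[symmetric] by (simp add: distrib_left distrib_right mult.commute add.assoc)
qed

lemma one_minus_powr_le:
  fixes \<alpha> t :: real
  assumes t: "1 / 2 <= t" "t < 1"
  shows "\<bar>1 - t powr \<alpha>\<bar> <= \<bar>\<alpha>\<bar> * 2 powr (\<bar>\<alpha>\<bar> + 1) * (1 - t)"
proof -
  obtain z where z: "t < z" "z < 1" "1 powr \<alpha> - t powr \<alpha> = (1 - t) * (\<alpha> * z powr (\<alpha> - 1))"
  proof -
    have "((\<lambda>x. x powr \<alpha>) has_real_derivative \<alpha> * x powr (\<alpha> - 1)) (at x)" if "t <= x" for x
      using t that by (auto intro!: derivative_eq_intros)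
    then show ?thesis
      using MVT2[of t 1 "\<lambda>x. x powr \<alpha>" "\<lambda>x. \<alpha> * x powr (\<alpha> - 1)"] t that by blast
  qed
  have "z powr (\<alpha> - 1) <= 2 powr (\<bar>\<alpha>\<bar> + 1)"
  proof -
    have "z powr (\<alpha> - 1) = (1 / z) powr (1 - \<alpha>)" using z t by (simp add: powr_divide powr_diff)
    also have "\<dots> <= (1 / z) powr (\<bar>\<alpha>\<bar> + 1)" using z t by (intro powr_mono) auto
    also have "\<dots> <= 2 powr (\<bar>\<alpha>\<bar> + 1)" using z t by (intro powr_mono2) (auto simp: field_simps)
    finally show ?thesis .
  qed
  then have "\<bar>\<alpha>\<bar> * z powr (\<alpha> - 1) * (1 - t) <= \<bar>\<alpha>\<bar> * 2 powr (\<bar>\<alpha>\<bar> + 1) * (1 - t)"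
    using t by (intro mult_right_mono mult_left_mono) auto
  then show ?thesis using z t by (simp add: abs_mult mult_ac)
qed

text \<open>Near t = 1 the numerator is of order (1 - t)^p, which leaves the exponent p - 1 - a > -1
  because a < p. Near 0 the integrand is at most a multiple of 1 + t^(a-1), integrable because a >
  0.\<close>

lemma hC_finite:
  assumes p: "1 < p" and a: "0 < a" "a < p"
  shows "hC p a < \<infinity>"
proof -
  define \<alpha> where "\<alpha> = (a - 1) / p"
  have ap: "\<alpha> * p = a - 1" using p by (simp add: \<alpha>_def)
  define M where "M = (\<bar>\<alpha>\<bar> * 2 powr (\<bar>\<alpha>\<bar> + 1)) powr p"
  define L where "L = 2 powr (1 + a) * 2 powr p"
  let ?f = "\<lambda>t. \<bar>1 - t powr \<alpha>\<bar> powr p / (1 - t) powr (1 + a)"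
  have near1: "?f t <= M * (1 - t) powr (p - 1 - a)" if t: "1 / 2 <= t" "t < 1" for t
  proof -
    have "\<bar>1 - t powr \<alpha>\<bar> powr p <= (\<bar>\<alpha>\<bar> * 2 powr (\<bar>\<alpha>\<bar> + 1) * (1 - t)) powr p"
      using one_minus_powr_le[OF t] p by (intro powr_mono2) auto
    also have "\<dots> = M * (1 - t) powr p" by (simp add: M_def powr_mult)
    finally have "?f t <= M * (1 - t) powr p / (1 - t) powr (1 + a)" by (rule divide_right_mono) simp
    also have "\<dots> = M * (1 - t) powr (p - 1 - a)" using t by (simp add: powr_diff powr_add)
    finally show ?thesis .
  qed
  have near0: "?f t <= L * (t powr 0 + t powr (a - 1))" if t: "0 < t" "t < 1 / 2" for t
  proof -
    have "\<bar>1 - t powr \<alpha>\<bar> <= 2 * max 1 (t powr \<alpha>)" using powr_ge_zero[of t \<alpha>] by linarith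
    then have "\<bar>1 - t powr \<alpha>\<bar> powr p <= (2 * max 1 (t powr \<alpha>)) powr p"
      using p by (intro powr_mono2) auto
    also have "\<dots> = 2 powr p * (max 1 (t powr \<alpha>)) powr p" by (simp add: powr_mult)
    also have "(max 1 (t powr \<alpha>)) powr p <= 1 + t powr (a - 1)"
      using p by (auto simp: max_def powr_powr ap)
    finally have 1: "\<bar>1 - t powr \<alpha>\<bar> powr p <= 2 powr p * (1 + t powr (a - 1))" by simp
    have "(1 / 2) powr (1 + a) <= (1 - t) powr (1 + a)" using t a by (intro powr_mono2) auto
    then have "?f t <= 2 powr p * (1 + t powr (a - 1)) / ((1 / 2) powr (1 + a))"
      using 1 by (intro frac_le) auto
    also have "\<dots> = L * (t powr 0 + t powr (a - 1))" using t by (simp add: L_def powr_divide)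
    finally show ?thesis .
  qed
  have "(\<integral>\<^sup>+t\<in>{0<..<1}. ennreal (?f t) \<partial>lborel) <=
    (\<integral>\<^sup>+t. ennreal L * (ennreal (t powr 0) * indicator {0<..1} t + ennreal (t powr (a - 1)) * indicator {0<..1} t) +
       ennreal M * (ennreal ((1 - t) powr (p - 1 - a)) * indicator {0<..1} (1 - t)) \<partial>lborel)"
  proof (rule nn_integral_mono)
    fix t :: real
    have "ennreal (?f t) <= ennreal (L * (t powr 0 + t powr (a - 1)) + M * (1 - t) powr (p - 1 - a))"
      if t: "0 < t" "t < 1"
    proof (rule ennreal_leI)
      have "0 <= L * (t powr 0 + t powr (a - 1))" "0 <= M * (1 - t) powr (p - 1 - a)"
        by (auto simp: L_def M_def)
      then show "?f t <= L * (t powr 0 + t powr (a - 1)) + M * (1 - t) powr (p - 1 - a)"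
        using near0[of t] near1[of t] t by (cases "t < 1 / 2") linarith+
    qed
    moreover have "ennreal (L * (t powr 0 + t powr (a - 1)) + M * (1 - t) powr (p - 1 - a)) =
      ennreal L * (ennreal (t powr 0) + ennreal (t powr (a - 1))) + ennreal M * ennreal ((1 - t) powr (p - 1 - a))"
      by (simp add: L_def M_def ennreal_mult')
    ultimately show "ennreal (?f t) * indicator {0<..<1} t <=
      ennreal L * (ennreal (t powr 0) * indicator {0<..1} t + ennreal (t powr (a - 1)) * indicator {0<..1} t) +
       ennreal M * (ennreal ((1 - t) powr (p - 1 - a)) * indicator {0<..1} (1 - t))"
      by (auto simp: indicator_def)
  qed
  also have "\<dots> = ennreal L * ((\<integral>\<^sup>+t\<in>{0<..1}. ennreal (t powr 0) \<partial>lborel) + (\<integral>\<^sup>+t\<in>{0<..1}. ennreal (t powr (a - 1)) \<partial>lborel)) +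
     ennreal M * (\<integral>\<^sup>+t. ennreal ((1 - t) powr (p - 1 - a)) * indicator {0<..1} (1 - t) \<partial>lborel)"
    by (simp add: nn_integral_add nn_integral_cmult)
  also have "(\<integral>\<^sup>+t. ennreal ((1 - t) powr (p - 1 - a)) * indicator {0<..1} (1 - t) \<partial>lborel) =
      (\<integral>\<^sup>+t\<in>{0<..1}. ennreal (t powr (p - 1 - a)) \<partial>lborel)"
    by (subst nn_integral_real_affine[where c = "-1" and t = 1]) auto
  also have "ennreal L * ((\<integral>\<^sup>+t\<in>{0<..1}. ennreal (t powr 0) \<partial>lborel) + (\<integral>\<^sup>+t\<in>{0<..1}. ennreal (t powr (a - 1)) \<partial>lborel)) +
     ennreal M * (\<integral>\<^sup>+t\<in>{0<..1}. ennreal (t powr (p - 1 - a)) \<partial>lborel) < \<infinity>"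
    using nn_integral_powr_from_0[of 0 1] nn_integral_powr_from_0[of "a - 1" 1] nn_integral_powr_from_0[of "p - 1 - a" 1] a
    by (simp add: ennreal_mult_less_top)
  finally show ?thesis by (simp add: hC_def \<alpha>_def)
qed

lemma measurable_kept[measurable]:
  "Measurable.pred (borel \<Otimes>\<^sub>M borel) (\<lambda>z. ratio_kept th (fst z) (snd z))"
  unfolding ratio_kept_def by measurable

text \<open>Positivity of both points is built into the truncation because \<open>ratio_kept\<close>
  grows with the ratio only for nonnegative points, whereas monotonicity of the truncations is
  required for all reals.\<close>

lemma line_hardy_halfline:
  assumes p: "1 < p" and a: "0 < a" "a < p"
  shows "line_hardy p a {0<..} (\<lambda>x. x)"
proof (rule line_hardyI[where w = "\<lambda>x. x powr ((a - 1) / p)" and N = "\<lambda>n. (\<lambda>x y. ratio_kept (hth n) x y \<and> 0 < x \<and> 0 < y)"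
      and M = "\<lambda>n. flux_neg p a (hth n)", OF p hC_finite[OF p a]])
  have fl: "flux p a {0<..} w (\<lambda>x y. ratio_kept th x y \<and> 0 < x \<and> 0 < y) \<sigma> x = flux p a {0<..} w (ratio_kept th) \<sigma> x"
    if "0 < x" for w th \<sigma> x using that unfolding flux_def by (intro nn_integral_cong) auto
  fix n :: nat and x y :: real
  show "ratio_kept (hth 0) x y \<and> 0 < x \<and> 0 < y ==> ratio_kept (hth n) x y \<and> 0 < x \<and> 0 < y"
  proof -
    have "hth 0 * z <= hth n * z" if "0 < z" for z using hth(4)[of 0 n] that by simp
    then show "ratio_kept (hth 0) x y \<and> 0 < x \<and> 0 < y ==> ratio_kept (hth n) x y \<and> 0 < x \<and> 0 < y"
      unfolding ratio_kept_def by (meson order_trans)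
  qed
  assume x: "x \<in> {0<..}"
  show "flux p a {0<..} (\<lambda>x. x powr ((a - 1) / p)) (\<lambda>x y. ratio_kept (hth n) x y \<and> 0 < x \<and> 0 < y) (- 1) x
    <= flux_neg p a (hth n) * ennreal ((x powr ((a - 1) / p)) powr (p - 1) * x powr - a)"
    using halfline_flux_estimates(1)[OF p a(1) _ hth(1,2)] x by (simp add: fl)
  have "outer a {0<..} x = ennreal (x powr (- a) / a)"
    using outer_nonpos[OF a(1), of x] x unfolding outer_def by simp
  then show "flux p a {0<..} (\<lambda>x. x powr ((a - 1) / p)) (\<lambda>x y. ratio_kept (hth n) x y \<and> 0 < x \<and> 0 < y) (- 1) x +
      (hK p a (hth n) + ennreal (1 / a)) * ennreal ((x powr ((a - 1) / p)) powr (p - 1) * x powr - a)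
      <= flux p a {0<..} (\<lambda>x. x powr ((a - 1) / p)) (\<lambda>x y. ratio_kept (hth n) x y \<and> 0 < x \<and> 0 < y) 1 x +
        ennreal ((x powr ((a - 1) / p)) powr (p - 1)) * outer a {0<..} x"
    using halfline_flux_estimates(2)[OF p a(1) _ hth(1,2)] x by (simp add: fl)
  show "\<exists>\<eta>>0. \<forall>y. 0 < y \<and> y < \<eta> \<longrightarrow> y \<in> {0<..} \<and> (ratio_kept (hth 0) x y \<and> 0 < x \<and> 0 < y) \<and> y < x"
    using x by (intro exI[of _ "x / 2"]) (auto simp: ratio_kept_def hth(3))
next
  fix y :: real assume y: "0 < y" "y < 1 / 2"
  \<comment> \<open>The borderline case: the exponents a - 1 and - a sum to -1, so the bound by 1 /
    y is attained.\<close>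
  have "(y powr ((a - 1) / p)) powr p * y powr (- a) = y powr (-1)"
    using p y by (simp add: powr_powr powr_add[symmetric])
  then show "1 / y <= (y powr ((a - 1) / p)) powr p * y powr (- a)"
    using y by (simp add: powr_minus divide_simps)
next
  fix n x y show "ratio_kept (hth n) x y \<and> 0 < x \<and> 0 < y ==> ratio_kept (hth n) y x \<and> 0 < y \<and> 0 < x"
    by (auto simp: ratio_kept_def)
  show "flux_neg p a (hth n) < \<infinity>" by (rule flux_neg_finite[OF p a(1) hth(1,2)])
qed (auto)

subsection \<open>Bounded intervals, \<open>a \<ge> 1\<close>\<close>

definition end_dist :: "real => real" where
  "end_dist x = min x (1 - x)"

lemma end_dist_reflect: "end_dist (1 - x) = end_dist x"
  by (simp add: end_dist_def min.commute)

lemma measurable_end_dist[measurable]: "end_dist \<in> borel_measurable borel"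
  unfolding end_dist_def[abs_def] by measurable

lemma flux_reflect:
  assumes [measurable]: "w \<in> borel_measurable borel" "Measurable.pred (borel \<Otimes>\<^sub>M borel) (\<lambda>z. N (fst z) (snd z))"
    and w: "\<And>x. w (1 - x) = w x" and N: "\<And>x y. N (1 - x) (1 - y) = N x y"
  shows "flux p a {0<..<1} w N \<sigma> (1 - x) = flux p a {0<..<1} w N \<sigma> x"
proof -
  have [measurable]: "Measurable.pred borel (\<lambda>y. N x y)" for x
    using measurable_compose[OF measurable_Pair1' assms(2), of x] by simp
  have "flux p a {0<..<1} w N \<sigma> (1 - x) = (\<integral>\<^sup>+y. (if y \<in> {0<..<1} \<and> N (1 - x) y then
     ennreal (Jp p (\<sigma> * (w (1 - x) - w y)) / \<bar>1 - x - y\<bar> powr (1 + a)) else 0) \<partial>lborel)"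
    by (simp add: flux_def)
  also have "\<dots> = (\<integral>\<^sup>+y. (if 1 + (-1) * y \<in> {0<..<1} \<and> N (1 - x) (1 + (-1) * y) then
     ennreal (Jp p (\<sigma> * (w (1 - x) - w (1 + (-1) * y))) / \<bar>1 - x - (1 + (-1) * y)\<bar> powr (1 + a)) else 0) \<partial>lborel)"
    by (subst nn_integral_real_affine[where c = "-1" and t = 1]) auto
  also have "\<dots> = flux p a {0<..<1} w N \<sigma> x"
    unfolding flux_def using w N
    by (intro nn_integral_cong) (auto simp: abs_minus_commute)
  finally show ?thesis .
qed

lemma outer_reflect: "outer a {0<..<1} (1 - x) = outer a {0<..<1} x"
proof -
  have "outer a {0<..<1} (1 - x) = (\<integral>\<^sup>+y. ennreal (1 / \<bar>1 - x - (1 + (-1) * y)\<bar> powr (1 + a)) * indicator (- {0<..<1}) (1 + (-1) * y) \<partial>lborel)"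
    unfolding outer_def by (subst nn_integral_real_affine[where c = "-1" and t = 1]) auto
  also have "\<dots> = outer a {0<..<1} x"
    unfolding outer_def by (intro nn_integral_cong) (auto simp: indicator_def abs_minus_commute)
  finally show ?thesis .
qed

lemma ratio_kept_mono:
  assumes "th <= th'" "0 <= x" "0 <= y" "ratio_kept th x y"
  shows "ratio_kept th' x y"
  using assms mult_right_mono[OF assms(1,2)] mult_right_mono[OF assms(1,3)]
  unfolding ratio_kept_def by linarith

text \<open>A pair is kept if its ratio is far from 1 when measured from the left end or when
  measured from the right end. The union is invariant under x -> 1 - x, which permits the reduction
  to x <= 1/2, and within the interval it contains the half-line truncation of either end.\<close>

definition interval_kept :: "real => real => real => bool" where
  "interval_kept th x y \<longleftrightarrow> 0 < x \<and> x < 1 \<and> 0 < y \<and> y < 1 \<and> (ratio_kept th x y \<or> ratio_kept th (1 - x) (1 - y))"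

lemma measurable_interval_kept[measurable]:
  "Measurable.pred (borel \<Otimes>\<^sub>M borel) (\<lambda>z. interval_kept th (fst z) (snd z))"
  unfolding interval_kept_def ratio_kept_def by measurable

text \<open>As the exponent is nonnegative, the ground state \<open>w\<close> of the half-line is
  increasing, and \<open>v\<close> lies below it with equality up to 1/2. Negative flux at x <= 1/2
  comes from larger values at y, and these have only decreased. Positive flux on the half-line comes
  from y < x, where \<open>v\<close> and \<open>w\<close> agree.\<close>

lemma interval_vs_halfline:
  assumes p: "1 < p" and a: "1 <= a" and x: "0 < x" "x <= 1 / 2" and th: "0 < th" "th < 1"
  defines "w \<equiv> \<lambda>x. x powr ((a - 1) / p)" and "v \<equiv> \<lambda>x. end_dist x powr ((a - 1) / p)"
  shows "flux p a {0<..<1} v (interval_kept th) (-1) x <= flux p a {0<..} w (ratio_kept th) (-1) x"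
    and "flux p a {0<..} w (ratio_kept th) 1 x <= flux p a {0<..<1} v (interval_kept th) 1 x"
proof -
  define \<alpha> where "\<alpha> = (a - 1) / p"
  have \<alpha>: "0 <= \<alpha>" using p a by (simp add: \<alpha>_def)
  have vx: "v x = w x" using x by (simp add: v_def w_def end_dist_def)
  have wv: "w = (\<lambda>x. x powr \<alpha>)" "v = (\<lambda>x. end_dist x powr \<alpha>)" by (auto simp: w_def v_def \<alpha>_def)
  show "flux p a {0<..<1} v (interval_kept th) (-1) x <= flux p a {0<..} w (ratio_kept th) (-1) x"
    unfolding flux_def
  proof (rule nn_integral_mono)
    fix y :: real
    show "(if y \<in> {0<..<1} \<and> interval_kept th x y then ennreal (Jp p (- 1 * (v x - v y)) / \<bar>x - y\<bar> powr (1 + a)) else 0)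
      <= (if y \<in> {0<..} \<and> ratio_kept th x y then ennreal (Jp p (- 1 * (w x - w y)) / \<bar>x - y\<bar> powr (1 + a)) else 0)"
    proof (cases "y \<in> {0<..<1} \<and> interval_kept th x y")
      case True
      then have y: "0 < y" "y < 1" by auto
      have le: "v y <= w y" unfolding wv using y \<alpha> by (intro powr_mono2) (auto simp: end_dist_def)
      show ?thesis
      proof (cases "ratio_kept th x y")
        case True
        have "Jp p (- 1 * (v x - v y)) <= Jp p (- 1 * (w x - w y))"
          using le vx by (intro Jp_mono[OF p]) simp
        then show ?thesis using True y by (auto intro!: ennreal_leI divide_right_mono)
      next
        case False
        then have k: "th * x < y" "th * y < x" "1 - y <= th * (1 - x) \<or> 1 - x <= th * (1 - y)"
          using \<open>y \<in> {0<..<1} \<and> interval_kept th x y\<close> by (auto simp: interval_kept_def ratio_kept_def)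
        have "v y <= v x"
        proof (cases "x < y")
          case True
          have "th * (1 - y) <= 1 - y" using th y by (intro mult_left_le_one_le) auto
          moreover have "1 - y < 1 - x" using True by simp
          ultimately have "\<not> 1 - x <= th * (1 - y)" by (simp only: not_le order.strict_trans1)
          then have B: "1 - y <= th * (1 - x)" using k by blast
          \<comment> \<open>A pair y > x kept through the right end alone has y closer to 1 than x
            is to 0; hence v y <= v x and the pair carries no negative flux.\<close>
          have "1 - x < y"
          proof (rule ccontr)
            assume "\<not> 1 - x < y"
            then have "(1 - th) * y <= (1 - th) * (1 - x)" using th by (intro mult_left_mono) auto
            then show False using B k by (simp add: algebra_simps)
          qed
          then have "end_dist y <= end_dist x" using x by (simp add: end_dist_def)
          then show ?thesis unfolding wv using y \<alpha> by (intro powr_mono2) (auto simp: end_dist_def)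
        next
          case False
          then have "end_dist y <= end_dist x" using x by (simp add: end_dist_def)
          then show ?thesis unfolding wv using y \<alpha> by (intro powr_mono2) (auto simp: end_dist_def)
        qed
        then have "Jp p (- 1 * (v x - v y)) <= 0" by (intro Jp_nonpos) simp
        then have "Jp p (- 1 * (v x - v y)) / \<bar>x - y\<bar> powr (1 + a) <= 0" by (simp add: divide_le_0_iff)
        then show ?thesis by (simp add: ennreal_neg)
      qed
    qed auto
  qed
  show "flux p a {0<..} w (ratio_kept th) 1 x <= flux p a {0<..<1} v (interval_kept th) 1 x"
    unfolding flux_def
  proof (rule nn_integral_mono)
    fix y :: real
    show "(if y \<in> {0<..} \<and> ratio_kept th x y then ennreal (Jp p (1 * (w x - w y)) / \<bar>x - y\<bar> powr (1 + a)) else 0)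
      <= (if y \<in> {0<..<1} \<and> interval_kept th x y then ennreal (Jp p (1 * (v x - v y)) / \<bar>x - y\<bar> powr (1 + a)) else 0)"
    proof (cases "0 < y \<and> y < x \<and> ratio_kept th x y")
      case True
      then have "v y = w y" using x by (simp add: v_def w_def end_dist_def)
      then show ?thesis using True vx x by (simp add: interval_kept_def)
    next
      case False
      show ?thesis
      proof (cases "0 < y \<and> ratio_kept th x y")
        case True
        then have "x <= y" using False by auto
        then have "w x <= w y" unfolding wv using x \<alpha> by (intro powr_mono2) auto
        then have "Jp p (1 * (w x - w y)) <= 0" by (intro Jp_nonpos) simp
        then have "Jp p (1 * (w x - w y)) / \<bar>x - y\<bar> powr (1 + a) <= 0" by (simp add: divide_le_0_iff)
        then show ?thesis by (simp add: ennreal_neg)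
      qed auto
    qed
  qed
qed

text \<open>Reflection leaves the case x <= 1/2, where the flux is compared with that of the
  half-line. The exterior of the interval contains the exterior of the half-line, which again
  helps.\<close>

lemma line_hardy_interval_ge1:
  assumes p: "1 < p" and a: "1 <= a" "a < p"
  shows "line_hardy p a {0<..<1} end_dist"
proof -
  have a0: "0 < a" using a by simp
  define v where "v x = end_dist x powr ((a - 1) / p)" for x
  have v[measurable]: "v \<in> borel_measurable borel" unfolding v_def[abs_def] by measurable
  have vr: "v (1 - x) = v x" for x by (simp add: v_def end_dist_reflect)
  have Nr: "interval_kept th (1 - x) (1 - y) = interval_kept th x y" for th x y by (auto simp: interval_kept_def)
  have est: "flux p a {0<..<1} v (interval_kept th) (-1) x <=
        flux_neg p a th * ennreal (v x powr (p - 1) * end_dist x powr (- a)) \<and>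
      flux p a {0<..<1} v (interval_kept th) (-1) x +
        (hK p a th + ennreal (1 / a)) * ennreal (v x powr (p - 1) * end_dist x powr (- a))
      <= flux p a {0<..<1} v (interval_kept th) 1 x + ennreal (v x powr (p - 1)) * outer a {0<..<1} x"
    (is "?P x") if x: "0 < x" "x < 1" and th: "0 < th" "th < 1" for x th
  proof -
    have half: "?P x" if x: "0 < x" "x <= 1 / 2" for x
    proof -
      have vx: "v x = x powr ((a - 1) / p)" and ed: "end_dist x = x" using x by (auto simp: v_def end_dist_def)
      have out: "ennreal (x powr (- a) / a) <= outer a {0<..<1} x"
        unfolding outer_nonpos[OF a0 x(1), symmetric] outer_def
        by (intro nn_integral_mono) (auto simp: indicator_def)
      note c = interval_vs_halfline[OF p a(1) x th, folded v_def]
      note h = halfline_flux_estimates[OF p a0 x(1) th, folded vx]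
      show ?thesis unfolding ed
      proof
        show "flux p a {0<..<1} v (interval_kept th) (-1) x <= flux_neg p a th * ennreal (v x powr (p - 1) * x powr (- a))"
          by (rule order_trans[OF c(1) h(1)])
        show "flux p a {0<..<1} v (interval_kept th) (-1) x +
            (hK p a th + ennreal (1 / a)) * ennreal (v x powr (p - 1) * x powr (- a))
          <= flux p a {0<..<1} v (interval_kept th) 1 x + ennreal (v x powr (p - 1)) * outer a {0<..<1} x"
          by (rule order_trans[OF add_right_mono[OF c(1)] order_trans[OF h(2) add_mono[OF c(2) mult_left_mono[OF out]]]]) simp
      qed
    qed
    show ?thesis
    proof (cases "x <= 1 / 2")
      case True then show ?thesis using half x by blast
    next
      case False
      then have "?P (1 - x)" using x by (intro half) auto
      then show ?thesis
        unfolding flux_reflect[of v "interval_kept th", OF v measurable_interval_kept vr Nr] vr end_dist_reflect outer_reflect .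
    qed
  qed
  show ?thesis
  proof (rule line_hardyI[where w = v and N = "\<lambda>n. interval_kept (hth n)"
      and M = "\<lambda>n. flux_neg p a (hth n)", OF p hC_finite[OF p a0 a(2)]])
    fix n :: nat and x y :: real
    show "interval_kept (hth 0) x y ==> interval_kept (hth n) x y"
      using ratio_kept_mono[OF hth(4)[of 0 n]] by (auto simp: interval_kept_def)
    show "interval_kept (hth n) x y ==> interval_kept (hth n) y x"
      by (auto simp: interval_kept_def ratio_kept_def)
    show "flux_neg p a (hth n) < \<infinity>" by (rule flux_neg_finite[OF p a0 hth(1,2)])
    assume x: "x \<in> {0<..<1}"
    then have x': "0 < x" "x < 1" by auto
    show "0 < v x" using x by (simp add: v_def end_dist_def min_def)
    show "flux p a {0<..<1} v (interval_kept (hth n)) (- 1) x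
      <= flux_neg p a (hth n) * ennreal (v x powr (p - 1) * end_dist x powr - a)"
      "flux p a {0<..<1} v (interval_kept (hth n)) (- 1) x +
         (hK p a (hth n) + ennreal (1 / a)) * ennreal (v x powr (p - 1) * end_dist x powr - a)
         <= flux p a {0<..<1} v (interval_kept (hth n)) 1 x + ennreal (v x powr (p - 1)) * outer a {0<..<1} x"
      using est[OF x' hth(1,2)] by auto
    show "\<exists>\<eta>>0. \<forall>y. 0 < y \<and> y < \<eta> \<longrightarrow> y \<in> {0<..<1} \<and> interval_kept (hth 0) x y \<and> y < x"
      using x by (intro exI[of _ "x / 2"]) (auto simp: interval_kept_def ratio_kept_def hth(3))
  next
    fix y :: real assume y: "0 < y" "y < 1 / 2"
    then have ed: "end_dist y = y" by (simp add: end_dist_def)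
    have "v y powr p * end_dist y powr (- a) = y powr (-1)"
      using p y by (simp add: v_def ed powr_powr powr_add[symmetric])
    then show "1 / y <= v y powr p * end_dist y powr (- a)"
      using y by (simp add: powr_minus divide_simps)
  qed auto
qed


subsection \<open>Bounded intervals, \<open>p = 2\<close> and \<open>a < 1\<close>\<close>

text \<open>The Moebius map \<open>x \<mapsto> x / (1 - x)\<close> takes the interval to the half-line, and for \<open>p = 2\<close>
  the Gagliardo energy is conformally invariant. The pull-back of the truncation of the half-line
  is therefore the natural one.\<close>

definition moebius_kept :: "real => real => real => bool" where
  "moebius_kept th x y \<longleftrightarrow> 0 < x \<and> x < 1 \<and> 0 < y \<and> y < 1 \<and>
     (y * (1 - x) <= th * (x * (1 - y)) \<or> x * (1 - y) <= th * (y * (1 - x)))"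

lemma measurable_moebius_kept[measurable]:
  "Measurable.pred (borel \<Otimes>\<^sub>M borel) (\<lambda>z. moebius_kept th (fst z) (snd z))"
  unfolding moebius_kept_def by measurable

text \<open>In the coordinate y / (1 - y) the two maps are t -> A t and t -> A / t, so the images
  are the two kept pieces seen from the point with coordinate A.\<close>

lemma moebius_images:
  fixes A th :: real
  assumes A: "0 < A" and th: "0 < th" "th < 1"
  shows "(\<lambda>t. A * t / (1 + A * t)) ` {0<..th} = {0<..A * th / (1 + A * th)}"
    and "(\<lambda>t. A / (t + A)) ` {0<..th} = {A / (th + A)..<1}"
proof -
  show "(\<lambda>t. A * t / (1 + A * t)) ` {0<..th} = {0<..A * th / (1 + A * th)}"
  proof (intro set_eqI iffI)
    fix y assume "y \<in> (\<lambda>t. A * t / (1 + A * t)) ` {0<..th}"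
    then obtain t where t: "0 < t" "t <= th" "y = A * t / (1 + A * t)" by auto
    have pos: "0 < 1 + A * t" "0 < 1 + A * th" using A t th by (auto intro!: add_pos_pos)
    have "A * t / (1 + A * t) <= A * th / (1 + A * th)"
      unfolding pos_divide_le_eq[OF pos(1)] times_divide_eq_left pos_le_divide_eq[OF pos(2)]
      using A t by (simp add: algebra_simps)
    moreover have "0 < y" using A t pos by simp
    ultimately show "y \<in> {0<..A * th / (1 + A * th)}" using t by simp
  next
    fix y assume y: "y \<in> {0<..A * th / (1 + A * th)}"
    have pos: "0 < 1 + A * th" using A th by (auto intro!: add_pos_pos)
    then have le: "y * (1 + A * th) <= A * th" "0 < y" using y by (auto simp: field_simps)
    then have y1: "y < 1"
    proof -
      have "A * th / (1 + A * th) < 1" using pos by simp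
      then show ?thesis using y by auto
    qed
    define t where "t = y / (A * (1 - y))"
    have d: "0 < A * (1 - y)" using A y1 by simp
    have t: "0 < t" "t <= th" using le d by (auto simp: t_def pos_divide_le_eq algebra_simps)
    have At: "A * t = y / (1 - y)" using A y1 by (simp add: t_def field_simps)
    have "A * t / (1 + A * t) = y" unfolding At using y1 by (simp add: field_simps)
    then show "y \<in> (\<lambda>t. A * t / (1 + A * t)) ` {0<..th}" using t by (intro image_eqI[of _ _ t]) auto
  qed
  show "(\<lambda>t. A / (t + A)) ` {0<..th} = {A / (th + A)..<1}"
  proof (intro set_eqI iffI)
    fix y assume "y \<in> (\<lambda>t. A / (t + A)) ` {0<..th}"
    then show "y \<in> {A / (th + A)..<1}" using A by (auto simp: field_simps)
  next
    fix y assume y: "y \<in> {A / (th + A)..<1}"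
    have "0 < A / (th + A)" using A th by simp
    then have y0: "0 < y" using y by auto
    have le: "A <= y * (th + A)" using y A th by (simp add: field_simps)
    have "A / (A * (1 - y) / y + A) = y" using y0 A by (simp add: field_simps)
    moreover have "0 < A * (1 - y) / y" "A * (1 - y) / y <= th"
      using y y0 A le by (auto simp: field_simps)
    ultimately show "y \<in> (\<lambda>t. A / (t + A)) ` {0<..th}" by (intro image_eqI[of _ _ "A * (1 - y) / y"]) auto
  qed
qed

text \<open>In terms of A = x / (1 - x) the weight equals A^\<alpha> (1 + A)^(1-a), the ground state
  of the half-line times a conformal factor. Folding over ratios of A gives the half-line integrands
  1 - t^\<alpha> and t^(a-1) - t^\<alpha>, with 1 and t^(a-1) replaced by \<open>u1\<close> and
  \<open>u2\<close>.\<close>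

lemma flux_moebius:
  assumes a: "0 < a" "a < 1" and x: "0 < x" "x < 1" and th: "0 < th" "th < 1"
  defines "\<alpha> \<equiv> (a - 1) / 2" and "A \<equiv> x / (1 - x)"
  defines "u1 \<equiv> \<lambda>t. ((1 + A) / (1 + A * t)) powr (1 - a)" and "u2 \<equiv> \<lambda>t. ((1 + A) / (t + A)) powr (1 - a)"
  shows "flux 2 a {0<..<1} (\<lambda>x. (x * (1 - x)) powr \<alpha>) (moebius_kept th) \<sigma> x =
    ennreal (A powr (\<alpha> - a) * (1 + A) powr (1 + a)) *
    ((\<integral>\<^sup>+t\<in>{0<..th}. ennreal (\<sigma> * (u1 t - t powr \<alpha>) / (1 - t) powr (1 + a)) \<partial>lborel) +
     (\<integral>\<^sup>+t\<in>{0<..th}. ennreal (\<sigma> * (u2 t - t powr \<alpha>) / (1 - t) powr (1 + a)) \<partial>lborel))"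
proof -
  define X where "X = A powr (\<alpha> - a) * (1 + A) powr (1 + a)"
  have X: "0 <= X" by (simp add: X_def)
  have A: "0 < A" using x by (simp add: A_def)
  have xA: "x = A / (1 + A)" "1 - x = 1 / (1 + A)"
  proof -
    have "1 + A = 1 / (1 - x)" using x by (simp add: A_def field_simps)
    then show "x = A / (1 + A)" "1 - x = 1 / (1 + A)" using x by (auto simp: A_def)
  qed
  \<comment> \<open>For p = 2 the flux is linear in the ground state, so the conformal factor can be
    pulled out.\<close>
  have J2: "Jp 2 t = t" for t by (simp add: Jp_def abs_mult_sgn mult.commute)
  have al: "2 * \<alpha> = a - 1" by (simp add: \<alpha>_def)
  define w where "w = (\<lambda>x::real. (x * (1 - x)) powr \<alpha>)"
  \<comment> \<open>A point is written as c / (c + d), so that c / d is its Moebius coordinate; the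
    pairs (A, 1), (A t, 1) and (A, t) give x and the two families of y.\<close>
  have wform: "w (c / (c + d)) = (c * d) powr \<alpha> * (c + d) powr (1 - a)" if "0 < c" "0 < d" for c d
  proof -
    have "c / (c + d) * (1 - c / (c + d)) = c * d / (c + d) powr 2"
      using that by (simp add: field_simps power2_eq_square)
    then have "w (c / (c + d)) = (c * d / (c + d) powr 2) powr \<alpha>" by (simp add: w_def)
    also have "\<dots> = (c * d) powr \<alpha> / (c + d) powr (2 * \<alpha>)"
      using that by (simp only: powr_divide powr_powr)
    also have "\<dots> = (c * d) powr \<alpha> * (c + d) powr (1 - a)"
    proof -
      have "- (2 * \<alpha>) = 1 - a" unfolding al by simp
      then show ?thesis by (metis powr_minus_divide divide_inverse inverse_eq_divide powr_minus)
    qed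
    finally show ?thesis .
  qed
  have wx: "w x = A powr \<alpha> * (1 + A) powr (1 - a)"
    using wform[of A 1] A xA(1) by (simp add: add.commute)
  have w1: "w (A * t / (1 + A * t)) = A powr \<alpha> * t powr \<alpha> * (1 + A * t) powr (1 - a)" if "0 < t" for t
    using wform[of "A * t" 1] A that by (simp add: add.commute powr_mult)
  have w2: "w (A / (t + A)) = A powr \<alpha> * t powr \<alpha> * (t + A) powr (1 - a)" if "0 < t" for t
    using wform[of A t] A that by (simp add: add.commute powr_mult)
  let ?h1 = "\<lambda>t. X * (\<sigma> * (u1 t - t powr \<alpha>) / (1 - t) powr (1 + a))"
  let ?h2 = "\<lambda>t. X * (\<sigma> * (u2 t - t powr \<alpha>) / (1 - t) powr (1 + a))"
  have [measurable]: "w \<in> borel_measurable borel" unfolding w_def by measurable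
  have E: "flux 2 a {0<..<1} w (moebius_kept th) \<sigma> x =
    (\<integral>\<^sup>+t\<in>{0<..th}. ennreal (?h1 t) \<partial>lborel) + (\<integral>\<^sup>+t\<in>{0<..th}. ennreal (?h2 t) \<partial>lborel)"
  proof (rule flux_fold[where ?g1.0 = "\<lambda>t. A * t / (1 + A * t)" and ?g2.0 = "\<lambda>t. A / (t + A)"
        and ?g1'.0 = "\<lambda>t. A / (1 + A * t)\<^sup>2" and ?g2'.0 = "\<lambda>t. - A / (t + A)\<^sup>2"])
    have sep: "A * th / (1 + A * th) < A / (th + A)"
    proof -
      have "th * th < 1 * 1" using th by (intro mult_strict_mono) auto
      then have "A * (th * th) < A * 1" using A by (intro mult_strict_left_mono) auto
      moreover have "0 < 1 + A * th" "0 < th + A" using A th by (auto intro!: add_pos_pos)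
      ultimately show ?thesis using A by (simp add: divide_less_eq less_divide_eq algebra_simps)
    qed
    have "y \<in> {0<..<1} \<and> moebius_kept th x y \<longleftrightarrow> y \<in> {0<..A * th / (1 + A * th)} \<union> {A / (th + A)..<1}" for y
    proof -
      have pos: "0 < 1 + A * th" "0 < th + A" using A th by (auto intro!: add_pos_pos)
      have "A * th / (1 + A * th) < 1" "0 < A / (th + A)" using pos A by auto
      moreover have "y * (1 - x) <= th * (x * (1 - y)) \<longleftrightarrow> y <= A * th / (1 + A * th)"
      proof -
        have "y * (1 - x) <= th * (x * (1 - y)) \<longleftrightarrow> y <= th * A * (1 - y)"
          using x by (simp add: A_def field_simps)
        also have "\<dots> \<longleftrightarrow> y * (1 + A * th) <= A * th" by (simp add: algebra_simps)
        also have "\<dots> \<longleftrightarrow> y <= A * th / (1 + A * th)" using pos by (simp add: pos_le_divide_eq)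
        finally show ?thesis .
      qed
      moreover have "x * (1 - y) <= th * (y * (1 - x)) \<longleftrightarrow> A / (th + A) <= y"
      proof -
        have "x * (1 - y) <= th * (y * (1 - x)) \<longleftrightarrow> A * (1 - y) <= th * y"
          using x by (simp add: A_def field_simps)
        also have "\<dots> \<longleftrightarrow> A <= y * (th + A)" by (simp add: algebra_simps)
        also have "\<dots> \<longleftrightarrow> A / (th + A) <= y" using pos by (simp add: pos_divide_le_eq)
        finally show ?thesis .
      qed
      ultimately show ?thesis using x unfolding moebius_kept_def by auto
    qed
    then show "{y \<in> {0<..<1}. moebius_kept th x y} = (\<lambda>t. A * t / (1 + A * t)) ` {0<..th} \<union> (\<lambda>t. A / (t + A)) ` {0<..th}"
      unfolding moebius_images[OF A th] by blast
    show "(\<lambda>t. A * t / (1 + A * t)) ` {0<..th} \<inter> (\<lambda>t. A / (t + A)) ` {0<..th} = {}"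
      unfolding moebius_images[OF A th] using sep by auto
    show "(\<lambda>t. A * t / (1 + A * t)) ` {0<..th} \<in> sets borel" "(\<lambda>t. A / (t + A)) ` {0<..th} \<in> sets borel"
      unfolding moebius_images[OF A th] by auto
    show "inj_on (\<lambda>t. A * t / (1 + A * t)) {0<..th}"
    proof (rule inj_onI)
      fix s t assume "s \<in> {0<..th}" "t \<in> {0<..th}" "A * s / (1 + A * s) = A * t / (1 + A * t)"
      moreover then have "1 + A * s \<noteq> 0" "1 + A * t \<noteq> 0" using A by (smt (verit) greaterThanAtMost_iff mult_pos_pos)+
      ultimately show "s = t" using A by (simp add: frac_eq_eq algebra_simps)
    qed
    show "inj_on (\<lambda>t. A / (t + A)) {0<..th}"
      using A by (auto simp: inj_on_def field_simps)
    fix t assume t: "0 < t" "t <= th"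
    then have t1: "0 < 1 - t" using th by simp
    have p1: "0 < 1 + A * t" "0 < t + A" "0 < 1 + A" using A t by (auto intro!: add_pos_pos)
    show "((\<lambda>t. A * t / (1 + A * t)) has_real_derivative A / (1 + A * t)\<^sup>2) (at t)"
      using p1 by (auto intro!: derivative_eq_intros simp: power2_eq_square field_simps)
    show "((\<lambda>t. A / (t + A)) has_real_derivative - A / (t + A)\<^sup>2) (at t)"
      using p1 by (auto intro!: derivative_eq_intros simp: power2_eq_square field_simps)
    have d1: "\<bar>x - A * t / (1 + A * t)\<bar> = A * (1 - t) / ((1 + A) * (1 + A * t))"
    proof -
      have "x - A * t / (1 + A * t) = A * (1 - t) / ((1 + A) * (1 + A * t))"
        unfolding xA(1) using p1 by (simp add: diff_frac_eq algebra_simps)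
      then show ?thesis using A t1 p1 by simp
    qed
    have d2: "\<bar>x - A / (t + A)\<bar> = A * (1 - t) / ((1 + A) * (t + A))"
    proof -
      have "x - A / (t + A) = - (A * (1 - t) / ((1 + A) * (t + A)))"
        unfolding xA(1) minus_divide_left using p1 by (simp add: diff_frac_eq algebra_simps)
      then show ?thesis using A t1 p1 by simp
    qed
    have pw: "(A * (1 - t) / ((1 + A) * z)) powr (1 + a) =
        A * A powr a * (1 - t) powr (1 + a) / ((1 + A) powr (1 + a) * (z\<^sup>2 * inverse (z powr (1 - a))))" if "0 < z" for z
    proof -
      have "z powr (1 + a) = z powr (2 + - (1 - a))" by simp
      also have "\<dots> = z\<^sup>2 * z powr (- (1 - a))" using that by (simp only: powr_add) simp
      finally have z: "z powr (1 + a) = z\<^sup>2 * z powr (- (1 - a))" .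
      have "A powr (1 + a) = A * A powr a" using A by (simp add: powr_add)
      then show ?thesis by (simp only: powr_divide powr_mult z powr_minus)
    qed
    have X': "X = A powr \<alpha> * (1 + A) powr (1 + a) / A powr a" by (simp add: X_def powr_diff)
    have alg: "A / z\<^sup>2 * (\<sigma> * (P * Q - P * T * Z) / (A * Aa * m / (Y * (z\<^sup>2 * inverse Z)))) =
        P * Y / Aa * (\<sigma> * (Q / Z - T) / m)"
      if "0 < z" "0 < Z" "0 < Aa" "0 < m" "0 < Y" for z P Q T Z Aa m Y
      using that A by (simp add: field_simps)
    have u: "u1 t = (1 + A) powr (1 - a) / (1 + A * t) powr (1 - a)" "u2 t = (1 + A) powr (1 - a) / (t + A) powr (1 - a)"
      by (simp_all only: u1_def u2_def powr_divide)
    have ab: "\<bar>A / (1 + A * t)\<^sup>2\<bar> = A / (1 + A * t)\<^sup>2" "\<bar>- A / (t + A)\<^sup>2\<bar> = A / (t + A)\<^sup>2"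
      using A by simp_all
    have pos: "0 < (1 + A * t) powr (1 - a)" "0 < (t + A) powr (1 - a)" "0 < A powr a"
      "0 < (1 - t) powr (1 + a)" "0 < (1 + A) powr (1 + a)" using A p1 t1 by simp_all
    show "\<bar>A / (1 + A * t)\<^sup>2\<bar> * (Jp 2 (\<sigma> * (w x - w (A * t / (1 + A * t)))) / \<bar>x - A * t / (1 + A * t)\<bar> powr (1 + a)) = ?h1 t"
      unfolding J2 wx w1[OF t(1)] d1 pw[OF p1(1)] X' u ab by (rule alg[OF p1(1) pos(1,3-5)])
    show "\<bar>- A / (t + A)\<^sup>2\<bar> * (Jp 2 (\<sigma> * (w x - w (A / (t + A)))) / \<bar>x - A / (t + A)\<bar> powr (1 + a)) = ?h2 t"
      unfolding J2 wx w2[OF t(1)] d2 pw[OF p1(2)] X' u ab by (rule alg[OF p1(2) pos(2,3-5)])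
  qed auto
  have pull: "(\<integral>\<^sup>+t\<in>{0<..th}. ennreal (X * f t) \<partial>lborel) = ennreal X * (\<integral>\<^sup>+t\<in>{0<..th}. ennreal (f t) \<partial>lborel)"
    if [measurable]: "f \<in> borel_measurable borel" for f
    using X by (simp add: ennreal_mult' mult.assoc nn_integral_cmult)
  show ?thesis
    unfolding E[unfolded w_def] X_def[symmetric] distrib_left u1_def u2_def by (intro arg_cong2[where f = "(+)"] pull) measurable
qed


text \<open>The identity z1 + z2 + c = d for z1 and z2 of unknown sign: each z enters by its
  positive part on one side and by its negative part on the other.\<close>

lemma ennreal_balance:
  fixes z1 z2 c d :: real
  assumes "0 <= c" "0 <= d" "z1 + z2 + c = d"
  shows "ennreal z1 + ennreal z2 + ennreal c = ennreal (- z1) + ennreal (- z2) + ennreal d"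
  using assms
  by (cases "0 <= z1"; cases "0 <= z2")
    (auto simp: ennreal_neg ennreal_plus[symmetric] not_le simp del: ennreal_plus)

lemma powr_concave:
  fixes a l x y :: real
  assumes a: "0 < a" "a < 1" and l: "0 <= l" "l <= 1" and xy: "0 < x" "0 < y"
  shows "l * x powr a + (1 - l) * y powr a <= (l * x + (1 - l) * y) powr a"
proof -
  have "convex_on {0<..} (\<lambda>x. - (x powr a))"
  proof (rule f''_ge0_imp_convex)
    show "convex {0::real<..}" by simp
    show "((\<lambda>x. - (x powr a)) has_real_derivative - (a * x powr (a - 1))) (at x)" if "x \<in> {0<..}" for x
      using that by (auto intro!: derivative_eq_intros)
    show "((\<lambda>x. - (a * x powr (a - 1))) has_real_derivative - (a * ((a - 1) * x powr (a - 1 - 1)))) (at x)"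
      if "x \<in> {0<..}" for x
      using that by (auto intro!: derivative_eq_intros)
    show "0 <= - (a * ((a - 1) * x powr (a - 1 - 1)))" if "x \<in> {0<..}" for x
      using a by (simp add: mult_nonneg_nonpos mult_nonpos_nonneg)
  qed
  from convex_onD[OF this, of "1 - l" x y] show ?thesis using l xy by simp
qed

text \<open>For affine g the derivative of (g / (1 - t))^a / a is g^(a-1) (g' (1 - t) + g) / (1 -
  t)^(1+a), and g' (1 - t) + g is constant; this integrates both densities explicitly. The
  comparison of \<open>F2\<close> with \<open>F1\<close> is concavity of the power a: (1 + A th) /
  (1 + A) and (th + A) / (1 + A) are convex combinations of 1 and th with interchanged
  weights.\<close>

lemma moebius_primitives:
  fixes A a th :: real
  assumes A: "0 < A" and a: "0 < a" "a < 1" and th: "0 < th" "th < 1"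
  defines "u1 \<equiv> \<lambda>t. ((1 + A) / (1 + A * t)) powr (1 - a)" and "u2 \<equiv> \<lambda>t. ((1 + A) / (t + A)) powr (1 - a)"
    and "F1 \<equiv> \<lambda>t. (1 + A) powr (- a) * ((1 + A * t) powr a + (t + A) powr a) / (a * (1 - t) powr a)"
    and "F2 \<equiv> \<lambda>t. (1 + t powr a) / (a * (1 - t) powr a)"
  shows "(\<integral>\<^sup>+t\<in>{0<..th}. ennreal ((u1 t + u2 t) / (1 - t) powr (1 + a)) \<partial>lborel) = ennreal (F1 th - F1 0)"
    and "(\<integral>\<^sup>+t\<in>{0<..th}. ennreal ((1 + t powr (a - 1)) / (1 - t) powr (1 + a)) \<partial>lborel) = ennreal (F2 th - 1 / a)"
    and "F2 th <= F1 th" and "F1 0 <= F1 th" and "1 / a <= F2 th"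
proof -
  have quot: "((\<lambda>t. (g t / (1 - t)) powr a / a) has_real_derivative
      g t powr (a - 1) * (g' * (1 - t) + g t) / (1 - t) powr (1 + a)) (at t)"
    if g: "(g has_real_derivative g') (at t)" and pos: "0 < g t" "t < 1" for g g' t
  proof -
    have q: "0 < g t / (1 - t)" using pos by simp
    have "((\<lambda>t. (g t / (1 - t)) powr a / a) has_real_derivative
      (a * (g t / (1 - t)) powr (a - 1) * ((g' * (1 - t) - g t * (0 - 1)) / ((1 - t) * (1 - t)))) / a) (at t)"
      using g q pos a by (intro derivative_eq_intros refl) auto
    moreover have "(a * (g t / (1 - t)) powr (a - 1) * ((g' * (1 - t) - g t * (0 - 1)) / ((1 - t) * (1 - t)))) / a =
        g t powr (a - 1) * (g' * (1 - t) + g t) / (1 - t) powr (1 + a)"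
    proof -
      have "(1 - t) powr (1 + a) = (1 - t) powr (2 + (a - 1))" by simp
      also have "\<dots> = (1 - t) * (1 - t) * (1 - t) powr (a - 1)"
        using pos by (simp only: powr_add) (simp add: power2_eq_square)
      finally show ?thesis using pos a by (simp add: powr_divide)
    qed
    ultimately show ?thesis by simp
  qed
  have F1q: "F1 t = (1 + A) powr (- a) * (((1 + A * t) / (1 - t)) powr a / a + ((t + A) / (1 - t)) powr a / a)" for t
    unfolding F1_def powr_divide by (simp add: add_divide_distrib distrib_left mult.commute)
  have F2q: "F2 t = (1 / (1 - t)) powr a / a + (t / (1 - t)) powr a / a" for t
    by (simp add: F2_def powr_divide add_divide_distrib mult.commute)
  have d1: "(F1 has_real_derivative (u1 t + u2 t) / (1 - t) powr (1 + a)) (at t)" if t: "0 <= t" "t < 1" for t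
  proof -
    have p1: "0 < 1 + A * t" "0 < t + A" using A t by (auto intro: add_pos_nonneg)
    have "(F1 has_real_derivative (1 + A) powr (- a) *
        ((1 + A * t) powr (a - 1) * (A * (1 - t) + (1 + A * t)) / (1 - t) powr (1 + a) +
         (t + A) powr (a - 1) * (1 * (1 - t) + (t + A)) / (1 - t) powr (1 + a))) (at t)"
      unfolding F1q using p1 t
      by (intro DERIV_cmult DERIV_add quot) (auto intro!: derivative_eq_intros)
    moreover have "(1 + A) powr (- a) *
        ((1 + A * t) powr (a - 1) * (A * (1 - t) + (1 + A * t)) / (1 - t) powr (1 + a) +
         (t + A) powr (a - 1) * (1 * (1 - t) + (t + A)) / (1 - t) powr (1 + a)) =
        (u1 t + u2 t) / (1 - t) powr (1 + a)"
    proof -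
      have e: "A * (1 - t) + (1 + A * t) = 1 + A" "1 * (1 - t) + (t + A) = 1 + A" by (auto simp: algebra_simps)
      have s: "(1 + A) powr (- a) * (z powr (a - 1) * (1 + A) / m) = ((1 + A) / z) powr (1 - a) / m" if "0 < z" for z m
      proof -
        have "(1 + A) powr (1 - a) = (1 + A) * (1 + A) powr (- a)"
          using powr_add[of "1 + A" 1 "- a"] A by simp
        moreover have "z powr (a - 1) = 1 / z powr (1 - a)"
          using powr_minus_divide[of z "1 - a"] by simp
        ultimately show ?thesis by (simp add: powr_divide)
      qed
      show ?thesis
        by (simp only: e distrib_left[of "(1 + A) powr (- a)"] s[OF p1(1)] s[OF p1(2)] u1_def u2_def
            add_divide_distrib[of "((1 + A) / (1 + A * t)) powr (1 - a)"])
    qed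
    ultimately show ?thesis by simp
  qed
  have d2: "(F2 has_real_derivative (1 + t powr (a - 1)) / (1 - t) powr (1 + a)) (at t)" if t: "0 < t" "t < 1" for t
  proof -
    have "(F2 has_real_derivative (1 powr (a - 1) * (0 * (1 - t) + 1) / (1 - t) powr (1 + a) +
         t powr (a - 1) * (1 * (1 - t) + t) / (1 - t) powr (1 + a))) (at t)"
      unfolding F2q using t by (intro DERIV_add quot) (auto intro!: derivative_eq_intros)
    then show ?thesis by (simp add: add_divide_distrib)
  qed
  have AE: "AE t::real in lborel. t \<noteq> 0" by (rule AE_lborel_singleton)
  have n1: "0 <= (u1 t + u2 t) / (1 - t) powr (1 + a)" for t by (simp add: u1_def u2_def)
  have [measurable]: "u1 \<in> borel_measurable borel" "u2 \<in> borel_measurable borel"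
    unfolding u1_def u2_def by measurable
  have "(\<integral>\<^sup>+t. ennreal ((u1 t + u2 t) / (1 - t) powr (1 + a)) * indicator {0..th} t \<partial>lborel) = ennreal (F1 th - F1 0)"
    using th n1 by (intro nn_integral_FTC_Icc d1) auto
  moreover have "(\<integral>\<^sup>+t\<in>{0<..th}. ennreal ((u1 t + u2 t) / (1 - t) powr (1 + a)) \<partial>lborel) =
      (\<integral>\<^sup>+t. ennreal ((u1 t + u2 t) / (1 - t) powr (1 + a)) * indicator {0..th} t \<partial>lborel)"
    using AE by (intro nn_integral_cong_AE) (auto elim!: eventually_mono simp: indicator_def)
  ultimately show "(\<integral>\<^sup>+t\<in>{0<..th}. ennreal ((u1 t + u2 t) / (1 - t) powr (1 + a)) \<partial>lborel) = ennreal (F1 th - F1 0)"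
    by simp
  show "F1 0 <= F1 th"
    using d1 n1 th by (intro DERIV_nonneg_imp_nondecreasing[of 0 th F1]) force+
  have l: "0 <= 1 / (1 + A)" "1 / (1 + A) <= 1" "1 - 1 / (1 + A) = A / (1 + A)"
    using A by (auto simp: field_simps)
  have c1: "1 / (1 + A) * 1 powr a + A / (1 + A) * th powr a <= ((1 + A * th) / (1 + A)) powr a"
    using powr_concave[OF a l(1,2), of 1 th] th by (simp add: l(3) add_divide_distrib)
  have c2: "1 / (1 + A) * th powr a + A / (1 + A) * 1 powr a <= ((th + A) / (1 + A)) powr a"
    using powr_concave[OF a l(1,2), of th 1] th by (simp add: l(3) add_divide_distrib)
  have "1 + th powr a = (1 / (1 + A) + A / (1 + A)) * (1 + th powr a)"
    using A by (simp add: add_divide_distrib[symmetric])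
  also have "\<dots> <= ((1 + A * th) / (1 + A)) powr a + ((th + A) / (1 + A)) powr a"
    using add_mono[OF c1 c2] by (simp only: distrib_left distrib_right powr_one_eq_one)
  also have "\<dots> = (1 + A) powr (- a) * ((1 + A * th) powr a + (th + A) powr a)"
    by (simp only: powr_divide powr_minus_divide) (simp add: add_divide_distrib)
  finally show "F2 th <= F1 th"
    unfolding F1_def F2_def using a by (intro divide_right_mono) auto
  show F2ge: "1 / a <= F2 th"
  proof -
    have "(1 - th) powr a <= 1" using th a by (simp add: powr_le1)
    then have "a * (1 - th) powr a <= a" "0 < a * (1 - th) powr a" using a th by (auto simp: mult_left_le)
    then have "1 / a <= 1 / (a * (1 - th) powr a)" using a by (intro frac_le) auto
    also have "\<dots> <= F2 th" unfolding F2_def using a by (intro divide_right_mono) auto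
    finally show ?thesis .
  qed
  have n2: "0 <= (1 + t powr (a - 1)) / (1 - t) powr (1 + a)" for t by simp
  \<comment> \<open>The derivative of \<open>F2\<close> is unbounded at 0 since a < 1, so the
    fundamental theorem is used with continuity at the end points and differentiability
    inside.\<close>
  have cont: "continuous_on {0..th} F2"
    unfolding F2_def using th a
    by (intro continuous_on_divide continuous_on_add continuous_on_mult continuous_on_powr'
        continuous_on_diff continuous_on_const continuous_on_id) auto
  have hi: "((\<lambda>t. (1 + t powr (a - 1)) / (1 - t) powr (1 + a)) has_integral (F2 th - F2 0)) {0..th}"
    using th d2 by (intro fundamental_theorem_of_calculus_interior cont)
      (auto simp: has_real_derivative_iff_has_vector_derivative[symmetric])
  have "(\<integral>\<^sup>+t. ennreal (indicator {0..th} t * ((1 + t powr (a - 1)) / (1 - t) powr (1 + a))) \<partial>lborel) = ennreal (F2 th - F2 0)"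
    using nn_integral_has_integral_lebesgue[OF n2 hi] by simp
  moreover have "(\<integral>\<^sup>+t\<in>{0<..th}. ennreal ((1 + t powr (a - 1)) / (1 - t) powr (1 + a)) \<partial>lborel) =
      (\<integral>\<^sup>+t. ennreal (indicator {0..th} t * ((1 + t powr (a - 1)) / (1 - t) powr (1 + a))) \<partial>lborel)"
    using AE by (intro nn_integral_cong_AE) (auto elim!: eventually_mono simp: indicator_def)
  moreover have "F2 0 = 1 / a" by (simp add: F2_def)
  ultimately show "(\<integral>\<^sup>+t\<in>{0<..th}. ennreal ((1 + t powr (a - 1)) / (1 - t) powr (1 + a)) \<partial>lborel) = ennreal (F2 th - 1 / a)"
    by simp
qed


lemma outer_interval:
  assumes a: "0 < a" and x: "0 < x" "x < 1"
  shows "outer a {0<..<1} x = ennreal (x powr (- a) / a) + ennreal ((1 - x) powr (- a) / a)"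
proof -
  have "outer a {0<..<1} x = (\<integral>\<^sup>+y. ennreal (1 / \<bar>x - y\<bar> powr (1 + a)) * indicator {..0} y +
      ennreal (1 / \<bar>x - y\<bar> powr (1 + a)) * indicator {1..} y \<partial>lborel)"
    unfolding outer_def by (intro nn_integral_cong) (auto simp: indicator_def)
  also have "\<dots> = (\<integral>\<^sup>+y\<in>{..0}. ennreal (1 / \<bar>x - y\<bar> powr (1 + a)) \<partial>lborel) +
      (\<integral>\<^sup>+y\<in>{1..}. ennreal (1 / \<bar>x - y\<bar> powr (1 + a)) \<partial>lborel)"
    by (rule nn_integral_add) auto
  also have "(\<integral>\<^sup>+y\<in>{1..}. ennreal (1 / \<bar>x - y\<bar> powr (1 + a)) \<partial>lborel) =
      (\<integral>\<^sup>+y. ennreal (1 / \<bar>x - (1 + (-1) * y)\<bar> powr (1 + a)) * indicator {1..} (1 + (-1) * y) \<partial>lborel)"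
    by (subst nn_integral_real_affine[where c = "-1" and t = 1]) auto
  also have "\<dots> = (\<integral>\<^sup>+y\<in>{..0}. ennreal (1 / \<bar>(1 - x) - y\<bar> powr (1 + a)) \<partial>lborel)"
  proof -
    have e: "\<bar>x - (1 + (-1) * y)\<bar> = \<bar>(1 - x) - y\<bar>" for y by linarith
    show ?thesis unfolding e by (intro nn_integral_cong) (auto simp: indicator_def)
  qed
  finally show ?thesis using outer_nonpos[OF a, of x] outer_nonpos[OF a, of "1 - x"] x by simp
qed

text \<open>As |1 - t^\<alpha>|^2 = 1 - 2 t^\<alpha> + t^(a-1), the normalised net flux is
  \<open>hK\<close> plus (F1 th - F1 0) - (F2 th - 1 / a). The exterior of the interval contributes
  exactly F1 0, so the surplus over hK + 1 / a is F1 th - F2 th, which is nonnegative.\<close>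

lemma line_hardy_interval_two:
  assumes a: "0 < a" "a < 1"
  shows "line_hardy 2 a {0<..<1} end_dist"
proof -
  define \<alpha> where "\<alpha> = (a - 1) / 2"
  have al: "-1 < \<alpha>" using a by (simp add: \<alpha>_def)
  define w where "w = (\<lambda>x::real. (x * (1 - x)) powr \<alpha>)"
  have wm[measurable]: "w \<in> borel_measurable borel" unfolding w_def by measurable
  define M where "M th = ennreal (2 powr a) * (2 * (ennreal (1 / (1 - th) powr (1 + a)) * ennreal (th powr (\<alpha> + 1) / (\<alpha> + 1))))" for th
  have w2: "w x powr (2 - 1) = w x" for x unfolding w_def by simp
  have est: "flux 2 a {0<..<1} w (moebius_kept th) (-1) x <= M th * ennreal (w x powr (2 - 1) * end_dist x powr (- a)) \<and>
      flux 2 a {0<..<1} w (moebius_kept th) (-1) x +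
        (hK 2 a th + ennreal (1 / a)) * ennreal (w x powr (2 - 1) * end_dist x powr (- a))
      <= flux 2 a {0<..<1} w (moebius_kept th) 1 x + ennreal (w x powr (2 - 1)) * outer a {0<..<1} x"
    if x: "0 < x" "x < 1" and th: "0 < th" "th < 1" for x th
  proof -
    define A where "A = x / (1 - x)"
    have A: "0 < A" using x by (simp add: A_def)
    have xA: "x = A / (1 + A)" "1 - x = 1 / (1 + A)"
    proof -
      have "1 + A = 1 / (1 - x)" using x by (simp add: A_def field_simps)
      then show "x = A / (1 + A)" "1 - x = 1 / (1 + A)" using x by (auto simp: A_def)
    qed
    define u1 u2 where "u1 t = ((1 + A) / (1 + A * t)) powr (1 - a)" and "u2 t = ((1 + A) / (t + A)) powr (1 - a)" for t
    have [measurable]: "u1 \<in> borel_measurable borel" "u2 \<in> borel_measurable borel"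
      unfolding u1_def[abs_def] u2_def[abs_def] by measurable
    have unn: "0 <= u1 t" "0 <= u2 t" for t by (auto simp: u1_def u2_def)
    define F1 where "F1 t = (1 + A) powr (- a) * ((1 + A * t) powr a + (t + A) powr a) / (a * (1 - t) powr a)" for t
    define F2 where "F2 t = (1 + t powr a) / (a * (1 - t) powr a)" for t
    note prim = moebius_primitives[OF A a th, folded u1_def u2_def F1_def F2_def]
    define X where "X = A powr (\<alpha> - a) * (1 + A) powr (1 + a)"
    have fl: "flux 2 a {0<..<1} w (moebius_kept th) \<sigma> x = ennreal X *
      ((\<integral>\<^sup>+t\<in>{0<..th}. ennreal (\<sigma> * (u1 t - t powr \<alpha>) / (1 - t) powr (1 + a)) \<partial>lborel) +
       (\<integral>\<^sup>+t\<in>{0<..th}. ennreal (\<sigma> * (u2 t - t powr \<alpha>) / (1 - t) powr (1 + a)) \<partial>lborel))" for \<sigma>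
      using flux_moebius[OF a x th, of \<sigma>] unfolding w_def \<alpha>_def X_def u1_def u2_def A_def .
    define m where "m t = (1 - t) powr (1 + a)" for t
    have [measurable]: "m \<in> borel_measurable borel" unfolding m_def[abs_def] by measurable
    define b where "b = (\<integral>\<^sup>+t\<in>{0<..th}. ennreal ((u1 t - t powr \<alpha>) / m t) \<partial>lborel) +
       (\<integral>\<^sup>+t\<in>{0<..th}. ennreal ((u2 t - t powr \<alpha>) / m t) \<partial>lborel)"
    define n where "n = (\<integral>\<^sup>+t\<in>{0<..th}. ennreal (- ((u1 t - t powr \<alpha>) / m t)) \<partial>lborel) +
       (\<integral>\<^sup>+t\<in>{0<..th}. ennreal (- ((u2 t - t powr \<alpha>) / m t)) \<partial>lborel)"
    have flb: "flux 2 a {0<..<1} w (moebius_kept th) 1 x = ennreal X * b"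
      and fln: "flux 2 a {0<..<1} w (moebius_kept th) (-1) x = ennreal X * n"
      unfolding fl b_def n_def m_def minus_divide_left by simp_all
    have tt: "t powr \<alpha> * t powr \<alpha> = t powr (a - 1)" for t :: real
      by (simp add: powr_add[symmetric] \<alpha>_def)
    have bal: "b + ennreal (F2 th - 1 / a) = n + hK 2 a th + ennreal (F1 th - F1 0)"
    proof -
      let ?i = "indicator {0<..th} :: real => ennreal"
      have "b + ennreal (F2 th - 1 / a) =
        (\<integral>\<^sup>+t. (ennreal ((u1 t - t powr \<alpha>) / m t) * ?i t + ennreal ((u2 t - t powr \<alpha>) / m t) * ?i t) +
            ennreal ((1 + t powr (a - 1)) / m t) * ?i t \<partial>lborel)"
        unfolding b_def prim(2)[symmetric] m_def[symmetric] by (simp add: nn_integral_add)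
      also have "\<dots> = (\<integral>\<^sup>+t. (ennreal (- ((u1 t - t powr \<alpha>) / m t)) * ?i t + ennreal (- ((u2 t - t powr \<alpha>) / m t)) * ?i t) +
            ennreal (\<bar>1 - t powr \<alpha>\<bar> powr 2 / m t) * ?i t + ennreal ((u1 t + u2 t) / m t) * ?i t \<partial>lborel)"
      proof (rule nn_integral_cong)
        fix t :: real
        have s: "\<bar>1 - t powr \<alpha>\<bar> powr 2 = 1 - 2 * t powr \<alpha> + t powr (a - 1)"
          unfolding tt[symmetric] by (simp add: power2_eq_square algebra_simps)
        have nnm: "0 <= m t" by (simp add: m_def)
        have "ennreal ((u1 t - t powr \<alpha>) / m t) + ennreal ((u2 t - t powr \<alpha>) / m t) + ennreal ((1 + t powr (a - 1)) / m t) =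
          ennreal (- ((u1 t - t powr \<alpha>) / m t)) + ennreal (- ((u2 t - t powr \<alpha>) / m t)) +
            ennreal (\<bar>1 - t powr \<alpha>\<bar> powr 2 / m t + (u1 t + u2 t) / m t)"
        proof (rule ennreal_balance)
          show "0 <= (1 + t powr (a - 1)) / m t" using nnm by simp
          show "0 <= \<bar>1 - t powr \<alpha>\<bar> powr 2 / m t + (u1 t + u2 t) / m t"
            using nnm unn by (intro add_nonneg_nonneg divide_nonneg_nonneg) auto
          show "(u1 t - t powr \<alpha>) / m t + (u2 t - t powr \<alpha>) / m t + (1 + t powr (a - 1)) / m t =
            \<bar>1 - t powr \<alpha>\<bar> powr 2 / m t + (u1 t + u2 t) / m t"
            unfolding s by (simp add: add_divide_distrib diff_divide_distrib)
        qed
        also have "ennreal (\<bar>1 - t powr \<alpha>\<bar> powr 2 / m t + (u1 t + u2 t) / m t) =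
          ennreal (\<bar>1 - t powr \<alpha>\<bar> powr 2 / m t) + ennreal ((u1 t + u2 t) / m t)"
          using nnm unn by (intro ennreal_plus) auto
        finally show "(ennreal ((u1 t - t powr \<alpha>) / m t) * ?i t + ennreal ((u2 t - t powr \<alpha>) / m t) * ?i t) +
            ennreal ((1 + t powr (a - 1)) / m t) * ?i t =
          (ennreal (- ((u1 t - t powr \<alpha>) / m t)) * ?i t + ennreal (- ((u2 t - t powr \<alpha>) / m t)) * ?i t) +
            ennreal (\<bar>1 - t powr \<alpha>\<bar> powr 2 / m t) * ?i t + ennreal ((u1 t + u2 t) / m t) * ?i t"
          by (simp add: indicator_def add.assoc)
      qed
      also have "\<dots> = n + hK 2 a th + ennreal (F1 th - F1 0)"
        unfolding n_def prim(1)[symmetric] m_def[symmetric] hK_def \<alpha>_def[symmetric] by (simp add: nn_integral_add)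
      finally show ?thesis .
    qed
    \<comment> \<open>The finite term F2 th - 1 / a is cancelled; what is left of the balance is F2
      th <= F1 th.\<close>
    have core: "n + (hK 2 a th + ennreal (1 / a)) <= b + ennreal (F1 0)"
    proof -
      have F10: "0 <= F1 0" using a by (simp add: F1_def)
      have "(n + (hK 2 a th + ennreal (1 / a))) + ennreal (F2 th - 1 / a) = n + hK 2 a th + ennreal (F2 th)"
        using prim(5) a ennreal_plus[of "1 / a" "F2 th - 1 / a"] by (simp add: add.assoc del: ennreal_plus)
      also have "\<dots> <= n + hK 2 a th + ennreal (F1 th)" using prim(3) by (intro add_left_mono ennreal_leI)
      also have "ennreal (F1 th) = ennreal (F1 th - F1 0) + ennreal (F1 0)"
        using prim(4) F10 ennreal_plus[of "F1 th - F1 0" "F1 0"] by (simp del: ennreal_plus)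
      also have "n + hK 2 a th + (ennreal (F1 th - F1 0) + ennreal (F1 0)) = (b + ennreal (F1 0)) + ennreal (F2 th - 1 / a)"
        using bal by (simp add: ac_simps)
      finally have "ennreal (F2 th - 1 / a) + (n + (hK 2 a th + ennreal (1 / a))) <= ennreal (F2 th - 1 / a) + (b + ennreal (F1 0))"
        by (simp only: add.commute)
      then show ?thesis by (subst (asm) ennreal_add_left_cancel_le) auto
    qed
    have wx: "w x = A powr \<alpha> * (1 + A) powr (1 - a)"
    proof -
      have "x * (1 - x) = A / (1 + A) powr 2"
        using A by (subst xA(2), subst xA(1)) (simp add: power2_eq_square)
      then have "w x = A powr \<alpha> / (1 + A) powr (2 * \<alpha>)"
        unfolding w_def by (simp only: powr_divide powr_powr)
      moreover have "1 - a = - (2 * \<alpha>)" by (simp add: \<alpha>_def field_simps)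
      then have "(1 + A) powr (1 - a) = (1 + A) powr (- (2 * \<alpha>))" by simp
      ultimately show ?thesis by (simp add: powr_minus_divide)
    qed
    \<comment> \<open>Here x (1 - x) takes the place of the distance. It is at most
      \<open>end_dist\<close>, which makes the weight larger than required, and at least half of it,
      which is what the finiteness bound uses.\<close>
    have Xw: "X = w x * (x * (1 - x)) powr (- a)"
    proof -
      have "x * (1 - x) = A / (1 + A) powr 2"
        using A by (subst xA(2), subst xA(1)) (simp add: power2_eq_square)
      then have "(x * (1 - x)) powr (- a) = A powr (- a) / (1 + A) powr (2 * - a)"
        by (simp only: powr_divide powr_powr)
      also have "\<dots> = A powr (- a) * (1 + A) powr (2 * a)"
        using powr_minus_divide[of "1 + A" "2 * a"] by simp
      finally have "w x * (x * (1 - x)) powr (- a) = (A powr \<alpha> * A powr (- a)) * ((1 + A) powr (1 - a) * (1 + A) powr (2 * a))"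
        by (simp add: wx)
      then show ?thesis by (simp add: X_def powr_add[symmetric] add.commute)
    qed
    have edpos: "0 < end_dist x" using x by (simp add: end_dist_def)
    have ed1: "x * (1 - x) <= end_dist x"
      using mult_left_le[of "1 - x" x] mult_left_le_one_le[of "1 - x" x] x by (simp add: end_dist_def)
    have ed2: "end_dist x <= 2 * (x * (1 - x))"
    proof (cases "x <= 1 / 2")
      case True
      then have "x * 1 <= x * (2 * (1 - x))" using x by (intro mult_left_mono) auto
      then have "x <= 2 * (x * (1 - x))" by (simp add: algebra_simps)
      then show ?thesis using True by (simp add: end_dist_def)
    next
      case False
      then have "1 * (1 - x) <= (2 * x) * (1 - x)" using x by (intro mult_right_mono) auto
      then have "1 - x <= 2 * (x * (1 - x))" by (simp add: algebra_simps)
      then show ?thesis using False by (simp add: end_dist_def)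
    qed
    have wnn: "0 <= w x" by (simp add: w_def)
    have lo: "w x * end_dist x powr (- a) <= X"
      unfolding Xw using ed1 x a wnn by (intro mult_left_mono powr_mono2') auto
    have hi: "X <= 2 powr a * (w x * end_dist x powr (- a))"
    proof -
      have "(x * (1 - x)) powr (- a) <= (end_dist x / 2) powr (- a)"
        using ed2 edpos a by (intro powr_mono2') auto
      also have "\<dots> = 2 powr a * end_dist x powr (- a)" by (simp add: powr_divide powr_minus_divide)
      finally have "w x * (x * (1 - x)) powr (- a) <= w x * (2 powr a * end_dist x powr (- a))"
        using wnn by (intro mult_left_mono)
      then show ?thesis unfolding Xw by (simp add: mult_ac)
    qed
    have wo: "ennreal (w x) * outer a {0<..<1} x = ennreal X * ennreal (F1 0)"
    proof -
      have "ennreal (w x) * outer a {0<..<1} x = ennreal (w x * (x powr (- a) / a + (1 - x) powr (- a) / a))"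
        unfolding outer_interval[OF a(1) x] using wnn a by (simp add: ennreal_mult' ennreal_plus[symmetric] del: ennreal_plus)
      also have "w x * (x powr (- a) / a + (1 - x) powr (- a) / a) = X * F1 0"
      proof -
        have pa: "(x * (1 - x)) powr (- a) * (x powr a + (1 - x) powr a) = x powr (- a) + (1 - x) powr (- a)"
        proof -
          have "x powr (- a) * x powr a = 1" "(1 - x) powr (- a) * (1 - x) powr a = 1"
            using x by (simp_all add: powr_add[symmetric])
          moreover have "(x * (1 - x)) powr (- a) * (x powr a + (1 - x) powr a) =
            (x powr (- a) * x powr a) * (1 - x) powr (- a) + ((1 - x) powr (- a) * (1 - x) powr a) * x powr (- a)"
            unfolding powr_mult by (simp only: algebra_simps)
          ultimately show ?thesis by simp
        qed
        have "x powr a = A powr a / (1 + A) powr a"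
          by (subst xA(1)) (simp only: powr_divide)
        moreover have "(1 - x) powr a = 1 / (1 + A) powr a"
          by (simp only: xA(2) powr_divide powr_one_eq_one)
        ultimately have "F1 0 = (x powr a + (1 - x) powr a) / a"
          unfolding F1_def by (simp add: powr_minus_divide add_divide_distrib algebra_simps)
        then show ?thesis unfolding Xw
          by (simp add: pa[symmetric] add_divide_distrib[symmetric])
      qed
      also have "ennreal (X * F1 0) = ennreal X * ennreal (F1 0)"
        by (rule ennreal_mult') (simp add: X_def)
      finally show ?thesis .
    qed
    have nM: "n <= 2 * (ennreal (1 / (1 - th) powr (1 + a)) * ennreal (th powr (\<alpha> + 1) / (\<alpha> + 1)))"
    proof -
      have le: "(\<integral>\<^sup>+t\<in>{0<..th}. ennreal (- ((u t - t powr \<alpha>) / m t)) \<partial>lborel) <=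
        ennreal (1 / (1 - th) powr (1 + a)) * ennreal (th powr (\<alpha> + 1) / (\<alpha> + 1))" if u: "\<And>t. 0 <= u t" for u
      proof -
        have "(\<integral>\<^sup>+t\<in>{0<..th}. ennreal (- ((u t - t powr \<alpha>) / m t)) \<partial>lborel) <=
          (\<integral>\<^sup>+t. ennreal (1 / (1 - th) powr (1 + a)) * (ennreal (t powr \<alpha>) * indicator {0<..th} t) \<partial>lborel)"
        proof (rule nn_integral_mono)
          fix t :: real
          show "ennreal (- ((u t - t powr \<alpha>) / m t)) * indicator {0<..th} t <=
            ennreal (1 / (1 - th) powr (1 + a)) * (ennreal (t powr \<alpha>) * indicator {0<..th} t)"
          proof (cases "0 < t \<and> t <= th")
            case True
            have mm: "0 < (1 - th) powr (1 + a)" "(1 - th) powr (1 + a) <= m t"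
              unfolding m_def using True th a by (auto intro!: powr_mono2)
            have "- ((u t - t powr \<alpha>) / m t) = (t powr \<alpha> - u t) / m t" by (simp add: minus_divide_left)
            also have "\<dots> <= t powr \<alpha> / m t" using u[of t] by (intro divide_right_mono) (auto simp: m_def)
            also have "\<dots> <= t powr \<alpha> / (1 - th) powr (1 + a)" using mm(2) mult_pos_pos[OF less_le_trans[OF mm] mm(1)]
              by (intro divide_left_mono) auto
            finally have "ennreal (- ((u t - t powr \<alpha>) / m t)) <= ennreal (1 / (1 - th) powr (1 + a) * t powr \<alpha>)"
              by (intro ennreal_leI) simp
            also have "\<dots> = ennreal (1 / (1 - th) powr (1 + a)) * ennreal (t powr \<alpha>)" by (rule ennreal_mult') simp
            finally show ?thesis using True by simp
          qed simp
        qed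
        also have "\<dots> = ennreal (1 / (1 - th) powr (1 + a)) * ennreal (th powr (\<alpha> + 1) / (\<alpha> + 1))"
          using nn_integral_powr_from_0[OF al, of th] th by (simp add: nn_integral_cmult)
        finally show ?thesis .
      qed
      show ?thesis unfolding n_def mult_2 by (intro add_mono le unn)
    qed
    show ?thesis unfolding w2
    proof
      have "ennreal X * n <= ennreal (2 powr a * (w x * end_dist x powr (- a))) *
          (2 * (ennreal (1 / (1 - th) powr (1 + a)) * ennreal (th powr (\<alpha> + 1) / (\<alpha> + 1))))"
        using hi nM by (intro mult_mono ennreal_leI) auto
      also have "\<dots> = M th * ennreal (w x * end_dist x powr (- a))"
        unfolding M_def by (subst ennreal_mult') (simp_all add: mult_ac)
      finally show "flux 2 a {0<..<1} w (moebius_kept th) (-1) x <= M th * ennreal (w x * end_dist x powr (- a))"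
        unfolding fln .
      have "ennreal X * n + (hK 2 a th + ennreal (1 / a)) * ennreal (w x * end_dist x powr (- a)) <=
          ennreal X * n + (hK 2 a th + ennreal (1 / a)) * ennreal X"
        using lo by (intro add_left_mono mult_left_mono ennreal_leI) auto
      also have "\<dots> = ennreal X * (n + (hK 2 a th + ennreal (1 / a)))" by (simp only: distrib_left mult.commute)
      also have "\<dots> <= ennreal X * (b + ennreal (F1 0))" using core by (intro mult_left_mono) auto
      finally show "flux 2 a {0<..<1} w (moebius_kept th) (-1) x +
          (hK 2 a th + ennreal (1 / a)) * ennreal (w x * end_dist x powr (- a))
        <= flux 2 a {0<..<1} w (moebius_kept th) 1 x + ennreal (w x) * outer a {0<..<1} x"
        unfolding flb fln wo distrib_left .
    qed
  qed
  show ?thesis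
  proof (rule line_hardyI[where w = w and N = "\<lambda>n. moebius_kept (hth n)" and M = "\<lambda>n. M (hth n)"])
    show "hC 2 a < \<infinity>" using a by (intro hC_finite) auto
    fix n :: nat and x y :: real
    have kept: "moebius_kept th x y \<longleftrightarrow> 0 < x \<and> x < 1 \<and> 0 < y \<and> y < 1 \<and> ratio_kept th (x * (1 - y)) (y * (1 - x))" for th x y
      by (simp add: moebius_kept_def ratio_kept_def)
    show "moebius_kept (hth 0) x y ==> moebius_kept (hth n) x y"
      unfolding kept using ratio_kept_mono[OF hth(4)[of 0 n], of "x * (1 - y)" "y * (1 - x)"] by simp
    show "moebius_kept (hth n) x y ==> moebius_kept (hth n) y x"
      by (auto simp: moebius_kept_def)
    show "M (hth n) < \<infinity>" by (simp add: M_def ennreal_mult_less_top)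
    assume x: "x \<in> {0<..<1}"
    then have x': "0 < x" "x < 1" by auto
    show "0 < w x" using x by (simp add: w_def)
    show "flux 2 a {0<..<1} w (moebius_kept (hth n)) (- 1) x
      <= M (hth n) * ennreal (w x powr (2 - 1) * end_dist x powr - a)"
      "flux 2 a {0<..<1} w (moebius_kept (hth n)) (- 1) x +
         (hK 2 a (hth n) + ennreal (1 / a)) * ennreal (w x powr (2 - 1) * end_dist x powr - a)
         <= flux 2 a {0<..<1} w (moebius_kept (hth n)) 1 x + ennreal (w x powr (2 - 1)) * outer a {0<..<1} x"
      using est[OF x' hth(1,2)] by auto
    show "\<exists>\<eta>>0. \<forall>y. 0 < y \<and> y < \<eta> \<longrightarrow> y \<in> {0<..<1} \<and> moebius_kept (hth 0) x y \<and> y < x"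
    proof (intro exI[of _ "x / 4"] conjI allI impI)
      fix y assume y: "0 < y \<and> y < x / 4"
      \<comment> \<open>With y < x / 4 < 1/2 one gets y (1 - x) <= x / 4 <= x (1 - y) / 2, and
        \<open>hth 0\<close> is 1/2.\<close>
      have "y * (1 - x) <= y" using x y by (simp add: mult_left_le)
      moreover have "x * (1 / 2) <= x * (1 - y)" using x y by (intro mult_left_mono) auto
      ultimately have "y * (1 - x) <= 1 / 2 * (x * (1 - y))" using y by linarith
      then show "moebius_kept (hth 0) x y" using x y by (simp add: moebius_kept_def hth(3))
    qed (use x in auto)
  next
    fix y :: real assume y: "0 < y" "y < 1 / 2"
    then have ed: "end_dist y = y" by (simp add: end_dist_def)
    \<comment> \<open>Compared with the pure power this ground state has an additional factor, which
      is at least 1 because a < 1.\<close>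
    have "1 <= (1 - y) powr (a - 1)" using powr_mono'[of "a - 1" 0 "1 - y"] y a by simp
    then have "1 / y <= (1 - y) powr (a - 1) / y" using y by (intro divide_right_mono) auto
    also have "\<dots> = w y powr 2 * end_dist y powr (- a)"
    proof -
      have "w y powr 2 = y powr (a - 1) * (1 - y) powr (a - 1)"
      proof -
        have "\<alpha> * 2 = a - 1" by (simp add: \<alpha>_def)
        then show ?thesis by (simp only: w_def powr_powr powr_mult)
      qed
      moreover have "y powr (a - 1) * y powr (- a) = 1 / y"
        using y by (simp only: powr_add[symmetric]) (simp add: powr_minus_divide)
      moreover have "z * (1 - y) powr (a - 1) = (1 - y) powr (a - 1) * z" for z :: real by simp
      ultimately show ?thesis unfolding ed by (metis mult.assoc mult.commute mult.left_commute times_divide_eq_right mult_1_right)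
    qed
    finally show "1 / y <= w y powr 2 * end_dist y powr (- a)" .
  qed (use wm in auto)
qed

subsection \<open>Arbitrary open intervals\<close>

text \<open>\<open>gap a S x h\<close> is \<open>d powr (- a)\<close>, where \<open>d\<close> is the distance from \<open>x\<close> to the complement of the
  convex set \<open>S\<close> along \<open>h\<close> and \<open>- h\<close>, measured in multiples of \<open>h\<close>. The infimum over rationals makes it
  measurable in \<open>x\<close> and \<open>h\<close> jointly.\<close>

definition gap :: "real => 'a::real_vector set => 'a => 'a => ennreal" where
  "gap a S x h = (INF q\<in>{q. q \<in> \<rat> \<and> 0 < q}.
     if x + q *\<^sub>R h \<in> S \<and> x - q *\<^sub>R h \<in> S then ennreal (q powr (- a)) else \<infinity>)"

text \<open>If the admissible multiples are exactly those below \<delta>, the infimum of the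
  decreasing function q^(-a) over the rationals is its left limit at \<delta>.\<close>

lemma gap_eq:
  assumes a: "0 < a" and \<delta>: "0 < \<delta>"
    and iff: "\<And>q. 0 < q ==> (x + q *\<^sub>R h \<in> S \<and> x - q *\<^sub>R h \<in> S) \<longleftrightarrow> q < \<delta>"
  shows "gap a S x h = ennreal (\<delta> powr (- a))"
proof (rule antisym)
  show "gap a S x h <= ennreal (\<delta> powr (- a))"
  proof -
    have "((\<lambda>q. ennreal (q powr (- a))) \<longlongrightarrow> ennreal (\<delta> powr (- a))) (at_left \<delta>)"
      using \<delta> by (intro tendsto_ennrealI tendsto_powr tendsto_intros) (auto simp: filterlim_ident)
    note lim = this
    show ?thesis
    proof (rule ccontr)
      assume "\<not> ?thesis"
      then have "\<forall>\<^sub>F q in at_left \<delta>. ennreal (q powr (- a)) < gap a S x h"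
        using order_tendstoD(2)[OF lim] by simp
      then obtain c where c: "c < \<delta>" "\<And>q. c < q ==> q < \<delta> ==> ennreal (q powr (- a)) < gap a S x h"
        unfolding eventually_at_left_field by blast
      have "max c 0 < \<delta>" using c \<delta> by simp
      from Rats_dense_in_real[OF this] obtain q where q: "q \<in> \<rat>" "max c 0 < q" "q < \<delta>" by blast
      then have "gap a S x h <= ennreal (q powr (- a))"
        unfolding gap_def using iff[of q] by (intro INF_lower2[of q]) auto
      then show False using c(2)[of q] q by auto
    qed
  qed
  show "ennreal (\<delta> powr (- a)) <= gap a S x h"
    unfolding gap_def
  proof (rule INF_greatest)
    fix q :: real assume q: "q \<in> {q. q \<in> \<rat> \<and> 0 < q}"
    show "ennreal (\<delta> powr (- a)) <= (if x + q *\<^sub>R h \<in> S \<and> x - q *\<^sub>R h \<in> S then ennreal (q powr (- a)) else \<infinity>)"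
      using iff[of q] q a by (auto intro!: ennreal_leI powr_mono2')
  qed
qed

lemma gap_UNIV: assumes "0 < a" shows "gap a UNIV x h = 0"
proof -
  have "gap a UNIV x h <= ennreal \<epsilon>" if "0 < \<epsilon>" for \<epsilon>
  proof -
    obtain q where q: "q \<in> \<rat>" "\<epsilon> powr (- 1 / a) < q"
      using Rats_dense_in_real[of "\<epsilon> powr (- 1 / a)" "\<epsilon> powr (- 1 / a) + 1"] by auto
    have e: "0 < \<epsilon> powr (- 1 / a)" using that by simp
    have "q powr (- a) <= (\<epsilon> powr (- 1 / a)) powr (- a)"
      using q e assms by (intro powr_mono2') auto
    also have "\<dots> = \<epsilon>" using assms that by (simp add: powr_powr)
    finally have "ennreal (q powr (- a)) <= ennreal \<epsilon>" by (rule ennreal_leI)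
    moreover have "0 < q" using q e by linarith
    ultimately show ?thesis unfolding gap_def using q by (intro INF_lower2[of q]) auto
  qed
  then have "gap a UNIV x h <= 0" by - (rule ennreal_le_epsilon, simp)
  then show ?thesis by simp
qed

text \<open>The content of \<open>line_hardy\<close> with the weight expressed by
  \<open>gap\<close>. In this form it makes sense for every open interval, including the empty set
  and the whole line, and the weight of a convex set restricts to the weight of its slices.\<close>

definition line_ineq :: "real => real => real set => bool" where
  "line_ineq p a I \<longleftrightarrow> (\<forall>v\<in>borel_measurable borel. (\<forall>x. x \<notin> I \<longrightarrow> v x = 0) \<longrightarrow>
     (\<integral>\<^sup>+x. ennreal (\<bar>v x\<bar> powr p) * gap a I x 1 \<partial>lborel) < \<infinity> \<longrightarrow>
     2 * (hC p a * (\<integral>\<^sup>+x. ennreal (\<bar>v x\<bar> powr p) * gap a I x 1 \<partial>lborel)) <= energy1 p a v \<and>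
     (energy1 p a v = 2 * (hC p a * (\<integral>\<^sup>+x. ennreal (\<bar>v x\<bar> powr p) * gap a I x 1 \<partial>lborel)) \<longrightarrow>
       (\<integral>\<^sup>+x. ennreal (\<bar>v x\<bar> powr p) * gap a I x 1 \<partial>lborel) = 0))"

text \<open>Two Jacobians |r| meet the factor |r|^(-1-a) of the kernel.\<close>

lemma energy1_affine:
  fixes c r :: real
  assumes [measurable]: "v \<in> borel_measurable borel" and r: "r \<noteq> 0"
  shows "energy1 p a v = ennreal (\<bar>r\<bar> powr (1 - a)) * energy1 p a (\<lambda>s. v (c + r * s))"
proof -
  have e: "(\<integral>\<^sup>+y. ennreal (\<bar>v x - v y\<bar> powr p / \<bar>x - y\<bar> powr (1 + a)) \<partial>lborel) = ennreal \<bar>r\<bar> *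
     (\<integral>\<^sup>+t. ennreal (\<bar>v x - v (c + r * t)\<bar> powr p / \<bar>x - (c + r * t)\<bar> powr (1 + a)) \<partial>lborel)" for x
    by (rule nn_integral_real_affine[OF _ r]) measurable
  have k: "ennreal (\<bar>v (c + r * s) - v (c + r * t)\<bar> powr p / \<bar>c + r * s - (c + r * t)\<bar> powr (1 + a)) =
     ennreal (\<bar>r\<bar> powr (- 1 - a)) * ennreal (\<bar>v (c + r * s) - v (c + r * t)\<bar> powr p / \<bar>s - t\<bar> powr (1 + a))" for s t
  proof -
    have "c + r * s - (c + r * t) = r * (s - t)" by (simp add: algebra_simps)
    moreover have "- 1 - a = - (1 + a)" by simp
    ultimately show ?thesis
      by (simp only: abs_mult powr_mult powr_minus_divide) (simp add: ennreal_mult'[symmetric])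
  qed
  have "energy1 p a v = ennreal \<bar>r\<bar> * (\<integral>\<^sup>+s. ennreal \<bar>r\<bar> *
     (\<integral>\<^sup>+t. ennreal (\<bar>v (c + r * s) - v (c + r * t)\<bar> powr p / \<bar>c + r * s - (c + r * t)\<bar> powr (1 + a)) \<partial>lborel) \<partial>lborel)"
    unfolding energy1_def e by (rule nn_integral_real_affine[OF _ r]) measurable
  also have "\<dots> = ennreal \<bar>r\<bar> * (ennreal \<bar>r\<bar> * (ennreal (\<bar>r\<bar> powr (- 1 - a)) * energy1 p a (\<lambda>s. v (c + r * s))))"
    unfolding k energy1_def by (simp add: nn_integral_cmult)
  also have "\<dots> = ennreal (\<bar>r\<bar> * (\<bar>r\<bar> * \<bar>r\<bar> powr (- 1 - a))) * energy1 p a (\<lambda>s. v (c + r * s))"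
    by (simp add: ennreal_mult' mult.assoc)
  also have "\<bar>r\<bar> * (\<bar>r\<bar> * \<bar>r\<bar> powr (- 1 - a)) = \<bar>r\<bar> powr (1 - a)"
    using r powr_mult_base[of "\<bar>r\<bar>" "- 1 - a"] powr_mult_base[of "\<bar>r\<bar>" "- a"] by simp
  finally show ?thesis .
qed

text \<open>The energy and the weighted integral scale by the same factor |r|^(1-a), so the constant
  is unchanged. Negative \<open>r\<close> serves the left half-lines.\<close>

lemma line_ineq_affine:
  fixes c r :: real
  assumes a: "0 < a" and base: "line_hardy p a I0 d" and r: "r \<noteq> 0"
    and dpos: "\<And>s. s \<in> I0 ==> 0 < d s" and d[measurable]: "d \<in> borel_measurable borel"
    and diff: "\<And>s q. s \<in> I0 ==> 0 < q ==> (s + q \<in> I0 \<and> s - q \<in> I0) \<longleftrightarrow> q < d s"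
    and I: "\<And>s. c + r * s \<in> I \<longleftrightarrow> s \<in> I0"
    and p: "0 < p" and I0[measurable]: "I0 \<in> sets borel"
  shows "line_ineq p a I"
  unfolding line_ineq_def
proof (intro ballI impI)
  fix v :: "real => real"
  assume v[measurable]: "v \<in> borel_measurable borel" and v0: "\<forall>x. x \<notin> I \<longrightarrow> v x = 0"
  let ?G = "\<integral>\<^sup>+x. ennreal (\<bar>v x\<bar> powr p) * gap a I x 1 \<partial>lborel"
  assume fin: "?G < \<infinity>"
  define v' where "v' s = v (c + r * s)" for s
  have v'[measurable]: "v' \<in> borel_measurable borel" unfolding v'_def[abs_def] by measurable
  let ?H = "\<integral>\<^sup>+x. ennreal (\<bar>v' x\<bar> powr p * d x powr (- a)) \<partial>lborel"
  have g: "gap a I (c + r * s) 1 = ennreal ((\<bar>r\<bar> * d s) powr (- a))" if s: "s \<in> I0" for s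
  proof (rule gap_eq[OF a])
    show "0 < \<bar>r\<bar> * d s" using r dpos[OF s] by simp
    fix q :: real assume q: "0 < q"
    have 1: "c + r * s + q = c + r * (s + q / r)" "c + r * s - q = c + r * (s - q / r)" using r by (auto simp: field_simps)
    have "(c + r * s + q \<in> I \<and> c + r * s - q \<in> I) \<longleftrightarrow> (s + q / \<bar>r\<bar> \<in> I0 \<and> s - q / \<bar>r\<bar> \<in> I0)"
      unfolding 1 I by (cases "0 < r") (auto simp: abs_if)
    also have "\<dots> \<longleftrightarrow> q / \<bar>r\<bar> < d s" using q r by (intro diff[OF s]) auto
    also have "\<dots> \<longleftrightarrow> q < \<bar>r\<bar> * d s" using r by (simp add: pos_divide_less_eq mult.commute)
    finally show "(c + r * s + q *\<^sub>R 1 \<in> I \<and> c + r * s - q *\<^sub>R 1 \<in> I) \<longleftrightarrow> q < \<bar>r\<bar> * d s" by simp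
  qed
  have rp: "0 < \<bar>r\<bar> powr (1 - a)" using r by simp
  have inv: "x = c + r * ((x - c) / r)" for x using r by simp
  define f where "f x = ennreal (\<bar>v x\<bar> powr p * (\<bar>r\<bar> * d ((x - c) / r)) powr (- a))" for x
  have [measurable]: "f \<in> borel_measurable borel" unfolding f_def[abs_def] by measurable
  have ff: "ennreal (\<bar>v x\<bar> powr p) * gap a I x 1 = f x" for x
  proof (cases "x \<in> I")
    case True
    then have "(x - c) / r \<in> I0" using I[of "(x - c) / r"] inv[of x] by simp
    from g[OF this] have "gap a I x 1 = ennreal ((\<bar>r\<bar> * d ((x - c) / r)) powr (- a))"
      unfolding inv[symmetric] .
    then show ?thesis by (simp add: f_def ennreal_mult')
  qed (use v0 p in \<open>simp add: f_def\<close>)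
  have "?G = ennreal \<bar>r\<bar> * (\<integral>\<^sup>+s. f (c + r * s) \<partial>lborel)"
    unfolding ff by (rule nn_integral_real_affine[OF _ r]) measurable
  also have "(\<integral>\<^sup>+s. f (c + r * s) \<partial>lborel) = (\<integral>\<^sup>+s. ennreal (\<bar>r\<bar> powr (- a)) * ennreal (\<bar>v' s\<bar> powr p * d s powr (- a)) \<partial>lborel)"
    using r by (intro nn_integral_cong) (simp add: f_def v'_def powr_mult ennreal_mult'[symmetric] mult_ac)
  also have "\<dots> = ennreal (\<bar>r\<bar> powr (- a)) * ?H" by (rule nn_integral_cmult) measurable
  also have "ennreal \<bar>r\<bar> * (ennreal (\<bar>r\<bar> powr (- a)) * ?H) = ennreal (\<bar>r\<bar> powr (1 - a)) * ?H"
    using r powr_mult_base[of "\<bar>r\<bar>" "- a"] by (simp add: mult.assoc[symmetric] ennreal_mult'[symmetric])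
  finally have GH: "?G = ennreal (\<bar>r\<bar> powr (1 - a)) * ?H" .
  have H: "?H < \<infinity>"
    using fin rp unfolding GH by (auto simp: ennreal_mult_less_top)
  have E: "energy1 p a v = ennreal (\<bar>r\<bar> powr (1 - a)) * energy1 p a v'"
    unfolding v'_def by (rule energy1_affine[OF v r])
  have "\<forall>x. x \<notin> I0 \<longrightarrow> v' x = 0" using v0 I by (auto simp: v'_def)
  then have b: "2 * (hC p a * ?H) <= energy1 p a v'" "energy1 p a v' = 2 * (hC p a * ?H) ==> ?H = 0"
    using base H v' unfolding line_hardy_def by blast+
  have eq: "2 * (hC p a * (ennreal (\<bar>r\<bar> powr (1 - a)) * ?H)) = ennreal (\<bar>r\<bar> powr (1 - a)) * (2 * (hC p a * ?H))"
    by (simp add: mult_ac)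
  show "2 * (hC p a * ?G) <= energy1 p a v \<and> (energy1 p a v = 2 * (hC p a * ?G) \<longrightarrow> ?G = 0)"
    unfolding GH E eq
  proof
    show "ennreal (\<bar>r\<bar> powr (1 - a)) * (2 * (hC p a * ?H)) <= ennreal (\<bar>r\<bar> powr (1 - a)) * energy1 p a v'"
      using b(1) by (rule mult_left_mono) simp
    show "ennreal (\<bar>r\<bar> powr (1 - a)) * energy1 p a v' = ennreal (\<bar>r\<bar> powr (1 - a)) * (2 * (hC p a * ?H)) \<longrightarrow>
      ennreal (\<bar>r\<bar> powr (1 - a)) * ?H = 0"
      using b(2) rp by (auto simp: ennreal_mult_cancel_left)
  qed
qed

lemma open_convex_real_cases:
  fixes I :: "real set"
  assumes "open I" "convex I"
  obtains "I = {}" | "I = UNIV" | c where "I = {c<..}" | c where "I = {..<c}"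
    | b c where "b < c" "I = {b<..<c}"
proof -
  have i: "interior I = I" using assms by (simp add: interior_open)
  have ii: "is_interval I" using assms by (simp add: is_interval_convex_1)
  consider "I = {}" | "I = UNIV" | b where "I = {..<b}" | b where "I = {..b}" | b where "I = {b<..}"
    | b where "I = {b..}" | b c where "I = {b<..<c}" | b c where "I = {b<..c}" | b c where "I = {b..<c}"
    | b c where "I = {b..c}"
    using is_real_interval[OF ii] by - (elim exE disjE, blast+)
  then show ?thesis
  proof cases
    case (4 b) show ?thesis by (rule that(4)[of b]) (use i 4 in simp)
  next
    case (6 b) show ?thesis by (rule that(3)[of b]) (use i 6 in simp)
  next
    case (7 b c) then show ?thesis using that(1) that(5)[of b c] by (cases "b < c") auto
  next
    case (8 b c)
    have "I = {b<..<c}" using i 8 by simp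
    then show ?thesis using that(1) that(5)[of b c] by (cases "b < c") auto
  next
    case (9 b c)
    have "I = {b<..<c}" using i 9 by simp
    then show ?thesis using that(1) that(5)[of b c] by (cases "b < c") auto
  next
    case (10 b c)
    have "I = {b<..<c}" using i 10 by simp
    then show ?thesis using that(1) that(5)[of b c] by (cases "b < c") auto
  qed (use that in auto)
qed

text \<open>Only the bounded case uses a >= 1 or p = 2. On the whole line the weight is 0, and on
  the empty set the function is 0.\<close>

lemma line_ineq_open_interval:
  assumes p: "1 < p" and a: "0 < a" "a < p" and I: "open I" "convex I"
    and bdd: "bounded I ==> 1 <= a \<or> p = 2"
  shows "line_ineq p a I"
  using I
proof (cases rule: open_convex_real_cases)
  case 1
  then show ?thesis using p by (auto simp: line_ineq_def)
next
  case 2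
  then show ?thesis by (auto simp: line_ineq_def gap_UNIV[OF a(1)])
next
  case (3 c)
  show ?thesis
    by (rule line_ineq_affine[OF a(1) line_hardy_halfline[OF p a], of 1 c]) (use 3 p in auto)
next
  case (4 c)
  show ?thesis
    by (rule line_ineq_affine[OF a(1) line_hardy_halfline[OF p a], of "-1" c]) (use 4 p in auto)
next
  case (5 b c)
  have lh: "line_hardy p a {0<..<1} end_dist"
  proof (cases "1 <= a")
    case True then show ?thesis by (rule line_hardy_interval_ge1[OF p _ a(2)])
  next
    case False then show ?thesis using bdd 5 line_hardy_interval_two[OF a(1)] by auto
  qed
  show ?thesis
  proof (rule line_ineq_affine[OF a(1) lh, of "c - b" b])
    fix s :: real
    show "b + (c - b) * s \<in> I \<longleftrightarrow> s \<in> {0<..<1}"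
    proof -
      have "b + (c - b) * s < c \<longleftrightarrow> (c - b) * s < (c - b) * 1" by (simp add: algebra_simps)
      also have "\<dots> \<longleftrightarrow> s < 1" using 5 by (subst mult_less_cancel_left_pos) auto
      finally show ?thesis using 5 by (auto simp: zero_less_mult_iff)
    qed
  qed (use 5 p in \<open>auto simp: end_dist_def\<close>)
qed

subsection \<open>Lebesgue measure: rotations, coordinates, rays\<close>

lemma nn_integral_lborel_translate:
  fixes f :: "'a::euclidean_space => ennreal"
  assumes [measurable]: "f \<in> borel_measurable borel"
  shows "(\<integral>\<^sup>+x. f (c + x) \<partial>lborel) = (\<integral>\<^sup>+x. f x \<partial>lborel)"
proof -
  have "(\<integral>\<^sup>+x. f x \<partial>lborel) = (\<integral>\<^sup>+x. f x \<partial>distr lborel borel ((+) c))" by (simp add: lborel_distr_plus)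
  also have "\<dots> = (\<integral>\<^sup>+x. f (c + x) \<partial>lborel)" by (subst nn_integral_distr) auto
  finally show ?thesis by simp
qed

lemma nn_integral_lborel_scale:
  fixes f :: "'a::euclidean_space => ennreal"
  assumes [measurable]: "f \<in> borel_measurable borel" and c: "c \<noteq> 0"
  shows "(\<integral>\<^sup>+x. f x \<partial>lborel) = ennreal (\<bar>c\<bar> ^ DIM('a)) * (\<integral>\<^sup>+x. f (c *\<^sub>R x) \<partial>lborel)"
  by (subst lborel_affine[OF c, of 0])
    (simp add: nn_integral_density nn_integral_distr nn_integral_cmult)

lemma nn_integral_lborel_uminus:
  fixes f :: "'a::euclidean_space => ennreal"
  assumes [measurable]: "f \<in> borel_measurable borel"
  shows "(\<integral>\<^sup>+x. f (- x) \<partial>lborel) = (\<integral>\<^sup>+x. f x \<partial>lborel)"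
  using nn_integral_lborel_scale[of f "-1"] by simp

text \<open>Uniqueness of Haar measure, in the form of Tonelli's theorem tested on a rotation invariant set.\<close>

lemma nn_integral_lborel_isometry:
  fixes f :: "'a::euclidean_space => ennreal" and R :: "'a => 'a"
  assumes f[measurable]: "f \<in> borel_measurable borel" and lin: "linear R"
    and iso: "\<And>x. norm (R x) = norm x" and inv: "\<And>x. R (R x) = x"
  shows "(\<integral>\<^sup>+x. f (R x) \<partial>lborel) = (\<integral>\<^sup>+x. f x \<partial>lborel)"
proof -
  have "continuous_on UNIV R" using lin by (simp add: linear_continuous_on linear_conv_bounded_linear)
  then have R[measurable]: "R \<in> borel_measurable borel" by (rule borel_measurable_continuous_onI)
  have lb: "R (x + y) = R x + R y" "R (x - y) = R x - R y" for x y
    using lin by (auto simp: linear_add linear_diff)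
  define B where "B x = (indicator (ball 0 1) x :: ennreal)" for x :: 'a
  have B[measurable]: "B \<in> borel_measurable borel" unfolding B_def[abs_def] by (intro borel_measurable_indicator) simp
  define m where "m = (\<integral>\<^sup>+x. B x \<partial>lborel)"
  have m: "m \<noteq> 0" "m \<noteq> \<infinity>"
    using content_ball_pos[of 1 "0::'a"] emeasure_lborel_ball_finite[of "0::'a" 1]
    by (auto simp: m_def B_def measure_def)
  have t: "(\<integral>\<^sup>+x. f (R (R y + x)) \<partial>lborel) = (\<integral>\<^sup>+x. f (R x) \<partial>lborel)" for y
    by (rule nn_integral_lborel_translate[of "\<lambda>x. f (R x)"]) measurable
  have "m * (\<integral>\<^sup>+x. f (R x) \<partial>lborel) = (\<integral>\<^sup>+y. B y * (\<integral>\<^sup>+x. f (R (R y + x)) \<partial>lborel) \<partial>lborel)"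
    unfolding m_def t by (simp add: nn_integral_multc)
  also have "\<dots> = (\<integral>\<^sup>+y. (\<integral>\<^sup>+x. B y * f (R x + y) \<partial>lborel) \<partial>lborel)"
    by (simp add: nn_integral_cmult lb inv add.commute)
  also have "\<dots> = (\<integral>\<^sup>+x. (\<integral>\<^sup>+y. B y * f (R x + y) \<partial>lborel) \<partial>lborel)"
    by (rule lborel_pair.Fubini') measurable
  also have "\<dots> = (\<integral>\<^sup>+x. (\<integral>\<^sup>+y. B (y - R x) * f y \<partial>lborel) \<partial>lborel)"
  proof (rule nn_integral_cong)
    fix x
    show "(\<integral>\<^sup>+y. B y * f (R x + y) \<partial>lborel) = (\<integral>\<^sup>+y. B (y - R x) * f y \<partial>lborel)"
      using nn_integral_lborel_translate[of "\<lambda>y. B (y - R x) * f y" "R x"] by simp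
  qed
  also have "\<dots> = (\<integral>\<^sup>+y. (\<integral>\<^sup>+x. B (y - R x) * f y \<partial>lborel) \<partial>lborel)"
    by (rule lborel_pair.Fubini') measurable
  also have "\<dots> = (\<integral>\<^sup>+y. m * f y \<partial>lborel)"
  proof (rule nn_integral_cong)
    fix y
    \<comment> \<open>An isometric involution satisfies |y - R x| = |R y - x|, so the inner integral
      runs over a translate of the unit ball.\<close>
    have "B (y - R x) = B (- R y + x)" for x
    proof -
      have "norm (y - R x) = norm (R (R y - x))" by (simp add: lb inv)
      also have "\<dots> = norm (- R y + x)" by (simp add: iso norm_minus_commute)
      finally show ?thesis by (simp add: B_def indicator_def)
    qed
    then have "(\<integral>\<^sup>+x. B (y - R x) * f y \<partial>lborel) = (\<integral>\<^sup>+x. B (- R y + x) * f y \<partial>lborel)" by simp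
    also have "\<dots> = (\<integral>\<^sup>+x. B (- R y + x) \<partial>lborel) * f y" by (rule nn_integral_multc) measurable
    also have "\<dots> = m * f y" using nn_integral_lborel_translate[OF B, of "- R y"] by (simp only: m_def)
    finally show "(\<integral>\<^sup>+x. B (y - R x) * f y \<partial>lborel) = m * f y" .
  qed
  also have "\<dots> = m * (\<integral>\<^sup>+x. f x \<partial>lborel)" by (rule nn_integral_cmult) measurable
  finally show ?thesis using m by (simp add: ennreal_mult_cancel_left)
qed

text \<open>Householder reflection; for \<open>n = b\<close> the quotient is \<open>0 / 0 = 0\<close> and the map is the identity.\<close>

definition reflect :: "'a::euclidean_space => 'a => 'a => 'a" where
  "reflect n b x = x - (2 * (x \<bullet> (n - b)) / ((n - b) \<bullet> (n - b))) *\<^sub>R (n - b)"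

lemma reflect:
  fixes n b :: "'a::euclidean_space"
  assumes "norm n = 1" "norm b = 1"
  shows "linear (reflect n b)" "norm (reflect n b x) = norm x" "reflect n b (reflect n b x) = x"
    "reflect n b b = n" "reflect n b n = b" "reflect n b x \<bullet> reflect n b y = x \<bullet> y"
proof -
  define u where "u = n - b"
  define c where "c = 2 / (u \<bullet> u)"
  have r: "reflect n b x = x - (c * (x \<bullet> u)) *\<^sub>R u" for x by (simp add: reflect_def u_def c_def)
  show lin: "linear (reflect n b)"
    by (rule linearI) (simp_all add: r inner_left_distrib algebra_simps)
  \<comment> \<open>Also true for u = 0, where c = 2 / 0 = 0.\<close>
  have cu: "c * (c * (u \<bullet> u)) = 2 * c" by (cases "u = 0") (auto simp: c_def)
  show i: "reflect n b x \<bullet> reflect n b y = x \<bullet> y" for x y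
  proof -
    have "reflect n b x \<bullet> reflect n b y = x \<bullet> y - 2 * c * ((x \<bullet> u) * (y \<bullet> u)) + c * (c * (u \<bullet> u)) * ((x \<bullet> u) * (y \<bullet> u))"
      by (simp add: r inner_diff_left inner_diff_right inner_commute algebra_simps)
    then show ?thesis unfolding cu by simp
  qed
  show "norm (reflect n b x) = norm x" by (simp add: norm_eq_sqrt_inner i)
  show rr: "reflect n b (reflect n b x) = x" for x
  proof -
    define k where "k = c * (x \<bullet> u)"
    define l where "l = c * ((x - k *\<^sub>R u) \<bullet> u)"
    have "l = k - c * (c * (u \<bullet> u)) * (x \<bullet> u)" by (simp add: l_def k_def inner_diff_left algebra_simps)
    then have "k + l = 0" unfolding cu by (simp add: k_def)
    have "reflect n b (reflect n b x) = x - k *\<^sub>R u - l *\<^sub>R u" by (simp add: r k_def l_def)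
    also have "\<dots> = x - (k + l) *\<^sub>R u" by (simp add: scaleR_add_left)
    finally show ?thesis using \<open>k + l = 0\<close> by simp
  qed
  show b: "reflect n b b = n"
  proof (cases "u = 0")
    case False
    have "b \<bullet> u = - (u \<bullet> u) / 2"
      using assms by (simp add: u_def inner_diff_left inner_diff_right inner_commute norm_eq_1)
    then have "c * (b \<bullet> u) = -1" using False by (simp add: c_def)
    then show ?thesis by (simp add: r u_def)
  qed (simp add: reflect_def u_def)
  show "reflect n b n = b" using rr[of b] b by simp
qed

text \<open>Lebesgue measure of the hyperplane orthogonal to the basis vector \<open>b\<close>,
  pushed forward to the whole space. In dimension one the index set is empty and this is the unit
  mass at 0, so the formulas for slices cover that case as well.\<close>

definition orth :: "'a::euclidean_space => 'a measure" where
  "orth b = distr (\<Pi>\<^sub>M i\<in>Basis - {b}. lborel) borel (\<lambda>f. \<Sum>i\<in>Basis - {b}. f i *\<^sub>R i)"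

lemma sets_orth[measurable_cong, simp]: "sets (orth b) = sets borel"
  by (simp add: orth_def)

lemma space_orth[simp]: "space (orth b) = UNIV"
  by (simp add: orth_def)

lemma orth_embedding_measurable[measurable]:
  "(\<lambda>f. \<Sum>i\<in>Basis - {b}. f i *\<^sub>R (i :: 'a::euclidean_space)) \<in> (\<Pi>\<^sub>M i\<in>Basis - {b}. lborel) \<rightarrow>\<^sub>M borel"
  by measurable

lemma AE_orth: "AE z in orth (b :: 'a::euclidean_space). b \<in> Basis \<longrightarrow> z \<bullet> b = 0"
  unfolding orth_def
  by (subst AE_distr_iff) (auto simp: inner_sum_left inner_Basis intro!: AE_I2 sum.neutral)

lemma norm_orth_embedding:
  assumes "b \<in> Basis"
  shows "norm (\<Sum>i\<in>Basis - {b}. f i *\<^sub>R (i :: 'a::euclidean_space)) = sqrt (\<Sum>i\<in>Basis - {b}. (f i)\<^sup>2)"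
proof -
  let ?z = "\<Sum>i\<in>Basis - {b}. f i *\<^sub>R (i :: 'a)"
  have c: "?z \<bullet> j = (if j = b then 0 else f j)" if "j \<in> Basis" for j
  proof -
    have "?z \<bullet> j = (\<Sum>i\<in>Basis - {b}. if i = j then f j else 0)"
      unfolding inner_sum_left using that by (intro sum.cong) (auto simp: inner_Basis)
    then show ?thesis using that by simp
  qed
  have "norm ?z = sqrt (\<Sum>j\<in>Basis. (?z \<bullet> j)\<^sup>2)" by (simp add: norm_eq_sqrt_inner euclidean_inner[of ?z ?z] power2_eq_square)
  also have "(\<Sum>j\<in>Basis. (?z \<bullet> j)\<^sup>2) = (\<Sum>j\<in>Basis - {b}. (?z \<bullet> j)\<^sup>2)"
    using assms c by (intro sum.mono_neutral_right) auto
  also have "\<dots> = (\<Sum>j\<in>Basis - {b}. (f j)\<^sup>2)" using c by (intro sum.cong) auto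
  finally show ?thesis .
qed

lemma emeasure_orth_cball:
  fixes b :: "'a::euclidean_space"
  assumes b: "b \<in> Basis" and r: "0 < r"
  shows "emeasure (orth b) (cball 0 r) = ennreal (unit_ball_vol (real (DIM('a) - 1)) * r ^ (DIM('a) - 1))"
proof -
  let ?M = "\<Pi>\<^sub>M i\<in>Basis - {b}. (lborel :: real measure)"
  have "emeasure (orth b) (cball 0 r) = emeasure ?M ((\<lambda>f. \<Sum>i\<in>Basis - {b}. f i *\<^sub>R i) -` cball 0 r \<inter> space ?M)"
    unfolding orth_def by (subst emeasure_distr) auto
  also have "(\<lambda>f. \<Sum>i\<in>Basis - {b}. f i *\<^sub>R i) -` cball 0 r \<inter> space ?M =
     {f. sqrt (\<Sum>i\<in>Basis - {b}. (f i)\<^sup>2) <= r} \<inter> space ?M"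
    by (auto simp: norm_orth_embedding[OF b])
  also have "emeasure ?M \<dots> = ennreal (unit_ball_vol (real (card (Basis - {b}))) * r ^ card (Basis - {b}))"
    using r by (intro emeasure_cball_aux) auto
  finally show ?thesis using b by simp
qed

lemma sigma_finite_orth:
  fixes b :: "'a::euclidean_space"
  assumes b: "b \<in> Basis"
  shows "sigma_finite_measure (orth b)"
proof
  show "\<exists>A. countable A \<and> A \<subseteq> sets (orth b) \<and> \<Union> A = space (orth b) \<and> (\<forall>a\<in>A. emeasure (orth b) a \<noteq> \<infinity>)"
  proof (intro exI[of _ "range (\<lambda>n::nat. cball 0 (real n + 1))"] conjI ballI)
    show "\<Union> (range (\<lambda>n::nat. cball 0 (real n + 1))) = space (orth b)"
    proof -
      have "\<exists>n::nat. norm x <= real n + 1" for x :: 'a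
        using real_arch_simple[of "norm x"] by (meson add_increasing2 zero_le_one)
      then show ?thesis by auto
    qed
    fix a assume "a \<in> range (\<lambda>n::nat. cball (0::'a) (real n + 1))"
    then show "emeasure (orth b) a \<noteq> \<infinity>" by (auto simp: emeasure_orth_cball[OF b])
  qed auto
qed

lemma nn_integral_lborel_orth:
  fixes F :: "'a::euclidean_space => ennreal"
  assumes [measurable]: "F \<in> borel_measurable borel" and b: "b \<in> Basis"
  shows "(\<integral>\<^sup>+x. F x \<partial>lborel) = (\<integral>\<^sup>+z. (\<integral>\<^sup>+r. F (z + r *\<^sub>R b) \<partial>lborel) \<partial>orth b)"
proof -
  interpret product_sigma_finite "\<lambda>_. lborel :: real measure" ..
  have ins: "insert b (Basis - {b}) = Basis" using b by auto
  let ?e = "\<lambda>f. \<Sum>i\<in>Basis. f i *\<^sub>R (i::'a)"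
  have m: "(\<lambda>f. F (?e f)) \<in> borel_measurable (Pi\<^sub>M (insert b (Basis - {b})) (\<lambda>_. lborel))"
    unfolding ins by measurable
  have "(\<integral>\<^sup>+x. F x \<partial>lborel) = (\<integral>\<^sup>+f. F (?e f) \<partial>(\<Pi>\<^sub>M i\<in>Basis. lborel))"
    by (subst lborel_eq) (simp add: nn_integral_distr)
  also have "\<dots> = (\<integral>\<^sup>+f. (\<integral>\<^sup>+r. F (?e (f(b := r))) \<partial>lborel) \<partial>(\<Pi>\<^sub>M i\<in>Basis - {b}. lborel))"
    using product_nn_integral_insert[OF _ _ m] unfolding ins by simp
  also have "\<dots> = (\<integral>\<^sup>+f. (\<integral>\<^sup>+r. F ((\<Sum>i\<in>Basis - {b}. f i *\<^sub>R i) + r *\<^sub>R b) \<partial>lborel) \<partial>(\<Pi>\<^sub>M i\<in>Basis - {b}. lborel))"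
  proof -
    have "?e (f(b := r)) = (\<Sum>i\<in>Basis - {b}. f i *\<^sub>R i) + r *\<^sub>R b" for f r
      by (subst sum.remove[OF _ b]) (auto intro!: sum.cong simp: add.commute)
    then show ?thesis by simp
  qed
  also have "\<dots> = (\<integral>\<^sup>+z. (\<integral>\<^sup>+r. F (z + r *\<^sub>R b) \<partial>lborel) \<partial>orth b)"
    unfolding orth_def by (subst nn_integral_distr) auto
  finally show ?thesis .
qed

text \<open>The reflection that takes \<open>b\<close> to the direction of \<open>h\<close> turns
  the splitting along \<open>b\<close> into one along \<open>h\<close>; measuring the line in
  multiples of \<open>h\<close> costs the factor norm h.\<close>

lemma nn_integral_lborel_lines:
  fixes F :: "'a::euclidean_space => ennreal"
  assumes [measurable]: "F \<in> borel_measurable borel" and b: "b \<in> Basis" and h: "h \<noteq> 0"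
  shows "(\<integral>\<^sup>+x. F x \<partial>lborel) =
    ennreal (norm h) * (\<integral>\<^sup>+z. (\<integral>\<^sup>+t. F (reflect (h /\<^sub>R norm h) b z + t *\<^sub>R h) \<partial>lborel) \<partial>orth b)"
proof -
  define n where "n = h /\<^sub>R norm h"
  have n: "norm n = 1" using h by (simp add: n_def)
  have bn: "norm b = 1" using b by simp
  note R = reflect[OF n bn]
  have "continuous_on UNIV (reflect n b)" using R(1) by (simp add: linear_continuous_on linear_conv_bounded_linear)
  then have [measurable]: "reflect n b \<in> borel_measurable borel" by (rule borel_measurable_continuous_onI)
  have "(\<integral>\<^sup>+x. F x \<partial>lborel) = (\<integral>\<^sup>+x. F (reflect n b x) \<partial>lborel)"
    by (rule nn_integral_lborel_isometry[symmetric]) (use R in auto)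
  also have "\<dots> = (\<integral>\<^sup>+z. (\<integral>\<^sup>+r. F (reflect n b (z + r *\<^sub>R b)) \<partial>lborel) \<partial>orth b)"
    by (rule nn_integral_lborel_orth[OF _ b]) measurable
  also have "\<dots> = (\<integral>\<^sup>+z. ennreal (norm h) * (\<integral>\<^sup>+t. F (reflect n b z + t *\<^sub>R h) \<partial>lborel) \<partial>orth b)"
  proof (rule nn_integral_cong)
    fix z
    have e: "reflect n b (z + r *\<^sub>R b) = reflect n b z + r *\<^sub>R n" for r
      using R(1,4) by (simp add: linear_add linear_scale)
    have "(\<integral>\<^sup>+r. F (reflect n b (z + r *\<^sub>R b)) \<partial>lborel) = (\<integral>\<^sup>+r. F (reflect n b z + r *\<^sub>R n) \<partial>lborel)"
      unfolding e ..
    also have "\<dots> = ennreal \<bar>norm h\<bar> * (\<integral>\<^sup>+t. F (reflect n b z + (0 + norm h * t) *\<^sub>R n) \<partial>lborel)"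
      using h by (intro nn_integral_real_affine) auto
    also have "(\<lambda>t. (0 + norm h * t) *\<^sub>R n) = (\<lambda>t. t *\<^sub>R h)"
      using h by (simp add: n_def field_simps)
    finally show "(\<integral>\<^sup>+r. F (reflect n b (z + r *\<^sub>R b)) \<partial>lborel) = ennreal (norm h) * (\<integral>\<^sup>+t. F (reflect n b z + t *\<^sub>R h) \<partial>lborel)"
      by (simp add: fun_eq_iff)
  qed
  also have "\<dots> = ennreal (norm h) * (\<integral>\<^sup>+z. (\<integral>\<^sup>+t. F (reflect n b z + t *\<^sub>R h) \<partial>lborel) \<partial>orth b)"
    by (rule nn_integral_cmult) measurable
  finally show ?thesis by (simp add: n_def)
qed

text \<open>Polar coordinates are replaced by an average over the rays through the shell
  \<open>1 <= norm h <= 2\<close>, which only needs the scaling of Lebesgue measure.\<close>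

definition shell :: "'a::euclidean_space set" where
  "shell = {h. 1 <= norm h \<and> norm h <= 2}"

lemma shell_measurable[measurable]: "shell \<in> sets borel"
  unfolding shell_def by measurable

text \<open>The integral of \<tau>^(-1-a-N) over the interval from 1/2 to 1.\<close>

definition shell_const :: "nat => real => real" where
  "shell_const N a = (2 powr (real N + a) - 1) / (real N + a)"

lemma shell_const_pos: "0 < a ==> 0 < shell_const N a"
  by (simp add: shell_const_def)

text \<open>A nonzero point k has the form \<tau> h with h in the shell exactly for \<tau> between
  norm k / 2 and norm k. After the substitution h = k / \<tau> the integral over \<tau> yields norm
  k^(-N-a) times a constant. The N-dimensional kernel is thus an average of one-dimensional kernels
  along rays.\<close>

lemma nn_integral_rays:
  fixes G :: "'a::euclidean_space => ennreal"
  assumes [measurable]: "G \<in> borel_measurable borel" and a: "0 < a"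
  shows "(\<integral>\<^sup>+h\<in>shell. (\<integral>\<^sup>+\<tau>\<in>{0<..}. (G (\<tau> *\<^sub>R h) * ennreal (1 / \<tau> powr (1 + a))) \<partial>lborel) \<partial>lborel) =
    ennreal (shell_const DIM('a) a) * (\<integral>\<^sup>+k. G k * ennreal (1 / norm k powr (real DIM('a) + a)) \<partial>lborel)"
proof -
  let ?N = "real DIM('a)"
  have s: "(\<integral>\<^sup>+h. indicator shell h * G (\<tau> *\<^sub>R h) \<partial>lborel) =
     ennreal (1 / \<tau> ^ DIM('a)) * (\<integral>\<^sup>+k. indicator shell (k /\<^sub>R \<tau>) * G k \<partial>lborel)" if \<tau>: "0 < \<tau>" for \<tau>
  proof -
    have "(\<integral>\<^sup>+k. indicator shell (k /\<^sub>R \<tau>) * G k \<partial>lborel) = ennreal (\<tau> ^ DIM('a)) * (\<integral>\<^sup>+h. indicator shell h * G (\<tau> *\<^sub>R h) \<partial>lborel)"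
      using \<tau> by (subst nn_integral_lborel_scale[of _ \<tau>]) auto
    then show ?thesis using \<tau> by (simp add: mult.assoc[symmetric] ennreal_mult'[symmetric])
  qed
  have inner: "(\<integral>\<^sup>+\<tau>\<in>{0<..}. (ennreal (1 / \<tau> powr (1 + a)) * (ennreal (1 / \<tau> ^ DIM('a)) * indicator shell (k /\<^sub>R \<tau>))) \<partial>lborel) =
     ennreal (shell_const DIM('a) a) * ennreal (1 / norm k powr (?N + a))" if k: "k \<noteq> 0" for k :: 'a
  proof -
    define l where "l = norm k / 2"
    have l: "0 < l" "norm k = 2 * l" using k by (auto simp: l_def)
    have "(\<integral>\<^sup>+\<tau>\<in>{0<..}. (ennreal (1 / \<tau> powr (1 + a)) * (ennreal (1 / \<tau> ^ DIM('a)) * indicator shell (k /\<^sub>R \<tau>))) \<partial>lborel) =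
      (\<integral>\<^sup>+\<tau>. ennreal (1 / \<tau> powr (1 + a + ?N)) * indicator {l..2 * l} \<tau> \<partial>lborel)"
    proof (rule nn_integral_cong)
      fix \<tau> :: real
      show "ennreal (1 / \<tau> powr (1 + a)) * (ennreal (1 / \<tau> ^ DIM('a)) * indicator shell (k /\<^sub>R \<tau>)) * indicator {0<..} \<tau> =
        ennreal (1 / \<tau> powr (1 + a + ?N)) * indicator {l..2 * l} \<tau>"
      proof (cases "0 < \<tau>")
        case True
        then have "k /\<^sub>R \<tau> \<in> shell \<longleftrightarrow> \<tau> \<in> {l..2 * l}"
          by (auto simp: shell_def l(2) field_simps)
        then show ?thesis using True
          by (simp add: indicator_def ennreal_mult'[symmetric] powr_add powr_realpow)
      next
        case False then show ?thesis using l by (auto simp: indicator_def)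
      qed
    qed
    also have "\<dots> = ennreal (- ((2 * l) powr (- (a + ?N)) / (a + ?N)) - - (l powr (- (a + ?N)) / (a + ?N)))"
    proof (rule nn_integral_FTC_Icc)
      fix t assume "t \<in> {l..2 * l}"
      then have t: "0 < t" using l by auto
      have "((\<lambda>t. - (t powr (- c) / c)) has_real_derivative t powr (- c - 1)) (at t)" if "0 < c" for c
        using t that by (auto intro!: derivative_eq_intros)
      from this[of "a + ?N"]
      have "((\<lambda>t. - (t powr (- (a + ?N)) / (a + ?N))) has_real_derivative t powr (- (a + ?N) - 1)) (at t)"
        using a by simp
      moreover have "- (a + ?N) - 1 = - (1 + a + ?N)" by simp
      then have "t powr (- (a + ?N) - 1) = 1 / t powr (1 + a + ?N)"
        by (simp only: powr_minus_divide)
      ultimately show "((\<lambda>t. - (t powr (- (a + ?N)) / (a + ?N))) has_real_derivative 1 / t powr (1 + a + ?N)) (at t)"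
        by simp
    qed (use l in auto)
    also have "- ((2 * l) powr (- (a + ?N)) / (a + ?N)) - - (l powr (- (a + ?N)) / (a + ?N)) =
       shell_const DIM('a) a * (1 / norm k powr (?N + a))"
    proof -
      have "l powr (- (a + ?N)) = 2 powr (?N + a) * (2 * l) powr (- (a + ?N))"
        by (simp only: powr_mult powr_minus_divide) (simp add: add.commute)
      moreover have "(2 * l) powr (- (a + ?N)) = 1 / norm k powr (?N + a)"
        by (simp only: powr_minus_divide l(2) add.commute)
      ultimately show ?thesis
        by (simp add: shell_const_def diff_divide_distrib algebra_simps)
    qed
    also have "ennreal \<dots> = ennreal (shell_const DIM('a) a) * ennreal (1 / norm k powr (?N + a))"
      using shell_const_pos[OF a, of "DIM('a)"] by (intro ennreal_mult') simp
    finally show ?thesis .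
  qed
  have "(\<integral>\<^sup>+h\<in>shell. (\<integral>\<^sup>+\<tau>\<in>{0<..}. (G (\<tau> *\<^sub>R h) * ennreal (1 / \<tau> powr (1 + a))) \<partial>lborel) \<partial>lborel) =
    (\<integral>\<^sup>+h. (\<integral>\<^sup>+\<tau>. ennreal (1 / \<tau> powr (1 + a)) * indicator {0<..} \<tau> * (indicator shell h * G (\<tau> *\<^sub>R h)) \<partial>lborel) \<partial>lborel)"
  proof (rule nn_integral_cong)
    fix h :: 'a
    show "(\<integral>\<^sup>+\<tau>\<in>{0<..}. (G (\<tau> *\<^sub>R h) * ennreal (1 / \<tau> powr (1 + a))) \<partial>lborel) * indicator shell h =
      (\<integral>\<^sup>+\<tau>. ennreal (1 / \<tau> powr (1 + a)) * indicator {0<..} \<tau> * (indicator shell h * G (\<tau> *\<^sub>R h)) \<partial>lborel)"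
      by (subst nn_integral_multc[symmetric]) (auto intro!: nn_integral_cong simp: mult_ac)
  qed
  also have "\<dots> = (\<integral>\<^sup>+\<tau>. (\<integral>\<^sup>+h. ennreal (1 / \<tau> powr (1 + a)) * indicator {0<..} \<tau> * (indicator shell h * G (\<tau> *\<^sub>R h)) \<partial>lborel) \<partial>lborel)"
    by (rule lborel_pair.Fubini') measurable
  also have "\<dots> = (\<integral>\<^sup>+\<tau>. (\<integral>\<^sup>+k. ennreal (1 / \<tau> powr (1 + a)) * (ennreal (1 / \<tau> ^ DIM('a)) * indicator shell (k /\<^sub>R \<tau>)) * indicator {0<..} \<tau> * G k \<partial>lborel) \<partial>lborel)"
  proof (rule nn_integral_cong)
    fix \<tau> :: real
    show "(\<integral>\<^sup>+h. ennreal (1 / \<tau> powr (1 + a)) * indicator {0<..} \<tau> * (indicator shell h * G (\<tau> *\<^sub>R h)) \<partial>lborel) =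
      (\<integral>\<^sup>+k. ennreal (1 / \<tau> powr (1 + a)) * (ennreal (1 / \<tau> ^ DIM('a)) * indicator shell (k /\<^sub>R \<tau>)) * indicator {0<..} \<tau> * G k \<partial>lborel)"
    proof (cases "0 < \<tau>")
      case True
      then show ?thesis by (simp add: nn_integral_cmult s mult.assoc)
    qed simp
  qed
  also have "\<dots> = (\<integral>\<^sup>+k. (\<integral>\<^sup>+\<tau>. ennreal (1 / \<tau> powr (1 + a)) * (ennreal (1 / \<tau> ^ DIM('a)) * indicator shell (k /\<^sub>R \<tau>)) * indicator {0<..} \<tau> * G k \<partial>lborel) \<partial>lborel)"
    by (rule lborel_pair.Fubini') measurable
  also have "\<dots> = (\<integral>\<^sup>+k. ennreal (shell_const DIM('a) a) * (G k * ennreal (1 / norm k powr (?N + a))) \<partial>lborel)"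
  proof (rule nn_integral_cong_AE)
    have "AE k in lborel. k \<noteq> (0 :: 'a)" by (rule AE_lborel_singleton)
    then show "AE k in lborel. (\<integral>\<^sup>+\<tau>. ennreal (1 / \<tau> powr (1 + a)) * (ennreal (1 / \<tau> ^ DIM('a)) * indicator shell (k /\<^sub>R \<tau>)) * indicator {0<..} \<tau> * G k \<partial>lborel) =
       ennreal (shell_const DIM('a) a) * (G k * ennreal (1 / norm k powr (?N + a)))"
    proof eventually_elim
      fix k :: 'a assume k: "k \<noteq> 0"
      show "(\<integral>\<^sup>+\<tau>. ennreal (1 / \<tau> powr (1 + a)) * (ennreal (1 / \<tau> ^ DIM('a)) * indicator shell (k /\<^sub>R \<tau>)) * indicator {0<..} \<tau> * G k \<partial>lborel) =
       ennreal (shell_const DIM('a) a) * (G k * ennreal (1 / norm k powr (?N + a)))"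
      proof -
        have "(\<integral>\<^sup>+\<tau>. ennreal (1 / \<tau> powr (1 + a)) * (ennreal (1 / \<tau> ^ DIM('a)) * indicator shell (k /\<^sub>R \<tau>)) * indicator {0<..} \<tau> * G k \<partial>lborel) =
          (\<integral>\<^sup>+\<tau>\<in>{0<..}. (ennreal (1 / \<tau> powr (1 + a)) * (ennreal (1 / \<tau> ^ DIM('a)) * indicator shell (k /\<^sub>R \<tau>))) \<partial>lborel) * G k"
          by (rule nn_integral_multc) measurable
        then show ?thesis unfolding inner[OF k] by (simp only: mult_ac)
      qed
    qed
  qed
  also have "\<dots> = ennreal (shell_const DIM('a) a) * (\<integral>\<^sup>+k. G k * ennreal (1 / norm k powr (?N + a)) \<partial>lborel)"
    by (rule nn_integral_cmult) measurable
  finally show ?thesis .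
qed

subsection \<open>Integrating the kernel over hyperplanes\<close>

text \<open>\<open>dim_const\<close> as a nonnegative integral, which can be handled before its
  finiteness is known.\<close>

definition slice_const :: "nat => real => ennreal" where
  "slice_const N a = (if N = 1 then 1 else (\<integral>\<^sup>+t\<in>{0<..}.
     ennreal (real (N - 1) * unit_ball_vol (real (N - 1)) * (t ^ (N - 2) * (1 + t\<^sup>2) powr (- (real N + a) / 2))) \<partial>lborel))"

text \<open>The integrand is minus the derivative of (r^2 + \<sigma>^2)^(-q). In this form the
  kernel can be integrated over a hyperplane from the volumes of balls alone.\<close>

lemma layer_cake_kernel:
  fixes q r s :: real
  assumes q: "0 < q" and rs: "0 <= s" "0 < r"
  shows "(\<integral>\<^sup>+\<sigma>\<in>{s..}. ennreal (2 * q * \<sigma> * (r\<^sup>2 + \<sigma>\<^sup>2) powr (- q - 1)) \<partial>lborel) = ennreal ((r\<^sup>2 + s\<^sup>2) powr (- q))"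
proof -
  have lim: "((\<lambda>\<sigma>. - ((r\<^sup>2 + \<sigma>\<^sup>2) powr (- q))) \<longlongrightarrow> - 0) at_top"
    using q by (intro tendsto_minus tendsto_neg_powr filterlim_tendsto_add_at_top[OF tendsto_const]
        filterlim_pow_at_top filterlim_ident) auto
  have "(\<integral>\<^sup>+\<sigma>\<in>{s..}. ennreal (2 * q * \<sigma> * (r\<^sup>2 + \<sigma>\<^sup>2) powr (- q - 1)) \<partial>lborel) =
     ennreal (- 0 - - ((r\<^sup>2 + s\<^sup>2) powr (- q)))"
  proof (rule nn_integral_FTC_atLeast[OF _ _ _ lim])
    fix t assume t: "s <= t"
    have pos: "0 < r\<^sup>2 + t\<^sup>2" using rs by (simp add: add_pos_nonneg)
    show "((\<lambda>\<sigma>. - ((r\<^sup>2 + \<sigma>\<^sup>2) powr (- q))) has_real_derivative 2 * q * t * (r\<^sup>2 + t\<^sup>2) powr (- q - 1)) (at t)"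
      using pos by (auto intro!: derivative_eq_intros)
    show "0 <= 2 * q * t * (r\<^sup>2 + t\<^sup>2) powr (- q - 1)" using t rs q by simp
  qed auto
  then show ?thesis by simp
qed

lemma nn_integral_orth_radial:
  fixes b :: "'a::euclidean_space"
  assumes b: "b \<in> Basis" and q: "0 < q" and r: "0 < r"
  shows "(\<integral>\<^sup>+z. ennreal ((r\<^sup>2 + (norm z)\<^sup>2) powr (- q)) \<partial>orth b) =
    (\<integral>\<^sup>+\<sigma>\<in>{0<..}. (ennreal (2 * q * \<sigma> * (r\<^sup>2 + \<sigma>\<^sup>2) powr (- q - 1)) *
       ennreal (unit_ball_vol (real (DIM('a) - 1)) * \<sigma> ^ (DIM('a) - 1))) \<partial>lborel)"
proof -
  interpret sigma_finite_measure "orth b" by (rule sigma_finite_orth[OF b])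
  interpret P: pair_sigma_finite "orth b" "lborel :: real measure" ..
  let ?f = "\<lambda>\<sigma>. ennreal (2 * q * \<sigma> * (r\<^sup>2 + \<sigma>\<^sup>2) powr (- q - 1))"
  have AE: "AE \<sigma>::real in lborel. \<sigma> \<noteq> 0" by (rule AE_lborel_singleton)
  have "(\<integral>\<^sup>+z. ennreal ((r\<^sup>2 + (norm z)\<^sup>2) powr (- q)) \<partial>orth b) =
     (\<integral>\<^sup>+z. (\<integral>\<^sup>+\<sigma>. ?f \<sigma> * indicator {norm z..} \<sigma> \<partial>lborel) \<partial>orth b)"
    using layer_cake_kernel[OF q _ r] by simp
  also have "\<dots> = (\<integral>\<^sup>+\<sigma>. (\<integral>\<^sup>+z. ?f \<sigma> * indicator {norm z..} \<sigma> \<partial>orth b) \<partial>lborel)"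
    unfolding indicator_def atLeast_iff by (rule P.Fubini'[symmetric]) measurable
  also have "\<dots> = (\<integral>\<^sup>+\<sigma>\<in>{0<..}. (?f \<sigma> * ennreal (unit_ball_vol (real (DIM('a) - 1)) * \<sigma> ^ (DIM('a) - 1))) \<partial>lborel)"
  proof (rule nn_integral_cong_AE, use AE in eventually_elim)
    fix \<sigma> :: real assume s0: "\<sigma> \<noteq> 0"
    have ind: "indicator {norm z..} \<sigma> = (indicator (cball 0 \<sigma>) z :: ennreal)" for z :: 'a
      by (auto simp: indicator_def)
    have "(\<integral>\<^sup>+z. ?f \<sigma> * indicator {norm z..} \<sigma> \<partial>orth b) = ?f \<sigma> * emeasure (orth b) (cball 0 \<sigma>)"
      unfolding ind by (subst nn_integral_cmult_indicator) auto
    also have "\<dots> = (?f \<sigma> * ennreal (unit_ball_vol (real (DIM('a) - 1)) * \<sigma> ^ (DIM('a) - 1))) * indicator {0<..} \<sigma>"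
      using s0 by (cases "0 < \<sigma>") (auto simp: emeasure_orth_cball[OF b])
    finally show "(\<integral>\<^sup>+z. ?f \<sigma> * indicator {norm z..} \<sigma> \<partial>orth b) =
      (?f \<sigma> * ennreal (unit_ball_vol (real (DIM('a) - 1)) * \<sigma> ^ (DIM('a) - 1))) * indicator {0<..} \<sigma>" .
  qed
  finally show ?thesis .
qed

text \<open>Integration by parts in the form of Tonelli's theorem: V \<sigma>^(m+1) is the integral
  of its derivative over 0 < t <= \<sigma>, and exchanging the order restores the kernel from its
  layers.\<close>

lemma nn_integral_radial_1d:
  fixes q r V :: real and m :: nat
  assumes q: "0 < q" and r: "0 < r" and V: "0 <= V"
  shows "(\<integral>\<^sup>+\<sigma>\<in>{0<..}. (ennreal (2 * q * \<sigma> * (r\<^sup>2 + \<sigma>\<^sup>2) powr (- q - 1)) * ennreal (V * \<sigma> ^ Suc m)) \<partial>lborel) =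
    (\<integral>\<^sup>+t\<in>{0<..}. ennreal (real (Suc m) * V * (t ^ m * (r\<^sup>2 + t\<^sup>2) powr (- q))) \<partial>lborel)"
proof -
  let ?f = "\<lambda>\<sigma>. ennreal (2 * q * \<sigma> * (r\<^sup>2 + \<sigma>\<^sup>2) powr (- q - 1))"
  let ?g = "\<lambda>t. ennreal (real (Suc m) * V * t ^ m)"
  have AE: "AE \<sigma>::real in lborel. \<sigma> \<noteq> 0" by (rule AE_lborel_singleton)
  have pow: "(\<integral>\<^sup>+t. ?g t * indicator {0..\<sigma>} t \<partial>lborel) = ennreal (V * \<sigma> ^ Suc m)" if "0 < \<sigma>" for \<sigma>
  proof -
    have "(\<integral>\<^sup>+t. ?g t * indicator {0..\<sigma>} t \<partial>lborel) = ennreal (V * \<sigma> ^ Suc m - V * 0 ^ Suc m)"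
      using that V by (intro nn_integral_FTC_Icc) (auto intro!: derivative_eq_intros simp del: of_nat_Suc power_Suc)
    then show ?thesis by simp
  qed
  have "(\<integral>\<^sup>+\<sigma>\<in>{0<..}. (?f \<sigma> * ennreal (V * \<sigma> ^ Suc m)) \<partial>lborel) =
    (\<integral>\<^sup>+\<sigma>. (\<integral>\<^sup>+t. ?f \<sigma> * (?g t * (indicator {0<..} t * indicator {t..} \<sigma>)) \<partial>lborel) \<partial>lborel)"
  proof (rule nn_integral_cong)
    fix \<sigma> :: real
    have "(\<integral>\<^sup>+t. ?f \<sigma> * (?g t * (indicator {0<..} t * indicator {t..} \<sigma>)) \<partial>lborel) =
      ?f \<sigma> * (\<integral>\<^sup>+t. ?g t * (indicator {0<..} t * indicator {t..} \<sigma>) \<partial>lborel)"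
      unfolding indicator_def atLeast_iff by (rule nn_integral_cmult) measurable
    also have "(\<integral>\<^sup>+t. ?g t * (indicator {0<..} t * indicator {t..} \<sigma>) \<partial>lborel) =
      (\<integral>\<^sup>+t. ?g t * indicator {0..\<sigma>} t \<partial>lborel)"
      using AE by (intro nn_integral_cong_AE) (auto elim!: eventually_mono simp: indicator_def)
    also have "?f \<sigma> * \<dots> = (?f \<sigma> * ennreal (V * \<sigma> ^ Suc m)) * indicator {0<..} \<sigma>"
    proof (cases "0 < \<sigma>")
      case True then show ?thesis by (simp only: pow) simp
    next
      case False
      then have "?f \<sigma> = 0" using q by (intro ennreal_neg) (simp add: mult_le_0_iff not_less)
      then show ?thesis by simp
    qed
    finally show "(?f \<sigma> * ennreal (V * \<sigma> ^ Suc m)) * indicator {0<..} \<sigma> =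
      (\<integral>\<^sup>+t. ?f \<sigma> * (?g t * (indicator {0<..} t * indicator {t..} \<sigma>)) \<partial>lborel)" by simp
  qed
  also have "\<dots> = (\<integral>\<^sup>+t. (\<integral>\<^sup>+\<sigma>. ?f \<sigma> * (?g t * (indicator {0<..} t * indicator {t..} \<sigma>)) \<partial>lborel) \<partial>lborel)"
    unfolding indicator_def atLeast_iff by (rule lborel_pair.Fubini') measurable
  also have "\<dots> = (\<integral>\<^sup>+t\<in>{0<..}. ennreal (real (Suc m) * V * (t ^ m * (r\<^sup>2 + t\<^sup>2) powr (- q))) \<partial>lborel)"
  proof (rule nn_integral_cong)
    fix t :: real
    have "(\<integral>\<^sup>+\<sigma>. ?f \<sigma> * (?g t * (indicator {0<..} t * indicator {t..} \<sigma>)) \<partial>lborel) =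
      (\<integral>\<^sup>+\<sigma>. (?g t * indicator {0<..} t) * (?f \<sigma> * indicator {t..} \<sigma>) \<partial>lborel)"
      by (simp add: mult_ac)
    also have "\<dots> = (?g t * indicator {0<..} t) * (\<integral>\<^sup>+\<sigma>. ?f \<sigma> * indicator {t..} \<sigma> \<partial>lborel)"
      by (rule nn_integral_cmult) measurable
    also have "\<dots> = ennreal (real (Suc m) * V * (t ^ m * (r\<^sup>2 + t\<^sup>2) powr (- q))) * indicator {0<..} t"
    proof (cases "0 < t")
      case True
      have "?g t * ennreal ((r\<^sup>2 + t\<^sup>2) powr (- q)) = ennreal (real (Suc m) * V * t ^ m * (r\<^sup>2 + t\<^sup>2) powr (- q))"
        using True V by (intro ennreal_mult[symmetric]) auto
      then show ?thesis using True layer_cake_kernel[OF q _ r, of t] by (simp add: mult.assoc)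
    qed simp
    finally show "(\<integral>\<^sup>+\<sigma>. ?f \<sigma> * (?g t * (indicator {0<..} t * indicator {t..} \<sigma>)) \<partial>lborel) =
      ennreal (real (Suc m) * V * (t ^ m * (r\<^sup>2 + t\<^sup>2) powr (- q))) * indicator {0<..} t" .
  qed
  finally show ?thesis .
qed

text \<open>Integrating out the directions parallel to a hyperplane at height r leaves the
  one-dimensional kernel; the substitution t -> |r| t extracts the power of |r|. The constant left
  over is C_(N,sp).\<close>

lemma slice_kernel:
  fixes b :: "'a::euclidean_space"
  assumes b: "b \<in> Basis" and a: "0 < a" and r: "r \<noteq> 0"
  shows "(\<integral>\<^sup>+z. ennreal (1 / norm (z + r *\<^sub>R b) powr (real DIM('a) + a)) \<partial>orth b) =
    ennreal (1 / \<bar>r\<bar> powr (1 + a)) * slice_const DIM('a) a"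
proof -
  define q where "q = (real DIM('a) + a) / 2"
  have q: "0 < q" using a by (simp add: q_def)
  have q2: "2 * q = real DIM('a) + a" by (simp add: q_def)
  have r0: "0 < \<bar>r\<bar>" using r by simp
  have bb: "b \<bullet> b = 1" using b by simp
  have nrm: "1 / norm (z + r *\<^sub>R b) powr (real DIM('a) + a) = (\<bar>r\<bar>\<^sup>2 + (norm z)\<^sup>2) powr (- q)" if "z \<bullet> b = 0" for z
  proof -
    have n2: "(norm (z + r *\<^sub>R b))\<^sup>2 = \<bar>r\<bar>\<^sup>2 + (norm z)\<^sup>2"
      unfolding power2_norm_eq_inner
      using that bb by (simp add: inner_left_distrib inner_right_distrib inner_commute power2_eq_square)
    have "0 < \<bar>r\<bar>\<^sup>2 + (norm z)\<^sup>2" using r by (simp add: add_pos_nonneg)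
    then have np: "0 < norm (z + r *\<^sub>R b)" unfolding n2[symmetric] by (simp add: zero_less_power2)
    have "(norm (z + r *\<^sub>R b))\<^sup>2 powr (- q) = norm (z + r *\<^sub>R b) powr (2 * - q)"
      using np by (simp add: powr_powr flip: powr_numeral)
    also have "2 * - q = - (real DIM('a) + a)" using q2 by linarith
    finally show ?thesis unfolding n2 by (simp only: powr_minus_divide)
  qed
  have "(\<integral>\<^sup>+z. ennreal (1 / norm (z + r *\<^sub>R b) powr (real DIM('a) + a)) \<partial>orth b) =
     (\<integral>\<^sup>+z. ennreal ((\<bar>r\<bar>\<^sup>2 + (norm z)\<^sup>2) powr (- q)) \<partial>orth b)"
    using AE_orth[of b] b by (intro nn_integral_cong_AE) (auto elim!: eventually_mono simp: nrm)
  also have "\<dots> = (\<integral>\<^sup>+\<sigma>\<in>{0<..}. (ennreal (2 * q * \<sigma> * (\<bar>r\<bar>\<^sup>2 + \<sigma>\<^sup>2) powr (- q - 1)) *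
       ennreal (unit_ball_vol (real (DIM('a) - 1)) * \<sigma> ^ (DIM('a) - 1))) \<partial>lborel)"
    by (rule nn_integral_orth_radial[OF b q r0])
  also have "\<dots> = ennreal (1 / \<bar>r\<bar> powr (1 + a)) * slice_const DIM('a) a"
  proof (cases "DIM('a) = 1")
    case True
    have AE: "AE \<sigma>::real in lborel. \<sigma> \<noteq> 0" by (rule AE_lborel_singleton)
    have "(\<integral>\<^sup>+\<sigma>\<in>{0<..}. (ennreal (2 * q * \<sigma> * (\<bar>r\<bar>\<^sup>2 + \<sigma>\<^sup>2) powr (- q - 1)) *
       ennreal (unit_ball_vol (real (DIM('a) - 1)) * \<sigma> ^ (DIM('a) - 1))) \<partial>lborel) =
      (\<integral>\<^sup>+\<sigma>\<in>{0..}. ennreal (2 * q * \<sigma> * (\<bar>r\<bar>\<^sup>2 + \<sigma>\<^sup>2) powr (- q - 1)) \<partial>lborel)"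
      using AE True by (intro nn_integral_cong_AE) (auto elim!: eventually_mono simp: indicator_def)
    also have "\<dots> = ennreal ((\<bar>r\<bar>\<^sup>2 + 0\<^sup>2) powr (- q))" by (rule layer_cake_kernel[OF q _ r0]) simp
    also have "(\<bar>r\<bar>\<^sup>2 + 0\<^sup>2) powr (- q) = 1 / \<bar>r\<bar> powr (1 + a)"
    proof -
      have "\<bar>r\<bar>\<^sup>2 powr (- q) = \<bar>r\<bar> powr (2 * - q)"
        using r0 powr_powr[of "\<bar>r\<bar>" 2 "- q"] by simp
      also have "2 * - q = - (1 + a)" using q2 unfolding True by simp
      finally show ?thesis by (simp only: powr_minus_divide) simp
    qed
    finally show ?thesis using True by (simp add: slice_const_def)
  next
    case False
    define V where "V = unit_ball_vol (real (DIM('a) - 1))"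
    have V: "0 <= V" unfolding V_def by (rule unit_ball_vol_nonneg) (rule of_nat_0_le_iff)
    define m where "m = DIM('a) - 2"
    have m: "DIM('a) - 1 = Suc m" "DIM('a) - 2 = m" "real DIM('a) = 2 + real m"
    proof -
      have "2 <= n" if "0 < n" "n \<noteq> 1" for n :: nat using that by arith
      from this[of "DIM('a)"] have "2 <= DIM('a)" using False by simp
      then obtain k where "DIM('a) = 2 + k" using le_Suc_ex by blast
      then show "DIM('a) - 1 = Suc m" "DIM('a) - 2 = m" "real DIM('a) = 2 + real m" by (auto simp: m_def)
    qed
    have "(\<integral>\<^sup>+\<sigma>\<in>{0<..}. (ennreal (2 * q * \<sigma> * (\<bar>r\<bar>\<^sup>2 + \<sigma>\<^sup>2) powr (- q - 1)) * ennreal (V * \<sigma> ^ Suc m)) \<partial>lborel) =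
      (\<integral>\<^sup>+t. ennreal (real (Suc m) * V * (t ^ m * (\<bar>r\<bar>\<^sup>2 + t\<^sup>2) powr (- q))) * indicator {0<..} t \<partial>lborel)"
      by (rule nn_integral_radial_1d[OF q r0 V])
    also have "\<dots> = ennreal \<bar>\<bar>r\<bar>\<bar> * (\<integral>\<^sup>+t. ennreal (real (Suc m) * V * ((0 + \<bar>r\<bar> * t) ^ m * (\<bar>r\<bar>\<^sup>2 + (0 + \<bar>r\<bar> * t)\<^sup>2) powr (- q))) * indicator {0<..} (0 + \<bar>r\<bar> * t) \<partial>lborel)"
      using r0 by (intro nn_integral_real_affine) auto
    also have "(\<integral>\<^sup>+t. ennreal (real (Suc m) * V * ((0 + \<bar>r\<bar> * t) ^ m * (\<bar>r\<bar>\<^sup>2 + (0 + \<bar>r\<bar> * t)\<^sup>2) powr (- q))) * indicator {0<..} (0 + \<bar>r\<bar> * t) \<partial>lborel) =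
      (\<integral>\<^sup>+t. ennreal (\<bar>r\<bar> ^ m * \<bar>r\<bar> powr (- (2 * q))) * (ennreal (real (Suc m) * V * (t ^ m * (1 + t\<^sup>2) powr (- q))) * indicator {0<..} t) \<partial>lborel)"
    proof (rule nn_integral_cong)
      fix t :: real
      have "\<bar>r\<bar>\<^sup>2 + (0 + \<bar>r\<bar> * t)\<^sup>2 = \<bar>r\<bar>\<^sup>2 * (1 + t\<^sup>2)" by (simp add: algebra_simps power_mult_distrib)
      then have "(\<bar>r\<bar>\<^sup>2 + (0 + \<bar>r\<bar> * t)\<^sup>2) powr (- q) = (\<bar>r\<bar>\<^sup>2) powr (- q) * (1 + t\<^sup>2) powr (- q)"
        by (simp only: powr_mult)
      also have "(\<bar>r\<bar>\<^sup>2) powr (- q) = \<bar>r\<bar> powr (- (2 * q))"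
        using r0 powr_powr[of "\<bar>r\<bar>" 2 "- q"] by simp
      finally have e: "real (Suc m) * V * ((0 + \<bar>r\<bar> * t) ^ m * (\<bar>r\<bar>\<^sup>2 + (0 + \<bar>r\<bar> * t)\<^sup>2) powr (- q)) =
         (\<bar>r\<bar> ^ m * \<bar>r\<bar> powr (- (2 * q))) * (real (Suc m) * V * (t ^ m * (1 + t\<^sup>2) powr (- q)))"
        by (simp only: power_mult_distrib add_0) (simp only: mult_ac)
      have "indicator {0<..} (0 + \<bar>r\<bar> * t) = (indicator {0<..} t :: ennreal)"
        using r0 by (simp add: indicator_def zero_less_mult_iff)
      then show "ennreal (real (Suc m) * V * ((0 + \<bar>r\<bar> * t) ^ m * (\<bar>r\<bar>\<^sup>2 + (0 + \<bar>r\<bar> * t)\<^sup>2) powr (- q))) * indicator {0<..} (0 + \<bar>r\<bar> * t) =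
        ennreal (\<bar>r\<bar> ^ m * \<bar>r\<bar> powr (- (2 * q))) * (ennreal (real (Suc m) * V * (t ^ m * (1 + t\<^sup>2) powr (- q))) * indicator {0<..} t)"
        unfolding e by (subst ennreal_mult') (simp_all add: mult_ac)
    qed
    also have "\<dots> = ennreal (\<bar>r\<bar> ^ m * \<bar>r\<bar> powr (- (2 * q))) * slice_const DIM('a) a"
    proof -
      have qq: "- q = - (real DIM('a) + a) / 2" unfolding q_def by (rule minus_divide_left)
      have "slice_const DIM('a) a = (\<integral>\<^sup>+t\<in>{0<..}. ennreal (real (Suc m) * V * (t ^ m * (1 + t\<^sup>2) powr (- q))) \<partial>lborel)"
        unfolding slice_const_def V_def m qq using False by simp
      then show ?thesis by (simp add: nn_integral_cmult)
    qed
    also have "ennreal \<bar>\<bar>r\<bar>\<bar> * (ennreal (\<bar>r\<bar> ^ m * \<bar>r\<bar> powr (- (2 * q))) * slice_const DIM('a) a) =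
       ennreal (\<bar>r\<bar> * (\<bar>r\<bar> ^ m * \<bar>r\<bar> powr (- (2 * q)))) * slice_const DIM('a) a"
      by (simp add: ennreal_mult' mult.assoc)
    also have "\<bar>r\<bar> * (\<bar>r\<bar> ^ m * \<bar>r\<bar> powr (- (2 * q))) = 1 / \<bar>r\<bar> powr (1 + a)"
    proof -
      have "\<bar>r\<bar> * (\<bar>r\<bar> ^ m * \<bar>r\<bar> powr (- (2 * q))) = \<bar>r\<bar> powr (real (Suc m) + - (2 * q))"
        using r0 by (simp only: powr_add powr_realpow power_Suc mult.assoc)
      also have "real (Suc m) + - (2 * q) = - (1 + a)" using q2 m(3) by simp
      finally show ?thesis by (simp only: powr_minus_divide)
    qed
    finally show ?thesis by (simp only: m V_def)
  qed
  finally show ?thesis .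
qed

lemma slice_const_eq:
  assumes N: "1 <= N" and a: "0 < a"
  shows "slice_const N a = ennreal (dim_const N a)" "0 < dim_const N a"
proof -
  have "slice_const N a = ennreal (dim_const N a) \<and> 0 < dim_const N a"
  proof (cases "N = 1")
    case True then show ?thesis by (simp add: slice_const_def dim_const_def)
  next
    case False
    then have N2: "2 <= N" using N by simp
    define g where "g t = t ^ (N - 2) * (1 + t\<^sup>2) powr (- (real N + a) / 2)" for t :: real
    have g[measurable]: "g \<in> borel_measurable borel" unfolding g_def[abs_def] by measurable
    define V where "V = real (N - 1) * unit_ball_vol (real (N - 1))"
    have V: "0 < V" unfolding V_def using N2 by (intro mult_pos_pos unit_ball_vol_pos) auto
    have gn: "0 <= g t" if "0 < t" for t using that by (simp add: g_def)
    \<comment> \<open>Bounding t^(N-2) by (1 + t^2)^((N-2)/2) leaves (1 + t^2)^(-1-a/2).\<close>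
    have bnd: "g t <= 1 / (1 + t\<^sup>2)" if t: "0 < t" for t
    proof -
      have "t ^ (N - 2) = (t\<^sup>2) powr ((real N - 2) / 2)"
      proof -
        have "(t\<^sup>2) powr ((real N - 2) / 2) = t powr (2 * ((real N - 2) / 2))"
          using t powr_powr[of t 2 "(real N - 2) / 2"] by simp
        also have "2 * ((real N - 2) / 2) = real (N - 2)" using N2 by simp
        finally show ?thesis using t by (simp add: powr_realpow)
      qed
      also have "\<dots> <= (1 + t\<^sup>2) powr ((real N - 2) / 2)" using N2 by (intro powr_mono2) auto
      finally have "g t <= (1 + t\<^sup>2) powr ((real N - 2) / 2) * (1 + t\<^sup>2) powr (- (real N + a) / 2)"
        unfolding g_def by (intro mult_right_mono) auto
      also have "\<dots> = (1 + t\<^sup>2) powr (- 1 - a / 2)"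
      proof -
        have "(real N - 2) / 2 + - (real N + a) / 2 = - 1 - a / 2" by (simp add: field_simps)
        then show ?thesis by (simp only: powr_add[symmetric])
      qed
      also have "\<dots> <= (1 + t\<^sup>2) powr (- 1)" using a by (intro powr_mono) auto
      also have "\<dots> = 1 / (1 + t\<^sup>2)" by (simp add: powr_minus_divide add_pos_nonneg)
      finally show ?thesis .
    qed
    have fin: "(\<integral>\<^sup>+t\<in>{0<..}. ennreal (g t) \<partial>lborel) < \<infinity>"
    proof -
      have "(\<integral>\<^sup>+t\<in>{0<..}. ennreal (g t) \<partial>lborel) <= (\<integral>\<^sup>+t\<in>{0..}. ennreal (1 / (1 + t\<^sup>2)) \<partial>lborel)"
        using bnd by (intro nn_integral_mono) (auto simp: indicator_def intro: ennreal_leI)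
      also have "\<dots> = ennreal (pi / 2 - arctan 0)"
      proof (rule nn_integral_FTC_atLeast)
        show "(arctan \<longlongrightarrow> pi / 2) at_top" by (rule tendsto_arctan_at_top)
        show "(arctan has_real_derivative 1 / (1 + t\<^sup>2)) (at t)" for t
          using DERIV_arctan[of t] by (simp add: divide_inverse)
      qed auto
      finally show ?thesis by (simp add: le_less_trans)
    qed
    have int: "integrable lborel (\<lambda>t. indicator {0<..} t *\<^sub>R g t)"
    proof (rule integrableI_bounded)
      have "(\<integral>\<^sup>+t. ennreal (norm (indicator {0<..} t *\<^sub>R g t)) \<partial>lborel) = (\<integral>\<^sup>+t\<in>{0<..}. ennreal (g t) \<partial>lborel)"
        using gn by (intro nn_integral_cong) (auto simp: indicator_def)
      then show "(\<integral>\<^sup>+t. ennreal (norm (indicator {0<..} t *\<^sub>R g t)) \<partial>lborel) < \<infinity>" using fin by simp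
    qed measurable
    have eq: "(\<integral>\<^sup>+t\<in>{0<..}. ennreal (g t) \<partial>lborel) = ennreal (LINT t:{0<..}|lborel. g t)"
    proof -
      have "(\<integral>\<^sup>+t\<in>{0<..}. ennreal (g t) \<partial>lborel) = (\<integral>\<^sup>+t. ennreal (indicator {0<..} t *\<^sub>R g t) \<partial>lborel)"
        by (intro nn_integral_cong) (auto simp: indicator_def)
      also have "\<dots> = ennreal (LINT t|lborel. indicator {0<..} t *\<^sub>R g t)"
        using gn by (intro nn_integral_eq_integral[OF int]) (auto simp: indicator_def)
      finally show ?thesis by (simp add: set_lebesgue_integral_def)
    qed
    have "slice_const N a = (\<integral>\<^sup>+t. ennreal V * (ennreal (g t) * indicator {0<..} t) \<partial>lborel)"
    proof -
      have "ennreal (V * g t) * indicator {0<..} t = ennreal V * (ennreal (g t) * indicator {0<..} t)" for t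
        using V by (simp add: ennreal_mult' mult.assoc)
      then show ?thesis
        unfolding slice_const_def V_def[symmetric] g_def[symmetric] using False by simp
    qed
    also have "\<dots> = ennreal V * (\<integral>\<^sup>+t\<in>{0<..}. ennreal (g t) \<partial>lborel)" by (rule nn_integral_cmult) measurable
    also have "\<dots> = ennreal (dim_const N a)"
      unfolding eq dim_const_def V_def[symmetric] g_def[symmetric] using False V by (simp add: ennreal_mult')
    finally have 1: "slice_const N a = ennreal (dim_const N a)" .
    have "(\<integral>\<^sup>+t\<in>{0<..}. ennreal (g t) \<partial>lborel) \<noteq> 0"
    proof
      assume "(\<integral>\<^sup>+t\<in>{0<..}. ennreal (g t) \<partial>lborel) = 0"
      then have "AE t in lborel. ennreal (g t) * indicator {0<..} t = 0"
        by (subst (asm) nn_integral_0_iff_AE) auto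
      moreover have "0 < g t" if "0 < t" for t
      proof -
        have "0 < 1 + t\<^sup>2" by (simp add: add_pos_nonneg)
        then show ?thesis unfolding g_def using that by (intro mult_pos_pos) auto
      qed
      ultimately have "AE t::real in lborel. t \<notin> {0<..<1}"
        by (auto elim!: eventually_mono simp: indicator_def ennreal_eq_0_iff split: if_splits) (meson not_le)
      then have "emeasure lborel {0<..<1::real} = 0" by (subst (asm) AE_iff_measurable[where N = "{0<..<1}"]) auto
      then show False by simp
    qed
    then have "0 < (LINT t:{0<..}|lborel. g t)" unfolding eq by (simp add: ennreal_eq_0_iff not_le)
    then have 2: "0 < dim_const N a" unfolding dim_const_def V_def[symmetric] g_def[symmetric] using False V by simp
    from 1 2 show ?thesis by blast
  qed
  then show "slice_const N a = ennreal (dim_const N a)" "0 < dim_const N a" by auto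
qed

subsection \<open>The lower bound in convex sets\<close>

lemma nn_integral_eq_imp_AE_eq:
  fixes f g :: "'a => ennreal"
  assumes [measurable]: "f \<in> borel_measurable M" "g \<in> borel_measurable M"
    and le: "AE x in M. f x <= g x" and eq: "(\<integral>\<^sup>+x. f x \<partial>M) = (\<integral>\<^sup>+x. g x \<partial>M)"
    and fin: "(\<integral>\<^sup>+x. f x \<partial>M) < \<infinity>"
  shows "AE x in M. f x = g x"
proof -
  have "(\<integral>\<^sup>+x. g x - f x \<partial>M) = 0"
    using fin le by (subst nn_integral_diff) (auto simp: eq[symmetric])
  then have "AE x in M. g x - f x = 0" by (subst (asm) nn_integral_0_iff_AE) auto
  then show ?thesis using le
    by eventually_elim (auto simp: diff_eq_0_iff_ennreal intro: antisym)
qed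

text \<open>\<open>y0\<close> is a nearest boundary point and \<open>n\<close> the inner unit normal
  of a hyperplane separating it from the set. The ball about x whose radius is the distance d lies
  in the set, so moving from x against \<open>n\<close> by less than d stays on the positive side.
  This gives n . (x - y0) >= d = |x - y0|, and equality in the Cauchy-Schwarz inequality identifies
  x - y0 with d n.\<close>

lemma convex_tangent:
  fixes \<Omega> :: "'a::euclidean_space set"
  assumes \<Omega>: "open \<Omega>" "convex \<Omega>" "\<Omega> \<noteq> UNIV" and x: "x \<in> \<Omega>"
  obtains n y0 where "norm n = 1" "0 < bdry_dist \<Omega> x" "x - y0 = bdry_dist \<Omega> x *\<^sub>R n"
    "ball x (bdry_dist \<Omega> x) \<subseteq> \<Omega>" "\<And>y. y \<in> \<Omega> ==> 0 < n \<bullet> (y - y0)" "y0 \<in> frontier \<Omega>"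
proof -
  define d where "d = bdry_dist \<Omega> x"
  have fr: "frontier \<Omega> \<noteq> {}" using \<Omega> x frontier_eq_empty by blast
  obtain y0 where y0: "y0 \<in> frontier \<Omega>" "d = dist x y0"
    using infdist_attains_inf[OF frontier_closed fr, of x] by (metis bdry_dist_def d_def)
  have y0n: "y0 \<notin> \<Omega>" using y0 \<Omega>(1) by (simp add: frontier_def interior_open)
  then have d: "0 < d" using y0 x by auto
  have ball: "ball x d \<subseteq> \<Omega>"
  proof (rule ccontr)
    assume "\<not> ball x d \<subseteq> \<Omega>"
    moreover have "x \<in> ball x d \<inter> \<Omega>" using x d by simp
    ultimately have "ball x d \<inter> frontier \<Omega> \<noteq> {}"
      by (intro connected_Int_frontier) (blast intro: connected_ball)+
    then obtain y where y: "dist x y < d" "y \<in> frontier \<Omega>" by auto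
    then have "d <= dist x y" unfolding d_def bdry_dist_def by (intro infdist_le)
    then show False using y by simp
  qed
  obtain a \<beta> where a: "a \<noteq> 0" "\<forall>y\<in>{y0}. a \<bullet> y <= \<beta>" "\<forall>y\<in>\<Omega>. \<beta> <= a \<bullet> y"
    using separating_hyperplane_sets[of "{y0}" \<Omega>] \<Omega>(2) x y0n by auto
  define n where "n = a /\<^sub>R norm a"
  have n: "norm n = 1" using a by (simp add: n_def)
  have nn: "n \<bullet> n = 1" using n by (simp add: norm_eq_1)
  have ge: "0 <= n \<bullet> (y - y0)" if "y \<in> \<Omega>" for y
    using a that by (auto simp: n_def inner_diff_right zero_le_mult_iff intro: order_trans)
  \<comment> \<open>Moving slightly against \<open>n\<close> inside the open set makes the
    separation strict.\<close>
  have pos: "0 < n \<bullet> (y - y0)" if y: "y \<in> \<Omega>" for y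
  proof -
    obtain e where e: "0 < e" "ball y e \<subseteq> \<Omega>" using \<Omega>(1) y openE by blast
    have "y - (e / 2) *\<^sub>R n \<in> \<Omega>" using e n by (intro subsetD[OF e(2)]) (simp add: dist_norm)
    from ge[OF this] show ?thesis using e nn by (simp add: inner_diff_right)
  qed
  have "d <= n \<bullet> (x - y0)"
  proof (rule ccontr)
    assume "\<not> d <= n \<bullet> (x - y0)"
    then have lt: "n \<bullet> (x - y0) < d" by simp
    then obtain t where t: "n \<bullet> (x - y0) < t" "t < d" "0 < t" using d dense[of "max 0 (n \<bullet> (x - y0))" d] by auto
    have "x - t *\<^sub>R n \<in> \<Omega>" using t n by (intro subsetD[OF ball]) (simp add: dist_norm)
    from ge[OF this] show False using t nn by (simp add: inner_diff_right)
  qed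
  moreover have "n \<bullet> (x - y0) <= norm n * norm (x - y0)" by (rule norm_cauchy_schwarz)
  ultimately have "n \<bullet> (x - y0) = norm n * norm (x - y0)" using y0 n by (simp add: dist_norm)
  then have "x - y0 = d *\<^sub>R n"
    unfolding norm_cauchy_schwarz_eq using n y0 by (simp add: dist_norm)
  then show thesis using that n d ball pos y0(1) unfolding d_def by blast
qed

text \<open>Otherwise the projection of y to the hyperplane would lie in the ball about y that is
  contained in the set.\<close>

lemma bdry_dist_le:
  fixes \<Omega> :: "'a::euclidean_space set"
  assumes "open \<Omega>" "convex \<Omega>" "\<Omega> \<noteq> UNIV" "y \<in> \<Omega>" and n: "norm n = 1" "\<And>y. y \<in> \<Omega> ==> 0 < n \<bullet> (y - y0)"
  shows "bdry_dist \<Omega> y <= n \<bullet> (y - y0)"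
proof (rule ccontr)
  assume lt: "\<not> bdry_dist \<Omega> y <= n \<bullet> (y - y0)"
  have ball: "ball y (bdry_dist \<Omega> y) \<subseteq> \<Omega>"
    by (rule convex_tangent[OF assms(1-4)])
  have "0 < n \<bullet> (y - y0)" using assms by blast
  then have "dist y (y - (n \<bullet> (y - y0)) *\<^sub>R n) = n \<bullet> (y - y0)" using n(1) by (simp add: dist_norm)
  then have "y - (n \<bullet> (y - y0)) *\<^sub>R n \<in> \<Omega>" using lt by (intro subsetD[OF ball]) simp
  from n(2)[OF this] show False using n(1) by (simp add: inner_diff_right norm_eq_1)
qed

text \<open>Every q below d / norm h is admissible; a rational one above half of this value gives
  the factor 2.\<close>

lemma gap_finite:
  fixes \<Omega> :: "'a::euclidean_space set"
  assumes "0 < a" and d: "0 < d" "ball x d \<subseteq> \<Omega>" and h: "h \<noteq> 0"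
  shows "gap a \<Omega> x h <= ennreal ((2 * norm h) powr a * d powr (- a))"
proof -
  have nh: "0 < norm h" using h by simp
  have "d / (2 * norm h) < d / norm h" using d nh by (simp add: field_simps)
  from Rats_dense_in_real[OF this] obtain q where q: "q \<in> \<rat>" "d / (2 * norm h) < q" "q < d / norm h" by blast
  have q0: "0 < q" using q(2) d nh by (meson divide_pos_pos less_trans mult_pos_pos zero_less_numeral)
  have "q * norm h < d" using q(3) nh by (simp add: pos_less_divide_eq)
  then have "x + q *\<^sub>R h \<in> \<Omega> \<and> x - q *\<^sub>R h \<in> \<Omega>"
    using q0 by (intro conjI subsetD[OF d(2)]) (auto simp: dist_norm)
  then have "gap a \<Omega> x h <= ennreal (q powr (- a))"
    unfolding gap_def using q q0 by (intro INF_lower2[of q]) auto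
  also have "\<dots> <= ennreal ((d / (2 * norm h)) powr (- a))"
    using q d nh assms by (intro ennreal_leI powr_mono2') auto
  also have "(d / (2 * norm h)) powr (- a) = (2 * norm h) powr a * d powr (- a)"
    by (simp only: powr_divide powr_minus_divide) simp
  finally show ?thesis .
qed

text \<open>If x + q h and x - q h both lie on the positive side of the hyperplane, then q |h . n|
  <= d. For a half-space bounded by this hyperplane the estimate is an equality, which is why the
  average over directions stays sharp.\<close>

lemma gap_ge:
  fixes \<Omega> :: "'a::euclidean_space set"
  assumes a: "0 < a" and n: "\<And>y. y \<in> \<Omega> ==> 0 < n \<bullet> (y - y0)" and d: "0 < d" "n \<bullet> (x - y0) = d"
  shows "ennreal (\<bar>h \<bullet> n\<bar> powr a * d powr (- a)) <= gap a \<Omega> x h"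
  unfolding gap_def
proof (rule INF_greatest)
  fix q :: real assume "q \<in> {q. q \<in> \<rat> \<and> 0 < q}"
  then have q: "0 < q" by simp
  show "ennreal (\<bar>h \<bullet> n\<bar> powr a * d powr (- a)) <= (if x + q *\<^sub>R h \<in> \<Omega> \<and> x - q *\<^sub>R h \<in> \<Omega> then ennreal (q powr (- a)) else \<infinity>)"
  proof (cases "x + q *\<^sub>R h \<in> \<Omega> \<and> x - q *\<^sub>R h \<in> \<Omega>")
    case True
    then have "0 < n \<bullet> (x + q *\<^sub>R h - y0)" "0 < n \<bullet> (x - q *\<^sub>R h - y0)" using n by blast+
    then have "0 < d + q * (h \<bullet> n)" "0 < d - q * (h \<bullet> n)"
      unfolding d(2)[symmetric] by (simp_all add: inner_diff_right inner_add_right inner_commute algebra_simps)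
    then have "q * \<bar>h \<bullet> n\<bar> <= d" by (auto simp: abs_if)
    then have "\<bar>h \<bullet> n\<bar> <= d / q" using q by (simp add: field_simps)
    then have "\<bar>h \<bullet> n\<bar> powr a * d powr (- a) <= (d / q) powr a * d powr (- a)"
      using a by (intro mult_right_mono powr_mono2) auto
    also have "\<dots> = q powr (- a)"
      using d q by (simp only: powr_divide powr_minus_divide) simp
    finally show ?thesis using True by (simp add: ennreal_leI)
  next
    case False
    then show ?thesis by auto
  qed
qed

lemma measurable_gap:
  fixes \<Omega> :: "'a::euclidean_space set"
  assumes [measurable]: "\<Omega> \<in> sets borel"
  shows "(\<lambda>z. gap a \<Omega> (fst z) (snd z)) \<in> borel_measurable (borel \<Otimes>\<^sub>M borel)"
  unfolding gap_def
proof (rule borel_measurable_INF)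
  show "countable {q :: real. q \<in> \<rat> \<and> 0 < q}" by (rule countable_subset[OF _ countable_rat]) auto
qed measurable

section \<open>Decomposition of the Gagliardo energy into directional energies\<close>

definition gagliardo :: "real => real => ('a::euclidean_space => real) => ennreal" where
  "gagliardo p a u = (\<integral>\<^sup>+x. \<integral>\<^sup>+k. ennreal (\<bar>u x - u (x + k)\<bar> powr p / norm k powr (real DIM('a) + a)) \<partial>lborel \<partial>lborel)"

definition dir_energy :: "real => real => 'a => ('a::euclidean_space => real) => ennreal" where
  "dir_energy p a h u = (\<integral>\<^sup>+x. \<integral>\<^sup>+\<tau>. ennreal (\<bar>u x - u (x + \<tau> *\<^sub>R h)\<bar> powr p / \<bar>\<tau>\<bar> powr (1 + a)) \<partial>lborel \<partial>lborel)"

text \<open>After Tonelli's theorem the energy is an integral over differences k of the even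
  function G k = integral of |u x - u (x + k)|^p. The two signs of \<tau> contribute equally, hence
  the factor 2, and the kernel is averaged over rays.\<close>

lemma gagliardo_rays:
  fixes u :: "'a::euclidean_space => real"
  assumes u[measurable]: "u \<in> borel_measurable borel" and a: "0 < a"
  shows "2 * (ennreal (shell_const DIM('a) a) * gagliardo p a u) = (\<integral>\<^sup>+h\<in>shell. dir_energy p a h u \<partial>lborel)"
proof -
  define G where "G k = (\<integral>\<^sup>+x. ennreal (\<bar>u x - u (x + k)\<bar> powr p) \<partial>lborel)" for k
  have G[measurable]: "G \<in> borel_measurable borel" unfolding G_def[abs_def] by measurable
  have sym: "G (- k) = G k" for k
  proof -
    have "G (- k) = (\<integral>\<^sup>+x. ennreal (\<bar>u (k + x) - u (k + x + - k)\<bar> powr p) \<partial>lborel)"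
      unfolding G_def by (rule nn_integral_lborel_translate[symmetric]) measurable
    also have "\<dots> = G k" unfolding G_def by (simp add: add.commute abs_minus_commute)
    finally show ?thesis .
  qed
  have 1: "gagliardo p a u = (\<integral>\<^sup>+k. G k * ennreal (1 / norm k powr (real DIM('a) + a)) \<partial>lborel)"
  proof -
    have "gagliardo p a u = (\<integral>\<^sup>+k. (\<integral>\<^sup>+x. ennreal (\<bar>u x - u (x + k)\<bar> powr p / norm k powr (real DIM('a) + a)) \<partial>lborel) \<partial>lborel)"
      unfolding gagliardo_def by (rule lborel_pair.Fubini'[symmetric]) measurable
    also have "\<dots> = (\<integral>\<^sup>+k. (\<integral>\<^sup>+x. ennreal (\<bar>u x - u (x + k)\<bar> powr p) * ennreal (1 / norm k powr (real DIM('a) + a)) \<partial>lborel) \<partial>lborel)"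
      by (simp add: ennreal_mult'[symmetric])
    also have "\<dots> = (\<integral>\<^sup>+k. G k * ennreal (1 / norm k powr (real DIM('a) + a)) \<partial>lborel)"
      unfolding G_def by (simp add: nn_integral_multc)
    finally show ?thesis .
  qed
  have 2: "dir_energy p a h u = 2 * (\<integral>\<^sup>+\<tau>\<in>{0<..}. (G (\<tau> *\<^sub>R h) * ennreal (1 / \<tau> powr (1 + a))) \<partial>lborel)" for h
  proof -
    let ?g = "\<lambda>\<tau>. G (\<tau> *\<^sub>R h) * ennreal (1 / \<bar>\<tau>\<bar> powr (1 + a))"
    have "dir_energy p a h u = (\<integral>\<^sup>+\<tau>. (\<integral>\<^sup>+x. ennreal (\<bar>u x - u (x + \<tau> *\<^sub>R h)\<bar> powr p / \<bar>\<tau>\<bar> powr (1 + a)) \<partial>lborel) \<partial>lborel)"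
      unfolding dir_energy_def by (rule lborel_pair.Fubini'[symmetric]) measurable
    also have "\<dots> = (\<integral>\<^sup>+\<tau>. (\<integral>\<^sup>+x. ennreal (\<bar>u x - u (x + \<tau> *\<^sub>R h)\<bar> powr p) * ennreal (1 / \<bar>\<tau>\<bar> powr (1 + a)) \<partial>lborel) \<partial>lborel)"
      by (simp add: ennreal_mult'[symmetric])
    also have "\<dots> = (\<integral>\<^sup>+\<tau>. ?g \<tau> \<partial>lborel)"
      unfolding G_def by (simp add: nn_integral_multc)
    also have "\<dots> = (\<integral>\<^sup>+\<tau>. ?g \<tau> * indicator {0<..} \<tau> + ?g \<tau> * indicator {0<..} (- \<tau>) \<partial>lborel)"
    proof (rule nn_integral_cong_AE)
      have "AE \<tau>::real in lborel. \<tau> \<noteq> 0" by (rule AE_lborel_singleton)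
      then show "AE \<tau> in lborel. ?g \<tau> = ?g \<tau> * indicator {0<..} \<tau> + ?g \<tau> * indicator {0<..} (- \<tau>)"
        by eventually_elim (auto simp: indicator_def)
    qed
    also have "\<dots> = (\<integral>\<^sup>+\<tau>. ?g \<tau> * indicator {0<..} \<tau> \<partial>lborel) + (\<integral>\<^sup>+\<tau>. ?g \<tau> * indicator {0<..} (- \<tau>) \<partial>lborel)"
      by (rule nn_integral_add) measurable
    also have "(\<integral>\<^sup>+\<tau>. ?g \<tau> * indicator {0<..} (- \<tau>) \<partial>lborel) = (\<integral>\<^sup>+\<tau>. ?g (- \<tau>) * indicator {0<..} (- (- \<tau>)) \<partial>lborel)"
      by (rule nn_integral_lborel_uminus[symmetric]) measurable
    also have "\<dots> = (\<integral>\<^sup>+\<tau>. ?g \<tau> * indicator {0<..} \<tau> \<partial>lborel)"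
      using sym[of "\<tau> *\<^sub>R h" for \<tau>] by simp
    also have "(\<integral>\<^sup>+\<tau>. ?g \<tau> * indicator {0<..} \<tau> \<partial>lborel) = (\<integral>\<^sup>+\<tau>\<in>{0<..}. (G (\<tau> *\<^sub>R h) * ennreal (1 / \<tau> powr (1 + a))) \<partial>lborel)"
      by (intro nn_integral_cong) (auto simp: indicator_def)
    finally show ?thesis by (simp add: mult_2)
  qed
  show ?thesis unfolding 1 2 nn_integral_rays[OF G a, symmetric]
    by (subst nn_integral_cmult[symmetric]) (auto simp: mult.assoc)
qed

lemma dir_energy_lines:
  fixes u :: "'a::euclidean_space => real"
  assumes u[measurable]: "u \<in> borel_measurable borel" and b: "b \<in> Basis" and h: "h \<noteq> 0"
  shows "dir_energy p a h u = ennreal (norm h) *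
    (\<integral>\<^sup>+z. energy1 p a (\<lambda>t. u (reflect (h /\<^sub>R norm h) b z + t *\<^sub>R h)) \<partial>orth b)"
proof -
  have e: "(\<integral>\<^sup>+\<tau>. ennreal (\<bar>u (w + t *\<^sub>R h) - u (w + t *\<^sub>R h + \<tau> *\<^sub>R h)\<bar> powr p / \<bar>\<tau>\<bar> powr (1 + a)) \<partial>lborel) =
     (\<integral>\<^sup>+y. ennreal (\<bar>u (w + t *\<^sub>R h) - u (w + y *\<^sub>R h)\<bar> powr p / \<bar>t - y\<bar> powr (1 + a)) \<partial>lborel)" for w t
  proof -
    have "(\<integral>\<^sup>+\<tau>. ennreal (\<bar>u (w + t *\<^sub>R h) - u (w + (t + \<tau>) *\<^sub>R h)\<bar> powr p / \<bar>t - (t + \<tau>)\<bar> powr (1 + a)) \<partial>lborel) =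
     (\<integral>\<^sup>+y. ennreal (\<bar>u (w + t *\<^sub>R h) - u (w + y *\<^sub>R h)\<bar> powr p / \<bar>t - y\<bar> powr (1 + a)) \<partial>lborel)"
      by (rule nn_integral_lborel_translate) measurable
    then show ?thesis by (simp add: scaleR_add_left add.assoc)
  qed
  show ?thesis
    unfolding dir_energy_def energy1_def e[symmetric]
    by (rule nn_integral_lborel_lines[OF _ b h]) measurable
qed

text \<open>The line inequality is integrated over all lines parallel to \<open>h\<close>. If the
  integrals agree, finiteness gives equality on almost every line, and rigidity there makes the
  Hardy integral of the line vanish.\<close>

lemma dir_energy_lower:
  fixes u :: "'a::euclidean_space => real"
  assumes u[measurable]: "u \<in> borel_measurable borel" and \<Omega>: "open \<Omega>"
    and u0: "\<And>x. x \<notin> \<Omega> ==> u x = 0" and h: "h \<noteq> 0"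
    and line: "\<And>w. line_ineq p a {t. w + t *\<^sub>R h \<in> \<Omega>}"
    and C: "hC p a < \<infinity>"
    and fin: "(\<integral>\<^sup>+x. ennreal (\<bar>u x\<bar> powr p) * gap a \<Omega> x h \<partial>lborel) < \<infinity>"
  shows "2 * (hC p a * (\<integral>\<^sup>+x. ennreal (\<bar>u x\<bar> powr p) * gap a \<Omega> x h \<partial>lborel)) <= dir_energy p a h u"
    and "dir_energy p a h u = 2 * (hC p a * (\<integral>\<^sup>+x. ennreal (\<bar>u x\<bar> powr p) * gap a \<Omega> x h \<partial>lborel)) ==>
      (\<integral>\<^sup>+x. ennreal (\<bar>u x\<bar> powr p) * gap a \<Omega> x h \<partial>lborel) = 0"
proof -
  obtain b :: 'a where b: "b \<in> Basis" using nonempty_Basis by blast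
  interpret sigma_finite_measure "orth b" by (rule sigma_finite_orth[OF b])
  have \<Omega>m[measurable]: "\<Omega> \<in> sets borel" using \<Omega> by simp
  have gm: "(\<lambda>z. gap a \<Omega> (fst z) (snd z)) \<in> borel_measurable (borel \<Otimes>\<^sub>M borel)" by (rule measurable_gap[OF \<Omega>m])
  have [measurable]: "(\<lambda>x. gap a \<Omega> x h) \<in> borel_measurable borel"
    using measurable_compose[OF measurable_Pair2' gm, of h] by simp
  define R where "R = reflect (h /\<^sub>R norm h) b"
  have n1: "norm (h /\<^sub>R norm h) = 1" "norm b = 1" using h b by auto
  have "continuous_on UNIV R" unfolding R_def
    using reflect(1)[OF n1] by (simp add: linear_continuous_on linear_conv_bounded_linear)
  then have [measurable]: "R \<in> borel_measurable borel" by (rule borel_measurable_continuous_onI)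
  define v where "v z t = u (R z + t *\<^sub>R h)" for z t
  define I where "I z = {t. R z + t *\<^sub>R h \<in> \<Omega>}" for z
  have vm: "v z \<in> borel_measurable borel" for z unfolding v_def[abs_def] by measurable
  \<comment> \<open>As \<open>gap\<close> measures distances in multiples of \<open>h\<close>, the
    weight of the set restricts to the one-dimensional weight of its slice without a factor.\<close>
  have g: "gap a \<Omega> (R z + t *\<^sub>R h) h = gap a (I z) t 1" for z t
    unfolding gap_def I_def by (intro INF_cong) (auto simp: scaleR_add_left scaleR_diff_left algebra_simps)
  define Hz where "Hz z = (\<integral>\<^sup>+t. ennreal (\<bar>v z t\<bar> powr p) * gap a (I z) t 1 \<partial>lborel)" for z
  define Ez where "Ez z = energy1 p a (v z)" for z
  have Hz: "Hz z = (\<integral>\<^sup>+t. ennreal (\<bar>u (R z + t *\<^sub>R h)\<bar> powr p) * gap a \<Omega> (R z + t *\<^sub>R h) h \<partial>lborel)" for z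
    unfolding Hz_def v_def g ..
  have Hm[measurable]: "Hz \<in> borel_measurable borel" unfolding Hz[abs_def] by measurable
  have Em[measurable]: "Ez \<in> borel_measurable borel" unfolding Ez_def[abs_def] energy1_def v_def by measurable
  let ?H = "\<integral>\<^sup>+x. ennreal (\<bar>u x\<bar> powr p) * gap a \<Omega> x h \<partial>lborel"
  have H: "?H = ennreal (norm h) * (\<integral>\<^sup>+z. Hz z \<partial>orth b)"
    unfolding Hz R_def by (rule nn_integral_lborel_lines[OF _ b h]) measurable
  have E: "dir_energy p a h u = ennreal (norm h) * (\<integral>\<^sup>+z. Ez z \<partial>orth b)"
    unfolding Ez_def v_def R_def by (rule dir_energy_lines[OF u b h])
  have nh: "0 < norm h" using h by simp
  have Hfin: "(\<integral>\<^sup>+z. Hz z \<partial>orth b) < \<infinity>" using fin nh unfolding H by (auto simp: ennreal_mult_less_top)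
  then have ae: "AE z in orth b. Hz z \<noteq> \<infinity>" by (intro nn_integral_PInf_AE) auto
  have li: "2 * (hC p a * Hz z) <= Ez z" "Ez z = 2 * (hC p a * Hz z) ==> Hz z = 0" if "Hz z \<noteq> \<infinity>" for z
  proof -
    have "\<forall>x. x \<notin> I z \<longrightarrow> v z x = 0" using u0 by (auto simp: v_def I_def)
    moreover have "line_ineq p a (I z)" unfolding I_def by (rule line)
    ultimately show "2 * (hC p a * Hz z) <= Ez z" "Ez z = 2 * (hC p a * Hz z) ==> Hz z = 0"
      using that vm[of z] unfolding line_ineq_def Hz_def Ez_def by (auto simp: less_top)
  qed
  have ge: "AE z in orth b. 2 * (hC p a * Hz z) <= Ez z" using ae by eventually_elim (rule li(1))
  have i2: "(\<integral>\<^sup>+z. 2 * (hC p a * Hz z) \<partial>orth b) = 2 * (hC p a * (\<integral>\<^sup>+z. Hz z \<partial>orth b))"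
    by (simp add: nn_integral_cmult)
  have c: "2 * (hC p a * ?H) = ennreal (norm h) * (\<integral>\<^sup>+z. 2 * (hC p a * Hz z) \<partial>orth b)"
    unfolding H i2 by (simp add: mult_ac)
  show "2 * (hC p a * ?H) <= dir_energy p a h u"
    unfolding c E using ge by (intro mult_left_mono nn_integral_mono_AE) auto
  assume eq: "dir_energy p a h u = 2 * (hC p a * ?H)"
  have "(\<integral>\<^sup>+z. 2 * (hC p a * Hz z) \<partial>orth b) = (\<integral>\<^sup>+z. Ez z \<partial>orth b)"
    using eq nh unfolding c E by (auto simp: ennreal_mult_cancel_left)
  moreover have "(\<integral>\<^sup>+z. 2 * (hC p a * Hz z) \<partial>orth b) < \<infinity>"
    unfolding i2 using C Hfin by (simp add: ennreal_mult_less_top)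
  ultimately have "AE z in orth b. 2 * (hC p a * Hz z) = Ez z"
    using ge by (intro nn_integral_eq_imp_AE_eq) auto
  then have "AE z in orth b. Hz z = 0" using ae by eventually_elim (metis li(2))
  then have "(\<integral>\<^sup>+z. Hz z \<partial>orth b) = 0" by (subst nn_integral_0_iff_AE) auto
  then show "?H = 0" unfolding H by simp
qed

text \<open>For h . b > 0 the number (h . b)^a / a is the integral of \<tau>^(-1-a) over \<tau> > 1
  / (h . b), the part of the ray in the half-space k . b > 1. Averaging over rays turns this into
  the integral of the N-dimensional kernel over that half-space, which slicing evaluates as
  \<open>slice_const\<close> divided by a. The directions with h . b < 0 double the result.\<close>

lemma nn_integral_shell_inner:
  fixes n :: "'a::euclidean_space"
  assumes n: "norm n = 1" and a: "0 < a"
  shows "(\<integral>\<^sup>+h\<in>shell. ennreal (\<bar>h \<bullet> n\<bar> powr a) \<partial>lborel) =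
    2 * (ennreal (shell_const DIM('a) a) * slice_const DIM('a) a)"
proof -
  obtain b :: 'a where b: "b \<in> Basis" using nonempty_Basis by blast
  then have nb: "norm b = 1" by simp
  let ?\<kappa> = "ennreal (shell_const DIM('a) a)"
  have "(\<integral>\<^sup>+h\<in>shell. ennreal (\<bar>h \<bullet> n\<bar> powr a) \<partial>lborel) = (\<integral>\<^sup>+h\<in>shell. ennreal (\<bar>h \<bullet> b\<bar> powr a) \<partial>lborel)"
  proof -
    have "(\<integral>\<^sup>+h\<in>shell. ennreal (\<bar>h \<bullet> n\<bar> powr a) \<partial>lborel) =
       (\<integral>\<^sup>+h. ennreal (\<bar>reflect n b h \<bullet> n\<bar> powr a) * indicator shell (reflect n b h) \<partial>lborel)"
      by (rule nn_integral_lborel_isometry[symmetric]) (use reflect[OF n nb] in auto)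
    also have "\<dots> = (\<integral>\<^sup>+h\<in>shell. ennreal (\<bar>h \<bullet> b\<bar> powr a) \<partial>lborel)"
      using reflect(2)[OF n nb] reflect(6)[OF n nb, of _ b] unfolding reflect(4)[OF n nb]
      by (intro nn_integral_cong) (auto simp: indicator_def shell_def)
    finally show ?thesis .
  qed
  also have "\<dots> = (\<integral>\<^sup>+h. ennreal ((h \<bullet> b) powr a) * indicator {x. 0 < x \<bullet> b} h * indicator shell h +
      ennreal (((- h) \<bullet> b) powr a) * indicator {x. 0 < x \<bullet> b} (- h) * indicator shell (- h) \<partial>lborel)"
    using a by (intro nn_integral_cong) (auto simp: indicator_def shell_def abs_if)
  also have "\<dots> = (\<integral>\<^sup>+h. ennreal ((h \<bullet> b) powr a) * indicator {x. 0 < x \<bullet> b} h * indicator shell h \<partial>lborel) +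
      (\<integral>\<^sup>+h. ennreal (((- h) \<bullet> b) powr a) * indicator {x. 0 < x \<bullet> b} (- h) * indicator shell (- h) \<partial>lborel)"
    by (rule nn_integral_add) measurable
  also have "(\<integral>\<^sup>+h. ennreal (((- h) \<bullet> b) powr a) * indicator {x. 0 < x \<bullet> b} (- h) * indicator shell (- h) \<partial>lborel) =
      (\<integral>\<^sup>+h. ennreal ((h \<bullet> b) powr a) * indicator {x. 0 < x \<bullet> b} h * indicator shell h \<partial>lborel)"
    by (rule nn_integral_lborel_uminus) measurable
  also have "(\<integral>\<^sup>+h. ennreal ((h \<bullet> b) powr a) * indicator {x. 0 < x \<bullet> b} h * indicator shell h \<partial>lborel) =
      ennreal a * (\<integral>\<^sup>+h\<in>shell. (\<integral>\<^sup>+\<tau>\<in>{0<..}. (indicator {k. 1 < k \<bullet> b} (\<tau> *\<^sub>R h) * ennreal (1 / \<tau> powr (1 + a))) \<partial>lborel) \<partial>lborel)"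
  proof -
    have inner: "(\<integral>\<^sup>+\<tau>\<in>{0<..}. (indicator {k. 1 < k \<bullet> b} (\<tau> *\<^sub>R h) * ennreal (1 / \<tau> powr (1 + a))) \<partial>lborel) =
       ennreal (1 / a) * (ennreal ((h \<bullet> b) powr a) * indicator {x. 0 < x \<bullet> b} h)" for h :: 'a
    proof (cases "0 < h \<bullet> b")
      case True
      have AE: "AE \<tau>::real in lborel. \<tau> \<noteq> 1 / (h \<bullet> b)" by (rule AE_lborel_singleton)
      have "(\<integral>\<^sup>+\<tau>\<in>{0<..}. (indicator {k. 1 < k \<bullet> b} (\<tau> *\<^sub>R h) * ennreal (1 / \<tau> powr (1 + a))) \<partial>lborel) =
        (\<integral>\<^sup>+\<tau>\<in>{1 / (h \<bullet> b)..}. ennreal (1 / \<tau> powr (1 + a)) \<partial>lborel)"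
      proof (rule nn_integral_cong_AE, use AE in eventually_elim)
        fix \<tau> assume "\<tau> \<noteq> 1 / (h \<bullet> b)"
        then have "1 < \<tau> * (h \<bullet> b) \<longleftrightarrow> 1 / (h \<bullet> b) <= \<tau>" using True by (auto simp: field_simps)
        moreover have "0 < 1 / (h \<bullet> b)" using True by simp
        then have "1 / (h \<bullet> b) <= \<tau> ==> 0 < \<tau>" by linarith
        ultimately show "indicator {k. 1 < k \<bullet> b} (\<tau> *\<^sub>R h) * ennreal (1 / \<tau> powr (1 + a)) * indicator {0<..} \<tau> =
          ennreal (1 / \<tau> powr (1 + a)) * indicator {1 / (h \<bullet> b)..} \<tau>" by (auto simp: indicator_def)
      qed
      also have "\<dots> = ennreal ((1 / (h \<bullet> b)) powr (- a) / a)" using True by (intro nn_integral_power_tail[OF a]) simp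
      also have "(1 / (h \<bullet> b)) powr (- a) = (h \<bullet> b) powr a"
        by (simp only: powr_divide powr_minus_divide powr_one_eq_one) simp
      finally show ?thesis using True a by (simp add: ennreal_mult'[symmetric])
    next
      case False
      have "(\<integral>\<^sup>+\<tau>\<in>{0<..}. (indicator {k. 1 < k \<bullet> b} (\<tau> *\<^sub>R h) * ennreal (1 / \<tau> powr (1 + a))) \<partial>lborel) =
        (\<integral>\<^sup>+\<tau>. 0 \<partial>(lborel :: real measure))"
      proof (intro nn_integral_cong)
        fix \<tau> :: real
        have "\<not> 1 < \<tau> * (h \<bullet> b)" if "0 < \<tau>" using mult_nonneg_nonpos[of \<tau> "h \<bullet> b"] that False by simp
        then show "indicator {k. 1 < k \<bullet> b} (\<tau> *\<^sub>R h) * ennreal (1 / \<tau> powr (1 + a)) * indicator {0<..} \<tau> = 0"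
          by (auto simp: indicator_def)
      qed
      then show ?thesis using False by simp
    qed
    have aa: "ennreal a * ennreal (1 / a) = 1" using a by (simp add: ennreal_mult'[symmetric])
    show ?thesis
      unfolding inner using aa
      by (subst nn_integral_cmult[symmetric]) (auto intro!: nn_integral_cong simp: mult.assoc[symmetric])
  qed
  also have "(\<integral>\<^sup>+h\<in>shell. (\<integral>\<^sup>+\<tau>\<in>{0<..}. (indicator {k. 1 < k \<bullet> b} (\<tau> *\<^sub>R h) * ennreal (1 / \<tau> powr (1 + a))) \<partial>lborel) \<partial>lborel) =
      ?\<kappa> * (\<integral>\<^sup>+k. indicator {k. 1 < k \<bullet> b} k * ennreal (1 / norm k powr (real DIM('a) + a)) \<partial>lborel)"
    by (rule nn_integral_rays[OF _ a]) measurable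
  also have "(\<integral>\<^sup>+k. indicator {k. 1 < k \<bullet> b} k * ennreal (1 / norm k powr (real DIM('a) + a)) \<partial>lborel) =
      ennreal (1 / a) * slice_const DIM('a) a"
  proof -
    interpret sigma_finite_measure "orth b" by (rule sigma_finite_orth[OF b])
    interpret P: pair_sigma_finite "orth b" "lborel :: real measure" ..
    have "(\<integral>\<^sup>+k. indicator {k. 1 < k \<bullet> b} k * ennreal (1 / norm k powr (real DIM('a) + a)) \<partial>lborel) =
      (\<integral>\<^sup>+z. (\<integral>\<^sup>+r. indicator {k. 1 < k \<bullet> b} (z + r *\<^sub>R b) * ennreal (1 / norm (z + r *\<^sub>R b) powr (real DIM('a) + a)) \<partial>lborel) \<partial>orth b)"
      by (rule nn_integral_lborel_orth[OF _ b]) measurable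
    also have "\<dots> = (\<integral>\<^sup>+r. (\<integral>\<^sup>+z. indicator {k. 1 < k \<bullet> b} (z + r *\<^sub>R b) * ennreal (1 / norm (z + r *\<^sub>R b) powr (real DIM('a) + a)) \<partial>orth b) \<partial>lborel)"
      by (rule P.Fubini'[symmetric]) measurable
    also have "\<dots> = (\<integral>\<^sup>+r. (ennreal (1 / r powr (1 + a)) * indicator {1..} r) * slice_const DIM('a) a \<partial>lborel)"
    proof (rule nn_integral_cong_AE)
      have "AE r::real in lborel. r \<noteq> 1" by (rule AE_lborel_singleton)
      then show "AE r in lborel. (\<integral>\<^sup>+z. indicator {k. 1 < k \<bullet> b} (z + r *\<^sub>R b) * ennreal (1 / norm (z + r *\<^sub>R b) powr (real DIM('a) + a)) \<partial>orth b) =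
         (ennreal (1 / r powr (1 + a)) * indicator {1..} r) * slice_const DIM('a) a"
      proof eventually_elim
        fix r :: real assume r: "r \<noteq> 1"
        have bb: "b \<bullet> b = 1" using b by simp
        have "(\<integral>\<^sup>+z. indicator {k. 1 < k \<bullet> b} (z + r *\<^sub>R b) * ennreal (1 / norm (z + r *\<^sub>R b) powr (real DIM('a) + a)) \<partial>orth b) =
          (\<integral>\<^sup>+z. indicator {1..} r * ennreal (1 / norm (z + r *\<^sub>R b) powr (real DIM('a) + a)) \<partial>orth b)"
          using AE_orth[of b] b r bb
          by (intro nn_integral_cong_AE) (auto elim!: eventually_mono simp: indicator_def inner_add_left)
        also have "\<dots> = indicator {1..} r * (\<integral>\<^sup>+z. ennreal (1 / norm (z + r *\<^sub>R b) powr (real DIM('a) + a)) \<partial>orth b)"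
          by (rule nn_integral_cmult) measurable
        also have "\<dots> = (ennreal (1 / r powr (1 + a)) * indicator {1..} r) * slice_const DIM('a) a"
          using slice_kernel[OF b a, of r] by (cases "1 <= r") auto
        finally show "(\<integral>\<^sup>+z. indicator {k. 1 < k \<bullet> b} (z + r *\<^sub>R b) * ennreal (1 / norm (z + r *\<^sub>R b) powr (real DIM('a) + a)) \<partial>orth b) =
         (ennreal (1 / r powr (1 + a)) * indicator {1..} r) * slice_const DIM('a) a" .
      qed
    qed
    also have "\<dots> = (\<integral>\<^sup>+r\<in>{1..}. ennreal (1 / r powr (1 + a)) \<partial>lborel) * slice_const DIM('a) a"
      by (rule nn_integral_multc) measurable
    finally show ?thesis using nn_integral_power_tail[OF a, of 1] by simp
  qed
  also have "ennreal a * (?\<kappa> * (ennreal (1 / a) * slice_const DIM('a) a)) + ennreal a * (?\<kappa> * (ennreal (1 / a) * slice_const DIM('a) a)) =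
    (ennreal a * ennreal (1 / a)) * (2 * (?\<kappa> * slice_const DIM('a) a))"
    by (simp only: mult_2[symmetric] mult_ac)
  also have "ennreal a * ennreal (1 / a) = 1" using a by (simp add: ennreal_mult'[symmetric])
  finally show ?thesis by simp
qed

text \<open>With \<kappa> the shell constant and S the slice constant, 2 \<kappa> times the energy
  is the integral of directional energies over the shell. This is at least 2 hC times the integral
  of the directional Hardy integrals, which by \<open>gap_ge\<close> and
  \<open>nn_integral_shell_inner\<close> is at least 2 \<kappa> S times the Hardy integral. Dividing
  by 2 \<kappa> gives the bound; equality at the ends forces equality throughout, so almost every
  directional Hardy integral vanishes.\<close>

lemma gagliardo_lower:
  fixes u :: "'a::euclidean_space => real"
  assumes p: "1 < p" and a: "0 < a" "a < p"
    and u[measurable]: "u \<in> borel_measurable borel"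
    and \<Omega>: "open \<Omega>" "convex \<Omega>" "\<Omega> \<noteq> UNIV" and u0: "\<And>x. x \<notin> \<Omega> ==> u x = 0"
    and line: "\<And>w h. line_ineq p a {t. w + t *\<^sub>R h \<in> \<Omega>}"
    and fin: "(\<integral>\<^sup>+x. ennreal (\<bar>u x\<bar> powr p * bdry_dist \<Omega> x powr (- a)) \<partial>lborel) < \<infinity>"
  shows "2 * (hC p a * (slice_const DIM('a) a * (\<integral>\<^sup>+x. ennreal (\<bar>u x\<bar> powr p * bdry_dist \<Omega> x powr (- a)) \<partial>lborel)))
      <= gagliardo p a u"
    and "gagliardo p a u =
      2 * (hC p a * (slice_const DIM('a) a * (\<integral>\<^sup>+x. ennreal (\<bar>u x\<bar> powr p * bdry_dist \<Omega> x powr (- a)) \<partial>lborel))) ==>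
      (\<integral>\<^sup>+x. ennreal (\<bar>u x\<bar> powr p * bdry_dist \<Omega> x powr (- a)) \<partial>lborel) = 0"
proof -
  let ?H = "\<integral>\<^sup>+x. ennreal (\<bar>u x\<bar> powr p * bdry_dist \<Omega> x powr (- a)) \<partial>lborel"
  let ?\<kappa> = "ennreal (shell_const DIM('a) a)"
  let ?S = "slice_const DIM('a) a"
  have DIM1: "1 <= DIM('a)" using DIM_positive[where 'a='a] by linarith
  have S: "0 < ?S" "?S < \<infinity>" using slice_const_eq[OF DIM1 a(1)] by auto
  have \<kappa>: "0 < ?\<kappa>" "?\<kappa> < \<infinity>" using shell_const_pos[OF a(1)] by auto
  have C: "hC p a < \<infinity>" by (rule hC_finite[OF p a])
  have \<Omega>m[measurable]: "\<Omega> \<in> sets borel" using \<Omega> by simp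
  have [measurable]: "bdry_dist \<Omega> \<in> borel_measurable borel"
    unfolding bdry_dist_def[abs_def] by (intro borel_measurable_continuous_onI continuous_intros)
  have gm[measurable]: "(\<lambda>z. gap a \<Omega> (fst z) (snd z)) \<in> borel_measurable (borel \<Otimes>\<^sub>M borel)"
    by (rule measurable_gap[OF \<Omega>m])
  define f where "f x h = ennreal (\<bar>u x\<bar> powr p) * gap a \<Omega> x h" for x h
  have fm[measurable]: "(\<lambda>z. f (fst z) (snd z)) \<in> borel_measurable (borel \<Otimes>\<^sub>M borel)"
    unfolding f_def by measurable
  define Hh where "Hh h = (\<integral>\<^sup>+x. f x h \<partial>lborel)" for h
  have fm2: "(\<lambda>z. f (snd z) (fst z)) \<in> borel_measurable (borel \<Otimes>\<^sub>M borel)"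
    using measurable_pair_swap[OF fm] by (simp add: case_prod_beta')
  have Hm[measurable]: "Hh \<in> borel_measurable borel"
    unfolding Hh_def[abs_def] using lborel.borel_measurable_nn_integral_fst[of "\<lambda>z. f (snd z) (fst z)" borel] fm2 by simp
  have fx[measurable]: "f x \<in> borel_measurable borel" for x
    using measurable_compose[OF measurable_Pair1' fm, of x] by simp
  have fin_h: "Hh h < \<infinity>" if h: "h \<noteq> 0" for h
  proof -
    have "Hh h <= (\<integral>\<^sup>+x. ennreal ((2 * norm h) powr a) * ennreal (\<bar>u x\<bar> powr p * bdry_dist \<Omega> x powr (- a)) \<partial>lborel)"
      unfolding Hh_def
    proof (rule nn_integral_mono)
      fix x
      show "f x h <= ennreal ((2 * norm h) powr a) * ennreal (\<bar>u x\<bar> powr p * bdry_dist \<Omega> x powr (- a))"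
      proof (cases "x \<in> \<Omega>")
        case True
        obtain n y0 where "0 < bdry_dist \<Omega> x" "ball x (bdry_dist \<Omega> x) \<subseteq> \<Omega>"
          using convex_tangent[OF \<Omega> True] by metis
        from gap_finite[OF a(1) this h]
        have "f x h <= ennreal (\<bar>u x\<bar> powr p) * ennreal ((2 * norm h) powr a * bdry_dist \<Omega> x powr (- a))"
          unfolding f_def by (intro mult_left_mono) auto
        then show ?thesis by (simp add: ennreal_mult'[symmetric] mult_ac)
      qed (use u0 p in \<open>simp add: f_def\<close>)
    qed
    also have "\<dots> < \<infinity>" using fin by (simp add: nn_integral_cmult ennreal_mult_less_top)
    finally show ?thesis .
  qed
  have dl1: "2 * (hC p a * Hh h) <= dir_energy p a h u" if h: "h \<noteq> 0" for h
    unfolding Hh_def f_def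
    by (rule dir_energy_lower(1)[OF u \<Omega>(1) _ h line C]) (use u0 fin_h[OF h] in \<open>auto simp: Hh_def f_def\<close>)
  have dl2: "Hh h = 0" if h: "h \<noteq> 0" and e: "dir_energy p a h u = 2 * (hC p a * Hh h)" for h
    unfolding Hh_def f_def
    by (rule dir_energy_lower(2)[OF u \<Omega>(1) _ h line C]) (use u0 fin_h[OF h] e in \<open>auto simp: Hh_def f_def\<close>)
  have shell0: "h \<noteq> 0" if "h \<in> shell" for h :: 'a using that by (auto simp: shell_def)
  have low: "2 * (hC p a * Hh h) * indicator shell h <= dir_energy p a h u * indicator shell h" for h
    using dl1 shell0 by (cases "h \<in> shell") auto
  have dm[measurable]: "(\<lambda>h. dir_energy p a h u) \<in> borel_measurable borel"
    unfolding dir_energy_def by measurable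
  have HH: "2 * (?\<kappa> * ?S) * ?H <= (\<integral>\<^sup>+h\<in>shell. Hh h \<partial>lborel)"
  proof -
    have "2 * (?\<kappa> * ?S) * ?H = (\<integral>\<^sup>+x. 2 * (?\<kappa> * ?S) * ennreal (\<bar>u x\<bar> powr p * bdry_dist \<Omega> x powr (- a)) \<partial>lborel)"
      by (rule nn_integral_cmult[symmetric]) measurable
    also have "\<dots> <= (\<integral>\<^sup>+x. (\<integral>\<^sup>+h. f x h * indicator shell h \<partial>lborel) \<partial>lborel)"
    proof (rule nn_integral_mono)
      fix x
      show "2 * (?\<kappa> * ?S) * ennreal (\<bar>u x\<bar> powr p * bdry_dist \<Omega> x powr (- a)) <= (\<integral>\<^sup>+h. f x h * indicator shell h \<partial>lborel)"
      proof (cases "x \<in> \<Omega>")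
        case True
        obtain n y0 where n: "norm n = 1" "0 < bdry_dist \<Omega> x" "x - y0 = bdry_dist \<Omega> x *\<^sub>R n"
            "\<And>y. y \<in> \<Omega> ==> 0 < n \<bullet> (y - y0)"
          using convex_tangent[OF \<Omega> True] by metis
        have nd: "n \<bullet> (x - y0) = bdry_dist \<Omega> x" using n(1,3) by (simp add: norm_eq_1)
        let ?k = "\<bar>u x\<bar> powr p * bdry_dist \<Omega> x powr (- a)"
        have "2 * (?\<kappa> * ?S) * ennreal ?k = (\<integral>\<^sup>+h. ennreal (\<bar>h \<bullet> n\<bar> powr a) * indicator shell h * ennreal ?k \<partial>lborel)"
          unfolding nn_integral_shell_inner[OF n(1) a(1), symmetric] by (rule nn_integral_multc[symmetric]) measurable
        also have "\<dots> <= (\<integral>\<^sup>+h. f x h * indicator shell h \<partial>lborel)"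
        proof (rule nn_integral_mono)
          fix h
          have "ennreal (\<bar>h \<bullet> n\<bar> powr a) * ennreal ?k = ennreal (\<bar>u x\<bar> powr p) * ennreal (\<bar>h \<bullet> n\<bar> powr a * bdry_dist \<Omega> x powr (- a))"
            by (simp add: ennreal_mult'[symmetric] mult_ac)
          also have "\<dots> <= f x h"
            unfolding f_def by (intro mult_left_mono gap_ge[OF a(1) _ n(2) nd] n(4)) auto
          finally show "ennreal (\<bar>h \<bullet> n\<bar> powr a) * indicator shell h * ennreal ?k <= f x h * indicator shell h"
            by (auto simp: indicator_def)
        qed
        finally show ?thesis .
      qed (use u0 p in simp)
    qed
    also have "\<dots> = (\<integral>\<^sup>+h. (\<integral>\<^sup>+x. f x h * indicator shell h \<partial>lborel) \<partial>lborel)"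
      by (rule lborel_pair.Fubini'[symmetric]) measurable
    also have "\<dots> = (\<integral>\<^sup>+h\<in>shell. Hh h \<partial>lborel)"
    proof (rule nn_integral_cong)
      fix h
      have "(\<lambda>x. f x h) \<in> borel_measurable borel"
        using measurable_compose[OF measurable_Pair2' fm, of h] by simp
      then show "(\<integral>\<^sup>+x. f x h * indicator shell h \<partial>lborel) = Hh h * indicator shell h"
        unfolding Hh_def by (simp add: nn_integral_multc)
    qed
    finally show ?thesis .
  qed
  have int2: "(\<integral>\<^sup>+h. 2 * (hC p a * Hh h) * indicator shell h \<partial>lborel) = 2 * (hC p a * (\<integral>\<^sup>+h\<in>shell. Hh h \<partial>lborel))"
    by (simp add: mult.assoc nn_integral_cmult)
  have E: "2 * (?\<kappa> * gagliardo p a u) = (\<integral>\<^sup>+h. dir_energy p a h u * indicator shell h \<partial>lborel)"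
    by (rule gagliardo_rays[OF u a(1)])
  have E1: "2 * (hC p a * (\<integral>\<^sup>+h\<in>shell. Hh h \<partial>lborel)) <= 2 * (?\<kappa> * gagliardo p a u)"
    unfolding E int2[symmetric] by (rule nn_integral_mono) (rule low)
  have E2: "2 * (hC p a * (2 * (?\<kappa> * ?S) * ?H)) <= 2 * (hC p a * (\<integral>\<^sup>+h\<in>shell. Hh h \<partial>lborel))"
    using HH by (intro mult_left_mono) auto
  have re: "2 * (hC p a * (2 * (?\<kappa> * ?S) * ?H)) = (2 * ?\<kappa>) * (2 * (hC p a * (?S * ?H)))"
    by (simp only: mult_ac)
  have k2: "0 < 2 * ?\<kappa>" "2 * ?\<kappa> < \<infinity>" using \<kappa> by (auto simp: ennreal_mult_less_top ennreal_zero_less_mult_iff)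
  show "2 * (hC p a * (?S * ?H)) <= gagliardo p a u"
  proof -
    have "(2 * ?\<kappa>) * (2 * (hC p a * (?S * ?H))) <= (2 * ?\<kappa>) * gagliardo p a u"
      using order_trans[OF E2 E1] unfolding re by (simp only: mult.assoc)
    then show ?thesis using k2 by (subst (asm) ennreal_mult_le_mult_iff) auto
  qed
  assume eq: "gagliardo p a u = 2 * (hC p a * (?S * ?H))"
  have t: "2 * (?\<kappa> * gagliardo p a u) = 2 * (hC p a * (2 * (?\<kappa> * ?S) * ?H))" unfolding re eq by (simp only: mult.assoc)
  have both: "2 * (hC p a * (\<integral>\<^sup>+h\<in>shell. Hh h \<partial>lborel)) = 2 * (?\<kappa> * gagliardo p a u)"
    using E1 E2 unfolding t by (rule antisym)
  have "2 * (?\<kappa> * gagliardo p a u) < \<infinity>" unfolding t using C fin S \<kappa> by (simp add: ennreal_mult_less_top)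
  then have "AE h in lborel. 2 * (hC p a * Hh h) * indicator shell h = dir_energy p a h u * indicator shell h"
    using both low unfolding int2[symmetric] E by (intro nn_integral_eq_imp_AE_eq) auto
  then have "AE h in lborel. Hh h * indicator shell h = 0"
  proof eventually_elim
    fix h assume e: "2 * (hC p a * Hh h) * indicator shell h = dir_energy p a h u * indicator shell h"
    show "Hh h * indicator shell h = 0"
      using dl2[of h] shell0[of h] e by (cases "h \<in> shell") auto
  qed
  then have "(\<integral>\<^sup>+h\<in>shell. Hh h \<partial>lborel) = 0" by (subst nn_integral_0_iff_AE) auto
  then have "2 * (?\<kappa> * ?S) * ?H = 0" using HH by simp
  then show "?H = 0" using \<kappa> S by auto
qed

subsection \<open>Smooth functions of one variable\<close>

text \<open>The derivative is two-sided and existentially quantified, so on open sets the notion is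
  local and pieces can be glued as in \<open>Ck1_Un\<close>.\<close>

primrec Ck1 :: "nat => real set => (real => real) => bool" where
  "Ck1 0 S g \<longleftrightarrow> continuous_on S g"
| "Ck1 (Suc k) S g \<longleftrightarrow> (\<exists>g'. (\<forall>x\<in>S. (g has_real_derivative g' x) (at x)) \<and> Ck1 k S g')"

lemma Ck1_Suc_imp: "Ck1 (Suc k) S g ==> Ck1 k S g"
proof (induction k arbitrary: g)
  case 0
  then obtain g' where "\<forall>x\<in>S. (g has_real_derivative g' x) (at x)" by auto
  then show ?case
    by (auto intro!: continuous_at_imp_continuous_on DERIV_isCont)
next
  case (Suc k)
  then obtain g' where g': "\<forall>x\<in>S. (g has_real_derivative g' x) (at x)" "Ck1 (Suc k) S g'"
    by (metis Ck1.simps(2))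
  from Suc.IH[OF g'(2)] g'(1) show ?case by auto
qed

lemma Ck1_cong:
  assumes "open S" "\<And>x. x \<in> S ==> f x = g x" "Ck1 k S f"
  shows "Ck1 k S g"
proof (cases k)
  case 0
  then show ?thesis using assms continuous_on_cong[of S S f g] by auto
next
  case (Suc m)
  then obtain f' where f': "\<forall>x\<in>S. (f has_real_derivative f' x) (at x)" "Ck1 m S f'" using assms by auto
  have "\<forall>x\<in>S. (g has_real_derivative f' x) (at x)"
    using f'(1) assms(1,2) by (metis has_field_derivative_transform_within_open)
  then show ?thesis using f'(2) Suc by auto
qed

lemma Ck1_Un:
  assumes "open S" "open T" "Ck1 k S g" "Ck1 k T g"
  shows "Ck1 k (S \<union> T) g"
  using assms(3,4)
proof (induction k arbitrary: g)
  case 0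
  then show ?case using assms(1,2) by (simp add: continuous_on_open_Un)
next
  case (Suc k)
  then obtain f h where f: "\<forall>x\<in>S. (g has_real_derivative f x) (at x)" "Ck1 k S f"
    and h: "\<forall>x\<in>T. (g has_real_derivative h x) (at x)" "Ck1 k T h" by auto
  define l where "l x = (if x \<in> S then f x else h x)" for x
  have l: "\<forall>x\<in>S. f x = l x" "\<forall>x\<in>T. h x = l x"
    using f(1) h(1) by (auto simp: l_def intro: DERIV_unique)
  have "Ck1 k S l" "Ck1 k T l"
    using Ck1_cong[OF assms(1) _ f(2), of l] Ck1_cong[OF assms(2) _ h(2), of l] l by auto
  then have "Ck1 k (S \<union> T) l" by (rule Suc.IH)
  moreover have "\<forall>x\<in>S \<union> T. (g has_real_derivative l x) (at x)" using f(1) h(1) l by auto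
  ultimately show ?case by auto
qed

lemma Ck1_const: "Ck1 k S (\<lambda>x. c)"
proof (induction k arbitrary: c)
  case (Suc k)
  then show ?case by (auto intro!: exI[of _ "\<lambda>x. 0"])
qed simp

lemma Ck1_ident: "Ck1 k S (\<lambda>x. x)"
proof (cases k)
  case (Suc m)
  then show ?thesis using Ck1_const[of m S 1] by (auto intro!: exI[of _ "\<lambda>x. 1"])
qed simp

lemma Ck1_add: "Ck1 k S f ==> Ck1 k S g ==> Ck1 k S (\<lambda>x. f x + g x)"
proof (induction k arbitrary: f g)
  case (Suc k)
  then obtain f' g' where f: "\<forall>x\<in>S. (f has_real_derivative f' x) (at x)" "Ck1 k S f'"
    and g: "\<forall>x\<in>S. (g has_real_derivative g' x) (at x)" "Ck1 k S g'" by auto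
  from Suc.IH[OF f(2) g(2)] f(1) g(1) show ?case
    by (auto intro!: exI[of _ "\<lambda>x. f' x + g' x"] derivative_intros)
qed (auto intro: continuous_on_add)

lemma Ck1_mult: "Ck1 k S f ==> Ck1 k S g ==> Ck1 k S (\<lambda>x. f x * g x)"
proof (induction k arbitrary: f g)
  case (Suc k)
  then obtain f' g' where f: "\<forall>x\<in>S. (f has_real_derivative f' x) (at x)" "Ck1 k S f'"
    and g: "\<forall>x\<in>S. (g has_real_derivative g' x) (at x)" "Ck1 k S g'" by auto
  have "Ck1 k S (\<lambda>x. f' x * g x + g' x * f x)"
    using Suc.IH f(2) g(2) Ck1_Suc_imp[OF Suc.prems(1)] Ck1_Suc_imp[OF Suc.prems(2)] by (intro Ck1_add) auto
  then show ?case using f(1) g(1)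
    by (auto intro!: exI[of _ "\<lambda>x. f' x * g x + g' x * f x"] DERIV_mult)
qed (auto intro: continuous_on_mult)

lemma Ck1_compose: "Ck1 k T f ==> Ck1 k S g ==> (\<And>x. x \<in> S ==> g x \<in> T) ==> Ck1 k S (\<lambda>x. f (g x))"
proof (induction k arbitrary: f g)
  case 0
  then show ?case by (auto intro!: continuous_on_compose2[of T f S g])
next
  case (Suc k)
  then obtain f' g' where f: "\<forall>x\<in>T. (f has_real_derivative f' x) (at x)" "Ck1 k T f'"
    and g: "\<forall>x\<in>S. (g has_real_derivative g' x) (at x)" "Ck1 k S g'" by auto
  have "Ck1 k S (\<lambda>x. f' (g x) * g' x)"
    using Suc.IH[OF f(2) Ck1_Suc_imp[OF Suc.prems(2)] Suc.prems(3)] g(2) by (rule Ck1_mult)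
  moreover have "\<forall>x\<in>S. ((\<lambda>x. f (g x)) has_real_derivative f' (g x) * g' x) (at x)"
    using f(1) g(1) Suc.prems(3) by (auto intro: DERIV_chain2)
  ultimately show ?case by auto
qed

lemma Ck1_exp: "Ck1 k S exp"
proof (induction k)
  case (Suc k)
  then show ?case by (auto intro!: exI[of _ exp] DERIV_exp)
qed (auto intro: continuous_intros)

lemma Ck1_inverse: "Ck1 k {0<..} (\<lambda>x. inverse x)"
proof (induction k)
  case (Suc k)
  have "Ck1 k {0<..} (\<lambda>x. (-1) * (inverse x * inverse x))"
    by (intro Ck1_mult Ck1_const Suc)
  then show ?case
    by (auto intro!: exI[of _ "\<lambda>x. (-1) * (inverse x * inverse x)"] derivative_eq_intros)
qed (auto intro!: continuous_intros)

lemma Ck1_ln: "Ck1 k {0<..} ln"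
proof (cases k)
  case (Suc m)
  then show ?thesis using Ck1_inverse[of m]
    by (auto intro!: exI[of _ "\<lambda>x. inverse x"] DERIV_ln)
qed (auto intro!: continuous_intros)

text \<open>t^(-m) exp(-1/t), extended by 0. The whole family is introduced because differentiating
  one member gives a combination of two others, so a single induction yields smoothness of
  all.\<close>

definition flat :: "nat => real => real" where
  "flat m t = (if 0 < t then (1 / t) ^ m * exp (- (1 / t)) else 0)"

lemma flat_tendsto: "((\<lambda>t. flat m t) \<longlongrightarrow> 0) (at_right 0)"
proof -
  have "((\<lambda>s::real. s ^ m / exp s) \<longlongrightarrow> 0) at_top" by (rule tendsto_power_div_exp_0)
  then have "((\<lambda>t::real. (inverse t) ^ m / exp (inverse t)) \<longlongrightarrow> 0) (at_right 0)"
    by (rule filterlim_compose[OF _ filterlim_inverse_at_top_right])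
  moreover have "\<forall>\<^sub>F t in at_right 0. (inverse t) ^ m / exp (inverse t) = flat m t"
    unfolding eventually_at_right_field
    by (intro exI[of _ 1]) (auto simp: flat_def exp_minus divide_inverse power_inverse)
  ultimately show ?thesis by (rule Lim_transform_eventually)
qed

text \<open>At 0 the right difference quotient of \<open>flat m\<close> is
  \<open>flat (m + 1)\<close>, which tends to 0 there.\<close>

lemma flat_derivative:
  "(flat m has_real_derivative flat (m + 2) t + (- real m) * flat (m + 1) t) (at t)"
proof -
  consider "0 < t" | "t < 0" | "t = 0" by linarith
  then show ?thesis
  proof cases
    case 1
    have "((\<lambda>t. (1 / t) ^ m * exp (- (1 / t))) has_real_derivative
        (1 / t) ^ (m + 2) * exp (- (1 / t)) + (- real m) * ((1 / t) ^ (m + 1) * exp (- (1 / t)))) (at t)"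
    proof -
      have i: "((\<lambda>t. 1 / t) has_real_derivative - ((1 / t)\<^sup>2)) (at t)"
        using 1 by (auto intro!: derivative_eq_intros simp: power2_eq_square)
      have e: "((\<lambda>t. exp (- (1 / t))) has_real_derivative exp (- (1 / t)) * - (- ((1 / t)\<^sup>2))) (at t)"
        by (intro DERIV_fun_exp DERIV_minus i)
      have "real m * (- (q\<^sup>2) * q ^ (m - Suc 0)) = - real m * q ^ (m + 1)" for q :: real
        by (cases m) (auto simp: power2_eq_square algebra_simps)
      from this[of "1 / t"] show ?thesis
        using DERIV_mult[OF DERIV_power[OF i, of m] e] by (simp add: power_add power2_eq_square mult_ac)
    qed
    then have "((\<lambda>t. (1 / t) ^ m * exp (- (1 / t))) has_real_derivative
        flat (m + 2) t + (- real m) * flat (m + 1) t) (at t)"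
      using 1 by (simp add: flat_def)
    then show ?thesis
      by (rule has_field_derivative_transform_within_open[where S = "{0<..}"]) (use 1 in \<open>auto simp: flat_def\<close>)
  next
    case 2
    have "((\<lambda>t. 0) has_real_derivative flat (m + 2) t + (- real m) * flat (m + 1) t) (at t)"
      using 2 by (simp add: flat_def)
    then show ?thesis
      by (rule has_field_derivative_transform_within_open[where S = "{..<0}"]) (use 2 in \<open>auto simp: flat_def\<close>)
  next
    case 3
    have "((\<lambda>h. (flat m (0 + h) - flat m 0) / h) \<longlongrightarrow> 0) (at 0)"
      unfolding filterlim_at_split
    proof
      have "\<forall>\<^sub>F h in at_left 0. 0 = (flat m (0 + h) - flat m 0) / h"
        unfolding eventually_at_left_field by (intro exI[of _ "-1"]) (auto simp: flat_def)
      then show "((\<lambda>h. (flat m (0 + h) - flat m 0) / h) \<longlongrightarrow> 0) (at_left 0)"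
        by (rule Lim_transform_eventually[OF tendsto_const])
      have "\<forall>\<^sub>F h in at_right 0. flat (m + 1) h = (flat m (0 + h) - flat m 0) / h"
        unfolding eventually_at_right_field by (intro exI[of _ 1]) (auto simp: flat_def)
      then show "((\<lambda>h. (flat m (0 + h) - flat m 0) / h) \<longlongrightarrow> 0) (at_right 0)"
        by (rule Lim_transform_eventually[OF flat_tendsto])
    qed
    then have "(flat m has_real_derivative 0) (at 0)" by (simp add: DERIV_def)
    then show ?thesis using 3 by (simp add: flat_def)
  qed
qed

lemma Ck1_flat: "Ck1 k S (flat m)"
proof (induction k arbitrary: m)
  case 0
  show ?case using flat_derivative by (auto intro!: continuous_at_imp_continuous_on DERIV_isCont)
next
  case (Suc k)
  have c: "Ck1 k S (\<lambda>t. flat (m + 2) t + (- real m) * flat (m + 1) t)"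
    by (intro Ck1_add Ck1_mult Ck1_const Suc)
  show ?case unfolding Ck1.simps
    by (rule exI[of _ "\<lambda>t. flat (m + 2) t + (- real m) * flat (m + 1) t"]) (intro conjI ballI flat_derivative c)
qed

definition bump :: "real => real => real => real" where
  "bump l r t = flat 0 (t - l) * flat 0 (r - t)"

lemma flat0: "0 <= flat 0 t" "flat 0 t <= 1" "t <= 0 ==> flat 0 t = 0" "0 < t ==> 0 < flat 0 t"
  by (auto simp: flat_def)

lemma bump: "0 <= bump l r t" "bump l r t <= 1" "t <= l \<or> r <= t ==> bump l r t = 0"
  "l < t ==> t < r ==> 0 < bump l r t"
  using flat0[of "t - l"] flat0[of "r - t"] mult_le_one[of "flat 0 (t - l)" "flat 0 (r - t)"] by (auto simp: bump_def)

lemma bump_support: "bump l r t \<noteq> 0 ==> l < t \<and> t < r"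
  using bump(3)[of t l r] by force

lemma Ck1_bump: "Ck1 k S (bump l r)"
proof -
  have 1: "Ck1 k S (\<lambda>t. flat 0 (t + (- l)))"
    by (rule Ck1_compose[OF Ck1_flat[of k UNIV]]) (intro Ck1_add Ck1_ident Ck1_const, simp)
  have 2: "Ck1 k S (\<lambda>t. flat 0 (r + (-1) * t))"
    by (rule Ck1_compose[OF Ck1_flat[of k UNIV]]) (intro Ck1_add Ck1_mult Ck1_ident Ck1_const, simp)
  have "bump l r = (\<lambda>t. flat 0 (t + (- l)) * flat 0 (r + (-1) * t))" by (auto simp: bump_def)
  then show ?thesis using Ck1_mult[OF 1 2] by simp
qed

lemma measurable_bump[measurable]: "bump l r \<in> borel_measurable borel"
  using Ck1_bump[of 0 UNIV] by (auto intro: borel_measurable_continuous_onI)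

text \<open>The derivative is bounded on the compact interval. Clamping the arguments to it leaves
  the values of \<open>bump\<close> unchanged and does not increase distances.\<close>

lemma bump_Lipschitz:
  assumes "l <= r"
  obtains L where "0 < L" "\<And>x y. \<bar>bump l r x - bump l r y\<bar> <= L * \<bar>x - y\<bar>"
proof -
  have "Ck1 (Suc 0) UNIV (bump l r)" by (rule Ck1_bump)
  then obtain f' where f': "\<And>x. (bump l r has_real_derivative f' x) (at x)" "continuous_on UNIV f'" by auto
  have "compact (f' ` {l..r})"
    using f'(2) by (intro compact_continuous_image continuous_on_subset[OF f'(2)]) auto
  then obtain B where B: "\<And>x. x \<in> {l..r} ==> \<bar>f' x\<bar> <= B"
    using compact_imp_bounded bounded_iff by (metis image_eqI real_norm_def)
  define L where "L = max B 0 + 1"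
  define c where "c x = max l (min r x)" for x
  have c: "bump l r (c x) = bump l r x" "c x \<in> {l..r}" "\<bar>c x - c y\<bar> <= \<bar>x - y\<bar>" for x y
    using assms bump(3)[of x l r] bump(3)[of l l r] bump(3)[of r l r] by (auto simp: c_def max_def min_def)
  have le: "\<bar>bump l r x - bump l r y\<bar> <= L * \<bar>x - y\<bar>" if xy: "x < y" "x \<in> {l..r}" "y \<in> {l..r}" for x y
  proof -
    obtain z where z: "x < z" "z < y" "bump l r y - bump l r x = (y - x) * f' z"
      using MVT2[OF xy(1), of "bump l r" f'] f'(1) by auto
    have "\<bar>f' z\<bar> <= L" using B[of z] z xy by (auto simp: L_def)
    then have "\<bar>y - x\<bar> * \<bar>f' z\<bar> <= \<bar>y - x\<bar> * L" by (intro mult_left_mono) auto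
    moreover have "\<bar>bump l r x - bump l r y\<bar> = \<bar>y - x\<bar> * \<bar>f' z\<bar>"
      unfolding abs_minus_commute[of "bump l r x"] z(3) abs_mult ..
    ultimately show ?thesis by (simp add: mult.commute abs_minus_commute)
  qed
  have le2: "\<bar>bump l r x - bump l r y\<bar> <= L * \<bar>x - y\<bar>" if "x \<in> {l..r}" "y \<in> {l..r}" for x y
    using le[of x y] le[of y x] that by (cases x y rule: linorder_cases) (auto simp: abs_minus_commute)
  have "\<bar>bump l r x - bump l r y\<bar> <= L * \<bar>x - y\<bar>" for x y
  proof -
    have "\<bar>bump l r x - bump l r y\<bar> <= L * \<bar>c x - c y\<bar>" using le2[OF c(2) c(2), of x y] by (simp add: c(1))
    also have "\<dots> <= L * \<bar>x - y\<bar>" using c(3) by (intro mult_left_mono) (auto simp: L_def)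
    finally show ?thesis .
  qed
  moreover have "0 < L" by (simp add: L_def)
  ultimately show thesis using that by blast
qed

subsection \<open>Test functions\<close>

text \<open>A partial derivative of a product of functions of single coordinates is a product of the
  same kind with one factor differentiated, so the induction runs over all families \<psi>.\<close>

lemma Ck_product:
  fixes \<psi> :: "'a::euclidean_space => real => real"
  assumes "\<And>i. i \<in> Basis ==> Ck1 k UNIV (\<psi> i)"
  shows "Ck k (\<lambda>x. \<Prod>i\<in>Basis. \<psi> i (x \<bullet> i))"
  using assms
proof (induction k arbitrary: \<psi>)
  case 0
  have "continuous_on UNIV (\<lambda>x. \<psi> i (x \<bullet> i))" if "i \<in> Basis" for i
  proof -
    have "continuous_on UNIV (\<psi> i)" using 0 that by simp
    moreover have "continuous_on UNIV (\<lambda>x. x \<bullet> i)" by (intro continuous_intros)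
    ultimately show ?thesis using continuous_on_compose2[of UNIV "\<psi> i" UNIV "\<lambda>x. x \<bullet> i"] by simp
  qed
  then show ?case by (simp add: continuous_on_prod)
next
  case (Suc k)
  have "\<forall>i\<in>Basis. \<exists>g'. (\<forall>x. (\<psi> i has_real_derivative g' x) (at x)) \<and> Ck1 k UNIV g'"
    using Suc.prems by auto
  then obtain D where D: "\<And>i x. i \<in> Basis ==> (\<psi> i has_real_derivative D i x) (at x)" "\<And>i. i \<in> Basis ==> Ck1 k UNIV (D i)"
    by metis
  let ?F = "\<lambda>x. \<Prod>i\<in>Basis. \<psi> i (x \<bullet> i)"
  have der: "(?F has_derivative (\<lambda>y. \<Sum>i\<in>Basis. (D i (x \<bullet> i) * (y \<bullet> i)) * (\<Prod>j\<in>Basis - {i}. \<psi> j (x \<bullet> j)))) (at x)" for x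
  proof (rule has_derivative_prod)
    fix i :: 'a assume "i \<in> Basis"
    have "((\<lambda>x. x \<bullet> i) has_derivative (\<lambda>y. y \<bullet> i)) (at x)" by (auto intro!: derivative_eq_intros)
    from DERIV_compose_FDERIV[OF D(1)[OF \<open>i \<in> Basis\<close>] this]
    show "((\<lambda>x. \<psi> i (x \<bullet> i)) has_derivative (\<lambda>y. D i (x \<bullet> i) * (y \<bullet> i))) (at x)" by (simp add: mult.commute)
  qed
  have part: "frechet_derivative ?F (at x) j = (\<Prod>i\<in>Basis. (\<psi>(j := D j)) i (x \<bullet> i))" if j: "j \<in> Basis" for x j
  proof -
    have "frechet_derivative ?F (at x) j = (\<Sum>i\<in>Basis. (D i (x \<bullet> i) * (j \<bullet> i)) * (\<Prod>j\<in>Basis - {i}. \<psi> j (x \<bullet> j)))"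
      using frechet_derivative_at[OF der[of x], symmetric] by (rule fun_cong)
    also have "\<dots> = (\<Sum>i\<in>Basis. if i = j then D j (x \<bullet> j) * (\<Prod>l\<in>Basis - {j}. \<psi> l (x \<bullet> l)) else 0)"
      using j by (intro sum.cong) (auto simp: inner_Basis)
    also have "\<dots> = D j (x \<bullet> j) * (\<Prod>l\<in>Basis - {j}. \<psi> l (x \<bullet> l))" using j by simp
    also have "\<dots> = (\<Prod>i\<in>Basis. (\<psi>(j := D j)) i (x \<bullet> i))"
      using j by (subst prod.remove[OF _ j]) (auto intro!: prod.cong)
    finally show ?thesis .
  qed
  have "Ck k (\<lambda>x. \<Prod>i\<in>Basis. (\<psi>(j := D j)) i (x \<bullet> i))" if j: "j \<in> Basis" for j
    using Suc.prems Ck1_Suc_imp D(2) by (intro Suc.IH) auto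
  moreover have "?F differentiable (at x)" for x using der by (auto simp: differentiable_def)
  ultimately show ?case by (simp add: part cong: ball_cong)
qed

lemma Ck_const0: "Ck k (\<lambda>x. 0)"
  by (induction k) (auto simp: frechet_derivative_const)

lemma Ck_scale_add: "Ck k u ==> Ck k v ==> Ck k (\<lambda>x. c * u x + v x)"
proof (induction k arbitrary: u v)
  case (Suc k)
  have d: "u differentiable (at x)" "v differentiable (at x)" for x using Suc.prems by auto
  have der: "((\<lambda>x. c * u x + v x) has_derivative
      (\<lambda>y. c * frechet_derivative u (at x) y + frechet_derivative v (at x) y)) (at x)" for x
    using d[of x] by (intro has_derivative_add has_derivative_mult_right) (auto simp: frechet_derivative_works)
  have "frechet_derivative (\<lambda>x. c * u x + v x) (at x) i = c * frechet_derivative u (at x) i + frechet_derivative v (at x) i" for x i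
    using frechet_derivative_at[OF der[of x], symmetric] by (rule fun_cong)
  moreover have "(\<lambda>x. c * u x + v x) differentiable (at x)" for x using der by (auto simp: differentiable_def)
  ultimately show ?case using Suc by simp
qed (auto intro!: continuous_intros)

lemma Ck_sum:
  assumes "finite I" "\<And>i. i \<in> I ==> Ck k (u i)"
  shows "Ck k (\<lambda>x. \<Sum>i\<in>I. c i * u i x)"
  using assms by (induction I) (auto intro!: Ck_const0 Ck_scale_add)

text \<open>The partial derivatives of the composition are linear combinations of partial
  derivatives of \<open>u\<close> composed with the same affine map.\<close>

lemma Ck_affine:
  fixes u :: "'a::euclidean_space => real" and A :: "'a => 'a"
  assumes A: "linear A" and u: "Ck k u"
  shows "Ck k (\<lambda>x. u (A x + c))"
  using u
proof (induction k arbitrary: u)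
  case 0
  have "continuous_on UNIV A" using A by (simp add: linear_continuous_on linear_conv_bounded_linear)
  then have "continuous_on UNIV (\<lambda>x. A x + c)" by (intro continuous_intros)
  moreover have "continuous_on UNIV u" using 0 by simp
  ultimately show ?case using continuous_on_compose2[of UNIV u UNIV "\<lambda>x. A x + c"] by simp
next
  case (Suc k)
  have bl: "bounded_linear A" using A by (simp add: linear_conv_bounded_linear)
  have d: "(u has_derivative frechet_derivative u (at x)) (at x)" for x
    using Suc.prems frechet_derivative_works by auto
  have lin: "linear (frechet_derivative u (at x))" for x
    using d[of x] by (auto intro: bounded_linear.linear has_derivative_bounded_linear)
  have der: "((\<lambda>x. u (A x + c)) has_derivative (\<lambda>y. frechet_derivative u (at (A x + c)) (A y))) (at x)" for x
  proof -
    have "((\<lambda>x. A x + c) has_derivative A) (at x)"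
      using bounded_linear_imp_has_derivative[OF bl, of "at x"] has_derivative_add_const by blast
    from has_derivative_compose[OF this d] show ?thesis .
  qed
  have part: "frechet_derivative (\<lambda>x. u (A x + c)) (at x) i =
      (\<Sum>j\<in>Basis. (A i \<bullet> j) * frechet_derivative u (at (A x + c)) j)" for x i
  proof -
    have "frechet_derivative (\<lambda>x. u (A x + c)) (at x) i = frechet_derivative u (at (A x + c)) (A i)"
      using frechet_derivative_at[OF der[of x], symmetric] by (rule fun_cong)
    also have "A i = (\<Sum>j\<in>Basis. (A i \<bullet> j) *\<^sub>R j)" by (rule euclidean_representation[symmetric])
    finally show ?thesis using lin by (simp add: linear_sum linear_scale)
  qed
  have "Ck k (\<lambda>x. \<Sum>j\<in>Basis. (A i \<bullet> j) * frechet_derivative u (at (A x + c)) j)" for i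
    using Suc by (intro Ck_sum) auto
  moreover have "(\<lambda>x. u (A x + c)) differentiable (at x)" for x using der by (auto simp: differentiable_def)
  ultimately show ?case by (simp add: part)
qed

lemma test_functions_scale:
  assumes "u \<in> test_functions \<Omega>" shows "(\<lambda>x. c * u x) \<in> test_functions \<Omega>"
proof -
  have "Ck k (\<lambda>x. c * u x)" for k
    using Ck_scale_add[OF _ Ck_const0, of k u c] assms by (simp add: test_functions_def smooth_def)
  moreover have "closure {x. c * u x \<noteq> 0} \<subseteq> closure {x. u x \<noteq> 0}" by (intro closure_mono) auto
  moreover from this have "compact (closure {x. c * u x \<noteq> 0})"
    using assms unfolding test_functions_def by (metis (mono_tags, lifting) closed_closure compact_Int_closed inf.absorb_iff2 mem_Collect_eq)
  ultimately show ?thesis using assms unfolding test_functions_def smooth_def by blast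
qed

section \<open>The almost optimal functions on the half-space\<close>

definition tang :: "'a::euclidean_space => 'a => real" where
  "tang b x = (\<Prod>i\<in>Basis - {b}. bump (-1) 1 (x \<bullet> i))"

text \<open>A cut-off in the variable \<delta> ln r. It lives on exp(-2/\<delta>) < r <
  exp(-1/\<delta>), a region of logarithmic length 1 / \<delta> that moves to the boundary as
  \<delta> -> 0, while its slope with respect to ln r is of order \<delta>.\<close>

definition prof :: "real => real => real" where
  "prof \<delta> r = (if 0 < r then bump (-2) (-1) (\<delta> * ln r) else 0)"

text \<open>The ground state in the normal direction, cut off logarithmically, times a tangential
  cut-off that does not depend on \<delta>. In dimension one the latter is the empty product
  1.\<close>

definition near_opt :: "real => real => 'a::euclidean_space => 'a => real" where
  "near_opt \<alpha> \<delta> b x = (x \<bullet> b) powr \<alpha> * prof \<delta> (x \<bullet> b) * tang b x"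

lemma prof: "0 <= prof \<delta> r" "prof \<delta> r <= 1" by (auto simp: prof_def bump)

lemma prof_support:
  assumes \<delta>: "0 < \<delta>" and "prof \<delta> r \<noteq> 0"
  shows "exp (- 2 / \<delta>) < r" "r < exp (- 1 / \<delta>)" "0 < r"
proof -
  have r: "0 < r" "- 2 < \<delta> * ln r" "\<delta> * ln r < - 1"
    using assms bump_support[of "-2" "-1" "\<delta> * ln r"] by (auto simp: prof_def split: if_splits)
  then have "- 2 / \<delta> < ln r" "ln r < - 1 / \<delta>" using \<delta> by (auto simp: field_simps)
  then show "exp (- 2 / \<delta>) < r" "r < exp (- 1 / \<delta>)" "0 < r"
    using r by (metis exp_ln exp_less_mono)+
qed

text \<open>On r > 0 this is composed of smooth functions, and it vanishes below exp(-2/\<delta>),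
  which takes care of the singularity of the power at 0.\<close>

lemma Ck1_prof: "0 < \<delta> ==> Ck1 k UNIV (\<lambda>r. r powr \<alpha> * prof \<delta> r)"
proof -
  assume \<delta>: "0 < \<delta>"
  let ?f = "\<lambda>r. r powr \<alpha> * prof \<delta> r"
  have l: "Ck1 k {0<..} (\<lambda>r. c * ln r)" for c by (intro Ck1_mult Ck1_const Ck1_ln)
  have "Ck1 k {0<..} (\<lambda>r. exp (\<alpha> * ln r) * bump (-2) (-1) (\<delta> * ln r))"
    by (intro Ck1_mult Ck1_compose[OF Ck1_exp[of k UNIV] l] Ck1_compose[OF Ck1_bump[of k UNIV] l]) auto
  then have 1: "Ck1 k {0<..} ?f"
    by (rule Ck1_cong[rotated 2]) (auto simp: powr_def prof_def)
  have 2: "Ck1 k {..<exp (- 2 / \<delta>)} ?f"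
    by (rule Ck1_cong[OF _ _ Ck1_const[of k _ 0]]) (use prof_support[OF \<delta>] in force)+
  have "{0<..} \<union> {..<exp (- 2 / \<delta>)} = (UNIV :: real set)" by (auto simp: not_less intro: le_less_trans[OF _ exp_gt_zero])
  then show ?thesis using Ck1_Un[OF _ _ 1 2] by simp
qed

lemma tang: "0 <= tang b x" "tang b x <= 1"
  by (auto simp: tang_def bump intro!: prod_nonneg prod_le_1)

lemma tang_support:
  assumes "tang b x \<noteq> 0" "i \<in> Basis" "i \<noteq> b" shows "\<bar>x \<bullet> i\<bar> < 1"
proof -
  have "bump (-1) 1 (x \<bullet> i) \<noteq> 0" using assms by (auto simp: tang_def)
  then show ?thesis using bump_support[of "-1" 1 "x \<bullet> i"] by (auto simp: abs_if)
qed

lemma near_opt_test: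
  fixes b :: "'a::euclidean_space"
  assumes b: "b \<in> Basis" and \<delta>: "0 < \<delta>"
  shows "near_opt \<alpha> \<delta> b \<in> test_functions (half_space b)"
proof -
  define \<psi> where "\<psi> i = (if i = b then (\<lambda>r. r powr \<alpha> * prof \<delta> r) else bump (-1) 1)" for i :: 'a
  have eq: "near_opt \<alpha> \<delta> b = (\<lambda>x. \<Prod>i\<in>Basis. \<psi> i (x \<bullet> i))"
  proof
    fix x :: 'a
    have "(\<Prod>i\<in>Basis. \<psi> i (x \<bullet> i)) = \<psi> b (x \<bullet> b) * (\<Prod>i\<in>Basis - {b}. \<psi> i (x \<bullet> i))"
      using b by (intro prod.remove) auto
    also have "(\<Prod>i\<in>Basis - {b}. \<psi> i (x \<bullet> i)) = tang b x"
      unfolding tang_def by (intro prod.cong) (auto simp: \<psi>_def)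
    finally show "near_opt \<alpha> \<delta> b x = (\<Prod>i\<in>Basis. \<psi> i (x \<bullet> i))" by (simp add: near_opt_def \<psi>_def)
  qed
  have "Ck k (near_opt \<alpha> \<delta> b)" for k
    unfolding eq using Ck1_prof[OF \<delta>] Ck1_bump by (intro Ck_product) (auto simp: \<psi>_def)
  then have sm: "smooth (near_opt \<alpha> \<delta> b)" by (simp add: smooth_def)
  define u where "u = (\<Sum>i\<in>Basis. (if i = b then exp (- 1 / \<delta>) else 1) *\<^sub>R i)"
  define l where "l = (\<Sum>i\<in>Basis. (if i = b then exp (- 2 / \<delta>) else -1) *\<^sub>R i)"
  have sub: "{x. near_opt \<alpha> \<delta> b x \<noteq> 0} \<subseteq> cbox l u"
  proof
    fix x assume "x \<in> {x. near_opt \<alpha> \<delta> b x \<noteq> 0}"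
    then have n: "prof \<delta> (x \<bullet> b) \<noteq> 0" "tang b x \<noteq> 0" by (auto simp: near_opt_def)
    show "x \<in> cbox l u"
      unfolding mem_box
    proof
      fix i :: 'a assume i: "i \<in> Basis"
      show "l \<bullet> i <= x \<bullet> i \<and> x \<bullet> i <= u \<bullet> i"
        using prof_support[OF \<delta> n(1)] tang_support[OF n(2) i] i b by (auto simp: l_def u_def abs_if split: if_splits)
    qed
  qed
  have cl: "closure {x. near_opt \<alpha> \<delta> b x \<noteq> 0} \<subseteq> cbox l u"
    using sub by (intro closure_minimal) auto
  moreover have "cbox l u \<subseteq> half_space b"
  proof
    fix x assume "x \<in> cbox l u"
    then have "l \<bullet> b <= x \<bullet> b" using b by (auto simp: mem_box)
    moreover have "l \<bullet> b = exp (- 2 / \<delta>)" using b by (simp add: l_def)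
    ultimately show "x \<in> half_space b" unfolding half_space_def using less_le_trans[OF exp_gt_zero[of "- 2 / \<delta>"]] by simp
  qed
  moreover have "compact (closure {x. near_opt \<alpha> \<delta> b x \<noteq> 0})"
    using cl compact_cbox by (metis closed_closure compact_Int_closed inf.absorb_iff2)
  ultimately show ?thesis using sm unfolding test_functions_def by blast
qed

subsection \<open>Integrals entering the upper bound\<close>

text \<open>For a function of the normal coordinate alone, \<open>slice_kernel\<close> integrates
  out the tangential directions and the one-dimensional kernel remains.\<close>

lemma slice_integral:
  fixes b x :: "'a::euclidean_space" and \<Theta> :: "real => ennreal"
  assumes b: "b \<in> Basis" and a: "0 < a" and [measurable]: "\<Theta> \<in> borel_measurable borel"
  shows "(\<integral>\<^sup>+y. \<Theta> (y \<bullet> b) * ennreal (1 / norm (x - y) powr (real DIM('a) + a)) \<partial>lborel) =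
    slice_const DIM('a) a * (\<integral>\<^sup>+\<rho>. \<Theta> \<rho> * ennreal (1 / \<bar>x \<bullet> b - \<rho>\<bar> powr (1 + a)) \<partial>lborel)"
proof -
  interpret sigma_finite_measure "orth b" by (rule sigma_finite_orth[OF b])
  interpret P: pair_sigma_finite "orth b" "lborel :: real measure" ..
  let ?N = "real DIM('a) + a"
  have bb: "b \<bullet> b = 1" using b by simp
  have "(\<integral>\<^sup>+y. \<Theta> (y \<bullet> b) * ennreal (1 / norm (x - y) powr ?N) \<partial>lborel) =
    (\<integral>\<^sup>+k. \<Theta> ((x + k) \<bullet> b) * ennreal (1 / norm (x - (x + k)) powr ?N) \<partial>lborel)"
    by (rule nn_integral_lborel_translate[symmetric]) measurable
  also have "\<dots> = (\<integral>\<^sup>+k. \<Theta> ((x + k) \<bullet> b) * ennreal (1 / norm k powr ?N) \<partial>lborel)" by simp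
  also have "\<dots> = (\<integral>\<^sup>+z. (\<integral>\<^sup>+r. \<Theta> ((x + (z + r *\<^sub>R b)) \<bullet> b) * ennreal (1 / norm (z + r *\<^sub>R b) powr ?N) \<partial>lborel) \<partial>orth b)"
    by (rule nn_integral_lborel_orth[OF _ b]) measurable
  also have "\<dots> = (\<integral>\<^sup>+r. (\<integral>\<^sup>+z. \<Theta> ((x + (z + r *\<^sub>R b)) \<bullet> b) * ennreal (1 / norm (z + r *\<^sub>R b) powr ?N) \<partial>orth b) \<partial>lborel)"
    by (rule P.Fubini'[symmetric]) measurable
  also have "\<dots> = (\<integral>\<^sup>+r. slice_const DIM('a) a * (\<Theta> (x \<bullet> b + r) * ennreal (1 / \<bar>r\<bar> powr (1 + a))) \<partial>lborel)"
  proof (rule nn_integral_cong_AE)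
    have "AE r::real in lborel. r \<noteq> 0" by (rule AE_lborel_singleton)
    then show "AE r in lborel. (\<integral>\<^sup>+z. \<Theta> ((x + (z + r *\<^sub>R b)) \<bullet> b) * ennreal (1 / norm (z + r *\<^sub>R b) powr ?N) \<partial>orth b) =
      slice_const DIM('a) a * (\<Theta> (x \<bullet> b + r) * ennreal (1 / \<bar>r\<bar> powr (1 + a)))"
    proof eventually_elim
      fix r :: real assume r: "r \<noteq> 0"
      have "(\<integral>\<^sup>+z. \<Theta> ((x + (z + r *\<^sub>R b)) \<bullet> b) * ennreal (1 / norm (z + r *\<^sub>R b) powr ?N) \<partial>orth b) =
        (\<integral>\<^sup>+z. \<Theta> (x \<bullet> b + r) * ennreal (1 / norm (z + r *\<^sub>R b) powr ?N) \<partial>orth b)"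
        using AE_orth[of b] b bb
        by (intro nn_integral_cong_AE) (auto elim!: eventually_mono simp: inner_add_left)
      also have "\<dots> = \<Theta> (x \<bullet> b + r) * (\<integral>\<^sup>+z. ennreal (1 / norm (z + r *\<^sub>R b) powr ?N) \<partial>orth b)"
        by (rule nn_integral_cmult) measurable
      finally show "(\<integral>\<^sup>+z. \<Theta> ((x + (z + r *\<^sub>R b)) \<bullet> b) * ennreal (1 / norm (z + r *\<^sub>R b) powr ?N) \<partial>orth b) =
        slice_const DIM('a) a * (\<Theta> (x \<bullet> b + r) * ennreal (1 / \<bar>r\<bar> powr (1 + a)))"
        unfolding slice_kernel[OF b a r] by (simp only: mult_ac)
    qed
  qed
  also have "\<dots> = slice_const DIM('a) a * (\<integral>\<^sup>+r. \<Theta> (x \<bullet> b + r) * ennreal (1 / \<bar>x \<bullet> b - (x \<bullet> b + r)\<bar> powr (1 + a)) \<partial>lborel)"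
    by (subst nn_integral_cmult) auto
  also have "(\<integral>\<^sup>+r. \<Theta> (x \<bullet> b + r) * ennreal (1 / \<bar>x \<bullet> b - (x \<bullet> b + r)\<bar> powr (1 + a)) \<partial>lborel) =
      (\<integral>\<^sup>+\<rho>. \<Theta> \<rho> * ennreal (1 / \<bar>x \<bullet> b - \<rho>\<bar> powr (1 + a)) \<partial>lborel)"
    by (rule nn_integral_lborel_translate) measurable
  finally show ?thesis .
qed

lemma product_integral:
  fixes b :: "'a::euclidean_space" and \<Theta> :: "real => ennreal" and G :: "'a => ennreal"
  assumes b: "b \<in> Basis" and [measurable]: "\<Theta> \<in> borel_measurable borel" "G \<in> borel_measurable borel"
    and G: "\<And>z r. G (z + r *\<^sub>R b) = G z"
  shows "(\<integral>\<^sup>+x. \<Theta> (x \<bullet> b) * G x \<partial>lborel) = (\<integral>\<^sup>+r. \<Theta> r \<partial>lborel) * (\<integral>\<^sup>+z. G z \<partial>orth b)"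
proof -
  have bb: "b \<bullet> b = 1" using b by simp
  have "(\<integral>\<^sup>+x. \<Theta> (x \<bullet> b) * G x \<partial>lborel) = (\<integral>\<^sup>+z. (\<integral>\<^sup>+r. \<Theta> ((z + r *\<^sub>R b) \<bullet> b) * G (z + r *\<^sub>R b) \<partial>lborel) \<partial>orth b)"
    by (rule nn_integral_lborel_orth[OF _ b]) measurable
  also have "\<dots> = (\<integral>\<^sup>+z. (\<integral>\<^sup>+r. \<Theta> r \<partial>lborel) * G z \<partial>orth b)"
    using AE_orth[of b] b bb
    by (intro nn_integral_cong_AE) (auto elim!: eventually_mono simp: G inner_add_left nn_integral_multc)
  also have "\<dots> = (\<integral>\<^sup>+r. \<Theta> r \<partial>lborel) * (\<integral>\<^sup>+z. G z \<partial>orth b)"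
    by (rule nn_integral_cmult) measurable
  finally show ?thesis .
qed

text \<open>Translation invariance is inherited from the whole space: \<open>G\<close> is multiplied
  by the indicator of the unit interval in the normal coordinate, which has integral 1, and the
  tangential part of \<open>c\<close> is used as shift.\<close>

lemma orth_translate:
  fixes b c :: "'a::euclidean_space" and G :: "'a => ennreal"
  assumes b: "b \<in> Basis" and [measurable]: "G \<in> borel_measurable borel"
    and G: "\<And>z r. G (z + r *\<^sub>R b) = G z"
  shows "(\<integral>\<^sup>+z. G (z + c) \<partial>orth b) = (\<integral>\<^sup>+z. G z \<partial>orth b)"
proof -
  let ?i = "\<lambda>r. indicator {0..1::real} r :: ennreal"
  define d where "d = c - (c \<bullet> b) *\<^sub>R b"
  have db: "d \<bullet> b = 0" using b by (simp add: d_def inner_diff_left)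
  have Gd: "G (x + d) = G (x + c)" for x
    using G[of "x + d" "c \<bullet> b"] by (simp add: d_def)
  have one: "(\<integral>\<^sup>+r. ?i r \<partial>lborel) = 1" by (subst nn_integral_indicator) auto
  have "(\<integral>\<^sup>+z. G (z + c) \<partial>orth b) = (\<integral>\<^sup>+x. ?i (x \<bullet> b) * G (x + c) \<partial>lborel)"
  proof -
    have "G (z + r *\<^sub>R b + c) = G (z + c)" for z r using G[of "z + c" r] by (simp add: ac_simps)
    then show ?thesis using product_integral[OF b, of ?i "\<lambda>x. G (x + c)"] one by simp
  qed
  also have "\<dots> = (\<integral>\<^sup>+x. ?i ((d + x) \<bullet> b) * G (d + x) \<partial>lborel)"
    using db Gd by (simp add: inner_add_left add.commute)
  also have "\<dots> = (\<integral>\<^sup>+x. ?i (x \<bullet> b) * G x \<partial>lborel)" by (rule nn_integral_lborel_translate) measurable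
  also have "\<dots> = (\<integral>\<^sup>+z. G z \<partial>orth b)" using product_integral[OF b, of ?i G] one G by simp
  finally show ?thesis .
qed

text \<open>By scaling, the energy density of the ground state is a multiple of 1 / r. The regions
  below and above r contribute equally under t -> 1 / t, once more because \<alpha> p = a -
  1.\<close>

lemma profile_integral:
  fixes a p r :: real
  assumes p: "1 < p" and r: "0 < r"
  defines "\<alpha> \<equiv> (a - 1) / p"
  shows "(\<integral>\<^sup>+\<rho>\<in>{0<..}. ennreal (\<bar>r powr \<alpha> - \<rho> powr \<alpha>\<bar> powr p / \<bar>r - \<rho>\<bar> powr (1 + a)) \<partial>lborel) =
    ennreal (1 / r) * (2 * (\<integral>\<^sup>+t\<in>{0<..<1}. ennreal (\<bar>1 - t powr \<alpha>\<bar> powr p / (1 - t) powr (1 + a)) \<partial>lborel))"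
proof -
  have ap: "\<alpha> * p = a - 1" using p by (simp add: \<alpha>_def)
  define f where "f \<rho> = \<bar>r powr \<alpha> - \<rho> powr \<alpha>\<bar> powr p / \<bar>r - \<rho>\<bar> powr (1 + a)" for \<rho>
  have f[measurable]: "f \<in> borel_measurable borel" unfolding f_def[abs_def] by measurable
  define F where "F t = \<bar>1 - t powr \<alpha>\<bar> powr p / (1 - t) powr (1 + a)" for t
  have F[measurable]: "F \<in> borel_measurable borel" unfolding F_def[abs_def] by measurable
  have im1: "(\<lambda>t. r * t) ` {0<..<1} = {0<..<r}"
  proof (intro set_eqI iffI)
    fix y assume "y \<in> {0<..<r}"
    then show "y \<in> (\<lambda>t. r * t) ` {0<..<1}" using r by (intro image_eqI[of _ _ "y / r"]) auto
  qed (use r in auto)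
  have im2: "(\<lambda>t. r / t) ` {0<..<1} = {r<..}"
  proof (intro set_eqI iffI)
    fix y assume "y \<in> {r<..}"
    then show "y \<in> (\<lambda>t. r / t) ` {0<..<1}" using r by (intro image_eqI[of _ _ "r / y"]) auto
  qed (use r in \<open>auto simp: field_simps\<close>)
  have pull: "(\<integral>\<^sup>+t\<in>{0<..<1}. ennreal (1 / r * F t) \<partial>lborel) = ennreal (1 / r) * (\<integral>\<^sup>+t\<in>{0<..<1}. ennreal (F t) \<partial>lborel)"
    using r by (simp only: ennreal_mult'[of "1 / r"] zero_le_divide_1_iff less_imp_le mult.assoc) (rule nn_integral_cmult, measurable)
  have 1: "(\<integral>\<^sup>+\<rho>\<in>{0<..<r}. ennreal (f \<rho>) \<partial>lborel) = ennreal (1 / r) * (\<integral>\<^sup>+t\<in>{0<..<1}. ennreal (F t) \<partial>lborel)"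
  proof -
    have "(\<integral>\<^sup>+\<rho>\<in>{0<..<r}. ennreal (f \<rho>) \<partial>lborel) = (\<integral>\<^sup>+t\<in>{0<..<1}. ennreal (\<bar>r\<bar> * f (r * t)) \<partial>lborel)"
      unfolding im1[symmetric]
      by (rule nn_integral_change_of_variables_real) (use r in \<open>auto simp: im1 inj_on_def f_def intro!: derivative_eq_intros\<close>)
    also have "\<dots> = (\<integral>\<^sup>+t\<in>{0<..<1}. ennreal (1 / r * F t) \<partial>lborel)"
    proof (rule nn_integral_cong)
      fix t :: real
      have "\<bar>r\<bar> * f (r * t) = 1 / r * F t" if t: "0 < t" "t < 1"
      proof -
        have "r powr \<alpha> - (r * t) powr \<alpha> = r powr \<alpha> * (1 - t powr \<alpha>)" by (simp add: powr_mult algebra_simps)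
        then have "\<bar>r powr \<alpha> - (r * t) powr \<alpha>\<bar> powr p = r powr (\<alpha> * p) * \<bar>1 - t powr \<alpha>\<bar> powr p"
          by (simp add: abs_mult powr_mult powr_powr)
        moreover have "\<bar>r - r * t\<bar> = r * (1 - t)" using r t by (simp add: abs_mult[symmetric] algebra_simps)
        ultimately have "f (r * t) = r powr (a - 1) * \<bar>1 - t powr \<alpha>\<bar> powr p / (r powr (1 + a) * (1 - t) powr (1 + a))"
          unfolding f_def ap by (simp only: powr_mult)
        moreover have "r powr (1 + a) = r * r * r powr (a - 1)"
        proof -
          have "1 + a = 1 + (1 + (a - 1))" by simp
          then have "r powr (1 + a) = r powr (1 + (1 + (a - 1)))" by (rule arg_cong)
          then show ?thesis using r by (simp only: powr_add powr_one)
        qed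
        ultimately show ?thesis using r by (simp add: F_def)
      qed
      then show "ennreal (\<bar>r\<bar> * f (r * t)) * indicator {0<..<1} t = ennreal (1 / r * F t) * indicator {0<..<1} t"
        by (auto simp: indicator_def)
    qed
    finally show ?thesis unfolding pull .
  qed
  have 2: "(\<integral>\<^sup>+\<rho>\<in>{r<..}. ennreal (f \<rho>) \<partial>lborel) = ennreal (1 / r) * (\<integral>\<^sup>+t\<in>{0<..<1}. ennreal (F t) \<partial>lborel)"
  proof -
    have "(\<integral>\<^sup>+\<rho>\<in>{r<..}. ennreal (f \<rho>) \<partial>lborel) = (\<integral>\<^sup>+t\<in>{0<..<1}. ennreal (\<bar>- r / t\<^sup>2\<bar> * f (r / t)) \<partial>lborel)"
      unfolding im2[symmetric]
      by (rule nn_integral_change_of_variables_real)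
        (use r in \<open>auto simp: im2 inj_on_def f_def power2_eq_square intro!: derivative_eq_intros\<close>)
    also have "\<dots> = (\<integral>\<^sup>+t\<in>{0<..<1}. ennreal (1 / r * F t) \<partial>lborel)"
    proof (rule nn_integral_cong)
      fix t :: real
      have "\<bar>- r / t\<^sup>2\<bar> * f (r / t) = 1 / r * F t" if t: "0 < t" "t < 1"
      proof -
        have ta: "0 < t powr \<alpha>" using t by simp
        have "r powr \<alpha> - (r / t) powr \<alpha> = - (r powr \<alpha> / t powr \<alpha> * (1 - t powr \<alpha>))"
          using ta by (simp add: powr_divide field_simps)
        then have A: "\<bar>r powr \<alpha> - (r / t) powr \<alpha>\<bar> powr p = r powr (a - 1) / t powr (a - 1) * \<bar>1 - t powr \<alpha>\<bar> powr p"
          using ta by (simp add: abs_mult powr_mult powr_divide powr_powr ap)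
        have "r - r / t = - (r / t * (1 - t))" using t by (simp add: field_simps)
        then have "\<bar>r - r / t\<bar> = r / t * (1 - t)" using r t by (simp add: abs_mult)
        then have B: "\<bar>r - r / t\<bar> powr (1 + a) = r powr (1 + a) / t powr (1 + a) * (1 - t) powr (1 + a)"
          by (simp only: powr_mult powr_divide)
        have e: "z powr (1 + a) = z * z * z powr (a - 1)" if "0 < z" for z :: real
        proof -
          have "1 + a = 1 + (1 + (a - 1))" by simp
          then have "z powr (1 + a) = z powr (1 + (1 + (a - 1)))" by (rule arg_cong)
          then show ?thesis using that by (simp only: powr_add powr_one)
        qed
        have alg: "r / (t * t) * (R / Ta * U / (r * r * R / (t * t * Ta) * m)) = 1 / r * (U / m)"
          if "0 < R" "0 < Ta" "0 < m" for R Ta U m using that r t by (simp add: field_simps)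
        have abs: "\<bar>- r / t\<^sup>2\<bar> = r / (t * t)" using r t by (simp add: power2_eq_square)
        show ?thesis unfolding abs f_def A B e[OF r] e[OF t(1)] F_def
          using r t by (intro alg) auto
      qed
      then show "ennreal (\<bar>- r / t\<^sup>2\<bar> * f (r / t)) * indicator {0<..<1} t = ennreal (1 / r * F t) * indicator {0<..<1} t"
        by (auto simp: indicator_def)
    qed
    finally show ?thesis unfolding pull .
  qed
  have "(\<integral>\<^sup>+\<rho>\<in>{0<..}. ennreal (f \<rho>) \<partial>lborel) = (\<integral>\<^sup>+\<rho>. ennreal (f \<rho>) * indicator {0<..<r} \<rho> + ennreal (f \<rho>) * indicator {r<..} \<rho> \<partial>lborel)"
  proof (rule nn_integral_cong_AE)
    have "AE \<rho>::real in lborel. \<rho> \<noteq> r" by (rule AE_lborel_singleton)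
    then show "AE \<rho> in lborel. ennreal (f \<rho>) * indicator {0<..} \<rho> = ennreal (f \<rho>) * indicator {0<..<r} \<rho> + ennreal (f \<rho>) * indicator {r<..} \<rho>"
      by eventually_elim (use r in \<open>auto simp: indicator_def\<close>)
  qed
  also have "\<dots> = (\<integral>\<^sup>+\<rho>\<in>{0<..<r}. ennreal (f \<rho>) \<partial>lborel) + (\<integral>\<^sup>+\<rho>\<in>{r<..}. ennreal (f \<rho>) \<partial>lborel)"
    by (rule nn_integral_add) measurable
  also note 1
  also note 2
  finally show ?thesis unfolding f_def F_def mult_2 distrib_left .
qed

text \<open>The part t > 1 is folded onto (0, 1). Close to 1, |ln t| <= 2 (1 - t) leaves the
  exponent p - 1 - a > -1; close to 0 the logarithm costs an arbitrarily small negative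
  power.\<close>

lemma log_kernel_finite:
  assumes p: "1 < p" and a: "0 < a" "a < p"
  shows "(\<integral>\<^sup>+t\<in>{0<..}. ennreal (t powr (a - 1) * \<bar>ln t\<bar> powr p / \<bar>1 - t\<bar> powr (1 + a)) \<partial>lborel) < \<infinity>"
proof -
  define q where "q t = t powr (a - 1) * \<bar>ln t\<bar> powr p / \<bar>1 - t\<bar> powr (1 + a)" for t
  have q[measurable]: "q \<in> borel_measurable borel" unfolding q_def[abs_def] by measurable
  define q2 where "q2 t = \<bar>ln t\<bar> powr p / \<bar>1 - t\<bar> powr (1 + a)" for t
  have q2[measurable]: "q2 \<in> borel_measurable borel" unfolding q2_def[abs_def] by measurable
  \<comment> \<open>Small enough that a - 1 - \<beta> p and - \<beta> p both stay above -1.\<close>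
  define \<beta> where "\<beta> = min a 1 / (2 * p)"
  have \<beta>: "0 < \<beta>" "\<beta> * p <= a / 2" "\<beta> * p <= 1 / 2" using a p by (auto simp: \<beta>_def)
  have im: "(\<lambda>t. 1 / t) ` {0<..<1::real} = {1<..}"
  proof (intro set_eqI iffI)
    fix y :: real assume "y \<in> {1<..}"
    then show "y \<in> (\<lambda>t. 1 / t) ` {0<..<1}" by (intro image_eqI[of _ _ "1 / y"]) auto
  qed auto
  have 2: "(\<integral>\<^sup>+t\<in>{1<..}. ennreal (q t) \<partial>lborel) = (\<integral>\<^sup>+t\<in>{0<..<1}. ennreal (q2 t) \<partial>lborel)"
  proof -
    have "(\<integral>\<^sup>+t\<in>{1<..}. ennreal (q t) \<partial>lborel) = (\<integral>\<^sup>+t\<in>{0<..<1}. ennreal (\<bar>- 1 / t\<^sup>2\<bar> * q (1 / t)) \<partial>lborel)"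
      unfolding im[symmetric]
      by (rule nn_integral_change_of_variables_real)
        (auto simp: im inj_on_def q_def power2_eq_square intro!: derivative_eq_intros)
    also have "\<dots> = (\<integral>\<^sup>+t\<in>{0<..<1}. ennreal (q2 t) \<partial>lborel)"
    proof (rule nn_integral_cong)
      fix t :: real
      have "\<bar>- 1 / t\<^sup>2\<bar> * q (1 / t) = q2 t" if t: "0 < t" "t < 1"
      proof -
        have "\<bar>ln (1 / t)\<bar> = \<bar>ln t\<bar>" using t by (simp add: ln_div)
        moreover have "\<bar>1 - 1 / t\<bar> = \<bar>1 - t\<bar> / t" using t by (simp add: abs_if field_simps)
        ultimately have "q (1 / t) = 1 / t powr (a - 1) * \<bar>ln t\<bar> powr p / (\<bar>1 - t\<bar> powr (1 + a) / t powr (1 + a))"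
          by (simp only: q_def powr_divide powr_one_eq_one)
        moreover have "t powr (1 + a) = t * t * t powr (a - 1)"
        proof -
          have "1 + a = 1 + (1 + (a - 1))" by simp
          then have "t powr (1 + a) = t powr (1 + (1 + (a - 1)))" by (rule arg_cong)
          then show ?thesis using t by (simp only: powr_add powr_one)
        qed
        moreover have alg: "\<bar>- 1 / t\<^sup>2\<bar> * (1 / Ta * U / (m / (t * t * Ta))) = U / m" if "0 < Ta" "0 < m" for Ta U m
          using that t by (simp add: power2_eq_square field_simps)
        ultimately show ?thesis using t by (simp add: q2_def)
      qed
      then show "ennreal (\<bar>- 1 / t\<^sup>2\<bar> * q (1 / t)) * indicator {0<..<1} t = ennreal (q2 t) * indicator {0<..<1} t"
        by (auto simp: indicator_def)
    qed
    finally show ?thesis .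
  qed
  define L where "L = (1 / \<beta>) powr p * 2 powr (1 + a)"
  define K where "K = 3 * 2 powr p"
  have bnd: "q t + q2 t <= L * (t powr (a - 1 - \<beta> * p) + t powr (- (\<beta> * p))) + K * (1 - t) powr (p - 1 - a)" if t: "0 < t" "t < 1" for t
  proof -
    have n1: "0 <= L * (t powr (a - 1 - \<beta> * p) + t powr (- (\<beta> * p)))" "0 <= K * (1 - t) powr (p - 1 - a)"
      by (auto simp: L_def K_def)
    have sum: "q t + q2 t = (t powr (a - 1) + 1) * (\<bar>ln t\<bar> powr p / (1 - t) powr (1 + a))"
      using t by (simp add: q_def q2_def distrib_right add_divide_distrib)
    show ?thesis
    proof (cases "t < 1 / 2")
      case True
      have "ln (t powr (- \<beta>)) <= t powr (- \<beta>) - 1" using t by (intro ln_le_minus_one) simp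
      then have "\<beta> * \<bar>ln t\<bar> <= t powr (- \<beta>)" using t by (simp add: ln_powr)
      then have "\<bar>ln t\<bar> <= 1 / \<beta> * t powr (- \<beta>)" using \<beta>(1) by (simp add: field_simps)
      then have "\<bar>ln t\<bar> powr p <= (1 / \<beta> * t powr (- \<beta>)) powr p" using p by (intro powr_mono2) auto
      also have "\<dots> = (1 / \<beta>) powr p * t powr (- (\<beta> * p))" by (simp only: powr_mult powr_powr minus_mult_left)
      finally have l: "\<bar>ln t\<bar> powr p <= (1 / \<beta>) powr p * t powr (- (\<beta> * p))" .
      have "(1 / 2) powr (1 + a) <= (1 - t) powr (1 + a)" using True a by (intro powr_mono2) auto
      then have "\<bar>ln t\<bar> powr p / (1 - t) powr (1 + a) <= (1 / \<beta>) powr p * t powr (- (\<beta> * p)) / (1 / 2) powr (1 + a)"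
        using l by (intro frac_le) auto
      also have "\<dots> = L * t powr (- (\<beta> * p))" by (simp add: L_def powr_divide)
      finally have "q t + q2 t <= (t powr (a - 1) + 1) * (L * t powr (- (\<beta> * p)))"
        unfolding sum by (intro mult_left_mono) auto
      also have "\<dots> = L * (t powr (a - 1) * t powr (- (\<beta> * p)) + t powr (- (\<beta> * p)))" by (simp add: algebra_simps)
      also have "t powr (a - 1) * t powr (- (\<beta> * p)) = t powr (a - 1 - \<beta> * p)" by (simp add: powr_add[symmetric])
      finally show ?thesis using n1 by linarith
    next
      case False
      have "ln (1 / t) <= 1 / t - 1" using t by (intro ln_le_minus_one) simp
      also have "1 / t - 1 <= 2 * (1 - t)"
      proof -
        have "(1 - t) * 1 <= (1 - t) * (2 * t)" using t False by (intro mult_left_mono) auto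
        then have "1 - t <= 2 * (1 - t) * t" by (simp add: algebra_simps)
        then have "(1 - t) / t <= 2 * (1 - t)" using t by (simp add: pos_divide_le_eq)
        then show ?thesis using t by (simp add: diff_divide_distrib)
      qed
      finally have "\<bar>ln t\<bar> <= 2 * (1 - t)" using t by (simp add: ln_div)
      then have "\<bar>ln t\<bar> powr p <= (2 * (1 - t)) powr p" using p by (intro powr_mono2) auto
      also have "\<dots> = 2 powr p * (1 - t) powr p" by (rule powr_mult)
      finally have "\<bar>ln t\<bar> powr p / (1 - t) powr (1 + a) <= 2 powr p * (1 - t) powr p / (1 - t) powr (1 + a)"
        by (rule divide_right_mono) simp
      also have "\<dots> = 2 powr p * (1 - t) powr (p - 1 - a)"
      proof -
        have "(1 - t) powr p = (1 - t) powr ((p - 1 - a) + (1 + a))" by simp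
        also have "\<dots> = (1 - t) powr (p - 1 - a) * (1 - t) powr (1 + a)" by (rule powr_add)
        finally show ?thesis using t by simp
      qed
      finally have l: "\<bar>ln t\<bar> powr p / (1 - t) powr (1 + a) <= 2 powr p * (1 - t) powr (p - 1 - a)" .
      have "t powr (a - 1) <= t powr (- 1)" using t a by (intro powr_mono') auto
      also have "\<dots> <= 2" using t False by (simp add: powr_minus_divide field_simps)
      finally have "t powr (a - 1) + 1 <= 3" by simp
      then have "q t + q2 t <= 3 * (2 powr p * (1 - t) powr (p - 1 - a))"
        unfolding sum using l by (intro mult_mono) auto
      then show ?thesis using n1 by (simp add: K_def)
    qed
  qed
  have "(\<integral>\<^sup>+t\<in>{0<..}. ennreal (q t) \<partial>lborel) = (\<integral>\<^sup>+t. ennreal (q t) * indicator {0<..<1} t + ennreal (q t) * indicator {1<..} t \<partial>lborel)"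
  proof (rule nn_integral_cong_AE)
    have "AE t::real in lborel. t \<noteq> 1" by (rule AE_lborel_singleton)
    then show "AE t in lborel. ennreal (q t) * indicator {0<..} t = ennreal (q t) * indicator {0<..<1} t + ennreal (q t) * indicator {1<..} t"
      by eventually_elim (auto simp: indicator_def)
  qed
  also have "\<dots> = (\<integral>\<^sup>+t\<in>{0<..<1}. ennreal (q t) \<partial>lborel) + (\<integral>\<^sup>+t\<in>{0<..<1}. ennreal (q2 t) \<partial>lborel)"
    by (simp add: nn_integral_add 2)
  also have "\<dots> = (\<integral>\<^sup>+t. ennreal (q t) * indicator {0<..<1} t + ennreal (q2 t) * indicator {0<..<1} t \<partial>lborel)"
    by (rule nn_integral_add[symmetric]) measurable
  also have "\<dots> <= (\<integral>\<^sup>+t. ennreal L * (ennreal (t powr (a - 1 - \<beta> * p)) * indicator {0<..1} t + ennreal (t powr (- (\<beta> * p))) * indicator {0<..1} t) +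
       ennreal K * (ennreal ((1 - t) powr (p - 1 - a)) * indicator {0<..1} (1 - t)) \<partial>lborel)"
  proof (rule nn_integral_mono)
    fix t :: real
    show "ennreal (q t) * indicator {0<..<1} t + ennreal (q2 t) * indicator {0<..<1} t <=
      ennreal L * (ennreal (t powr (a - 1 - \<beta> * p)) * indicator {0<..1} t + ennreal (t powr (- (\<beta> * p))) * indicator {0<..1} t) +
       ennreal K * (ennreal ((1 - t) powr (p - 1 - a)) * indicator {0<..1} (1 - t))"
    proof (cases "0 < t \<and> t < 1")
      case True
      have "ennreal (q t) + ennreal (q2 t) = ennreal (q t + q2 t)" by (simp add: q_def q2_def)
      also have "\<dots> <= ennreal (L * (t powr (a - 1 - \<beta> * p) + t powr (- (\<beta> * p))) + K * (1 - t) powr (p - 1 - a))"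
        using bnd True by (intro ennreal_leI) auto
      also have "\<dots> = ennreal L * (ennreal (t powr (a - 1 - \<beta> * p)) + ennreal (t powr (- (\<beta> * p)))) + ennreal K * ennreal ((1 - t) powr (p - 1 - a))"
        by (simp add: L_def K_def ennreal_mult')
      finally show ?thesis using True by simp
    qed (auto simp: indicator_def)
  qed
  also have "\<dots> = ennreal L * ((\<integral>\<^sup>+t\<in>{0<..1}. ennreal (t powr (a - 1 - \<beta> * p)) \<partial>lborel) + (\<integral>\<^sup>+t\<in>{0<..1}. ennreal (t powr (- (\<beta> * p))) \<partial>lborel)) +
     ennreal K * (\<integral>\<^sup>+t. ennreal ((1 - t) powr (p - 1 - a)) * indicator {0<..1} (1 - t) \<partial>lborel)"
    by (simp add: nn_integral_add nn_integral_cmult)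
  also have "(\<integral>\<^sup>+t. ennreal ((1 - t) powr (p - 1 - a)) * indicator {0<..1} (1 - t) \<partial>lborel) =
      (\<integral>\<^sup>+t\<in>{0<..1}. ennreal (t powr (p - 1 - a)) \<partial>lborel)"
    by (subst nn_integral_real_affine[where c = "-1" and t = 1]) auto
  also have "ennreal L * ((\<integral>\<^sup>+t\<in>{0<..1}. ennreal (t powr (a - 1 - \<beta> * p)) \<partial>lborel) + (\<integral>\<^sup>+t\<in>{0<..1}. ennreal (t powr (- (\<beta> * p))) \<partial>lborel)) +
     ennreal K * (\<integral>\<^sup>+t\<in>{0<..1}. ennreal (t powr (p - 1 - a)) \<partial>lborel) < \<infinity>"
    using nn_integral_powr_from_0[of "a - 1 - \<beta> * p" 1] nn_integral_powr_from_0[of "- (\<beta> * p)" 1] nn_integral_powr_from_0[of "p - 1 - a" 1] a \<beta>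
    by (simp add: ennreal_mult_less_top)
  finally show ?thesis unfolding q_def .
qed

lemma prof_measurable[measurable]: "prof \<delta> \<in> borel_measurable borel"
  unfolding prof_def[abs_def] by measurable

lemma tang_measurable[measurable]: "tang b \<in> borel_measurable borel"
  unfolding tang_def[abs_def] by measurable

lemma nn_integral_inverse_Icc:
  fixes l u :: real assumes "0 < l" "l <= u"
  shows "(\<integral>\<^sup>+r\<in>{l..u}. ennreal (1 / r) \<partial>lborel) = ennreal (ln u - ln l)"
  using assms by (intro nn_integral_FTC_Icc) (auto intro!: derivative_eq_intros)

text \<open>In the variable s = \<delta> ln r the measure dr / r is ds / \<delta>. On the middle
  half -7/4 <= s <= -5/4 of the support both factors of the bump are at least exp(-4), so the
  integral is at least exp(-8 p) / (2 \<delta>).\<close>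

lemma prof_integral_lower:
  assumes p: "1 < p" and \<delta>: "0 < \<delta>"
  shows "ennreal (1 / \<delta>) <= ennreal (2 * exp (8 * p)) * (\<integral>\<^sup>+r\<in>{0<..}. ennreal (prof \<delta> r powr p / r) \<partial>lborel)"
proof -
  have le: "ennreal (exp (- (8 * p))) * (ennreal (1 / r) * indicator {exp (- (7 / 4) / \<delta>)..exp (- (5 / 4) / \<delta>)} r) <=
    ennreal (prof \<delta> r powr p / r) * indicator {0<..} r" for r
  proof (cases "r \<in> {exp (- (7 / 4) / \<delta>)..exp (- (5 / 4) / \<delta>)}")
    case True
    then have r: "0 < r" by (meson atLeastAtMost_iff exp_gt_zero less_le_trans)
    have "- (7 / 4) / \<delta> <= ln r" "ln r <= - (5 / 4) / \<delta>"
      using True r by (auto simp: ln_ge_iff[symmetric]) (metis ln_exp ln_le_cancel_iff exp_gt_zero)+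
    then have t: "- (7 / 4) <= \<delta> * ln r" "\<delta> * ln r <= - (5 / 4)"
      using \<delta> by (auto simp: field_simps)
    have fl: "exp (- 4) <= flat 0 s" if "1 / 4 <= s" for s
      using that by (auto simp: flat_def field_simps)
    have "exp (- 4) * exp (- 4) <= flat 0 (\<delta> * ln r - - 2) * flat 0 (- 1 - \<delta> * ln r)"
      using t by (intro mult_mono fl) (auto simp: flat0)
    then have "exp (- 8) <= prof \<delta> r" using r by (simp add: prof_def bump_def exp_add[symmetric])
    then have "exp (- 8) powr p <= prof \<delta> r powr p" using p by (intro powr_mono2) auto
    then have "exp (- (8 * p)) <= prof \<delta> r powr p" by (simp add: exp_powr_real)
    then have "ennreal (exp (- (8 * p)) * (1 / r)) <= ennreal (prof \<delta> r powr p / r)"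
      using r by (intro ennreal_leI) (simp add: divide_right_mono)
    then have "ennreal (exp (- (8 * p))) * ennreal (1 / r) <= ennreal (prof \<delta> r powr p / r)"
      by (subst ennreal_mult'[symmetric]) auto
    then show ?thesis using True r by simp
  qed simp
  have "ennreal (exp (- (8 * p))) * ennreal (1 / (2 * \<delta>)) = ennreal (exp (- (8 * p))) * (\<integral>\<^sup>+r\<in>{exp (- (7 / 4) / \<delta>)..exp (- (5 / 4) / \<delta>)}. ennreal (1 / r) \<partial>lborel)"
    using \<delta> by (subst nn_integral_inverse_Icc) (auto simp: field_simps)
  also have "\<dots> <= (\<integral>\<^sup>+r\<in>{0<..}. ennreal (prof \<delta> r powr p / r) \<partial>lborel)"
    using le by (subst nn_integral_cmult[symmetric]) (auto intro: nn_integral_mono)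
  finally have "ennreal (2 * exp (8 * p)) * (ennreal (exp (- (8 * p))) * ennreal (1 / (2 * \<delta>))) <=
      ennreal (2 * exp (8 * p)) * (\<integral>\<^sup>+r\<in>{0<..}. ennreal (prof \<delta> r powr p / r) \<partial>lborel)"
    by (rule mult_left_mono) simp
  moreover have "ennreal (2 * exp (8 * p)) * (ennreal (exp (- (8 * p))) * ennreal (1 / (2 * \<delta>))) = ennreal (1 / \<delta>)"
    using \<delta> by (simp add: ennreal_mult'[symmetric] exp_minus)
  ultimately show ?thesis by simp
qed

text \<open>The Lipschitz bound in \<delta> ln r gives L \<delta> |ln t|, uniformly in r. The
  integrand lives where r or r t lies in the support, and each of these sets has dr / r measure at
  most 1 / \<delta>.\<close>

lemma prof_difference:
  assumes p: "1 < p" and \<delta>: "0 < \<delta>" and t: "0 < t"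
    and L: "0 < L" "\<And>x y. \<bar>bump (-2) (-1) x - bump (-2) (-1) y\<bar> <= L * \<bar>x - y\<bar>"
  shows "(\<integral>\<^sup>+r\<in>{0<..}. ennreal (\<bar>prof \<delta> r - prof \<delta> (r * t)\<bar> powr p / r) \<partial>lborel) <=
    ennreal (2 / \<delta> * (L * \<delta> * \<bar>ln t\<bar>) powr p)"
proof -
  let ?l = "exp (- 2 / \<delta>)" and ?u = "exp (- 1 / \<delta>)"
  have "(\<integral>\<^sup>+r\<in>{0<..}. ennreal (\<bar>prof \<delta> r - prof \<delta> (r * t)\<bar> powr p / r) \<partial>lborel) <=
    (\<integral>\<^sup>+r. ennreal ((L * \<delta> * \<bar>ln t\<bar>) powr p) * (ennreal (1 / r) * indicator {?l..?u} r + ennreal (1 / r) * indicator {?l / t..?u / t} r) \<partial>lborel)"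
  proof (rule nn_integral_mono)
    fix r :: real
    show "ennreal (\<bar>prof \<delta> r - prof \<delta> (r * t)\<bar> powr p / r) * indicator {0<..} r <=
      ennreal ((L * \<delta> * \<bar>ln t\<bar>) powr p) * (ennreal (1 / r) * indicator {?l..?u} r + ennreal (1 / r) * indicator {?l / t..?u / t} r)"
    proof (cases "0 < r \<and> (prof \<delta> r \<noteq> 0 \<or> prof \<delta> (r * t) \<noteq> 0)")
      case True
      then have r: "0 < r" "0 < r * t" using t by auto
      have "\<bar>prof \<delta> r - prof \<delta> (r * t)\<bar> <= L * \<bar>\<delta> * ln r - \<delta> * ln (r * t)\<bar>"
        using L(2) r by (simp add: prof_def)
      also have "\<delta> * ln r - \<delta> * ln (r * t) = - (\<delta> * ln t)" using r t by (simp add: ln_mult algebra_simps)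
      finally have "\<bar>prof \<delta> r - prof \<delta> (r * t)\<bar> <= L * \<delta> * \<bar>ln t\<bar>" using \<delta> by (simp add: abs_mult)
      then have "\<bar>prof \<delta> r - prof \<delta> (r * t)\<bar> powr p <= (L * \<delta> * \<bar>ln t\<bar>) powr p" using p by (intro powr_mono2) auto
      then have "ennreal (\<bar>prof \<delta> r - prof \<delta> (r * t)\<bar> powr p / r) <= ennreal ((L * \<delta> * \<bar>ln t\<bar>) powr p * (1 / r))"
        using r by (intro ennreal_leI) (simp add: divide_right_mono)
      also have "\<dots> = ennreal ((L * \<delta> * \<bar>ln t\<bar>) powr p) * ennreal (1 / r)" by (rule ennreal_mult') simp
      also have "\<dots> <= ennreal ((L * \<delta> * \<bar>ln t\<bar>) powr p) * (ennreal (1 / r) * indicator {?l..?u} r + ennreal (1 / r) * indicator {?l / t..?u / t} r)"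
      proof (rule mult_left_mono)
        have "r \<in> {?l..?u} \<or> r \<in> {?l / t..?u / t}"
          using True prof_support[OF \<delta>, of r] prof_support[OF \<delta>, of "r * t"] t
          by (auto simp: pos_divide_le_eq pos_le_divide_eq)
        then show "ennreal (1 / r) <= ennreal (1 / r) * indicator {?l..?u} r + ennreal (1 / r) * indicator {?l / t..?u / t} r"
          by (auto simp: indicator_def add_increasing)
      qed simp
      finally show ?thesis using r by simp
    next
      case False
      then show ?thesis using p by (auto simp: indicator_def)
    qed
  qed
  also have "\<dots> = ennreal ((L * \<delta> * \<bar>ln t\<bar>) powr p) * ((\<integral>\<^sup>+r\<in>{?l..?u}. ennreal (1 / r) \<partial>lborel) + (\<integral>\<^sup>+r\<in>{?l / t..?u / t}. ennreal (1 / r) \<partial>lborel))"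
    by (simp add: nn_integral_cmult nn_integral_add)
  also have "(\<integral>\<^sup>+r\<in>{?l..?u}. ennreal (1 / r) \<partial>lborel) = ennreal (1 / \<delta>)"
    using \<delta> by (subst nn_integral_inverse_Icc) (auto simp: field_simps)
  also have "(\<integral>\<^sup>+r\<in>{?l / t..?u / t}. ennreal (1 / r) \<partial>lborel) = ennreal (1 / \<delta>)"
    using \<delta> t by (subst nn_integral_inverse_Icc) (auto simp: ln_div divide_right_mono field_simps)
  also have "ennreal ((L * \<delta> * \<bar>ln t\<bar>) powr p) * (ennreal (1 / \<delta>) + ennreal (1 / \<delta>)) = ennreal (2 / \<delta> * (L * \<delta> * \<bar>ln t\<bar>) powr p)"
    using \<delta> by (simp add: ennreal_mult'[symmetric] ennreal_plus[symmetric] mult.commute del: ennreal_plus)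
  finally show ?thesis .
qed

subsection \<open>The energy of the almost optimal functions\<close>

lemma tang_Lipschitz:
  obtains L where "0 < L" "\<And>x y :: 'a::euclidean_space. \<bar>tang b x - tang b y\<bar> <= L * norm (x - y)"
proof -
  obtain L where L: "0 < L" "\<And>x y. \<bar>bump (-1) 1 x - bump (-1) 1 y\<bar> <= L * \<bar>x - y\<bar>"
    by (rule bump_Lipschitz[of "-1" 1]) auto
  have "\<bar>tang b x - tang b y\<bar> <= (real DIM('a) * L) * norm (x - y)" for x y :: 'a
  proof -
    have "\<bar>tang b x - tang b y\<bar> <= (\<Sum>i\<in>Basis - {b}. \<bar>bump (-1) 1 (x \<bullet> i) - bump (-1) 1 (y \<bullet> i)\<bar>)"
      using norm_prod_diff[of "Basis - {b}" "\<lambda>i. bump (-1) 1 (x \<bullet> i)" "\<lambda>i. bump (-1) 1 (y \<bullet> i)"] bump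
      by (auto simp: tang_def)
    also have "\<dots> <= (\<Sum>i\<in>Basis - {b}. L * norm (x - y))"
    proof (rule sum_mono)
      fix i :: 'a assume i: "i \<in> Basis - {b}"
      have "\<bar>x \<bullet> i - y \<bullet> i\<bar> <= norm (x - y)" using i Basis_le_norm[of i "x - y"] by (simp add: inner_diff_left)
      then show "\<bar>bump (-1) 1 (x \<bullet> i) - bump (-1) 1 (y \<bullet> i)\<bar> <= L * norm (x - y)"
        using L by (meson order_trans mult_left_mono less_imp_le)
    qed
    also have "\<dots> <= (\<Sum>i\<in>(Basis::'a set). L * norm (x - y))" using L(1) by (intro sum_mono2) auto
    finally show ?thesis by simp
  qed
  then show ?thesis using that[of "real DIM('a) * L"] L(1) by simp
qed

lemma tang_shift: "b \<in> Basis ==> tang b (z + r *\<^sub>R b) = tang b z"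
  unfolding tang_def by (rule prod.cong) (auto simp: inner_add_left inner_Basis)

lemma norm_le_orth:
  fixes z b :: "'a::euclidean_space"
  assumes "z \<bullet> b = 0" "0 <= c" and "\<And>i. i \<in> Basis ==> i \<noteq> b ==> \<bar>z \<bullet> i\<bar> <= c"
  shows "norm z <= real DIM('a) * c"
proof -
  have "norm z <= (\<Sum>i\<in>(Basis :: 'a set). \<bar>z \<bullet> i\<bar>)" by (rule norm_le_l1)
  also have "\<dots> <= (\<Sum>i\<in>(Basis :: 'a set). c)" using assms by (intro sum_mono) (metis abs_zero)
  finally show ?thesis by simp
qed

lemma tang_mass:
  fixes b :: "'a::euclidean_space"
  assumes b: "b \<in> Basis" and p: "1 < p"
  shows "(\<integral>\<^sup>+z. ennreal (tang b z powr p) \<partial>orth b) < \<infinity>" "0 < (\<integral>\<^sup>+z. ennreal (tang b z powr p) \<partial>orth b)"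
proof -
  have "(\<integral>\<^sup>+z. ennreal (tang b z powr p) \<partial>orth b) <= (\<integral>\<^sup>+z. indicator (cball 0 (real DIM('a))) z \<partial>orth b)"
  proof (rule nn_integral_mono_AE)
    show "AE z in orth b. ennreal (tang b z powr p) <= indicator (cball 0 (real DIM('a))) z"
      using AE_orth
    proof eventually_elim
      fix z :: 'a assume z: "b \<in> Basis \<longrightarrow> z \<bullet> b = 0"
      show "ennreal (tang b z powr p) <= indicator (cball 0 (real DIM('a))) z"
      proof (cases "tang b z = 0")
        case False
        then have "norm z <= real DIM('a) * 1"
          using z b tang_support[of b z] by (intro norm_le_orth[of z b]) (auto intro: less_imp_le)
        moreover have "tang b z powr p <= 1" using tang[of b z] p by (intro powr_le1) auto
        ultimately show ?thesis by (simp add: indicator_def)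
      qed (use p in simp)
    qed
  qed
  also have "\<dots> < \<infinity>" using emeasure_orth_cball[OF b, of "real DIM('a)"] by simp
  finally show "(\<integral>\<^sup>+z. ennreal (tang b z powr p) \<partial>orth b) < \<infinity>" .
  have "(\<integral>\<^sup>+z. ennreal (tang b z powr p) \<partial>orth b) \<noteq> 0"
  proof
    assume "(\<integral>\<^sup>+z. ennreal (tang b z powr p) \<partial>orth b) = 0"
    then have "AE z in orth b. ennreal (tang b z powr p) = 0"
      by (subst (asm) nn_integral_0_iff_AE) measurable
    then have "AE z in orth b. z \<notin> cball 0 (1 / 2)"
    proof eventually_elim
      fix z :: 'a assume z: "ennreal (tang b z powr p) = 0"
      show "z \<notin> cball 0 (1 / 2)"
      proof
        assume z2: "z \<in> cball 0 (1 / 2)"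
        have "0 < bump (-1) 1 (z \<bullet> i)" if "i \<in> Basis" for i
          using Basis_le_norm[OF that, of z] z2 by (intro bump) auto
        then have "0 < tang b z" unfolding tang_def by (intro prod_pos) auto
        then show False using z by simp
      qed
    qed
    then have "emeasure (orth b) (cball 0 (1 / 2)) = 0"
      by (subst (asm) AE_iff_measurable[of "cball 0 (1 / 2)"]) auto
    moreover have "emeasure (orth b) (cball 0 (1 / 2)) = ennreal (unit_ball_vol (real (DIM('a) - 1)) * (1 / 2) ^ (DIM('a) - 1))"
      by (rule emeasure_orth_cball[OF b]) simp
    moreover have "0 < unit_ball_vol (real (DIM('a) - 1)) * (1 / 2) ^ (DIM('a) - 1)"
      by (intro mult_pos_pos unit_ball_vol_pos) auto
    ultimately show False by (metis ennreal_eq_0_iff leD)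
  qed
  then show "0 < (\<integral>\<^sup>+z. ennreal (tang b z powr p) \<partial>orth b)" by (simp add: zero_less_iff_neq_zero)
qed

text \<open>Along a ray the integrand is of order \<tau>^(p-1-a) near 0 and \<tau>^(-1-a) at
  infinity; a < p and a > 0 make both integrable.\<close>

lemma truncated_kernel_finite:
  assumes a: "0 < a" "a < p"
  shows "(\<integral>\<^sup>+k. ennreal (if norm (k :: 'a::euclidean_space) <= 1 then norm k powr p else 1) *
    ennreal (1 / norm k powr (real DIM('a) + a)) \<partial>lborel) < \<infinity>"
proof -
  define G where "G k = ennreal (if norm k <= 1 then norm k powr p else 1)" for k :: 'a
  have G[measurable]: "G \<in> borel_measurable borel" unfolding G_def[abs_def] by measurable
  define M where "M = ennreal (2 powr p) * ennreal (1 / (p - a)) + ennreal (1 / a)"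
  have "ennreal (shell_const DIM('a) a) * (\<integral>\<^sup>+k. G k * ennreal (1 / norm k powr (real DIM('a) + a)) \<partial>lborel) =
    (\<integral>\<^sup>+h\<in>shell. (\<integral>\<^sup>+\<tau>\<in>{0<..}. (G (\<tau> *\<^sub>R h) * ennreal (1 / \<tau> powr (1 + a))) \<partial>lborel) \<partial>lborel)"
    by (rule nn_integral_rays[symmetric]) (use a in auto)
  also have "\<dots> <= (\<integral>\<^sup>+h. M * indicator (shell :: 'a set) h \<partial>lborel)"
  proof (rule nn_integral_mono)
    fix h :: 'a
    show "(\<integral>\<^sup>+\<tau>\<in>{0<..}. (G (\<tau> *\<^sub>R h) * ennreal (1 / \<tau> powr (1 + a))) \<partial>lborel) * indicator shell h <= M * indicator shell h"
    proof (cases "h \<in> shell")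
      case h: True
      have "(\<integral>\<^sup>+\<tau>\<in>{0<..}. (G (\<tau> *\<^sub>R h) * ennreal (1 / \<tau> powr (1 + a))) \<partial>lborel) <=
        (\<integral>\<^sup>+\<tau>. ennreal (2 powr p) * (ennreal (\<tau> powr (p - 1 - a)) * indicator {0<..1} \<tau>) + ennreal (1 / \<tau> powr (1 + a)) * indicator {1..} \<tau> \<partial>lborel)"
      proof (rule nn_integral_mono)
        fix \<tau> :: real
        consider "\<tau> <= 0" | "0 < \<tau>" "\<tau> <= 1" | "1 < \<tau>" by linarith
        then show "G (\<tau> *\<^sub>R h) * ennreal (1 / \<tau> powr (1 + a)) * indicator {0<..} \<tau> <=
          ennreal (2 powr p) * (ennreal (\<tau> powr (p - 1 - a)) * indicator {0<..1} \<tau>) + ennreal (1 / \<tau> powr (1 + a)) * indicator {1..} \<tau>"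
        proof cases
          case 2
          have nh: "norm (\<tau> *\<^sub>R h) <= 2 * \<tau>" using h 2 by (simp add: shell_def)
          have "(if norm (\<tau> *\<^sub>R h) <= 1 then norm (\<tau> *\<^sub>R h) powr p else 1) <= (2 * \<tau>) powr p"
            using nh a by (auto intro!: powr_mono2 ge_one_powr_ge_zero)
          then have "G (\<tau> *\<^sub>R h) * ennreal (1 / \<tau> powr (1 + a)) <= ennreal ((2 * \<tau>) powr p) * ennreal (1 / \<tau> powr (1 + a))"
            unfolding G_def by (intro mult_right_mono ennreal_leI) auto
          also have "\<dots> = ennreal ((2 * \<tau>) powr p * (1 / \<tau> powr (1 + a)))" by (rule ennreal_mult'[symmetric]) simp
          also have "(2 * \<tau>) powr p * (1 / \<tau> powr (1 + a)) = 2 powr p * \<tau> powr (p - 1 - a)"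
            unfolding diff_diff_eq by (simp only: powr_mult powr_diff times_divide_eq_right mult_1_right)
          also have "ennreal \<dots> = ennreal (2 powr p) * ennreal (\<tau> powr (p - 1 - a))" by (rule ennreal_mult') simp
          finally show ?thesis using 2 by (auto simp: add_increasing2)
        next
          case 3
          have "G (\<tau> *\<^sub>R h) <= ennreal 1" unfolding G_def using a by (intro ennreal_leI) (auto intro!: powr_le1)
          then have "G (\<tau> *\<^sub>R h) * ennreal (1 / \<tau> powr (1 + a)) <= ennreal 1 * ennreal (1 / \<tau> powr (1 + a))" by (intro mult_right_mono) auto
          then show ?thesis using 3 by simp
        qed simp
      qed
      also have "\<dots> = ennreal (2 powr p) * (\<integral>\<^sup>+\<tau>\<in>{0<..1}. ennreal (\<tau> powr (p - 1 - a)) \<partial>lborel) + (\<integral>\<^sup>+\<tau>\<in>{1..}. ennreal (1 / \<tau> powr (1 + a)) \<partial>lborel)"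
        by (simp add: nn_integral_add nn_integral_cmult)
      also have "\<dots> = M"
        using nn_integral_powr_from_0[of "p - 1 - a" 1] nn_integral_power_tail[of a 1] a by (simp add: M_def)
      finally show ?thesis using h by simp
    qed simp
  qed
  also have "\<dots> = M * emeasure lborel (shell :: 'a set)" by (simp add: nn_integral_cmult_indicator)
  also have "\<dots> < \<infinity>"
  proof -
    have "emeasure lborel (shell :: 'a set) <= emeasure lborel (cball 0 2 :: 'a set)"
      by (intro emeasure_mono) (auto simp: shell_def)
    also have "\<dots> < \<infinity>" by (rule emeasure_lborel_cball_finite)
    finally show ?thesis using a by (simp add: M_def ennreal_mult_less_top)
  qed
  finally show ?thesis unfolding G_def using shell_const_pos[OF a(1), of "DIM('a)"]
    by (auto simp: ennreal_mult_less_top less_top)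
qed

text \<open>For norm k <= 1 the difference is bounded by the Lipschitz constant on a bounded set,
  for larger k by the mass of \<open>tang\<close> and translation invariance. Both bounds are
  multiples of the weight in \<open>truncated_kernel_finite\<close>.\<close>

lemma tang_energy:
  fixes b :: "'a::euclidean_space"
  assumes b: "b \<in> Basis" and p: "1 < p" and a: "0 < a" "a < p"
  shows "(\<integral>\<^sup>+z. (\<integral>\<^sup>+k. ennreal (\<bar>tang b (z + k) - tang b z\<bar> powr p) * ennreal (1 / norm k powr (real DIM('a) + a)) \<partial>lborel) \<partial>orth b) < \<infinity>"
proof -
  interpret sigma_finite_measure "orth b" by (rule sigma_finite_orth[OF b])
  interpret P: pair_sigma_finite "orth b" "lborel :: 'a measure" ..
  let ?k = "\<lambda>k::'a. ennreal (1 / norm k powr (real DIM('a) + a))"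
  define A where "A = (\<integral>\<^sup>+z. ennreal (tang b z powr p) \<partial>orth b)"
  define V where "V = emeasure (orth b) (cball 0 (real DIM('a) * 2))"
  obtain L where L: "0 < L" "\<And>x y :: 'a. \<bar>tang b x - tang b y\<bar> <= L * norm (x - y)" by (rule tang_Lipschitz[of b]) auto
  define D where "D = ennreal (L powr p) * V + 2 * A"
  have D: "D < \<infinity>" using tang_mass(1)[OF b p] emeasure_orth_cball[OF b, of "real DIM('a) * 2"]
    by (simp add: D_def V_def A_def ennreal_mult_less_top)
  have B: "(\<integral>\<^sup>+z. ennreal (\<bar>tang b (z + k) - tang b z\<bar> powr p) \<partial>orth b) <= D * ennreal (if norm k <= 1 then norm k powr p else 1)" for k
  proof (cases "norm k <= 1")
    case True
    have "(\<integral>\<^sup>+z. ennreal (\<bar>tang b (z + k) - tang b z\<bar> powr p) \<partial>orth b) <=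
      (\<integral>\<^sup>+z. ennreal ((L * norm k) powr p) * indicator (cball 0 (real DIM('a) * 2)) z \<partial>orth b)"
    proof (rule nn_integral_mono_AE)
      show "AE z in orth b. ennreal (\<bar>tang b (z + k) - tang b z\<bar> powr p) <= ennreal ((L * norm k) powr p) * indicator (cball 0 (real DIM('a) * 2)) z"
        using AE_orth
      proof eventually_elim
        fix z :: 'a assume z: "b \<in> Basis \<longrightarrow> z \<bullet> b = 0"
        show "ennreal (\<bar>tang b (z + k) - tang b z\<bar> powr p) <= ennreal ((L * norm k) powr p) * indicator (cball 0 (real DIM('a) * 2)) z"
        proof (cases "tang b (z + k) = 0 \<and> tang b z = 0")
          case False
          have "\<bar>z \<bullet> i\<bar> <= 2" if i: "i \<in> Basis" "i \<noteq> b" for i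
          proof -
            have "\<bar>k \<bullet> i\<bar> <= 1" using Basis_le_norm[OF i(1), of k] True by linarith
            moreover have "\<bar>(z + k) \<bullet> i\<bar> < 1 \<or> \<bar>z \<bullet> i\<bar> < 1"
              using False tang_support[OF _ i] by blast
            ultimately show ?thesis by (auto simp: inner_add_left)
          qed
          then have "norm z <= real DIM('a) * 2" using z b by (intro norm_le_orth[of z b]) auto
          moreover have "\<bar>tang b (z + k) - tang b z\<bar> <= L * norm k" using L(2)[of "z + k" z] by simp
          then have "\<bar>tang b (z + k) - tang b z\<bar> powr p <= (L * norm k) powr p" using p by (intro powr_mono2) auto
          ultimately show ?thesis by (simp add: ennreal_leI)
        qed (use p in simp)
      qed
    qed
    also have "\<dots> = ennreal ((L * norm k) powr p) * V" by (simp add: V_def nn_integral_cmult_indicator)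
    also have "\<dots> = ennreal (L powr p) * V * ennreal (norm k powr p)" by (simp add: powr_mult ennreal_mult' mult_ac)
    also have "\<dots> <= D * ennreal (norm k powr p)" unfolding D_def by (intro mult_right_mono) auto
    finally show ?thesis using True by simp
  next
    case False
    have "(\<integral>\<^sup>+z. ennreal (\<bar>tang b (z + k) - tang b z\<bar> powr p) \<partial>orth b) <=
      (\<integral>\<^sup>+z. ennreal (tang b (z + k) powr p) + ennreal (tang b z powr p) \<partial>orth b)"
    proof (rule nn_integral_mono)
      fix z
      have "\<bar>tang b (z + k) - tang b z\<bar> <= tang b (z + k) \<or> \<bar>tang b (z + k) - tang b z\<bar> <= tang b z"
        using tang(1)[of b z] tang(1)[of b "z + k"] by linarith
      then have "\<bar>tang b (z + k) - tang b z\<bar> powr p <= tang b (z + k) powr p \<or> \<bar>tang b (z + k) - tang b z\<bar> powr p <= tang b z powr p"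
        using p by (auto intro: powr_mono2)
      then have "\<bar>tang b (z + k) - tang b z\<bar> powr p <= tang b (z + k) powr p + tang b z powr p"
        using powr_ge_zero[of "tang b z" p] powr_ge_zero[of "tang b (z + k)" p] by linarith
      then show "ennreal (\<bar>tang b (z + k) - tang b z\<bar> powr p) <= ennreal (tang b (z + k) powr p) + ennreal (tang b z powr p)"
        by (simp add: ennreal_leI flip: ennreal_plus)
    qed
    also have "\<dots> = (\<integral>\<^sup>+z. ennreal (tang b (z + k) powr p) \<partial>orth b) + A"
      unfolding A_def by (rule nn_integral_add) measurable
    also have "(\<integral>\<^sup>+z. ennreal (tang b (z + k) powr p) \<partial>orth b) = A"
      unfolding A_def by (rule orth_translate[OF b]) (auto simp: tang_shift[OF b])
    also have "A + A <= D" by (simp add: D_def mult_2)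
    finally show ?thesis using False by simp
  qed
  have "(\<integral>\<^sup>+z. (\<integral>\<^sup>+k. ennreal (\<bar>tang b (z + k) - tang b z\<bar> powr p) * ?k k \<partial>lborel) \<partial>orth b) =
    (\<integral>\<^sup>+k. (\<integral>\<^sup>+z. ennreal (\<bar>tang b (z + k) - tang b z\<bar> powr p) * ?k k \<partial>orth b) \<partial>lborel)"
    by (rule P.Fubini'[symmetric]) measurable
  also have "\<dots> = (\<integral>\<^sup>+k. (\<integral>\<^sup>+z. ennreal (\<bar>tang b (z + k) - tang b z\<bar> powr p) \<partial>orth b) * ?k k \<partial>lborel)"
    by (intro nn_integral_cong nn_integral_multc) measurable
  also have "\<dots> <= (\<integral>\<^sup>+k. D * (ennreal (if norm k <= 1 then norm k powr p else 1) * ?k k) \<partial>lborel)"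
    unfolding mult.assoc[symmetric] by (intro nn_integral_mono mult_right_mono B) auto
  also have "\<dots> = D * (\<integral>\<^sup>+k. ennreal (if norm k <= 1 then norm k powr p else 1) * ?k k \<partial>lborel)"
    by (rule nn_integral_cmult) measurable
  also have "\<dots> < \<infinity>" using D truncated_kernel_finite[OF a, where 'a='a] by (simp add: ennreal_mult_less_top)
  finally show ?thesis .
qed

text \<open>Convexity for s + t = (1 - l) (s / (1 - l)) + l (t / l). The coefficient of s^p is (1 -
  l)^(1-p), which tends to 1 as l -> 0, at the price of a large coefficient of t^p.\<close>

lemma powr_add_le:
  fixes s t p l :: real
  assumes p: "1 < p" and l: "0 < l" "l < 1" and st: "0 <= s" "0 <= t"
  shows "(s + t) powr p <= (1 - l) * (1 / (1 - l)) powr p * s powr p + l * (1 / l) powr p * t powr p"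
proof -
  have e: "s + t = (1 - l) * (s / (1 - l)) + (1 - (1 - l)) * (t / l)" using l by simp
  have c: "(s / (1 - l)) powr p = (1 / (1 - l)) powr p * s powr p" "(t / l) powr p = (1 / l) powr p * t powr p"
    by (simp_all add: powr_mult[symmetric])
  show ?thesis
  proof (cases "s / (1 - l) = t / l")
    case True
    have "s + t = t / l" using e l unfolding True by (simp add: field_simps)
    then have "(s + t) powr p = (1 - l) * (s / (1 - l)) powr p + l * (t / l) powr p" unfolding True by (simp add: algebra_simps)
    then show ?thesis unfolding c by (simp add: mult.assoc)
  next
    case False
    have "(s + t) powr p < (1 - l) * \<bar>s / (1 - l)\<bar> powr p + (1 - (1 - l)) * (t / l) powr p"
      by (rule abs_powr_convex_strict[OF p _ _ _ e _ False]) (use l st in auto)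
    moreover have "\<bar>s / (1 - l)\<bar> = s / (1 - l)" using l st by simp
    ultimately show ?thesis by (simp add: c mult.assoc)
  qed
qed

text \<open>The difference is telescoped. The change of the ground state is the main term and
  receives the coefficient close to 1; the changes of the two cut-offs are errors, with a
  coefficient that depends on \<open>l\<close>.\<close>

lemma powr_product_difference:
  fixes p l w w' X X' T T' :: real
  assumes p: "1 < p" and l: "0 < l" "l < 1" and nn: "0 <= w'" "0 <= X" "0 <= X'" "0 <= T"
  shows "\<bar>w * X * T - w' * X' * T'\<bar> powr p <=
    (1 - l) * (1 / (1 - l)) powr p * ((X * T) powr p * \<bar>w - w'\<bar> powr p) +
    l * (1 / l) powr p * 2 powr p * (w' powr p * (T powr p * \<bar>X - X'\<bar> powr p) + w' powr p * (X' powr p * \<bar>T - T'\<bar> powr p))"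
proof -
  define s where "s = X * T * \<bar>w - w'\<bar>"
  define u where "u = w' * (T * \<bar>X - X'\<bar>)"
  define v where "v = w' * (X' * \<bar>T - T'\<bar>)"
  have nn': "0 <= s" "0 <= u" "0 <= v" using nn by (auto simp: s_def u_def v_def)
  have "w * X * T - w' * X' * T' = X * T * (w - w') + (w' * (T * (X - X')) + w' * (X' * (T - T')))" by (simp add: algebra_simps)
  also have "\<bar>\<dots>\<bar> <= \<bar>X * T * (w - w')\<bar> + (\<bar>w' * (T * (X - X'))\<bar> + \<bar>w' * (X' * (T - T'))\<bar>)" by linarith
  also have "\<dots> = s + (u + v)" using nn by (simp add: s_def u_def v_def abs_mult)
  finally have "\<bar>w * X * T - w' * X' * T'\<bar> powr p <= (s + (u + v)) powr p" using p by (intro powr_mono2) auto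
  also have "\<dots> <= (1 - l) * (1 / (1 - l)) powr p * s powr p + l * (1 / l) powr p * (u + v) powr p"
    using nn' by (intro powr_add_le p l) auto
  also have "(u + v) powr p <= 2 powr p * (u powr p + v powr p)"
  proof -
    have "(u + v) powr p <= (2 * max u v) powr p" using nn' p by (intro powr_mono2) auto
    also have "\<dots> = 2 powr p * max u v powr p" by (rule powr_mult)
    also have "max u v powr p <= u powr p + v powr p" by (auto simp: max_def)
    finally show ?thesis by (simp add: mult_left_mono)
  qed
  then have "l * (1 / l) powr p * (u + v) powr p <= l * (1 / l) powr p * (2 powr p * (u powr p + v powr p))"
    using l by (intro mult_left_mono) auto
  finally show ?thesis unfolding s_def u_def v_def by (simp only: powr_mult mult.assoc add_left_mono)
qed

text \<open>The substitution \<rho> = r t separates the variables: the integral over r is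
  \<open>prof_difference\<close>, and the one over t is the kernel of
  \<open>log_kernel_finite\<close>. The bound is of order \<delta>^(p-1).\<close>

lemma radial_difference:
  assumes p: "1 < p" and \<delta>: "0 < \<delta>"
    and L: "0 < L" "\<And>x y. \<bar>bump (-2) (-1) x - bump (-2) (-1) y\<bar> <= L * \<bar>x - y\<bar>"
  shows "(\<integral>\<^sup>+r\<in>{0<..}. (\<integral>\<^sup>+\<rho>\<in>{0<..}. ennreal (\<rho> powr (a - 1) * \<bar>prof \<delta> r - prof \<delta> \<rho>\<bar> powr p / \<bar>r - \<rho>\<bar> powr (1 + a)) \<partial>lborel) \<partial>lborel) <=
    ennreal (2 / \<delta> * (L * \<delta>) powr p) * (\<integral>\<^sup>+t\<in>{0<..}. ennreal (t powr (a - 1) * \<bar>ln t\<bar> powr p / \<bar>1 - t\<bar> powr (1 + a)) \<partial>lborel)"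
proof -
  define W where "W t = ennreal (t powr (a - 1) / \<bar>1 - t\<bar> powr (1 + a)) * indicator {0<..} t" for t :: real
  have W[measurable]: "W \<in> borel_measurable borel" unfolding W_def[abs_def] by measurable
  define Y where "Y r t = ennreal (\<bar>prof \<delta> r - prof \<delta> (r * t)\<bar> powr p / r) * indicator {0<..} r" for r t
  have Y[measurable]: "(\<lambda>z. Y (fst z) (snd z)) \<in> borel_measurable (borel \<Otimes>\<^sub>M borel)" unfolding Y_def[abs_def] by measurable
  have Y1[measurable]: "(\<lambda>r. Y r t) \<in> borel_measurable borel" for t unfolding Y_def[abs_def] by measurable
  have "(\<integral>\<^sup>+r\<in>{0<..}. (\<integral>\<^sup>+\<rho>\<in>{0<..}. ennreal (\<rho> powr (a - 1) * \<bar>prof \<delta> r - prof \<delta> \<rho>\<bar> powr p / \<bar>r - \<rho>\<bar> powr (1 + a)) \<partial>lborel) \<partial>lborel) =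
    (\<integral>\<^sup>+r. (\<integral>\<^sup>+t. W t * Y r t \<partial>lborel) \<partial>lborel)"
  proof (rule nn_integral_cong)
    fix r :: real
    show "(\<integral>\<^sup>+\<rho>\<in>{0<..}. ennreal (\<rho> powr (a - 1) * \<bar>prof \<delta> r - prof \<delta> \<rho>\<bar> powr p / \<bar>r - \<rho>\<bar> powr (1 + a)) \<partial>lborel) * indicator {0<..} r =
      (\<integral>\<^sup>+t. W t * Y r t \<partial>lborel)"
    proof (cases "0 < r")
      case r: True
      have "(\<integral>\<^sup>+\<rho>\<in>{0<..}. ennreal (\<rho> powr (a - 1) * \<bar>prof \<delta> r - prof \<delta> \<rho>\<bar> powr p / \<bar>r - \<rho>\<bar> powr (1 + a)) \<partial>lborel) =
        ennreal r * (\<integral>\<^sup>+t. ennreal ((r * t) powr (a - 1) * \<bar>prof \<delta> r - prof \<delta> (r * t)\<bar> powr p / \<bar>r - r * t\<bar> powr (1 + a)) * indicator {0<..} (r * t) \<partial>lborel)"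
        using r by (subst nn_integral_real_affine[where c = r and t = 0]) auto
      also have "\<dots> = (\<integral>\<^sup>+t. ennreal r * (ennreal ((r * t) powr (a - 1) * \<bar>prof \<delta> r - prof \<delta> (r * t)\<bar> powr p / \<bar>r - r * t\<bar> powr (1 + a)) * indicator {0<..} (r * t)) \<partial>lborel)"
        by (rule nn_integral_cmult[symmetric]) measurable
      also have "\<dots> = (\<integral>\<^sup>+t. W t * Y r t \<partial>lborel)"
      proof (rule nn_integral_cong)
        fix t :: real
        show "ennreal r * (ennreal ((r * t) powr (a - 1) * \<bar>prof \<delta> r - prof \<delta> (r * t)\<bar> powr p / \<bar>r - r * t\<bar> powr (1 + a)) * indicator {0<..} (r * t)) = W t * Y r t"
        proof (cases "0 < t")
          case t: True
          have "r - r * t = r * (1 - t)" by (simp add: algebra_simps)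
          then have "\<bar>r - r * t\<bar> = r * \<bar>1 - t\<bar>" using r by (simp only: abs_mult abs_of_pos)
          moreover have "r powr (1 + a) = r * (r * r powr (a - 1))"
          proof -
            have "1 + a = 1 + (1 + (a - 1))" by simp
            then have "r powr (1 + a) = r powr (1 + (1 + (a - 1)))" by (rule arg_cong)
            then show ?thesis using r by (simp only: powr_add powr_one)
          qed
          ultimately have "r * ((r * t) powr (a - 1) * \<bar>prof \<delta> r - prof \<delta> (r * t)\<bar> powr p / \<bar>r - r * t\<bar> powr (1 + a)) =
            t powr (a - 1) / \<bar>1 - t\<bar> powr (1 + a) * (\<bar>prof \<delta> r - prof \<delta> (r * t)\<bar> powr p / r)"
            using r by (simp add: powr_mult)
          then show ?thesis using r t by (simp add: W_def Y_def ennreal_mult'[symmetric])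
        qed (use r in \<open>auto simp: W_def indicator_def zero_less_mult_iff\<close>)
      qed
      finally show ?thesis using r by simp
    qed (simp add: Y_def)
  qed
  also have "\<dots> = (\<integral>\<^sup>+t. (\<integral>\<^sup>+r. W t * Y r t \<partial>lborel) \<partial>lborel)"
    by (rule lborel_pair.Fubini'[symmetric]) measurable
  also have "\<dots> = (\<integral>\<^sup>+t. W t * (\<integral>\<^sup>+r. Y r t \<partial>lborel) \<partial>lborel)"
    by (intro nn_integral_cong nn_integral_cmult) measurable
  also have "\<dots> <= (\<integral>\<^sup>+t. ennreal (2 / \<delta> * (L * \<delta>) powr p) * (ennreal (t powr (a - 1) * \<bar>ln t\<bar> powr p / \<bar>1 - t\<bar> powr (1 + a)) * indicator {0<..} t) \<partial>lborel)"
  proof (rule nn_integral_mono)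
    fix t :: real
    show "W t * (\<integral>\<^sup>+r. Y r t \<partial>lborel) <= ennreal (2 / \<delta> * (L * \<delta>) powr p) * (ennreal (t powr (a - 1) * \<bar>ln t\<bar> powr p / \<bar>1 - t\<bar> powr (1 + a)) * indicator {0<..} t)"
    proof (cases "0 < t")
      case t: True
      have "W t * (\<integral>\<^sup>+r. Y r t \<partial>lborel) <= W t * ennreal (2 / \<delta> * (L * \<delta> * \<bar>ln t\<bar>) powr p)"
        unfolding Y_def by (intro mult_left_mono prof_difference p \<delta> t L) auto
      also have "\<dots> = ennreal (t powr (a - 1) / \<bar>1 - t\<bar> powr (1 + a) * (2 / \<delta> * (L * \<delta> * \<bar>ln t\<bar>) powr p))"
        using t \<delta> by (simp add: W_def ennreal_mult'[symmetric])
      also have "t powr (a - 1) / \<bar>1 - t\<bar> powr (1 + a) * (2 / \<delta> * (L * \<delta> * \<bar>ln t\<bar>) powr p) =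
          2 / \<delta> * (L * \<delta>) powr p * (t powr (a - 1) * \<bar>ln t\<bar> powr p / \<bar>1 - t\<bar> powr (1 + a))"
        by (simp only: powr_mult[of "L * \<delta>"]) (simp add: mult_ac)
      also have "ennreal \<dots> = ennreal (2 / \<delta> * (L * \<delta>) powr p) * ennreal (t powr (a - 1) * \<bar>ln t\<bar> powr p / \<bar>1 - t\<bar> powr (1 + a))"
        using \<delta> by (intro ennreal_mult') auto
      finally show ?thesis using t by simp
    qed (simp add: W_def)
  qed
  also have "\<dots> = ennreal (2 / \<delta> * (L * \<delta>) powr p) * (\<integral>\<^sup>+t\<in>{0<..}. ennreal (t powr (a - 1) * \<bar>ln t\<bar> powr p / \<bar>1 - t\<bar> powr (1 + a)) \<partial>lborel)"
    by (rule nn_integral_cmult) measurable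
  finally show ?thesis .
qed

text \<open>The exponents a - 1 and - a leave 1 / r, so the Hardy integral is the dr / r mass of the
  profile, at least of order 1 / \<delta>, times a fixed tangential mass.\<close>

lemma near_opt_mass:
  fixes b :: "'a::euclidean_space" and a p :: real
  assumes p: "1 < p" and b: "b \<in> Basis"
  defines "\<alpha> \<equiv> (a - 1) / p"
  shows "(\<integral>\<^sup>+x\<in>half_space b. ennreal (near_opt \<alpha> \<delta> b x powr p * (x \<bullet> b) powr (- a)) \<partial>lborel) =
    (\<integral>\<^sup>+r\<in>{0<..}. ennreal (prof \<delta> r powr p / r) \<partial>lborel) * (\<integral>\<^sup>+z. ennreal (tang b z powr p) \<partial>orth b)"
proof -
  have ap: "\<alpha> * p = a - 1" using p by (simp add: \<alpha>_def)
  have "(\<integral>\<^sup>+x\<in>half_space b. ennreal (near_opt \<alpha> \<delta> b x powr p * (x \<bullet> b) powr (- a)) \<partial>lborel) =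
    (\<integral>\<^sup>+x. (ennreal (prof \<delta> (x \<bullet> b) powr p / (x \<bullet> b)) * indicator {0<..} (x \<bullet> b)) * ennreal (tang b x powr p) \<partial>lborel)"
  proof (rule nn_integral_cong)
    fix x :: 'a
    show "ennreal (near_opt \<alpha> \<delta> b x powr p * (x \<bullet> b) powr (- a)) * indicator (half_space b) x =
      (ennreal (prof \<delta> (x \<bullet> b) powr p / (x \<bullet> b)) * indicator {0<..} (x \<bullet> b)) * ennreal (tang b x powr p)"
    proof (cases "0 < x \<bullet> b")
      case True
      have e: "(x \<bullet> b) powr (a - 1) * (x \<bullet> b) powr (- a) = 1 / (x \<bullet> b)"
        using True by (simp add: powr_diff powr_minus_divide)
      have "near_opt \<alpha> \<delta> b x powr p * (x \<bullet> b) powr (- a) =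
          prof \<delta> (x \<bullet> b) powr p * tang b x powr p * ((x \<bullet> b) powr (a - 1) * (x \<bullet> b) powr (- a))"
        by (simp only: near_opt_def powr_mult powr_powr ap mult_ac)
      also have "\<dots> = prof \<delta> (x \<bullet> b) powr p / (x \<bullet> b) * tang b x powr p" unfolding e by simp
      finally have "ennreal (near_opt \<alpha> \<delta> b x powr p * (x \<bullet> b) powr (- a)) =
          ennreal (prof \<delta> (x \<bullet> b) powr p / (x \<bullet> b)) * ennreal (tang b x powr p)"
        by (simp only: ennreal_mult''[OF powr_ge_zero])
      then show ?thesis using True by (simp add: half_space_def)
    qed (simp add: half_space_def)
  qed
  also have "\<dots> = (\<integral>\<^sup>+r\<in>{0<..}. ennreal (prof \<delta> r powr p / r) \<partial>lborel) * (\<integral>\<^sup>+z. ennreal (tang b z powr p) \<partial>orth b)"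
    by (rule product_integral[OF b]) (auto simp: tang_shift[OF b])
  finally show ?thesis .
qed

lemma gagliardo_pair:
  fixes u :: "'a::euclidean_space => real"
  assumes [measurable]: "u \<in> borel_measurable borel"
  shows "gagliardo p a u =
    (\<integral>\<^sup>+x. \<integral>\<^sup>+y. ennreal (\<bar>u x - u y\<bar> powr p) * ennreal (1 / norm (x - y) powr (real DIM('a) + a)) \<partial>lborel \<partial>lborel)"
proof -
  have "(\<integral>\<^sup>+k. ennreal (\<bar>u x - u (x + k)\<bar> powr p / norm k powr (real DIM('a) + a)) \<partial>lborel) =
    (\<integral>\<^sup>+y. ennreal (\<bar>u x - u y\<bar> powr p) * ennreal (1 / norm (x - y) powr (real DIM('a) + a)) \<partial>lborel)" for x
    using nn_integral_lborel_translate[of "\<lambda>y. ennreal (\<bar>u x - u y\<bar> powr p) * ennreal (1 / norm (x - y) powr (real DIM('a) + a))" x]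
    by (simp add: ennreal_mult'[symmetric])
  then show ?thesis unfolding gagliardo_def by simp
qed

text \<open>\<open>D\<close> is independent of \<delta>. The ground state term \<open>F1\<close> and
  the interaction \<open>F4\<close> with the complement give the sharp constant times the Hardy
  integral. The profile error \<open>F2\<close> is of order \<delta>^(p-1), that is \<delta>^p
  relative to the Hardy integral; the tangential error \<open>F3\<close> is exp(-a/\<delta>)
  relative to it, since r < exp(-1/\<delta>) on the support.\<close>

lemma near_opt_energy:
  fixes b :: "'a::euclidean_space" and a p l :: real
  assumes p: "1 < p" and a: "0 < a" "a < p" and b: "b \<in> Basis" and l: "0 < l" "l < 1"
  defines "\<alpha> \<equiv> (a - 1) / p"
  obtains D where "D < \<infinity>" "\<And>\<delta>. 0 < \<delta> ==> gagliardo p a (near_opt \<alpha> \<delta> b) <=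
    (ennreal ((1 - l) * (1 / (1 - l)) powr p) * (2 * (hC p a * slice_const DIM('a) a)) + D * (ennreal (\<delta> powr p) + ennreal (exp (- a / \<delta>)))) *
    (\<integral>\<^sup>+x\<in>half_space b. ennreal (near_opt \<alpha> \<delta> b x powr p * (x \<bullet> b) powr (- a)) \<partial>lborel)"
proof -
  have ap: "\<alpha> * p = a - 1" using p by (simp add: \<alpha>_def)
  have bb: "b \<bullet> b = 1" using b by simp
  define \<kappa> where "\<kappa> x y = ennreal (1 / norm (x - y) powr (real DIM('a) + a))" for x y :: 'a
  have \<kappa>[measurable]: "(\<lambda>y. \<kappa> x y) \<in> borel_measurable borel" "(\<lambda>x. \<kappa> x y) \<in> borel_measurable borel" for x y
    unfolding \<kappa>_def[abs_def] by measurable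
  have \<kappa>_sym: "\<kappa> x y = \<kappa> y x" for x y by (simp add: \<kappa>_def norm_minus_commute)
  define S where "S = slice_const DIM('a) a"
  define K where "K = (\<integral>\<^sup>+t\<in>{0<..<1}. ennreal (\<bar>1 - t powr \<alpha>\<bar> powr p / (1 - t) powr (1 + a)) \<partial>lborel)"
  define A where "A = (\<integral>\<^sup>+z. ennreal (tang b z powr p) \<partial>orth b)"
  define Q where "Q = (\<integral>\<^sup>+t\<in>{0<..}. ennreal (t powr (a - 1) * \<bar>ln t\<bar> powr p / \<bar>1 - t\<bar> powr (1 + a)) \<partial>lborel)"
  define M where "M = (\<integral>\<^sup>+z. (\<integral>\<^sup>+k. ennreal (\<bar>tang b (z + k) - tang b z\<bar> powr p) * ennreal (1 / norm k powr (real DIM('a) + a)) \<partial>lborel) \<partial>orth b)"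
  define c1 where "c1 = ennreal ((1 - l) * (1 / (1 - l)) powr p)"
  define c2 where "c2 = ennreal (l * (1 / l) powr p * 2 powr p)"
  have A: "A < \<infinity>" "0 < A" unfolding A_def by (rule tang_mass[OF b p])+
  \<comment> \<open>Lets the exterior term, which enters without this coefficient, be absorbed into
    the main term.\<close>
  have c1: "1 <= c1"
  proof -
    have "(1 / (1 - l)) powr 1 <= (1 / (1 - l)) powr p" using l p by (intro powr_mono) (auto simp: field_simps)
    then have "1 <= (1 - l) * (1 / (1 - l)) powr p" using l by (simp add: field_simps)
    then show ?thesis unfolding c1_def by simp
  qed
  obtain L where L: "0 < L" "\<And>x y. \<bar>bump (-2) (-1) x - bump (-2) (-1) y\<bar> <= L * \<bar>x - y\<bar>"
    by (rule bump_Lipschitz[of "-2" "-1"]) auto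
  \<comment> \<open>In \<open>D1\<close> the bound of \<open>prof_integral_lower\<close> has
    replaced 1 / \<delta> by a multiple of the profile mass; in \<open>D2\<close> the division by
    the tangential mass \<open>A\<close> expresses the error through the Hardy integral.\<close>
  define D1 where "D1 = c2 * (S * (ennreal (2 * L powr p) * (Q * ennreal (2 * exp (8 * p)))))"
  define D2 where "D2 = c2 * (M / A)"
  have Df: "D1 + D2 < \<infinity>"
  proof -
    have "S < \<infinity>" using slice_const_eq(1)[of "DIM('a)" a] a by (simp add: S_def Suc_le_eq)
    moreover have "Q < \<infinity>" unfolding Q_def by (rule log_kernel_finite[OF p a])
    moreover have "M < \<infinity>" unfolding M_def by (rule tang_energy[OF b p a])
    moreover have "M / A \<noteq> top" using \<open>M < \<infinity>\<close> A(2) by (auto simp: ennreal_divide_eq_top_iff)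
    then have "M / A < \<infinity>" by (metis infinity_ennreal_def less_top)
    ultimately show ?thesis by (simp add: D1_def D2_def c2_def ennreal_mult_less_top)
  qed
  have "gagliardo p a (near_opt \<alpha> \<delta> b) <=
    (c1 * (2 * (hC p a * S)) + (D1 + D2) * (ennreal (\<delta> powr p) + ennreal (exp (- a / \<delta>)))) *
    (\<integral>\<^sup>+x\<in>half_space b. ennreal (near_opt \<alpha> \<delta> b x powr p * (x \<bullet> b) powr (- a)) \<partial>lborel)" if \<delta>: "0 < \<delta>" for \<delta>
  proof -
    define \<phi> where "\<phi> = near_opt \<alpha> \<delta> b"
    have \<phi>[measurable]: "\<phi> \<in> borel_measurable borel" unfolding \<phi>_def near_opt_def[abs_def] by measurable
    define h :: "'a => ennreal" where "h x = indicator {0<..} (x \<bullet> b)" for x :: 'a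
    define g :: "'a => ennreal" where "g x = indicator {..0} (x \<bullet> b)" for x :: 'a
    have hg[measurable]: "h \<in> borel_measurable borel" "(g :: 'a => ennreal) \<in> borel_measurable borel"
      unfolding h_def[abs_def] g_def[abs_def] by measurable
    define I where "I = (\<integral>\<^sup>+r\<in>{0<..}. ennreal (prof \<delta> r powr p / r) \<partial>lborel)"
    define H where "H = (\<integral>\<^sup>+x\<in>half_space b. ennreal (\<phi> x powr p * (x \<bullet> b) powr (- a)) \<partial>lborel)"
    have H: "H = I * A" unfolding H_def I_def A_def \<phi>_def \<alpha>_def by (rule near_opt_mass[OF p b])
    have I: "ennreal (1 / \<delta>) <= ennreal (2 * exp (8 * p)) * I" unfolding I_def by (rule prof_integral_lower[OF p \<delta>])
    define F1 where "F1 x y = (ennreal ((prof \<delta> (x \<bullet> b) * tang b x) powr p) * h x) * ((ennreal (\<bar>(x \<bullet> b) powr \<alpha> - (y \<bullet> b) powr \<alpha>\<bar> powr p) * h y) * \<kappa> x y)" for x y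
    define F2 where "F2 x y = (ennreal (tang b x powr p) * h x) * ((ennreal ((y \<bullet> b) powr (a - 1) * \<bar>prof \<delta> (x \<bullet> b) - prof \<delta> (y \<bullet> b)\<bar> powr p) * h y) * \<kappa> x y)" for x y
    define F3 where "F3 x y = (ennreal ((y \<bullet> b) powr (a - 1) * prof \<delta> (y \<bullet> b) powr p) * h y) * (ennreal (\<bar>tang b x - tang b y\<bar> powr p) * \<kappa> x y)" for x y
    define F4 where "F4 x y = (ennreal (\<phi> x powr p) * h x) * (g y * \<kappa> x y)" for x y
    have F[measurable]: "(\<lambda>z. F1 (fst z) (snd z)) \<in> borel_measurable (borel \<Otimes>\<^sub>M borel)"
      "(\<lambda>z. F2 (fst z) (snd z)) \<in> borel_measurable (borel \<Otimes>\<^sub>M borel)"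
      "(\<lambda>z. F3 (fst z) (snd z)) \<in> borel_measurable (borel \<Otimes>\<^sub>M borel)"
      "(\<lambda>z. F4 (fst z) (snd z)) \<in> borel_measurable (borel \<Otimes>\<^sub>M borel)"
      "(\<lambda>z. F4 (snd z) (fst z)) \<in> borel_measurable (borel \<Otimes>\<^sub>M borel)"
      unfolding F1_def[abs_def] F2_def[abs_def] F3_def[abs_def] F4_def[abs_def] h_def[abs_def] g_def[abs_def] \<kappa>_def[abs_def] by measurable
    have Fs[measurable]: "(\<lambda>y. F1 x y) \<in> borel_measurable borel" "(\<lambda>y. F2 x y) \<in> borel_measurable borel"
      "(\<lambda>y. F3 x y) \<in> borel_measurable borel" "(\<lambda>y. F4 x y) \<in> borel_measurable borel"
      "(\<lambda>x. F3 x y) \<in> borel_measurable borel" "(\<lambda>x. F4 x y) \<in> borel_measurable borel" for x y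
      unfolding F1_def[abs_def] F2_def[abs_def] F3_def[abs_def] F4_def[abs_def] h_def[abs_def] g_def[abs_def] \<kappa>_def[abs_def] by measurable
    have pw: "ennreal (\<bar>\<phi> x - \<phi> y\<bar> powr p) * \<kappa> x y <= c1 * F1 x y + c2 * (F2 x y + F3 x y) + (F4 x y + F4 y x)" for x y
    proof -
      consider "0 < x \<bullet> b" "0 < y \<bullet> b" | "0 < x \<bullet> b" "y \<bullet> b <= 0" | "x \<bullet> b <= 0" "0 < y \<bullet> b" | "x \<bullet> b <= 0" "y \<bullet> b <= 0" by linarith
      then show ?thesis
      proof cases
        case 1
        let ?w = "\<lambda>x. (x \<bullet> b) powr \<alpha>" and ?X = "\<lambda>x. prof \<delta> (x \<bullet> b)"
        have "ennreal (\<bar>\<phi> x - \<phi> y\<bar> powr p) <= ennreal ((1 - l) * (1 / (1 - l)) powr p * ((?X x * tang b x) powr p * \<bar>?w x - ?w y\<bar> powr p) +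
          l * (1 / l) powr p * 2 powr p * (?w y powr p * (tang b x powr p * \<bar>?X x - ?X y\<bar> powr p) + ?w y powr p * (?X y powr p * \<bar>tang b x - tang b y\<bar> powr p)))"
          unfolding \<phi>_def near_opt_def by (intro ennreal_leI powr_product_difference p l) (auto simp: prof tang)
        also have "\<dots> = c1 * (ennreal ((?X x * tang b x) powr p) * ennreal (\<bar>?w x - ?w y\<bar> powr p)) +
          c2 * (ennreal (tang b x powr p) * ennreal ((y \<bullet> b) powr (a - 1) * \<bar>?X x - ?X y\<bar> powr p) +
            ennreal ((y \<bullet> b) powr (a - 1) * ?X y powr p) * ennreal (\<bar>tang b x - tang b y\<bar> powr p))"
          using l by (simp add: c1_def c2_def powr_powr ap ennreal_mult' ennreal_mult'' ennreal_plus mult_ac)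
        finally have "ennreal (\<bar>\<phi> x - \<phi> y\<bar> powr p) * \<kappa> x y <= \<dots> * \<kappa> x y" by (rule mult_right_mono) simp
        also have "\<dots> = c1 * F1 x y + c2 * (F2 x y + F3 x y)"
          using 1 by (simp add: F1_def F2_def F3_def h_def distrib_right distrib_left mult.assoc)
        finally show ?thesis by (meson add_increasing2 order_trans zero_le)
      next
        case 2
        then have "\<phi> y = 0" "0 <= \<phi> x" by (auto simp: \<phi>_def near_opt_def prof_def[of _ "y \<bullet> b"] prof tang)
        then show ?thesis using 2 by (simp add: F1_def F2_def F4_def[of x y] h_def g_def add_increasing add_increasing2)
      next
        case 3
        then have "\<phi> x = 0" "0 <= \<phi> y" by (auto simp: \<phi>_def near_opt_def prof_def[of _ "x \<bullet> b"] prof tang)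
        then show ?thesis using 3 by (simp add: F1_def F2_def F4_def[of y x] h_def g_def \<kappa>_sym[of x y] add_increasing add_increasing2)
      next
        case 4
        then have "\<phi> x = 0" "\<phi> y = 0" by (auto simp: \<phi>_def near_opt_def prof_def)
        then show ?thesis using p by simp
      qed
    qed
    have "gagliardo p a \<phi> = (\<integral>\<^sup>+x. \<integral>\<^sup>+y. ennreal (\<bar>\<phi> x - \<phi> y\<bar> powr p) * \<kappa> x y \<partial>lborel \<partial>lborel)"
      unfolding \<kappa>_def by (rule gagliardo_pair) measurable
    also have "\<dots> <= (\<integral>\<^sup>+x. \<integral>\<^sup>+y. c1 * F1 x y + c2 * (F2 x y + F3 x y) + (F4 x y + F4 y x) \<partial>lborel \<partial>lborel)"
      by (intro nn_integral_mono pw)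
    also have "\<dots> = (\<integral>\<^sup>+x. c1 * (\<integral>\<^sup>+y. F1 x y \<partial>lborel) + c2 * ((\<integral>\<^sup>+y. F2 x y \<partial>lborel) + (\<integral>\<^sup>+y. F3 x y \<partial>lborel)) + ((\<integral>\<^sup>+y. F4 x y \<partial>lborel) + (\<integral>\<^sup>+y. F4 y x \<partial>lborel)) \<partial>lborel)"
      by (intro nn_integral_cong) (simp add: nn_integral_add nn_integral_cmult)
    also have "\<dots> = c1 * (\<integral>\<^sup>+x. \<integral>\<^sup>+y. F1 x y \<partial>lborel \<partial>lborel) +
      c2 * ((\<integral>\<^sup>+x. \<integral>\<^sup>+y. F2 x y \<partial>lborel \<partial>lborel) + (\<integral>\<^sup>+x. \<integral>\<^sup>+y. F3 x y \<partial>lborel \<partial>lborel)) +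
      ((\<integral>\<^sup>+x. \<integral>\<^sup>+y. F4 x y \<partial>lborel \<partial>lborel) + (\<integral>\<^sup>+x. \<integral>\<^sup>+y. F4 y x \<partial>lborel \<partial>lborel))"
      by (simp add: nn_integral_add nn_integral_cmult)
    also have "(\<integral>\<^sup>+x. \<integral>\<^sup>+y. F4 y x \<partial>lborel \<partial>lborel) = (\<integral>\<^sup>+x. \<integral>\<^sup>+y. F4 x y \<partial>lborel \<partial>lborel)"
      by (rule lborel_pair.Fubini') measurable
    also have "(\<integral>\<^sup>+x. \<integral>\<^sup>+y. F1 x y \<partial>lborel \<partial>lborel) = S * (2 * K) * H"
    proof -
      have "(\<integral>\<^sup>+y. F1 x y \<partial>lborel) = S * (2 * K) * (ennreal (prof \<delta> (x \<bullet> b) powr p / (x \<bullet> b)) * indicator {0<..} (x \<bullet> b) * ennreal (tang b x powr p))" for x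
      proof (cases "0 < x \<bullet> b")
        case True
        have "(\<integral>\<^sup>+y. F1 x y \<partial>lborel) = ennreal ((prof \<delta> (x \<bullet> b) * tang b x) powr p) * (\<integral>\<^sup>+y. (ennreal (\<bar>(x \<bullet> b) powr \<alpha> - (y \<bullet> b) powr \<alpha>\<bar> powr p) * h y) * \<kappa> x y \<partial>lborel)"
          using True unfolding F1_def by (subst nn_integral_cmult) (auto simp: h_def[of x])
        also have "(\<integral>\<^sup>+y. (ennreal (\<bar>(x \<bullet> b) powr \<alpha> - (y \<bullet> b) powr \<alpha>\<bar> powr p) * h y) * \<kappa> x y \<partial>lborel) =
          S * (\<integral>\<^sup>+\<rho>. (ennreal (\<bar>(x \<bullet> b) powr \<alpha> - \<rho> powr \<alpha>\<bar> powr p) * indicator {0<..} \<rho>) * ennreal (1 / \<bar>x \<bullet> b - \<rho>\<bar> powr (1 + a)) \<partial>lborel)"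
          unfolding \<kappa>_def S_def h_def by (rule slice_integral[OF b a(1)]) measurable
        also have "(\<integral>\<^sup>+\<rho>. (ennreal (\<bar>(x \<bullet> b) powr \<alpha> - \<rho> powr \<alpha>\<bar> powr p) * indicator {0<..} \<rho>) * ennreal (1 / \<bar>x \<bullet> b - \<rho>\<bar> powr (1 + a)) \<partial>lborel) =
          (\<integral>\<^sup>+\<rho>\<in>{0<..}. ennreal (\<bar>(x \<bullet> b) powr \<alpha> - \<rho> powr \<alpha>\<bar> powr p / \<bar>x \<bullet> b - \<rho>\<bar> powr (1 + a)) \<partial>lborel)"
          by (intro nn_integral_cong) (simp add: ennreal_mult'[symmetric] indicator_def)
        also have "\<dots> = ennreal (1 / (x \<bullet> b)) * (2 * K)" unfolding K_def \<alpha>_def by (rule profile_integral[OF p True])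
        finally show ?thesis using True by (simp add: powr_mult ennreal_mult' ennreal_mult'' divide_inverse mult_ac)
      qed (simp add: F1_def h_def)
      then have "(\<integral>\<^sup>+x. \<integral>\<^sup>+y. F1 x y \<partial>lborel \<partial>lborel) = (\<integral>\<^sup>+x. S * (2 * K) * (ennreal (prof \<delta> (x \<bullet> b) powr p / (x \<bullet> b)) * indicator {0<..} (x \<bullet> b) * ennreal (tang b x powr p)) \<partial>lborel)" by simp
      also have "\<dots> = S * (2 * K) * (\<integral>\<^sup>+x. ennreal (prof \<delta> (x \<bullet> b) powr p / (x \<bullet> b)) * indicator {0<..} (x \<bullet> b) * ennreal (tang b x powr p) \<partial>lborel)"
        by (rule nn_integral_cmult) measurable
      also have "(\<integral>\<^sup>+x. ennreal (prof \<delta> (x \<bullet> b) powr p / (x \<bullet> b)) * indicator {0<..} (x \<bullet> b) * ennreal (tang b x powr p) \<partial>lborel) = H"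
        unfolding H I_def A_def by (rule product_integral[OF b]) (auto simp: tang_shift[OF b])
      finally show ?thesis .
    qed
    also have "(\<integral>\<^sup>+x. \<integral>\<^sup>+y. F4 x y \<partial>lborel \<partial>lborel) = S * ennreal (1 / a) * H"
    proof -
      have "(\<integral>\<^sup>+y. F4 x y \<partial>lborel) = S * ennreal (1 / a) * (ennreal (\<phi> x powr p * (x \<bullet> b) powr (- a)) * indicator (half_space b) x)" for x
      proof (cases "0 < x \<bullet> b")
        case True
        have "(\<integral>\<^sup>+y. F4 x y \<partial>lborel) = ennreal (\<phi> x powr p) * (\<integral>\<^sup>+y. g y * \<kappa> x y \<partial>lborel)"
          using True unfolding F4_def by (subst nn_integral_cmult) (auto simp: h_def)
        also have "(\<integral>\<^sup>+y. g y * \<kappa> x y \<partial>lborel) = S * (\<integral>\<^sup>+\<rho>. indicator {..0} \<rho> * ennreal (1 / \<bar>x \<bullet> b - \<rho>\<bar> powr (1 + a)) \<partial>lborel)"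
          unfolding \<kappa>_def S_def g_def by (rule slice_integral[OF b a(1)]) measurable
        also have "(\<integral>\<^sup>+\<rho>. indicator {..0} \<rho> * ennreal (1 / \<bar>x \<bullet> b - \<rho>\<bar> powr (1 + a)) \<partial>lborel) = ennreal ((x \<bullet> b) powr (- a) / a)"
          using outer_nonpos[OF a(1) True] by (simp add: mult.commute)
        also have "\<dots> = ennreal (1 / a) * ennreal ((x \<bullet> b) powr (- a))" using a by (simp add: ennreal_mult'[symmetric])
        finally show ?thesis using True by (simp add: half_space_def ennreal_mult'' mult_ac)
      qed (simp add: F4_def h_def half_space_def)
      then have "(\<integral>\<^sup>+x. \<integral>\<^sup>+y. F4 x y \<partial>lborel \<partial>lborel) = (\<integral>\<^sup>+x. S * ennreal (1 / a) * (ennreal (\<phi> x powr p * (x \<bullet> b) powr (- a)) * indicator (half_space b) x) \<partial>lborel)" by simp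
      also have "\<dots> = S * ennreal (1 / a) * H" unfolding H_def
        by (rule nn_integral_cmult) (auto simp: half_space_def)
      finally show ?thesis .
    qed
    also have "(\<integral>\<^sup>+x. \<integral>\<^sup>+y. F2 x y \<partial>lborel \<partial>lborel) <= S * (ennreal (2 / \<delta> * (L * \<delta>) powr p) * Q) * A"
    proof -
      define W where "W r = (\<integral>\<^sup>+\<rho>\<in>{0<..}. ennreal (\<rho> powr (a - 1) * \<bar>prof \<delta> r - prof \<delta> \<rho>\<bar> powr p / \<bar>r - \<rho>\<bar> powr (1 + a)) \<partial>lborel)" for r
      have W[measurable]: "W \<in> borel_measurable borel" unfolding W_def[abs_def] by measurable
      have "(\<integral>\<^sup>+y. F2 x y \<partial>lborel) = S * (W (x \<bullet> b) * indicator {0<..} (x \<bullet> b) * ennreal (tang b x powr p))" for x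
      proof (cases "0 < x \<bullet> b")
        case True
        have "(\<integral>\<^sup>+y. F2 x y \<partial>lborel) = ennreal (tang b x powr p) * (\<integral>\<^sup>+y. (ennreal ((y \<bullet> b) powr (a - 1) * \<bar>prof \<delta> (x \<bullet> b) - prof \<delta> (y \<bullet> b)\<bar> powr p) * h y) * \<kappa> x y \<partial>lborel)"
          using True unfolding F2_def by (subst nn_integral_cmult) (auto simp: h_def[of x])
        also have "(\<integral>\<^sup>+y. (ennreal ((y \<bullet> b) powr (a - 1) * \<bar>prof \<delta> (x \<bullet> b) - prof \<delta> (y \<bullet> b)\<bar> powr p) * h y) * \<kappa> x y \<partial>lborel) =
          S * (\<integral>\<^sup>+\<rho>. (ennreal (\<rho> powr (a - 1) * \<bar>prof \<delta> (x \<bullet> b) - prof \<delta> \<rho>\<bar> powr p) * indicator {0<..} \<rho>) * ennreal (1 / \<bar>x \<bullet> b - \<rho>\<bar> powr (1 + a)) \<partial>lborel)"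
          unfolding \<kappa>_def S_def h_def by (rule slice_integral[OF b a(1)]) measurable
        also have "(\<integral>\<^sup>+\<rho>. (ennreal (\<rho> powr (a - 1) * \<bar>prof \<delta> (x \<bullet> b) - prof \<delta> \<rho>\<bar> powr p) * indicator {0<..} \<rho>) * ennreal (1 / \<bar>x \<bullet> b - \<rho>\<bar> powr (1 + a)) \<partial>lborel) = W (x \<bullet> b)"
          unfolding W_def by (intro nn_integral_cong) (simp add: ennreal_mult''[symmetric] indicator_def)
        finally show ?thesis using True by (simp add: mult_ac)
      qed (simp add: F2_def h_def)
      then have "(\<integral>\<^sup>+x. \<integral>\<^sup>+y. F2 x y \<partial>lborel \<partial>lborel) = (\<integral>\<^sup>+x. S * (W (x \<bullet> b) * indicator {0<..} (x \<bullet> b) * ennreal (tang b x powr p)) \<partial>lborel)" by simp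
      also have "\<dots> = S * (\<integral>\<^sup>+x. W (x \<bullet> b) * indicator {0<..} (x \<bullet> b) * ennreal (tang b x powr p) \<partial>lborel)"
        by (rule nn_integral_cmult) measurable
      also have "(\<integral>\<^sup>+x. W (x \<bullet> b) * indicator {0<..} (x \<bullet> b) * ennreal (tang b x powr p) \<partial>lborel) = (\<integral>\<^sup>+r\<in>{0<..}. W r \<partial>lborel) * A"
        unfolding A_def by (rule product_integral[OF b]) (auto simp: tang_shift[OF b])
      also have "(\<integral>\<^sup>+r\<in>{0<..}. W r \<partial>lborel) <= ennreal (2 / \<delta> * (L * \<delta>) powr p) * Q"
        unfolding W_def Q_def by (rule radial_difference[OF p \<delta> L])
      finally show ?thesis by (simp add: mult.assoc mult_left_mono mult_right_mono)
    qed
    also have "(\<integral>\<^sup>+x. \<integral>\<^sup>+y. F3 x y \<partial>lborel \<partial>lborel) <= ennreal (exp (- a / \<delta>)) * I * M"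
    proof -
      define T where "T y = (\<integral>\<^sup>+k. ennreal (\<bar>tang b (y + k) - tang b y\<bar> powr p) * ennreal (1 / norm k powr (real DIM('a) + a)) \<partial>lborel)" for y
      have T[measurable]: "T \<in> borel_measurable borel" unfolding T_def[abs_def] by measurable
      have "tang b (z + r *\<^sub>R b + k) = tang b (z + k)" for z r k
        using tang_shift[OF b, of "z + k" r] by (simp add: add_ac)
      then have T2: "T (z + r *\<^sub>R b) = T z" for z r by (simp add: T_def tang_shift[OF b])
      have "(\<integral>\<^sup>+x. F3 x y \<partial>lborel) = ennreal ((y \<bullet> b) powr (a - 1) * prof \<delta> (y \<bullet> b) powr p) * indicator {0<..} (y \<bullet> b) * T y" for y
      proof -
        have "T y = (\<integral>\<^sup>+k. ennreal (\<bar>tang b (y + k) - tang b y\<bar> powr p) * \<kappa> (y + k) y \<partial>lborel)" by (simp add: T_def \<kappa>_def)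
        also have "\<dots> = (\<integral>\<^sup>+x. ennreal (\<bar>tang b x - tang b y\<bar> powr p) * \<kappa> x y \<partial>lborel)"
          by (rule nn_integral_lborel_translate) measurable
        finally show ?thesis unfolding F3_def h_def by (subst nn_integral_cmult) auto
      qed
      moreover have "(\<integral>\<^sup>+x. \<integral>\<^sup>+y. F3 x y \<partial>lborel \<partial>lborel) = (\<integral>\<^sup>+y. \<integral>\<^sup>+x. F3 x y \<partial>lborel \<partial>lborel)"
        by (rule lborel_pair.Fubini'[symmetric]) measurable
      ultimately have "(\<integral>\<^sup>+x. \<integral>\<^sup>+y. F3 x y \<partial>lborel \<partial>lborel) = (\<integral>\<^sup>+y. ennreal ((y \<bullet> b) powr (a - 1) * prof \<delta> (y \<bullet> b) powr p) * indicator {0<..} (y \<bullet> b) * T y \<partial>lborel)" by simp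
      also have "\<dots> = (\<integral>\<^sup>+r\<in>{0<..}. ennreal (r powr (a - 1) * prof \<delta> r powr p) \<partial>lborel) * M"
        unfolding M_def T_def[symmetric] by (rule product_integral[OF b]) (auto simp: T2)
      also have "(\<integral>\<^sup>+r\<in>{0<..}. ennreal (r powr (a - 1) * prof \<delta> r powr p) \<partial>lborel) <= (\<integral>\<^sup>+r. ennreal (exp (- a / \<delta>)) * (ennreal (prof \<delta> r powr p / r) * indicator {0<..} r) \<partial>lborel)"
      proof (rule nn_integral_mono)
        fix r :: real
        show "ennreal (r powr (a - 1) * prof \<delta> r powr p) * indicator {0<..} r <= ennreal (exp (- a / \<delta>)) * (ennreal (prof \<delta> r powr p / r) * indicator {0<..} r)"
        proof (cases "prof \<delta> r = 0")
          case False
          note r = prof_support[OF \<delta> False]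
          have "r powr a <= exp (- 1 / \<delta>) powr a" using r a by (intro powr_mono2) auto
          also have "\<dots> = exp (- a / \<delta>)" by (simp add: exp_powr_real)
          finally have "r powr a * (prof \<delta> r powr p / r) <= exp (- a / \<delta>) * (prof \<delta> r powr p / r)"
            using r by (intro mult_right_mono) auto
          moreover have "r powr (a - 1) * prof \<delta> r powr p = r powr a * (prof \<delta> r powr p / r)" using r by (simp add: powr_diff)
          ultimately have "ennreal (r powr (a - 1) * prof \<delta> r powr p) <= ennreal (exp (- a / \<delta>) * (prof \<delta> r powr p / r))"
            by (intro ennreal_leI) simp
          then have "ennreal (r powr (a - 1) * prof \<delta> r powr p) <= ennreal (exp (- a / \<delta>)) * ennreal (prof \<delta> r powr p / r)"
            by (simp only: ennreal_mult'[OF exp_ge_zero])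
          then show ?thesis using r by simp
        qed (use p in simp)
      qed
      also have "\<dots> = ennreal (exp (- a / \<delta>)) * I" unfolding I_def by (rule nn_integral_cmult) measurable
      finally show ?thesis by (simp add: mult_right_mono)
    qed
    finally have le: "gagliardo p a \<phi> <= c1 * (S * (2 * K) * H) +
      c2 * (S * (ennreal (2 / \<delta> * (L * \<delta>) powr p) * Q) * A + ennreal (exp (- a / \<delta>)) * I * M) +
      (S * ennreal (1 / a) * H + S * ennreal (1 / a) * H)"
      by (simp add: add_left_mono add_right_mono mult_left_mono add_mono)
    have e1: "c1 * (S * (2 * K) * H) + (S * ennreal (1 / a) * H + S * ennreal (1 / a) * H) <= c1 * (2 * (hC p a * S)) * H"
    proof -
      have "S * ennreal (1 / a) * H + S * ennreal (1 / a) * H <= c1 * (S * ennreal (1 / a) * H + S * ennreal (1 / a) * H)"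
        using mult_right_mono[OF c1, of "S * ennreal (1 / a) * H + S * ennreal (1 / a) * H"] by simp
      then have "c1 * (S * (2 * K) * H) + (S * ennreal (1 / a) * H + S * ennreal (1 / a) * H) <=
        c1 * (S * (2 * K) * H) + c1 * (S * ennreal (1 / a) * H + S * ennreal (1 / a) * H)" by (rule add_left_mono)
      also have "\<dots> = c1 * (2 * ((K + ennreal (1 / a)) * S)) * H" by (simp add: distrib_left distrib_right mult_2 mult_ac)
      also have "K + ennreal (1 / a) = hC p a" by (simp add: hC_def K_def \<alpha>_def)
      finally show ?thesis .
    qed
    have e2: "c2 * (S * (ennreal (2 / \<delta> * (L * \<delta>) powr p) * Q) * A) <= D1 * ennreal (\<delta> powr p) * H"
    proof -
      have "2 / \<delta> * (L * \<delta>) powr p = (2 * L powr p) * \<delta> powr p * (1 / \<delta>)" by (simp add: powr_mult)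
      then have "ennreal (2 / \<delta> * (L * \<delta>) powr p) = ennreal ((2 * L powr p) * \<delta> powr p * (1 / \<delta>))" by (simp only:)
      also have "\<dots> = ennreal (2 * L powr p) * ennreal (\<delta> powr p) * ennreal (1 / \<delta>)"
        using \<delta> by (subst ennreal_mult'') (auto simp: ennreal_mult')
      also have "\<dots> <= ennreal (2 * L powr p) * ennreal (\<delta> powr p) * (ennreal (2 * exp (8 * p)) * I)"
        by (intro mult_left_mono I) auto
      finally have "c2 * (S * (ennreal (2 / \<delta> * (L * \<delta>) powr p) * Q) * A) <=
        c2 * (S * (ennreal (2 * L powr p) * ennreal (\<delta> powr p) * (ennreal (2 * exp (8 * p)) * I) * Q) * A)"
        by (intro mult_left_mono mult_right_mono) auto
      also have "\<dots> = D1 * ennreal (\<delta> powr p) * H" unfolding D1_def H by (simp only: mult_ac)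
      finally show ?thesis .
    qed
    have e3: "c2 * (ennreal (exp (- a / \<delta>)) * I * M) = D2 * ennreal (exp (- a / \<delta>)) * H"
    proof -
      have "M / A * A = M * (A / A)" by (rule ennreal_divide_times)
      also have "A / A = 1" using A by (intro ennreal_divide_self) auto
      finally have "M / A * A = M" by simp
      then show ?thesis unfolding D2_def H by (metis mult.assoc mult.commute)
    qed
    have "gagliardo p a \<phi> <= (c1 * (S * (2 * K) * H) + (S * ennreal (1 / a) * H + S * ennreal (1 / a) * H)) +
      (c2 * (S * (ennreal (2 / \<delta> * (L * \<delta>) powr p) * Q) * A) + c2 * (ennreal (exp (- a / \<delta>)) * I * M))"
      using le by (simp add: distrib_left add_ac)
    also have "\<dots> <= c1 * (2 * (hC p a * S)) * H + (D1 * ennreal (\<delta> powr p) * H + D2 * ennreal (exp (- a / \<delta>)) * H)"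
      unfolding e3 by (intro add_mono e1 e2) auto
    also have "\<dots> <= c1 * (2 * (hC p a * S)) * H + ((D1 + D2) * ennreal (\<delta> powr p) * H + (D1 + D2) * ennreal (exp (- a / \<delta>)) * H)"
      by (intro add_mono mult_right_mono) auto
    also have "\<dots> = (c1 * (2 * (hC p a * S)) + (D1 + D2) * (ennreal (\<delta> powr p) + ennreal (exp (- a / \<delta>)))) * H"
      by (simp only: distrib_left distrib_right)
    finally show ?thesis unfolding H_def \<phi>_def .
  qed
  then show ?thesis using that[OF Df] unfolding c1_def S_def by blast
qed

subsection \<open>Energies and Hardy integrals of measurable functions\<close>

lemma sigma_finite_lebesgue: "sigma_finite_measure (lebesgue :: 'a::euclidean_space measure)"
proof
  show "\<exists>A. countable A \<and> A \<subseteq> sets (lebesgue :: 'a measure) \<and> \<Union> A = space lebesgue \<and> (\<forall>a\<in>A. emeasure lebesgue a \<noteq> \<infinity>)"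
  proof (intro exI conjI ballI)
    show "\<Union> (range (\<lambda>n::nat. cball (0::'a) (real n))) = space lebesgue"
      using real_arch_simple by (auto simp: space_completion)
    fix A assume "A \<in> range (\<lambda>n::nat. cball (0::'a) (real n))"
    then obtain m :: nat where "A = cball 0 (real m)" by auto
    then show "emeasure lebesgue A \<noteq> \<infinity>" using fmeasurableD2[OF lmeasurable_cball[of "0::'a" "real m"]] by simp
  next
  qed auto
qed

text \<open>The energy is an integral over a product of two completed measures. Tonelli's theorem
  turns it into iterated integrals, in which the completion is invisible and \<open>u\<close> may be
  replaced by a Borel function equal to it almost everywhere.\<close>

lemma energy_eq_gagliardo:
  fixes u u' :: "'a::euclidean_space => real"
  assumes u[measurable]: "u \<in> borel_measurable lebesgue" and u'[measurable]: "u' \<in> borel_measurable borel"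
    and ae: "AE x in lborel. u x = u' x"
  shows "energy s p u = gagliardo p (s * p) u'"
proof -
  interpret L: sigma_finite_measure "lebesgue :: 'a measure" by (rule sigma_finite_lebesgue)
  let ?F = "\<lambda>u z. ennreal (\<bar>u (fst z) - u (snd z)\<bar> powr p / norm (fst z - snd z) powr (real DIM('a) + s * p))"
  have i: "(\<lambda>x::'a. x) \<in> lebesgue \<rightarrow>\<^sub>M borel" by (simp add: measurable_completion)
  have fs: "(\<lambda>z. fst z) \<in> lebesgue \<Otimes>\<^sub>M lebesgue \<rightarrow>\<^sub>M (borel :: 'a measure)"
    "(\<lambda>z. snd z) \<in> lebesgue \<Otimes>\<^sub>M lebesgue \<rightarrow>\<^sub>M (borel :: 'a measure)"
    using measurable_compose[OF measurable_fst i] measurable_compose[OF measurable_snd i] .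
  have n: "(\<lambda>z. norm (fst z - snd z)) \<in> borel_measurable (lebesgue \<Otimes>\<^sub>M (lebesgue :: 'a measure))"
    by (rule measurable_compose[OF borel_measurable_diff[OF fs] borel_measurable_norm])
  have U: "(\<lambda>z. u (fst z)) \<in> borel_measurable (lebesgue \<Otimes>\<^sub>M (lebesgue :: 'a measure))"
    "(\<lambda>z. u (snd z)) \<in> borel_measurable (lebesgue \<Otimes>\<^sub>M (lebesgue :: 'a measure))"
    using measurable_compose[OF measurable_fst u] measurable_compose[OF measurable_snd u] .
  have F: "?F u \<in> borel_measurable (lebesgue \<Otimes>\<^sub>M lebesgue)"
    by (intro measurable_compose[OF _ measurable_ennreal] borel_measurable_divide powr_real_measurable borel_measurable_abs borel_measurable_diff U n borel_measurable_const)
  have "energy s p u = (\<integral>\<^sup>+z. ?F u z \<partial>(lebesgue \<Otimes>\<^sub>M lebesgue))"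
    unfolding energy_def by (intro nn_integral_cong) (auto split: prod.split)
  also have "\<dots> = (\<integral>\<^sup>+x. \<integral>\<^sup>+y. ?F u (x, y) \<partial>lebesgue \<partial>lebesgue)" by (rule L.nn_integral_fst[OF F, symmetric])
  also have "\<dots> = (\<integral>\<^sup>+x. \<integral>\<^sup>+y. ?F u (x, y) \<partial>lborel \<partial>lborel)" by (simp only: nn_integral_completion)
  also have "\<dots> = (\<integral>\<^sup>+x. \<integral>\<^sup>+y. ?F u' (x, y) \<partial>lborel \<partial>lborel)"
  proof (rule nn_integral_cong_AE)
    show "AE x in lborel. (\<integral>\<^sup>+y. ?F u (x, y) \<partial>lborel) = (\<integral>\<^sup>+y. ?F u' (x, y) \<partial>lborel)"
      using ae
    proof eventually_elim
      fix x assume "u x = u' x"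
      then show "(\<integral>\<^sup>+y. ?F u (x, y) \<partial>lborel) = (\<integral>\<^sup>+y. ?F u' (x, y) \<partial>lborel)"
        by (intro nn_integral_cong_AE eventually_mono[OF ae]) simp
    qed
  qed
  also have "\<dots> = gagliardo p (s * p) u'"
    unfolding gagliardo_pair[OF u'] by (simp add: ennreal_mult''[symmetric])
  finally show ?thesis .
qed

lemma hardy_integral_eq:
  fixes u u' :: "'a::euclidean_space => real"
  assumes ae: "AE x in lborel. u x = u' x" and 0: "\<And>x. x \<notin> \<Omega> ==> u' x = 0" and p: "1 < p"
  shows "hardy_integral s p \<Omega> u = (\<integral>\<^sup>+x. ennreal (\<bar>u' x\<bar> powr p * bdry_dist \<Omega> x powr (- (s * p))) \<partial>lborel)"
  unfolding hardy_integral_def nn_integral_completion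
  by (intro nn_integral_cong_AE eventually_mono[OF ae]) (use 0 p in \<open>auto simp: powr_minus_divide indicator_def\<close>)

lemma test_function:
  assumes "u \<in> test_functions \<Omega>"
  shows "u \<in> borel_measurable borel" "continuous_on UNIV u" "\<And>x. x \<notin> \<Omega> ==> u x = 0" "u \<in> borel_measurable lebesgue"
proof -
  have "Ck 0 u" using assms by (auto simp: test_functions_def smooth_def)
  then show c: "continuous_on UNIV u" by simp
  then show b: "u \<in> borel_measurable borel" by (rule borel_measurable_continuous_onI)
  show "u \<in> borel_measurable lebesgue" using b by (simp add: measurable_completion)
  show "u x = 0" if "x \<notin> \<Omega>" for x
    using that assms closure_subset[of "{x. u x \<noteq> 0}"] by (auto simp: test_functions_def)
qed

lemma bdry_dist_measurable[measurable]: "bdry_dist \<Omega> \<in> borel_measurable borel"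
  unfolding bdry_dist_def[abs_def] by (intro borel_measurable_continuous_onI continuous_intros)

text \<open>The boundary distance is continuous and positive on the compact support, so the density
  is bounded there.\<close>

lemma test_function_hardy_finite:
  fixes u :: "'a::euclidean_space => real"
  assumes \<Omega>: "open \<Omega>" "convex \<Omega>" "\<Omega> \<noteq> UNIV" and u: "u \<in> test_functions \<Omega>" and p: "1 < p"
  shows "(\<integral>\<^sup>+x. ennreal (\<bar>u x\<bar> powr p * bdry_dist \<Omega> x powr (- a)) \<partial>lborel) < \<infinity>"
proof -
  define C where "C = closure {x. u x \<noteq> 0}"
  have C: "compact C" "C \<subseteq> \<Omega>" using u by (auto simp: test_functions_def C_def)
  have pos: "bdry_dist \<Omega> x \<noteq> 0" if "x \<in> C" for x
    using convex_tangent[OF \<Omega>, of x] C that by (metis less_irrefl subsetD)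
  have "continuous_on C (\<lambda>x. \<bar>u x\<bar> powr p * bdry_dist \<Omega> x powr (- a))"
    using pos p continuous_on_subset[OF test_function(2)[OF u], of C]
    unfolding bdry_dist_def by (intro continuous_intros continuous_on_powr') auto
  then have "bounded ((\<lambda>x. \<bar>u x\<bar> powr p * bdry_dist \<Omega> x powr (- a)) ` C)"
    using C(1) by (intro compact_imp_bounded compact_continuous_image)
  then obtain B where B: "\<And>x. x \<in> C ==> norm (\<bar>u x\<bar> powr p * bdry_dist \<Omega> x powr (- a)) <= B"
    unfolding bounded_iff by auto
  have "(\<integral>\<^sup>+x. ennreal (\<bar>u x\<bar> powr p * bdry_dist \<Omega> x powr (- a)) \<partial>lborel) <= (\<integral>\<^sup>+x. ennreal B * indicator C x \<partial>lborel)"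
  proof (rule nn_integral_mono)
    fix x
    show "ennreal (\<bar>u x\<bar> powr p * bdry_dist \<Omega> x powr (- a)) <= ennreal B * indicator C x"
    proof (cases "x \<in> C")
      case True
      then show ?thesis using B[OF True] by (auto intro!: ennreal_leI)
    next
      case False
      then have "u x = 0" using closure_subset[of "{x. u x \<noteq> 0}"] by (auto simp: C_def)
      then show ?thesis using p by simp
    qed
  qed
  also have "\<dots> = ennreal B * emeasure lborel C" using C(1) by (intro nn_integral_cmult_indicator) (auto intro: borel_compact)
  also have "\<dots> < \<infinity>" using emeasure_compact_finite[OF C(1)] by (simp add: ennreal_mult_less_top)
  finally show ?thesis .
qed

text \<open>Normalisation: multiplying \<phi> by h^(-1/p), with h its Hardy integral, makes the
  Hardy integral 1 and divides the energy by h.\<close>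

lemma hardy_const_le:
  fixes \<phi> :: "'a::euclidean_space => real"
  assumes p: "1 < p" and \<phi>: "\<phi> \<in> test_functions \<Omega>"
    and H: "H = (\<integral>\<^sup>+x. ennreal (\<bar>\<phi> x\<bar> powr p * bdry_dist \<Omega> x powr (- (s * p))) \<partial>lborel)" "0 < H" "H < \<infinity>"
    and le: "gagliardo p (s * p) \<phi> <= c * H"
  shows "hardy_const s p \<Omega> <= c"
proof -
  note [measurable] = test_function(1)[OF \<phi>]
  obtain h where h: "H = ennreal h" "0 < h" using H(2,3) by (cases H) auto
  define t where "t = (1 / h) powr (1 / p)"
  have t: "0 <= t" "t powr p = 1 / h" using h p by (auto simp: t_def powr_powr)
  define \<psi> where "\<psi> x = t * \<phi> x" for x
  have \<psi>: "\<psi> \<in> test_functions \<Omega>" unfolding \<psi>_def by (rule test_functions_scale[OF \<phi>])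
  have one: "ennreal (1 / h) * H = 1" using h by (simp add: ennreal_mult'[symmetric])
  have "hardy_integral s p \<Omega> \<psi> = (\<integral>\<^sup>+x. ennreal (\<bar>\<psi> x\<bar> powr p * bdry_dist \<Omega> x powr (- (s * p))) \<partial>lborel)"
    by (rule hardy_integral_eq) (use test_function(3)[OF \<psi>] p in auto)
  also have "\<dots> = (\<integral>\<^sup>+x. ennreal (1 / h) * ennreal (\<bar>\<phi> x\<bar> powr p * bdry_dist \<Omega> x powr (- (s * p))) \<partial>lborel)"
    using t h by (simp add: \<psi>_def abs_mult powr_mult ennreal_mult'[symmetric] mult_ac)
  also have "\<dots> = ennreal (1 / h) * H" unfolding H(1) by (rule nn_integral_cmult) measurable
  finally have 1: "hardy_integral s p \<Omega> \<psi> = 1" using one by simp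
  have "energy s p \<psi> = gagliardo p (s * p) \<psi>"
    by (rule energy_eq_gagliardo) (use test_function[OF \<psi>] in auto)
  also have "\<dots> = (\<integral>\<^sup>+x. \<integral>\<^sup>+k. ennreal (1 / h) * ennreal (\<bar>\<phi> x - \<phi> (x + k)\<bar> powr p / norm k powr (real DIM('a) + s * p)) \<partial>lborel \<partial>lborel)"
  proof -
    have e: "\<bar>t * x - t * y\<bar> powr p = 1 / h * \<bar>x - y\<bar> powr p" for x y
      unfolding right_diff_distrib[symmetric] abs_mult powr_mult using t by simp
    show ?thesis unfolding gagliardo_def \<psi>_def e using h by (simp add: ennreal_mult'[symmetric] mult_ac)
  qed
  also have "\<dots> = ennreal (1 / h) * gagliardo p (s * p) \<phi>"
    unfolding gagliardo_def by (simp add: nn_integral_cmult)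
  also have "\<dots> <= ennreal (1 / h) * (c * H)" by (intro mult_left_mono le) simp
  also have "\<dots> = c" using one by (metis mult.left_commute mult.right_neutral)
  finally have "energy s p \<psi> <= c" .
  then show ?thesis unfolding hardy_const_def using \<psi> 1 by (intro INF_lower2[of \<psi>]) auto
qed

subsection \<open>The upper bound\<close>

lemma nn_integral_similarity:
  fixes F :: "'a::euclidean_space => ennreal" and n b :: 'a
  assumes [measurable]: "F \<in> borel_measurable borel" and nb: "norm n = 1" "norm b = 1" and \<epsilon>: "0 < \<epsilon>"
  shows "(\<integral>\<^sup>+x. F x \<partial>lborel) = ennreal (\<epsilon> ^ DIM('a)) * (\<integral>\<^sup>+v. F (c + \<epsilon> *\<^sub>R reflect n b v) \<partial>lborel)"
proof -
  have "(\<integral>\<^sup>+x. F x \<partial>lborel) = (\<integral>\<^sup>+x. F (c + x) \<partial>lborel)"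
    by (rule nn_integral_lborel_translate[symmetric]) measurable
  also have "\<dots> = ennreal (\<bar>\<epsilon>\<bar> ^ DIM('a)) * (\<integral>\<^sup>+x. F (c + \<epsilon> *\<^sub>R x) \<partial>lborel)"
    by (rule nn_integral_lborel_scale) (use \<epsilon> in auto)
  also have "(\<integral>\<^sup>+x. F (c + \<epsilon> *\<^sub>R x) \<partial>lborel) = (\<integral>\<^sup>+v. F (c + \<epsilon> *\<^sub>R reflect n b v) \<partial>lborel)"
    by (rule nn_integral_lborel_isometry[symmetric]) (use reflect[OF nb] in auto)
  finally show ?thesis using \<epsilon> by simp
qed

text \<open>A small copy of a test function of the half-space, placed at a boundary point with an
  inner tangent ball, is a test function of \<open>\<Omega>\<close>; the supporting hyperplane there makes
  its Hardy integral at least that of the original.\<close>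

lemma hardy_const_le_half_space:
  fixes \<Omega> :: "'a::euclidean_space set" and b :: 'a
  assumes p: "1 < p" and s: "0 < s" and \<Omega>: "open \<Omega>" "convex \<Omega>" "\<Omega> \<noteq> {}" "\<Omega> \<noteq> UNIV" and b: "norm b = 1"
    and \<phi>: "\<phi> \<in> test_functions (half_space b)"
    and J: "J = (\<integral>\<^sup>+x\<in>half_space b. ennreal (\<bar>\<phi> x\<bar> powr p * (x \<bullet> b) powr (- (s * p))) \<partial>lborel)" "0 < J"
    and le: "gagliardo p (s * p) \<phi> <= c * J"
  shows "hardy_const s p \<Omega> <= c"
proof -
  define a where "a = s * p"
  have a: "0 < a" using s p by (simp add: a_def)
  note \<phi>m[measurable] = test_function(1)[OF \<phi>]
  obtain x where x: "x \<in> \<Omega>" using \<Omega>(3) by blast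
  obtain n y0 where n: "norm n = 1" and d0: "0 < bdry_dist \<Omega> x" and xy: "x - y0 = bdry_dist \<Omega> x *\<^sub>R n"
    and ball: "ball x (bdry_dist \<Omega> x) \<subseteq> \<Omega>" and tan: "\<And>y. y \<in> \<Omega> ==> 0 < n \<bullet> (y - y0)"
    by (rule convex_tangent[OF \<Omega>(1,2,4) x]) blast
  define d where "d = bdry_dist \<Omega> x"
  define C where "C = closure {x. \<phi> x \<noteq> 0}"
  have C: "compact C" "C \<subseteq> half_space b" using \<phi> by (auto simp: test_functions_def C_def)
  have C0: "x \<in> C" if "\<phi> x \<noteq> 0" for x using that closure_subset[of "{x. \<phi> x \<noteq> 0}"] by (auto simp: C_def)
  obtain m where m: "0 < m" "\<And>v. v \<in> C ==> m <= v \<bullet> b"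
  proof (cases "C = {}")
    case False
    have "continuous_on C (\<lambda>v. v \<bullet> b)" by (intro continuous_intros)
    then obtain v where v: "v \<in> C" "\<forall>w\<in>C. v \<bullet> b <= w \<bullet> b" using continuous_attains_inf[OF C(1) False] by blast
    then show ?thesis using that[of "v \<bullet> b"] C(2) by (auto simp: half_space_def)
  qed (use that[of 1] in auto)
  obtain B where B: "\<And>v. v \<in> C ==> norm v <= B" using compact_imp_bounded[OF C(1)] by (auto simp: bounded_iff)
  \<comment> \<open>From |x - g v|^2 = d^2 - \<epsilon> (2 d (v . b) - \<epsilon> |v|^2), the copy
    fits into the inner ball if \<epsilon> |v|^2 < 2 d (v . b). On the support v . b >= m and |v| <=
    B; the added 1 keeps the denominator positive.\<close>
  define \<epsilon> where "\<epsilon> = d * m / (B\<^sup>2 + 1)"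
  have B1: "0 < B\<^sup>2 + 1" by (simp add: add_nonneg_pos)
  have \<epsilon>: "0 < \<epsilon>" using d0 m B1 by (simp add: \<epsilon>_def d_def)
  have \<epsilon>B: "\<epsilon> * B\<^sup>2 < 2 * d * m"
  proof -
    have dm: "0 < d * m" using d0 m by (simp add: d_def)
    have "\<epsilon> * B\<^sup>2 <= \<epsilon> * (B\<^sup>2 + 1)" using \<epsilon> by (intro mult_left_mono) auto
    also have "\<dots> = d * m" using B1 by (simp add: \<epsilon>_def)
    finally show ?thesis using dm by simp
  qed
  let ?R = "reflect n b"
  note R = reflect[OF n b]
  define g where "g v = y0 + \<epsilon> *\<^sub>R ?R v" for v
  have Rb: "?R v \<bullet> n = v \<bullet> b" for v using R(6)[of v b] R(5) R(4) by simp
  have g\<Omega>: "g v \<in> \<Omega>" if v: "v \<in> C" for v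
  proof -
    have "x - g v = (x - y0) - \<epsilon> *\<^sub>R ?R v" by (simp add: g_def)
    then have "(norm (x - g v))\<^sup>2 = (norm (d *\<^sub>R n - \<epsilon> *\<^sub>R ?R v))\<^sup>2"
      unfolding xy d_def by (simp only:)
    also have "\<dots> = d\<^sup>2 * (n \<bullet> n) - 2 * (d * (\<epsilon> * (?R v \<bullet> n))) + \<epsilon>\<^sup>2 * (?R v \<bullet> ?R v)"
      unfolding power2_norm_eq_inner by (simp add: inner_diff_left inner_diff_right inner_commute power2_eq_square algebra_simps)
    also have "?R v \<bullet> ?R v = (norm v)\<^sup>2" using R(2)[of v] by (simp flip: power2_norm_eq_inner)
    also have "n \<bullet> n = 1" using n by (simp flip: power2_norm_eq_inner)
    finally have e: "(norm (x - g v))\<^sup>2 = d\<^sup>2 - \<epsilon> * (2 * d * (v \<bullet> b) - \<epsilon> * (norm v)\<^sup>2)"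
      unfolding Rb by (simp add: power2_eq_square algebra_simps)
    have "\<epsilon> * (norm v)\<^sup>2 <= \<epsilon> * B\<^sup>2" using B[OF v] \<epsilon> by (intro mult_left_mono power_mono) auto
    also have "\<dots> < 2 * d * m" by (rule \<epsilon>B)
    also have "2 * d * m <= 2 * d * (v \<bullet> b)" using m(2)[OF v] d0 by (intro mult_left_mono) (auto simp: d_def)
    finally have "0 < \<epsilon> * (2 * d * (v \<bullet> b) - \<epsilon> * (norm v)\<^sup>2)" using \<epsilon> by simp
    then have "(norm (x - g v))\<^sup>2 < d\<^sup>2" using e by linarith
    then have "norm (x - g v) < d" using d0 by (metis d_def power_less_imp_less_base less_imp_le)
    then show ?thesis using ball by (auto simp: d_def dist_norm)
  qed
  define \<psi> where "\<psi> y = \<phi> ((1 / \<epsilon>) *\<^sub>R ?R y + - ((1 / \<epsilon>) *\<^sub>R ?R y0))" for y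
  have linR: "linear (\<lambda>y. (1 / \<epsilon>) *\<^sub>R ?R y)" by (rule linear_compose_scale_right[OF R(1)])
  have \<psi>g: "\<psi> (g v) = \<phi> v" for v
    using \<epsilon> by (simp add: \<psi>_def g_def linear_add[OF R(1)] linear_scale[OF R(1)] R(3) scaleR_add_right)
  have gh: "g ((1 / \<epsilon>) *\<^sub>R ?R y + - ((1 / \<epsilon>) *\<^sub>R ?R y0)) = y" for y
    using \<epsilon> by (simp add: g_def linear_diff[OF R(1)] linear_scale[OF R(1)] R(3) scaleR_diff_right)
  have gc: "continuous_on UNIV g" unfolding g_def[abs_def]
    by (intro continuous_intros linear_continuous_on linear_conv_bounded_linear[THEN iffD1] R(1))
  have \<psi>: "\<psi> \<in> test_functions \<Omega>"
  proof -
    have cg: "compact (g ` C)" by (rule compact_continuous_image[OF continuous_on_subset[OF gc] C(1)]) simp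
    have "{y. \<psi> y \<noteq> 0} \<subseteq> g ` C"
    proof
      fix y assume "y \<in> {y. \<psi> y \<noteq> 0}"
      then have "(1 / \<epsilon>) *\<^sub>R ?R y + - ((1 / \<epsilon>) *\<^sub>R ?R y0) \<in> C" by (intro C0) (simp add: \<psi>_def)
      then show "y \<in> g ` C" using gh[of y] by (metis image_eqI)
    qed
    then have sub: "closure {y. \<psi> y \<noteq> 0} \<subseteq> g ` C" by (rule closure_minimal) (rule compact_imp_closed[OF cg])
    then have "compact (closure {y. \<psi> y \<noteq> 0})" using cg by (metis closed_closure compact_Int_closed inf.absorb2)
    moreover have "closure {y. \<psi> y \<noteq> 0} \<subseteq> \<Omega>" using sub g\<Omega> by blast
    moreover have "smooth \<psi>" unfolding smooth_def \<psi>_def[abs_def] using \<phi>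
      by (intro allI Ck_affine[OF linR]) (simp add: test_functions_def smooth_def)
    ultimately show ?thesis by (simp add: test_functions_def)
  qed
  note \<psi>m[measurable] = test_function(1)[OF \<psi>]
  let ?c = "ennreal (\<epsilon> ^ DIM('a))" and ?N = "real DIM('a) + a"
  define H where "H = (\<integral>\<^sup>+x. ennreal (\<bar>\<psi> x\<bar> powr p * bdry_dist \<Omega> x powr (- a)) \<partial>lborel)"
  have ng: "norm (g v - g w) = \<epsilon> * norm (v - w)" for v w
  proof -
    have "g v - g w = \<epsilon> *\<^sub>R ?R (v - w)" by (simp add: g_def linear_diff[OF R(1)] scaleR_diff_right)
    then show ?thesis using \<epsilon> R(2)[of "v - w"] by simp
  qed
  have sim: "(\<integral>\<^sup>+x. G x \<partial>lborel) = ?c * (\<integral>\<^sup>+v. G (g v) \<partial>lborel)"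
    if "G \<in> borel_measurable borel" for G :: "'a => ennreal"
    unfolding g_def by (rule nn_integral_similarity[OF that n b \<epsilon>])
  define K where "K x y = ennreal (\<bar>\<psi> x - \<psi> y\<bar> powr p) * ennreal (1 / norm (x - y) powr ?N)" for x y
  have K1: "(\<lambda>y. K x y) \<in> borel_measurable borel" for x unfolding K_def by measurable
  have K2: "(\<lambda>x. \<integral>\<^sup>+y. K x y \<partial>lborel) \<in> borel_measurable borel" unfolding K_def by measurable
  have "gagliardo p a \<psi> = (\<integral>\<^sup>+x. \<integral>\<^sup>+y. K x y \<partial>lborel \<partial>lborel)"
    unfolding K_def by (rule gagliardo_pair[OF \<psi>m])
  also have "\<dots> = ?c * (\<integral>\<^sup>+v. \<integral>\<^sup>+y. K (g v) y \<partial>lborel \<partial>lborel)" by (rule sim[OF K2])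
  also have "\<dots> = ?c * (\<integral>\<^sup>+v. ?c * (\<integral>\<^sup>+w. K (g v) (g w) \<partial>lborel) \<partial>lborel)"
    by (intro arg_cong[where f = "\<lambda>x. ?c * x"] nn_integral_cong sim K1)
  also have "\<dots> = ?c * (\<integral>\<^sup>+v. ?c * (ennreal (\<epsilon> powr (- ?N)) * (\<integral>\<^sup>+w. ennreal (\<bar>\<phi> v - \<phi> w\<bar> powr p) * ennreal (1 / norm (v - w) powr ?N) \<partial>lborel)) \<partial>lborel)"
  proof -
    have "(\<integral>\<^sup>+w. K (g v) (g w) \<partial>lborel) =
      (\<integral>\<^sup>+w. ennreal (\<epsilon> powr (- ?N)) * (ennreal (\<bar>\<phi> v - \<phi> w\<bar> powr p) * ennreal (1 / norm (v - w) powr ?N)) \<partial>lborel)" for v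
      unfolding K_def \<psi>g ng powr_minus_divide[of \<epsilon>] powr_mult
      by (intro nn_integral_cong) (simp add: ennreal_mult'[symmetric])
    moreover have "(\<integral>\<^sup>+w. ennreal (\<epsilon> powr (- ?N)) * (ennreal (\<bar>\<phi> v - \<phi> w\<bar> powr p) * ennreal (1 / norm (v - w) powr ?N)) \<partial>lborel) =
      ennreal (\<epsilon> powr (- ?N)) * (\<integral>\<^sup>+w. ennreal (\<bar>\<phi> v - \<phi> w\<bar> powr p) * ennreal (1 / norm (v - w) powr ?N) \<partial>lborel)" for v
      by (rule nn_integral_cmult) measurable
    ultimately show ?thesis by simp
  qed
  also have "\<dots> = ?c * (?c * (ennreal (\<epsilon> powr (- ?N)) * gagliardo p a \<phi>))"
    unfolding gagliardo_pair[OF \<phi>m] by (simp add: nn_integral_cmult)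
  finally have G: "gagliardo p a \<psi> = ?c * (?c * (ennreal (\<epsilon> powr (- ?N)) * gagliardo p a \<phi>))" .
  \<comment> \<open>One of the two Jacobians in the energy meets the kernel here. What remains is
    \<epsilon>^(N-a), the same factor as in the lower bound for the Hardy integral.\<close>
  have cc: "?c * ennreal (\<epsilon> powr (- ?N)) = ennreal (\<epsilon> powr (- a))"
  proof -
    have "\<epsilon> ^ DIM('a) * \<epsilon> powr (- ?N) = \<epsilon> powr (- a)"
      by (simp only: powr_realpow[OF \<epsilon>, symmetric] powr_add[symmetric]) simp
    then show ?thesis using \<epsilon> by (metis ennreal_mult' less_imp_le zero_less_power)
  qed
  have H1: "?c * (ennreal (\<epsilon> powr (- a)) * J) <= H"
  proof -
    have "?c * (ennreal (\<epsilon> powr (- a)) * J) = ?c * (\<integral>\<^sup>+v. ennreal (\<epsilon> powr (- a)) * (ennreal (\<bar>\<phi> v\<bar> powr p * (v \<bullet> b) powr (- a)) * indicator (half_space b) v) \<partial>lborel)"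
      unfolding J(1) a_def by (subst nn_integral_cmult) (auto simp: half_space_def)
    also have "\<dots> <= ?c * (\<integral>\<^sup>+v. ennreal (\<bar>\<psi> (g v)\<bar> powr p * bdry_dist \<Omega> (g v) powr (- a)) \<partial>lborel)"
    proof (intro mult_left_mono nn_integral_mono)
      fix v
      show "ennreal (\<epsilon> powr (- a)) * (ennreal (\<bar>\<phi> v\<bar> powr p * (v \<bullet> b) powr (- a)) * indicator (half_space b) v) <=
        ennreal (\<bar>\<psi> (g v)\<bar> powr p * bdry_dist \<Omega> (g v) powr (- a))"
      proof (cases "\<phi> v = 0")
        case False
        then have v: "v \<in> C" by (rule C0)
        then have g: "g v \<in> \<Omega>" by (rule g\<Omega>)
        have "0 < bdry_dist \<Omega> (g v)" by (rule convex_tangent[OF \<Omega>(1,2,4) g]) blast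
        moreover have "bdry_dist \<Omega> (g v) <= n \<bullet> (g v - y0)" by (rule bdry_dist_le[OF \<Omega>(1,2,4) g n tan])
        moreover have "n \<bullet> (g v - y0) = \<epsilon> * (v \<bullet> b)" using Rb[of v] by (simp add: g_def inner_commute)
        ultimately have "(\<epsilon> * (v \<bullet> b)) powr (- a) <= bdry_dist \<Omega> (g v) powr (- a)" using a by (intro powr_mono2') auto
        then have "\<bar>\<phi> v\<bar> powr p * (\<epsilon> * (v \<bullet> b)) powr (- a) <= \<bar>\<psi> (g v)\<bar> powr p * bdry_dist \<Omega> (g v) powr (- a)"
          unfolding \<psi>g by (rule mult_left_mono) simp
        then have "ennreal (\<epsilon> powr (- a) * (\<bar>\<phi> v\<bar> powr p * (v \<bullet> b) powr (- a))) <= ennreal (\<bar>\<psi> (g v)\<bar> powr p * bdry_dist \<Omega> (g v) powr (- a))"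
          by (intro ennreal_leI) (simp only: powr_mult mult_ac)
        moreover have "v \<in> half_space b" using C(2) v by blast
        ultimately show ?thesis by (simp only: ennreal_mult'[OF powr_ge_zero] indicator_simps mult_1_right)
      qed (use p in simp)
    qed simp
    also have "\<dots> = H" unfolding H_def by (rule sim[symmetric]) measurable
    finally show ?thesis .
  qed
  show ?thesis
  proof (rule hardy_const_le[OF p \<psi>])
    show "H = (\<integral>\<^sup>+x. ennreal (\<bar>\<psi> x\<bar> powr p * bdry_dist \<Omega> x powr (- (s * p))) \<partial>lborel)" by (simp add: H_def a_def)
    show "H < \<infinity>" unfolding H_def by (rule test_function_hardy_finite[OF \<Omega>(1,2,4) \<psi> p])
    have "0 < ?c * (ennreal (\<epsilon> powr (- a)) * J)" using \<epsilon> J(2) by (simp add: ennreal_zero_less_mult_iff)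
    then show "0 < H" using H1 by (rule less_le_trans)
    have "gagliardo p a \<psi> = ?c * (ennreal (\<epsilon> powr (- a)) * gagliardo p a \<phi>)" unfolding G cc[symmetric] by (simp only: mult_ac)
    also have "\<dots> <= ?c * (ennreal (\<epsilon> powr (- a)) * (c * J))" using le by (intro mult_left_mono) (auto simp: a_def)
    also have "\<dots> = c * (?c * (ennreal (\<epsilon> powr (- a)) * J))" by (simp only: mult_ac)
    also have "\<dots> <= c * H" by (intro mult_left_mono H1) simp
    finally show "gagliardo p (s * p) \<psi> <= c * H" by (simp add: a_def)
  qed
qed

text \<open>The limit \<delta> -> 0 is taken at fixed \<open>l\<close>, because the error constant
  depends on \<open>l\<close>; it removes the error terms. Only afterwards does \<open>l\<close>
  tend to 0, where (1 - l)^(1-p) tends to 1.\<close>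

lemma hardy_const_upper:
  fixes \<Omega> :: "'a::euclidean_space set"
  assumes p: "1 < p" and s: "0 < s" "s < 1" and \<Omega>: "open \<Omega>" "convex \<Omega>" "\<Omega> \<noteq> {}" "\<Omega> \<noteq> UNIV"
  shows "hardy_const s p \<Omega> <= 2 * (hC p (s * p) * slice_const DIM('a) (s * p))"
proof -
  define a where "a = s * p"
  have a: "0 < a" "a < p" using s p by (auto simp: a_def)
  obtain b :: 'a where b: "b \<in> Basis" using nonempty_Basis by blast
  define X where "X = 2 * (hC p a * slice_const DIM('a) a)"
  have "X < \<infinity>" using hC_finite[OF p a] slice_const_eq(1)[of "DIM('a)" a] a
    by (simp add: X_def ennreal_mult_less_top Suc_le_eq)
  then obtain x where x: "X = ennreal x" "0 <= x" by (cases X) auto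
  have 1: "hardy_const s p \<Omega> <= ennreal ((1 - l) * (1 / (1 - l)) powr p * x)" if l: "0 < l" "l < 1" for l
  proof -
    define \<gamma> where "\<gamma> = (1 - l) * (1 / (1 - l)) powr p"
    have \<gamma>: "0 <= \<gamma>" using l by (simp add: \<gamma>_def)
    obtain D where D: "D < \<infinity>" "\<And>\<delta>. 0 < \<delta> ==> gagliardo p a (near_opt ((a - 1) / p) \<delta> b) <=
      (ennreal \<gamma> * X + D * (ennreal (\<delta> powr p) + ennreal (exp (- a / \<delta>)))) *
      (\<integral>\<^sup>+x\<in>half_space b. ennreal (near_opt ((a - 1) / p) \<delta> b x powr p * (x \<bullet> b) powr (- a)) \<partial>lborel)"
      unfolding \<gamma>_def X_def using near_opt_energy[OF p a b l] by blast
    obtain D' where D': "D = ennreal D'" "0 <= D'" using D(1) by (cases D) auto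
    have le: "hardy_const s p \<Omega> <= ennreal (\<gamma> * x + D' * ((1 + 1 / a) * inverse (real (Suc m))))" for m
    proof -
      define \<delta> where "\<delta> = inverse (real (Suc m))"
      have \<delta>: "0 < \<delta>" "\<delta> <= 1" by (auto simp: \<delta>_def field_simps)
      let ?f = "near_opt ((a - 1) / p) \<delta> b"
      have f0: "\<bar>?f x\<bar> = ?f x" for x by (simp add: near_opt_def prof tang)
      define c where "c = ennreal \<gamma> * X + D * (ennreal (\<delta> powr p) + ennreal (exp (- a / \<delta>)))"
      define J where "J = (\<integral>\<^sup>+x\<in>half_space b. ennreal (\<bar>?f x\<bar> powr p * (x \<bullet> b) powr (- (s * p))) \<partial>lborel)"
      have J: "J = (\<integral>\<^sup>+x\<in>half_space b. ennreal (?f x powr p * (x \<bullet> b) powr (- a)) \<partial>lborel)"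
        unfolding J_def f0 a_def[symmetric] by (rule refl)
      have J0: "0 < J"
      proof -
        have "(\<integral>\<^sup>+r\<in>{0<..}. ennreal (prof \<delta> r powr p / r) \<partial>lborel) \<noteq> 0"
          using prof_integral_lower[OF p \<delta>(1)] \<delta>(1) by auto
        moreover have "(\<integral>\<^sup>+z. ennreal (tang b z powr p) \<partial>orth b) \<noteq> 0" using tang_mass(2)[OF b p] by simp
        ultimately show ?thesis unfolding J near_opt_mass[OF p b] by (simp add: zero_less_iff_neq_zero)
      qed
      have "hardy_const s p \<Omega> <= c"
      proof (rule hardy_const_le_half_space[OF p s(1) \<Omega> _ near_opt_test[OF b \<delta>(1)] J_def J0])
        show "norm b = 1" using b by simp
        show "gagliardo p (s * p) ?f <= c * J" using D(2)[OF \<delta>(1)] unfolding J c_def a_def .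
      qed
      also have "c = ennreal (\<gamma> * x + D' * (\<delta> powr p + exp (- a / \<delta>)))"
        unfolding c_def x(1) D'(1) using \<gamma> x(2) D'(2) by (simp add: ennreal_mult'[symmetric] flip: ennreal_plus)
      also have "\<dots> <= ennreal (\<gamma> * x + D' * ((1 + 1 / a) * \<delta>))"
      proof (intro ennreal_leI add_left_mono mult_left_mono D'(2))
        have "\<delta> powr p <= \<delta> powr 1" using \<delta> p by (intro powr_mono') auto
        moreover have "exp (- a / \<delta>) <= \<delta> / a"
        proof -
          have "a / \<delta> <= exp (a / \<delta>)" using exp_ge_add_one_self[of "a / \<delta>"] by linarith
          then have "inverse (exp (a / \<delta>)) <= inverse (a / \<delta>)" using a \<delta> by (intro le_imp_inverse_le) auto
          then show ?thesis by (simp add: exp_minus[symmetric])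
        qed
        ultimately show "\<delta> powr p + exp (- a / \<delta>) <= (1 + 1 / a) * \<delta>" using \<delta> by (simp add: distrib_right)
      qed
      finally show ?thesis by (simp add: \<delta>_def)
    qed
    have "(\<lambda>m. \<gamma> * x + D' * ((1 + 1 / a) * inverse (real (Suc m)))) \<longlonglongrightarrow> \<gamma> * x + D' * ((1 + 1 / a) * 0)"
      by (intro tendsto_intros LIMSEQ_inverse_real_of_nat)
    then have "(\<lambda>m. ennreal (\<gamma> * x + D' * ((1 + 1 / a) * inverse (real (Suc m))))) \<longlonglongrightarrow> ennreal (\<gamma> * x + D' * ((1 + 1 / a) * 0))"
      by (rule tendsto_ennrealI)
    then have "hardy_const s p \<Omega> <= ennreal (\<gamma> * x + D' * ((1 + 1 / a) * 0))"
      by (rule LIMSEQ_le_const) (use le in blast)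
    then show ?thesis by (simp add: \<gamma>_def)
  qed
  define l where "l m = inverse (real (Suc (Suc m)))" for m
  have "l \<longlonglongrightarrow> 0" unfolding l_def by (rule LIMSEQ_Suc[OF LIMSEQ_inverse_real_of_nat])
  then have "(\<lambda>m. (1 - l m) * (1 / (1 - l m)) powr p * x) \<longlonglongrightarrow> (1 - 0) * (1 / (1 - 0)) powr p * x"
    by (intro tendsto_intros) auto
  then have lim: "(\<lambda>m. ennreal ((1 - l m) * (1 / (1 - l m)) powr p * x)) \<longlonglongrightarrow> ennreal ((1 - 0) * (1 / (1 - 0)) powr p * x)"
    by (rule tendsto_ennrealI)
  have le: "hardy_const s p \<Omega> <= ennreal ((1 - l m) * (1 / (1 - l m)) powr p * x)" for m
    by (rule 1) (auto simp: l_def field_simps)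
  have "hardy_const s p \<Omega> <= ennreal ((1 - 0) * (1 / (1 - 0)) powr p * x)"
    by (rule LIMSEQ_le_const[OF lim]) (use le in blast)
  then show ?thesis using x by (simp add: X_def a_def)
qed

subsection \<open>The lower bound and the conclusion\<close>

text \<open>Test functions vanish outside the set, so the L^p mass of \<open>u\<close> there is at
  most the p-th power of its distance to any test function.\<close>

lemma Wsp0_AE_zero:
  fixes u :: "'a::euclidean_space => real"
  assumes p: "1 < p" and \<Omega>: "open \<Omega>" and u: "u \<in> Wsp0 s p \<Omega>"
  shows "AE x in lborel. x \<notin> \<Omega> \<longrightarrow> u x = 0"
proof -
  have um[measurable]: "u \<in> borel_measurable lebesgue" using u by (auto simp: Wsp0_def Wsp_def)
  have \<Omega>m[measurable]: "\<Omega> \<in> sets lebesgue" using \<Omega> by simp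
  define Z where "Z = (\<integral>\<^sup>+x\<in>-\<Omega>. ennreal (\<bar>u x\<bar> powr p) \<partial>lebesgue)"
  have "Z <= 0"
  proof (rule ennreal_le_epsilon)
    fix e :: real assume e: "0 < e"
    define r where "r = e powr (1 / p)"
    have r: "0 < r" "r powr p = e" using e p by (auto simp: r_def powr_powr)
    obtain \<phi> where \<phi>: "\<phi> \<in> test_functions \<Omega>" "Wsp_norm s p (\<lambda>x. u x - \<phi> x) < ennreal r"
      using u r(1) by (auto simp: Wsp0_def)
    define W where "W = (\<integral>\<^sup>+x. ennreal (\<bar>u x - \<phi> x\<bar> powr p) \<partial>lebesgue)"
    have "enn_root p W <= Wsp_norm s p (\<lambda>x. u x - \<phi> x)"
      unfolding Wsp_norm_def Lp_norm_def W_def by simp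
    then have lt: "enn_root p W < ennreal r" using \<phi>(2) by (rule le_less_trans)
    then have Wf: "W \<noteq> \<infinity>" by (auto simp: enn_root_def)
    then have "enn2real W powr (1 / p) < r" using lt r(1) by (simp add: enn_root_def ennreal_less_iff)
    then have "(enn2real W powr (1 / p)) powr p <= r powr p" using p by (intro powr_mono2) auto
    then have "enn2real W <= e" using r(2) p by (simp add: powr_powr)
    then have We: "W <= ennreal e" using Wf by (metis ennreal_enn2real ennreal_leI infinity_ennreal_def less_top)
    have "Z <= W" unfolding Z_def W_def
    proof (rule nn_integral_mono)
      fix x show "ennreal (\<bar>u x\<bar> powr p) * indicator (- \<Omega>) x <= ennreal (\<bar>u x - \<phi> x\<bar> powr p)"
        using test_function(3)[OF \<phi>(1), of x] by (cases "x \<in> \<Omega>") auto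
    qed
    then show "Z <= 0 + ennreal e" using We by simp
  qed
  then have "(\<integral>\<^sup>+x. ennreal (\<bar>u x\<bar> powr p) * indicator (-\<Omega>) x \<partial>lebesgue) = 0" by (simp add: Z_def)
  then have "AE x in lebesgue. ennreal (\<bar>u x\<bar> powr p) * indicator (-\<Omega>) x = 0"
    by (subst (asm) nn_integral_0_iff_AE) measurable
  then have "AE x in lebesgue. x \<notin> \<Omega> \<longrightarrow> u x = 0" by eventually_elim (auto simp: indicator_def)
  then show ?thesis by (simp add: AE_completion_iff)
qed

text \<open>\<open>u\<close> is replaced by a Borel function that agrees with it almost everywhere
  and vanishes outside the set. The inequality is strict because equality would force the Hardy
  integral to be 0 and not 1.\<close>

lemma hardy_lower:
  fixes \<Omega> :: "'a::euclidean_space set"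
  assumes p: "1 < p" and s: "0 < s" "s < 1" and \<Omega>: "open \<Omega>" "convex \<Omega>" "\<Omega> \<noteq> UNIV"
    and line: "\<And>w h. line_ineq p (s * p) {t. w + t *\<^sub>R h \<in> \<Omega>}"
    and u: "u \<in> borel_measurable lebesgue" "AE x in lborel. x \<notin> \<Omega> \<longrightarrow> u x = 0" "hardy_integral s p \<Omega> u = 1"
  shows "2 * (hC p (s * p) * slice_const DIM('a) (s * p)) < energy s p u"
proof -
  have a: "0 < s * p" "s * p < p" using s p by auto
  obtain v where v: "v \<in> borel_measurable lborel" "AE x in lborel. u x = v x"
    using completion_ex_borel_measurable_real[OF u(1)] by blast
  have \<Omega>m: "\<Omega> \<in> sets borel" using \<Omega> by simp
  define w where "w x = v x * indicator \<Omega> x" for x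
  have wm: "w \<in> borel_measurable borel" using v(1) \<Omega>m unfolding w_def[abs_def] by simp
  have w0: "w x = 0" if "x \<notin> \<Omega>" for x using that by (simp add: w_def)
  have ae: "AE x in lborel. u x = w x"
    using v(2) u(2) by eventually_elim (auto simp: w_def indicator_def)
  have H: "(\<integral>\<^sup>+x. ennreal (\<bar>w x\<bar> powr p * bdry_dist \<Omega> x powr (- (s * p))) \<partial>lborel) = 1"
    using hardy_integral_eq[where s = s, OF ae w0 p] u(3) by simp
  then have fin: "(\<integral>\<^sup>+x. ennreal (\<bar>w x\<bar> powr p * bdry_dist \<Omega> x powr (- (s * p))) \<partial>lborel) < \<infinity>" by simp
  have E: "energy s p u = gagliardo p (s * p) w" by (rule energy_eq_gagliardo[OF u(1) wm ae])
  note G = gagliardo_lower[OF p a wm \<Omega> w0 line fin, unfolded H mult_1_right]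
  show ?thesis unfolding E using G by (metis order_le_less zero_neq_one)
qed

text \<open>The strict bound applies to test functions and to all members of \<open>Wsp0\<close>
  alike, so it gives the lower estimate of the infimum and excludes minimisers at the same
  time.\<close>

lemma hardy_const_eq:
  fixes \<Omega> :: "'a::euclidean_space set"
  assumes p: "1 < p" and s: "0 < s" "s < 1" and \<Omega>: "open \<Omega>" "convex \<Omega>" "\<Omega> \<noteq> {}" "\<Omega> \<noteq> UNIV"
    and line: "\<And>w h. line_ineq p (s * p) {t. w + t *\<^sub>R h \<in> \<Omega>}"
  shows "hardy_const s p \<Omega> = 2 * (hC p (s * p) * slice_const DIM('a) (s * p))" (is "_ = ?X")
    and "\<not> hardy_attained s p \<Omega>"
proof -
  note low = hardy_lower[OF p s \<Omega>(1,2,4) line]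
  have "?X <= hardy_const s p \<Omega>"
    unfolding hardy_const_def
  proof (rule INF_greatest)
    fix u assume "u \<in> {u \<in> test_functions \<Omega>. hardy_integral s p \<Omega> u = 1}"
    then have u: "u \<in> test_functions \<Omega>" "hardy_integral s p \<Omega> u = 1" by auto
    show "?X <= energy s p u"
      by (intro less_imp_le low test_function(4)[OF u(1)] u(2)) (use test_function(3)[OF u(1)] in auto)
  qed
  then show e: "hardy_const s p \<Omega> = ?X" using hardy_const_upper[OF p s \<Omega>] by (rule antisym[rotated])
  show "\<not> hardy_attained s p \<Omega>"
  proof
    assume "hardy_attained s p \<Omega>"
    then obtain u where u: "u \<in> Wsp0 s p \<Omega>" "hardy_integral s p \<Omega> u = 1" "energy s p u = ?X"
      unfolding hardy_attained_def e by blast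
    have "u \<in> borel_measurable lebesgue" using u(1) by (auto simp: Wsp0_def Wsp_def)
    from low[OF this Wsp0_AE_zero[OF p \<Omega>(1) u(1)] u(2)] show False using u(3) by simp
  qed
qed

text \<open>\<open>Lambda\<close> contains a Bochner integral, which would be 0 by convention if it
  diverged; finiteness of \<open>hC\<close> makes the two notions agree.\<close>

lemma Lambda_eq:
  assumes p: "1 < p" and s: "0 < s" "s < 1"
  shows "2 * hC p (s * p) = ennreal (Lambda s p)" "0 <= Lambda s p"
proof -
  define a where "a = s * p"
  have a: "0 < a" "a < p" using s p by (auto simp: a_def)
  define F where "F t = indicator {0<..<1} t *\<^sub>R (\<bar>1 - t powr ((a - 1) / p)\<bar> powr p / (1 - t) powr (1 + a))" for t :: real
  have F0: "0 <= F t" for t by (auto simp: F_def)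
  have Fm: "F \<in> borel_measurable lborel" unfolding F_def[abs_def] by measurable
  have hC: "hC p a = (\<integral>\<^sup>+t. ennreal (F t) \<partial>lborel) + ennreal (1 / a)"
    unfolding hC_def F_def by (intro arg_cong2[where f = "(+)"] nn_integral_cong refl) (auto simp: indicator_def)
  have "(\<integral>\<^sup>+t. ennreal (F t) \<partial>lborel) < \<infinity>" using hC_finite[OF p a] unfolding hC by simp
  then have "integrable lborel F" by (intro integrableI_nonneg Fm) (auto simp: F0)
  then have I: "(\<integral>\<^sup>+t. ennreal (F t) \<partial>lborel) = ennreal (\<integral>t. F t \<partial>lborel)" by (intro nn_integral_eq_integral) (auto simp: F0)
  have I0: "0 <= (\<integral>t. F t \<partial>lborel)" by (intro integral_nonneg_AE) (auto simp: F0)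
  have L: "Lambda s p = 2 * ((\<integral>t. F t \<partial>lborel) + 1 / a)"
    by (simp add: Lambda_def set_lebesgue_integral_def F_def a_def)
  show "0 <= Lambda s p" unfolding L using I0 a by simp
  have "2 * hC p a = ennreal 2 * ennreal ((\<integral>t. F t \<partial>lborel) + 1 / a)"
    unfolding hC I using I0 a by simp
  also have "\<dots> = ennreal (Lambda s p)" unfolding L by (rule ennreal_mult'[symmetric]) simp
  finally show "2 * hC p (s * p) = ennreal (Lambda s p)" by (simp add: a_def)
qed

lemma line_slice:
  fixes \<Omega> :: "'a::euclidean_space set"
  assumes "open \<Omega>" "convex \<Omega>"
  shows "open {t. w + t *\<^sub>R h \<in> \<Omega>}" "convex {t. w + t *\<^sub>R h \<in> \<Omega>}"
proof -
  have "open ((\<lambda>t. w + t *\<^sub>R h) -` \<Omega>)" by (intro open_vimage assms continuous_intros)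
  then show "open {t. w + t *\<^sub>R h \<in> \<Omega>}" by (simp add: vimage_def)
  show "convex {t. w + t *\<^sub>R h \<in> \<Omega>}"
  proof (rule convexI)
    fix x y u v :: real
    assume xy: "x \<in> {t. w + t *\<^sub>R h \<in> \<Omega>}" "y \<in> {t. w + t *\<^sub>R h \<in> \<Omega>}" and uv: "0 <= u" "0 <= v" "u + v = 1"
    have "u *\<^sub>R (w + x *\<^sub>R h) + v *\<^sub>R (w + y *\<^sub>R h) \<in> \<Omega>" using xy uv by (intro convexD[OF assms(2)]) auto
    moreover have "u *\<^sub>R (w + x *\<^sub>R h) + v *\<^sub>R (w + y *\<^sub>R h) = (u + v) *\<^sub>R w + (u *\<^sub>R x + v *\<^sub>R y) *\<^sub>R h"
      by (simp add: algebra_simps)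
    ultimately show "u *\<^sub>R x + v *\<^sub>R y \<in> {t. w + t *\<^sub>R h \<in> \<Omega>}" using uv by simp
  qed
qed

lemma half_space:
  fixes b :: "'a::euclidean_space"
  assumes "b \<in> Basis"
  shows "open (half_space b)" "convex (half_space b)" "half_space b \<noteq> {}" "half_space b \<noteq> UNIV"
proof -
  have e: "half_space b = {x. 0 < b \<bullet> x}" by (simp add: half_space_def inner_commute)
  show "open (half_space b)" "convex (half_space b)" unfolding e by (rule open_halfspace_gt convex_halfspace_gt)+
  have "b \<in> half_space b" using assms by (simp add: half_space_def)
  then show "half_space b \<noteq> {}" by blast
  have "0 \<notin> half_space b" by (simp add: half_space_def)
  then show "half_space b \<noteq> UNIV" by blast
qed

lemma half_space_line_ineq:
  fixes b :: "'a::euclidean_space"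
  assumes p: "1 < p" and a: "0 < a" "a < p" and b: "b \<in> Basis"
  shows "line_ineq p a {t. w + t *\<^sub>R h \<in> half_space b}"
proof (cases "{t. w + t *\<^sub>R h \<in> half_space b} = {}")
  case True
  show ?thesis unfolding True using p by (auto simp: line_ineq_def)
next
  case False
  then obtain t where t: "0 < w \<bullet> b + t * (h \<bullet> b)" by (auto simp: half_space_def inner_add_left)
  show ?thesis
  proof (rule line_ineq_open_interval[OF p a line_slice[OF half_space(1,2)[OF b]]])
    assume "bounded {t. w + t *\<^sub>R h \<in> half_space b}"
    then obtain B where B: "\<And>r. 0 < w \<bullet> b + r * (h \<bullet> b) ==> \<bar>r\<bar> <= B"
      by (auto simp: bounded_iff half_space_def inner_add_left)
    \<comment> \<open>Moving from t by |t| + |B| + 1 in the direction in which h . b does not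
      decrease the height stays in the slice and passes the bound B.\<close>
    define r where "r = t + sgn (h \<bullet> b) * (\<bar>t\<bar> + \<bar>B\<bar> + 1)"
    have "0 <= sgn (h \<bullet> b) * (h \<bullet> b)" by (simp add: sgn_if)
    then have "0 <= (sgn (h \<bullet> b) * (h \<bullet> b)) * (\<bar>t\<bar> + \<bar>B\<bar> + 1)" by (rule mult_nonneg_nonneg) simp
    then have "0 < w \<bullet> b + r * (h \<bullet> b)" using t by (simp add: r_def algebra_simps)
    moreover have "h \<bullet> b \<noteq> 0"
    proof
      assume "h \<bullet> b = 0"
      then have "\<bar>\<bar>B\<bar> + 1\<bar> <= B" using t by (intro B) simp
      then show False by simp
    qed
    ultimately have "\<bar>r\<bar> <= B" "h \<bullet> b \<noteq> 0" using B by auto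
    then show "1 <= a \<or> p = 2" by (auto simp: r_def sgn_if abs_if split: if_splits)
  qed
qed

theorem mainTheorem1:
  fixes p :: real and b :: "'a::euclidean_space"
  assumes "1 < p" and "b \<in> Basis"
  shows
    "(\<forall>s. 0 < s \<and> s < 1 \<longrightarrow>
        hardy_const s p (half_space b) = ennreal (dim_const DIM('a) (s * p) * Lambda s p) \<and>
        \<not> hardy_attained s p (half_space b)) \<and>
     (\<forall>s (\<Omega> :: 'a set).
        1 / p \<le> s \<and> s < 1 \<and> open \<Omega> \<and> convex \<Omega> \<and> \<Omega> \<noteq> {} \<and> \<Omega> \<noteq> UNIV \<longrightarrow>
        hardy_const s p \<Omega> = hardy_const s p (half_space b) \<and> \<not> hardy_attained s p \<Omega>) \<and>
     (\<forall>s (\<Omega> :: 'a set).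
        0 < s \<and> s < 1 \<and> open \<Omega> \<and> convex \<Omega> \<and> \<Omega> \<noteq> {} \<and> \<Omega> \<noteq> UNIV \<longrightarrow>
        hardy_const s 2 \<Omega> = hardy_const s 2 (half_space b) \<and> \<not> hardy_attained s 2 \<Omega>)"
proof -
  have half: "hardy_const s q (half_space b) = 2 * (hC q (s * q) * slice_const DIM('a) (s * q))"
    "\<not> hardy_attained s q (half_space b)" if "1 < q" "0 < s" "s < 1" for s q
    using that by (intro hardy_const_eq half_space assms(2) half_space_line_ineq; simp)+
  have gen: "hardy_const s q \<Omega> = hardy_const s q (half_space b)" "\<not> hardy_attained s q \<Omega>"
    if q: "1 < q" "0 < s" "s < 1" and \<Omega>: "open \<Omega>" "convex \<Omega>" "\<Omega> \<noteq> {}" "\<Omega> \<noteq> UNIV" and c: "1 <= s * q \<or> q = 2"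
    for s q and \<Omega> :: "'a set"
  proof -
    have "line_ineq q (s * q) {t. w + t *\<^sub>R h \<in> \<Omega>}" for w h :: 'a
      using q c by (intro line_ineq_open_interval line_slice \<Omega>) auto
    from hardy_const_eq[OF q \<Omega> this] half(1)[OF q]
    show "hardy_const s q \<Omega> = hardy_const s q (half_space b)" "\<not> hardy_attained s q \<Omega>" by simp_all
  qed
  have "hardy_const s p (half_space b) = ennreal (dim_const DIM('a) (s * p) * Lambda s p)" if s: "0 < s" "s < 1" for s
  proof -
    have S: "slice_const DIM('a) (s * p) = ennreal (dim_const DIM('a) (s * p))" "0 < dim_const DIM('a) (s * p)"
      using slice_const_eq[of "DIM('a)" "s * p"] s assms(1) by (auto simp: Suc_le_eq)
    have "hardy_const s p (half_space b) = (2 * hC p (s * p)) * slice_const DIM('a) (s * p)"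
      using half(1)[OF assms(1) s] by (simp add: mult.assoc)
    also have "\<dots> = ennreal (dim_const DIM('a) (s * p)) * ennreal (Lambda s p)"
      unfolding Lambda_eq(1)[OF assms(1) s] S by (rule mult.commute)
    also have "\<dots> = ennreal (dim_const DIM('a) (s * p) * Lambda s p)"
      using S(2) by (intro ennreal_mult'[symmetric]) simp
    finally show ?thesis .
  qed
  \<comment> \<open>s >= 1 / p is the condition a >= 1 for bounded intervals.\<close>
  moreover have "0 < s \<and> 1 <= s * p" if "1 / p <= s" for s
    using that assms(1) by (auto simp: pos_divide_le_eq intro: less_le_trans[of 0 "1 / p" s])
  ultimately show ?thesis using half(2)[OF assms(1)] gen assms(1) by simp
qed

end
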